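(* Let $\mathbb{E}$ be a (possibly large) class of pairs $(V,\mathcal{F})$ with $V\in\mathrm{Vect}$ and $\mathcal{F}$ a filter of linear subspaces of $V$, and let $\mathcal{Q}=\mathcal{Q}(\mathbb{E})$ be the associated class of quotients of representables. Then the full subcategory of $\mathcal{Q}$-free objects of $\mathrm{Ind}\text{-}(\mathrm{Vect}^{\mathrm{op}})$ is an epi-reflective subcategory of $\mathrm{Ind}\text{-}(\mathrm{Vect}^{\mathrm{op}})$. Consequently it is the torsion-free part for a torsion theory on $\mathrm{Ind}\text{-}(\mathrm{Vect}^{\mathrm{op}})$.
   Context: Fix a field $\mathbf{k}$ and a (non-trivial) Grothendieck universe; sets in it are small. $\mathrm{Vect}$ is the category of small $\mathbf{k}$-vector spaces, $[\mathrm{Vect},\mathrm{Vect}]$ the category of $\mathbf{k}$-additive functors (acting $\mathbf{k}$-linearly on hom-spaces) and natural transformations, $\mathbb{Y}V:=\mathrm{Vect}(V,-)$. $\mathrm{Ind}\text{-}(\mathrm{Vect}^{\mathrm{op}})$ is the full subcategory of $[\mathrm{Vect},\mathrm{Vect}]$ on the small functors, i.e. those isomorphic to a colimit, over a small directed poset, of representables $\mathbb{Y}V$; it is an Abelian category with all small limits and colimits, computed pointwise. A filter of subspaces of $V$ is a nonempty set of linear subspaces closed under finite intersections and under passing to larger subspaces. For $H\le V$ regard $\mathbb{Y}(V/H)$ as a subfunctor of $\mathbb{Y}V$ (linear maps vanishing on $H$). Put $\mathcal{Q}(\mathbb{E}):=\{\mathbb{Y}V/\bigcup_{H\in\mathcal{F}}\mathbb{Y}(V/H):(V,\mathcal{F})\in\mathbb{E}\}$.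 An object $X$ is $\mathcal{Q}$-free if there is no nonzero arrow $Q\to X$ with $Q\in\mathcal{Q}$. A full subcategory is epi-reflective if its inclusion has a left adjoint all of whose unit (reflection) arrows are epimorphisms in the ambient category. In a category, arrows $e:a\to b$ and $m:c\to d$ satisfy $e\perp m$ if for all $l:a\to c$, $k:b\to d$ with $m l=k e$ there is a unique $h:b\to c$ with $he=l$ and $mh=k$. An orthogonal factorization system is a pair $(\mathcal{E},\mathcal{M})$ of classes of arrows with $\mathcal{M}=\{m:\forall e\in\mathcal{E},\,e\perp m\}$, $\mathcal{E}=\{e:\forall m\in\mathcal{M},\,e\perp m\}$ and such that every arrow factors as $m\cdot e$ with $m\in\mathcal{M}$, $e\in\mathcal{E}$. A torsion theory is an orthogonal factorization system in which both $\mathcal{E}$ and $\mathcal{M}$ have the 3-for-2 property (if two of $f,g,g\cdot f$ are in the class then so is the third); its torsion-free part is the class of objects $c$ such that $c\to 0$ is in $\mathcal{M}$. *)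

theory Defs
  imports "HOL-Algebra.Module" "HOL-Algebra.AbelCoset"
begin

section \<open>Grothendieck universes\<close>

text \<open>
  The elements of the type are the members of the universe, and \<open>elts x\<close> is the set of elements
  of \<open>x\<close>; transitivity of the universe is built in, since \<open>elts x\<close> is again a set of members.
  By Mostowski collapse the models are exactly the Grothendieck universes that contain an infinite
  set. The axiom \<open>elts_Pow\<close> says both that every subset of a member is a member and that
  the powerset is.
\<close>

class grothendieck_universe =
  fixes elts :: "'a \<Rightarrow> 'a set"
  assumes elts_ext: "elts x = elts y \<Longrightarrow> x = y"
    and elts_wf: "wf {(x, y). x \<in> elts y}"
    and elts_pair: "\<exists>z. elts z = {x, y}"
    and elts_Pow: "\<exists>z. elts ` elts z = Pow (elts x)"
    and elts_UN: "\<exists>z. elts z = (\<Union>i\<in>elts x. elts (f i))"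
    and elts_infinite: "\<exists>x. infinite (elts x)"

definition small :: "'u::grothendieck_universe set \<Rightarrow> bool" where
  "small A \<longleftrightarrow> A \<in> range elts"

text \<open>The member of the universe with a given (small) set of elements.\<close>

definition vset :: "'u::grothendieck_universe set \<Rightarrow> 'u" where
  "vset A = inv_into UNIV elts A"

text \<open>
  Kuratowski pairs, and functions as their graphs: this makes hom-sets of small sets small sets.
\<close>

definition kpair :: "'u::grothendieck_universe \<Rightarrow> 'u \<Rightarrow> 'u" where
  "kpair x y = vset {vset {x}, vset {x, y}}"

definition graph :: "'u::grothendieck_universe set \<Rightarrow> ('u \<Rightarrow> 'u) \<Rightarrow> 'u" where
  "graph A f = vset ((\<lambda>x. kpair x (f x)) ` A)"

definition graph_app :: "'u::grothendieck_universe \<Rightarrow> 'u \<Rightarrow> 'u" where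
  "graph_app p x = (THE y. kpair x y \<in> elts p)"


section \<open>Categories\<close>

record ('o, 'a) category =
  Obj :: "'o set"
  Arr :: "'a set"
  Dom :: "'a \<Rightarrow> 'o"
  Cod :: "'a \<Rightarrow> 'o"
  Ident :: "'o \<Rightarrow> 'a"
  Comp :: "'a \<Rightarrow> 'a \<Rightarrow> 'a"  \<comment> \<open>\<open>Comp C g f\<close> is \<open>g\<close> after \<open>f\<close>\<close>

definition Hom :: "('o, 'a) category \<Rightarrow> 'o \<Rightarrow> 'o \<Rightarrow> 'a set" where
  "Hom C a b = {f \<in> Arr C. Dom C f = a \<and> Cod C f = b}"

definition epi :: "('o, 'a) category \<Rightarrow> 'a \<Rightarrow> bool" where
  "epi C e \<longleftrightarrow> e \<in> Arr C \<and>
     (\<forall>f\<in>Arr C. \<forall>g\<in>Arr C. Dom C f = Cod C e \<and> Dom C g = Cod C e \<and> Cod C f = Cod C g \<and>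
        Comp C f e = Comp C g e \<longrightarrow> f = g)"

definition zero_object :: "('o, 'a) category \<Rightarrow> 'o \<Rightarrow> bool" where
  "zero_object C z \<longleftrightarrow> z \<in> Obj C \<and>
     (\<forall>c\<in>Obj C. (\<exists>!t. t \<in> Hom C c z) \<and> (\<exists>!t. t \<in> Hom C z c))"

definition zero_arrow :: "('o, 'a) category \<Rightarrow> 'a \<Rightarrow> bool" where
  "zero_arrow C f \<longleftrightarrow>
     (\<exists>z s t. zero_object C z \<and> s \<in> Hom C (Dom C f) z \<and> t \<in> Hom C z (Cod C f) \<and> f = Comp C t s)"

definition full_subcategory :: "('o, 'a) category \<Rightarrow> 'o set \<Rightarrow> ('o, 'a) category" where
  "full_subcategory C S =
     C\<lparr>Obj := S, Arr := {f \<in> Arr C. Dom C f \<in> S \<and> Cod C f \<in> S}\<rparr>"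


section \<open>Functors and natural transformations\<close>

record ('o1, 'a1, 'o2, 'a2) cfunctor =
  omap :: "'o1 \<Rightarrow> 'o2"
  amap :: "'a1 \<Rightarrow> 'a2"

text \<open>
  Functors and natural transformations are \<open>undefined\<close> outside their source, so that HOL equality
  is the intended equality.
\<close>

definition is_functor ::
  "('o1, 'a1) category \<Rightarrow> ('o2, 'a2) category \<Rightarrow> ('o1, 'a1, 'o2, 'a2) cfunctor \<Rightarrow> bool" where
  "is_functor C D F \<longleftrightarrow>
     omap F \<in> Obj C \<rightarrow>\<^sub>E Obj D \<and>
     amap F \<in> extensional (Arr C) \<and>
     (\<forall>f\<in>Arr C. amap F f \<in> Hom D (omap F (Dom C f)) (omap F (Cod C f))) \<and>
     (\<forall>c\<in>Obj C. amap F (Ident C c) = Ident D (omap F c)) \<and>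
     (\<forall>f\<in>Arr C. \<forall>g\<in>Arr C. Cod C f = Dom C g \<longrightarrow>
        amap F (Comp C g f) = Comp D (amap F g) (amap F f))"

definition is_natural ::
  "('o1, 'a1) category \<Rightarrow> ('o2, 'a2) category \<Rightarrow> ('o1, 'a1, 'o2, 'a2) cfunctor \<Rightarrow>
     ('o1, 'a1, 'o2, 'a2) cfunctor \<Rightarrow> ('o1 \<Rightarrow> 'a2) \<Rightarrow> bool" where
  "is_natural C D F G \<eta> \<longleftrightarrow>
     \<eta> \<in> extensional (Obj C) \<and>
     (\<forall>c\<in>Obj C. \<eta> c \<in> Hom D (omap F c) (omap G c)) \<and>
     (\<forall>f\<in>Arr C. Comp D (\<eta> (Cod C f)) (amap F f) = Comp D (amap G f) (\<eta> (Dom C f)))"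

definition identity_functor :: "('o, 'a) category \<Rightarrow> ('o, 'a, 'o, 'a) cfunctor" where
  "identity_functor C = \<lparr>omap = (\<lambda>c\<in>Obj C. c), amap = (\<lambda>f\<in>Arr C. f)\<rparr>"

definition compose_functor ::
  "('o1, 'a1) category \<Rightarrow> ('o2, 'a2, 'o3, 'a3) cfunctor \<Rightarrow> ('o1, 'a1, 'o2, 'a2) cfunctor \<Rightarrow>
     ('o1, 'a1, 'o3, 'a3) cfunctor" where
  "compose_functor C G F =
     \<lparr>omap = compose (Obj C) (omap G) (omap F), amap = compose (Arr C) (amap G) (amap F)\<rparr>"

text \<open>The full subcategory of the functor category on the functors satisfying \<open>P\<close>.\<close>

definition functor_category ::
  "('o1, 'a1) category \<Rightarrow> ('o2, 'a2) category \<Rightarrow> (('o1, 'a1, 'o2, 'a2) cfunctor \<Rightarrow> bool) \<Rightarrow>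
     (('o1, 'a1, 'o2, 'a2) cfunctor,
      ('o1, 'a1, 'o2, 'a2) cfunctor \<times> ('o1, 'a1, 'o2, 'a2) cfunctor \<times> ('o1 \<Rightarrow> 'a2)) category" where
  "functor_category C D P =
     \<lparr>Obj = {F. is_functor C D F \<and> P F},
      Arr = {(F, G, \<eta>). is_functor C D F \<and> P F \<and> is_functor C D G \<and> P G \<and> is_natural C D F G \<eta>},
      Dom = (\<lambda>(F, G, \<eta>). F),
      Cod = (\<lambda>(F, G, \<eta>). G),
      Ident = (\<lambda>F. (F, F, \<lambda>c\<in>Obj C. Ident D (omap F c))),
      Comp = (\<lambda>(_, H, \<theta>) (F, _, \<eta>). (F, H, \<lambda>c\<in>Obj C. Comp D (\<theta> c) (\<eta> c)))\<rparr>"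

text \<open>\<open>L : C \<rightarrow> D\<close> is left adjoint to \<open>G : D \<rightarrow> C\<close>, with unit \<open>\<eta>\<close>.\<close>

definition left_adjoint ::
  "('o1, 'a1) category \<Rightarrow> ('o2, 'a2) category \<Rightarrow> ('o1, 'a1, 'o2, 'a2) cfunctor \<Rightarrow>
     ('o2, 'a2, 'o1, 'a1) cfunctor \<Rightarrow> ('o1 \<Rightarrow> 'a1) \<Rightarrow> bool" where
  "left_adjoint C D L G \<eta> \<longleftrightarrow>
     is_functor C D L \<and> is_functor D C G \<and>
     is_natural C C (identity_functor C) (compose_functor C G L) \<eta> \<and>
     (\<forall>c\<in>Obj C. \<forall>d\<in>Obj D. \<forall>f\<in>Hom C c (omap G d).
        \<exists>!g. g \<in> Hom D (omap L c) d \<and> Comp C (amap G g) (\<eta> c) = f)"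

text \<open>The identity functor of a full subcategory, read as a functor into \<open>C\<close>, is the inclusion.\<close>

definition epi_reflective :: "('o, 'a) category \<Rightarrow> 'o set \<Rightarrow> bool" where
  "epi_reflective C S \<longleftrightarrow> S \<subseteq> Obj C \<and>
     (\<exists>L \<eta>. left_adjoint C (full_subcategory C S) L (identity_functor (full_subcategory C S)) \<eta> \<and>
        (\<forall>c\<in>Obj C. epi C (\<eta> c)))"


section \<open>Colimits over directed posets\<close>

definition poset_category :: "'i set \<Rightarrow> 'i rel \<Rightarrow> ('i, 'i \<times> 'i) category" where
  "poset_category I r =
     \<lparr>Obj = I, Arr = r, Dom = fst, Cod = snd, Ident = (\<lambda>i. (i, i)),
      Comp = (\<lambda>g f. (fst f, snd g))\<rparr>"

definition directed_poset :: "'i set \<Rightarrow> 'i rel \<Rightarrow> bool" where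
  "directed_poset I r \<longleftrightarrow> r \<subseteq> I \<times> I \<and> partial_order_on I r \<and> I \<noteq> {} \<and>
     (\<forall>i\<in>I. \<forall>j\<in>I. \<exists>k\<in>I. (i, k) \<in> r \<and> (j, k) \<in> r)"

definition is_cocone ::
  "('i, 'b) category \<Rightarrow> ('o, 'a) category \<Rightarrow> ('i, 'b, 'o, 'a) cfunctor \<Rightarrow> 'o \<Rightarrow> ('i \<Rightarrow> 'a) \<Rightarrow> bool"
  where
  "is_cocone J C D x \<gamma> \<longleftrightarrow> x \<in> Obj C \<and>
     (\<forall>j\<in>Obj J. \<gamma> j \<in> Hom C (omap D j) x) \<and>
     (\<forall>u\<in>Arr J. Comp C (\<gamma> (Cod J u)) (amap D u) = \<gamma> (Dom J u))"

definition is_colimit ::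
  "('i, 'b) category \<Rightarrow> ('o, 'a) category \<Rightarrow> ('i, 'b, 'o, 'a) cfunctor \<Rightarrow> 'o \<Rightarrow> ('i \<Rightarrow> 'a) \<Rightarrow> bool"
  where
  "is_colimit J C D x \<gamma> \<longleftrightarrow> is_cocone J C D x \<gamma> \<and>
     (\<forall>y \<delta>. is_cocone J C D y \<delta> \<longrightarrow>
        (\<exists>!h. h \<in> Hom C x y \<and> (\<forall>j\<in>Obj J. Comp C h (\<gamma> j) = \<delta> j)))"


section \<open>Torsion theories\<close>

definition orthogonal :: "('o, 'a) category \<Rightarrow> 'a \<Rightarrow> 'a \<Rightarrow> bool" where
  "orthogonal C e m \<longleftrightarrow>
     (\<forall>l\<in>Hom C (Dom C e) (Dom C m). \<forall>k\<in>Hom C (Cod C e) (Cod C m).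
        Comp C m l = Comp C k e \<longrightarrow>
        (\<exists>!h. h \<in> Hom C (Cod C e) (Dom C m) \<and> Comp C h e = l \<and> Comp C m h = k))"

definition orthogonal_factorization_system :: "('o, 'a) category \<Rightarrow> 'a set \<Rightarrow> 'a set \<Rightarrow> bool" where
  "orthogonal_factorization_system C \<E> \<M> \<longleftrightarrow>
     \<M> = {m \<in> Arr C. \<forall>e\<in>\<E>. orthogonal C e m} \<and>
     \<E> = {e \<in> Arr C. \<forall>m\<in>\<M>. orthogonal C e m} \<and>
     (\<forall>f\<in>Arr C. \<exists>e\<in>\<E>. \<exists>m\<in>\<M>. Cod C e = Dom C m \<and> f = Comp C m e)"

definition three_for_two :: "('o, 'a) category \<Rightarrow> 'a set \<Rightarrow> bool" where
  "three_for_two C \<X> \<longleftrightarrow>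
     (\<forall>f\<in>Arr C. \<forall>g\<in>Arr C. Cod C f = Dom C g \<longrightarrow>
        (f \<in> \<X> \<and> g \<in> \<X> \<longrightarrow> Comp C g f \<in> \<X>) \<and>
        (f \<in> \<X> \<and> Comp C g f \<in> \<X> \<longrightarrow> g \<in> \<X>) \<and>
        (g \<in> \<X> \<and> Comp C g f \<in> \<X> \<longrightarrow> f \<in> \<X>))"

definition torsion_theory :: "('o, 'a) category \<Rightarrow> 'a set \<Rightarrow> 'a set \<Rightarrow> bool" where
  "torsion_theory C \<E> \<M> \<longleftrightarrow>
     orthogonal_factorization_system C \<E> \<M> \<and> three_for_two C \<E> \<and> three_for_two C \<M>"

definition torsion_free_part :: "('o, 'a) category \<Rightarrow> 'a set \<Rightarrow> 'o set" where
  "torsion_free_part C \<M> = {c \<in> Obj C. \<exists>z t. zero_object C z \<and> t \<in> Hom C c z \<and> t \<in> \<M>}"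


section \<open>Small vector spaces\<close>

text \<open>
  A vector space over the field \<open>K\<close> is a \<open>K\<close>-module record; its ring multiplication and unit,
  and the values of its operations off the carrier, are irrelevant up to isomorphism.
\<close>

type_synonym ('k, 'u) vs = "('k, 'u) module"
type_synonym ('k, 'u) lin = "('k, 'u) vs \<times> ('k, 'u) vs \<times> ('u \<Rightarrow> 'u)"
type_synonym ('k, 'u) vfunctor = "(('k, 'u) vs, ('k, 'u) lin, ('k, 'u) vs, ('k, 'u) lin) cfunctor"
type_synonym ('k, 'u) vnat =
  "('k, 'u) vfunctor \<times> ('k, 'u) vfunctor \<times> (('k, 'u) vs \<Rightarrow> ('k, 'u) lin)"

definition linear_maps :: "'k ring \<Rightarrow> ('k, 'u) vs \<Rightarrow> ('k, 'u) vs \<Rightarrow> ('u \<Rightarrow> 'u) set" where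
  "linear_maps K V W = {f \<in> carrier V \<rightarrow>\<^sub>E carrier W.
     (\<forall>x\<in>carrier V. \<forall>y\<in>carrier V. f (x \<oplus>\<^bsub>V\<^esub> y) = f x \<oplus>\<^bsub>W\<^esub> f y) \<and>
     (\<forall>a\<in>carrier K. \<forall>x\<in>carrier V. f (a \<odot>\<^bsub>V\<^esub> x) = a \<odot>\<^bsub>W\<^esub> f x)}"

definition Vect :: "'k ring \<Rightarrow> (('k, 'u::grothendieck_universe) vs, ('k, 'u) lin) category" where
  "Vect K =
     \<lparr>Obj = {V. module K V \<and> small (carrier V)},
      Arr = {(V, W, f). module K V \<and> small (carrier V) \<and> module K W \<and> small (carrier W) \<and>
               f \<in> linear_maps K V W},
      Dom = (\<lambda>(V, W, f). V),
      Cod = (\<lambda>(V, W, f). W),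
      Ident = (\<lambda>V. (V, V, \<lambda>x\<in>carrier V. x)),
      Comp = (\<lambda>(_, W, g) (V, _, f). (V, W, compose (carrier V) g f))\<rparr>"

text \<open>The vector space structure on the hom-sets of \<open>Vect\<close>; in \<open>lin_add\<close> the arrows are parallel.\<close>

definition lin_add :: "('k, 'u) lin \<Rightarrow> ('k, 'u) lin \<Rightarrow> ('k, 'u) lin" where
  "lin_add = (\<lambda>(V, W, f) (_, _, g). (V, W, \<lambda>x\<in>carrier V. f x \<oplus>\<^bsub>W\<^esub> g x))"

definition lin_smult :: "'k \<Rightarrow> ('k, 'u) lin \<Rightarrow> ('k, 'u) lin" where
  "lin_smult a = (\<lambda>(V, W, f). (V, W, \<lambda>x\<in>carrier V. a \<odot>\<^bsub>W\<^esub> f x))"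

definition additive_functor :: "'k ring \<Rightarrow> ('k, 'u::grothendieck_universe) vfunctor \<Rightarrow> bool" where
  "additive_functor K F \<longleftrightarrow>
     (\<forall>V\<in>Obj (Vect K). \<forall>W\<in>Obj (Vect K). \<forall>f\<in>Hom (Vect K) V W.
        (\<forall>g\<in>Hom (Vect K) V W. amap F (lin_add f g) = lin_add (amap F f) (amap F g)) \<and>
        (\<forall>a\<in>carrier K. amap F (lin_smult a f) = lin_smult a (amap F f)))"

definition Vect_Vect ::
  "'k ring \<Rightarrow> (('k, 'u::grothendieck_universe) vfunctor, ('k, 'u) vnat) category" where
  "Vect_Vect K = functor_category (Vect K) (Vect K) (additive_functor K)"


section \<open>Representables and small functors\<close>

text \<open>\<open>Vect(V, W)\<close> as an object of \<open>Vect\<close>: its vectors are the graphs of the linear maps.\<close>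

definition hom_space ::
  "'k ring \<Rightarrow> ('k, 'u::grothendieck_universe) vs \<Rightarrow> ('k, 'u) vs \<Rightarrow> ('k, 'u) vs" where
  "hom_space K V W =
     \<lparr>carrier = graph (carrier V) ` linear_maps K V W,
      monoid.mult = (\<lambda>_ _. undefined),
      one = undefined,
      zero = graph (carrier V) (\<lambda>x. \<zero>\<^bsub>W\<^esub>),
      add = (\<lambda>p q. graph (carrier V) (\<lambda>x. graph_app p x \<oplus>\<^bsub>W\<^esub> graph_app q x)),
      smult = (\<lambda>a p. graph (carrier V) (\<lambda>x. a \<odot>\<^bsub>W\<^esub> graph_app p x))\<rparr>"

definition Yoneda :: "'k ring \<Rightarrow> ('k, 'u::grothendieck_universe) vs \<Rightarrow> ('k, 'u) vfunctor" where
  "Yoneda K V =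
     \<lparr>omap = (\<lambda>W\<in>Obj (Vect K). hom_space K V W),
      amap = (\<lambda>t\<in>Arr (Vect K). case t of (W, W', g) \<Rightarrow>
        (hom_space K V W, hom_space K V W',
         \<lambda>p\<in>carrier (hom_space K V W). graph (carrier V) (\<lambda>x. g (graph_app p x))))\<rparr>"

text \<open>
  Being the vertex of a colimit cocone is invariant under isomorphism, so this is the class of
  functors isomorphic to a chosen colimit.
\<close>

definition small_functor :: "'k ring \<Rightarrow> ('k, 'u::grothendieck_universe) vfunctor \<Rightarrow> bool" where
  "small_functor K X \<longleftrightarrow>
     (\<exists>(I :: 'u set) r D \<gamma>.
        small I \<and> directed_poset I r \<and>
        is_functor (poset_category I r) (Vect_Vect K) D \<and>
        (\<forall>i\<in>I. \<exists>V\<in>Obj (Vect K). omap D i = Yoneda K V) \<and>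
        is_colimit (poset_category I r) (Vect_Vect K) D X \<gamma>)"

definition Ind_Vect_op ::
  "'k ring \<Rightarrow> (('k, 'u::grothendieck_universe) vfunctor, ('k, 'u) vnat) category" where
  "Ind_Vect_op K =
     full_subcategory (Vect_Vect K) {X \<in> Obj (Vect_Vect K). small_functor K X}"


section \<open>Filters of subspaces and free objects\<close>

definition subspace_filter :: "'k ring \<Rightarrow> ('k, 'u) vs \<Rightarrow> 'u set set \<Rightarrow> bool" where
  "subspace_filter K V \<F> \<longleftrightarrow> \<F> \<noteq> {} \<and>
     (\<forall>H\<in>\<F>. submodule H K V) \<and>
     (\<forall>H\<in>\<F>. \<forall>H'\<in>\<F>. H \<inter> H' \<in> \<F>) \<and>
     (\<forall>H\<in>\<F>. \<forall>H'. submodule H' K V \<and> H \<subseteq> H' \<longrightarrow> H' \<in> \<F>)"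

text \<open>\<open>V / H\<close>: its vectors are the members of the universe whose elements form a coset of \<open>H\<close>.\<close>

definition quotient_space ::
  "('k, 'u::grothendieck_universe) vs \<Rightarrow> 'u set \<Rightarrow> ('k, 'u) vs" where
  "quotient_space V H =
     \<lparr>carrier = vset ` (a_rcosets\<^bsub>V\<^esub> H),
      monoid.mult = (\<lambda>_ _. undefined),
      one = undefined,
      zero = vset H,
      add = (\<lambda>p q. vset (elts p <+>\<^bsub>V\<^esub> elts q)),
      smult = (\<lambda>a p. vset (\<Union>x\<in>elts p. H +>\<^bsub>V\<^esub> (a \<odot>\<^bsub>V\<^esub> x)))\<rparr>"

text \<open>The pointwise quotient of \<open>X\<close> by a subfunctor, given by its value \<open>S W \<subseteq> X W\<close> at each \<open>W\<close>.\<close>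

definition quotient_functor ::
  "'k ring \<Rightarrow> ('k, 'u::grothendieck_universe) vfunctor \<Rightarrow> (('k, 'u) vs \<Rightarrow> 'u set) \<Rightarrow>
     ('k, 'u) vfunctor" where
  "quotient_functor K X S =
     \<lparr>omap = (\<lambda>W\<in>Obj (Vect K). quotient_space (omap X W) (S W)),
      amap = (\<lambda>t\<in>Arr (Vect K). case (Dom (Vect K) t, Cod (Vect K) t, amap X t) of
        (W, W', (_, _, u)) \<Rightarrow>
          (quotient_space (omap X W) (S W), quotient_space (omap X W') (S W'),
           \<lambda>p\<in>carrier (quotient_space (omap X W) (S W)).
             vset (\<Union>x\<in>elts p. S W' +>\<^bsub>omap X W'\<^esub> u x)))\<rparr>"

text \<open>The value at \<open>W\<close> of the subfunctor of \<open>Yoneda K V\<close> that is identified with \<open>Yoneda K (V/H)\<close>.\<close>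

definition vanishing_maps ::
  "'k ring \<Rightarrow> ('k, 'u::grothendieck_universe) vs \<Rightarrow> 'u set \<Rightarrow> ('k, 'u) vs \<Rightarrow> 'u set" where
  "vanishing_maps K V H W =
     graph (carrier V) ` {f \<in> linear_maps K V W. \<forall>x\<in>H. f x = \<zero>\<^bsub>W\<^esub>}"

definition \<Q> ::
  "'k ring \<Rightarrow> (('k, 'u::grothendieck_universe) vs \<times> 'u set set) set \<Rightarrow> ('k, 'u) vfunctor set" where
  "\<Q> K \<EE> =
     {quotient_functor K (Yoneda K V) (\<lambda>W. \<Union>H\<in>\<F>. vanishing_maps K V H W) | V \<F>. (V, \<F>) \<in> \<EE>}"

definition free_objects ::
  "'k ring \<Rightarrow> ('k, 'u::grothendieck_universe) vfunctor set \<Rightarrow> ('k, 'u) vfunctor set" where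
  "free_objects K QQ =
     {X \<in> Obj (Ind_Vect_op K).
        \<not> (\<exists>Q\<in>QQ. \<exists>t\<in>Hom (Vect_Vect K) Q X. \<not> zero_arrow (Vect_Vect K) t)}"

end

theory Submission
  imports Defs
begin

text \<open>
  By the Yoneda lemma \<open>X\<close> is free iff, for all \<open>(V, \<F>)\<close> in the class, a vector of \<open>X V\<close> that is
  annihilated by \<open>X f\<close> for every \<open>f\<close> vanishing on some \<open>H \<in> \<F>\<close> is zero. So \<open>X / N\<close> is free iff \<open>N\<close>
  satisfies a closure condition that is stable under arbitrary intersections, and the least closed
  subfunctor, the torsion of \<open>X\<close>, yields the reflection of \<open>X\<close>.

  To stay among small functors one uses that an additive \<open>X\<close> is small iff there is one \<open>V\<close> such that
  every vector of \<open>X\<close> is of the form \<open>X f v\<close> with \<open>v \<in> X V\<close>. This property passes to quotients and finite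
  products, and to subfunctors because every linear \<open>f\<close> has a linear \<open>h\<close> with \<open>f h f = f\<close>.

  Free objects are closed under extensions, so the torsion subfunctor is idempotent. The torsion
  theory consists of the arrows that induce an isomorphism on reflections and of those that
  restrict to an isomorphism on torsion subfunctors.
\<close>

section \<open>Small sets\<close>

text \<open>Smallness is the obstacle. The class of pairs may be large, so the torsion subfunctor is
  an intersection with no bound on the number of its terms, and nothing in this construction makes
  the reflection a small colimit. Generation at one vector space is a condition on elements that
  survives what occurs: the reflection is a quotient, the middle object of a factorization is a
  subfunctor of a product of two functors, and a zero object is reached from \<open>X\<close> as the
  quotient of \<open>X\<close> by itself.

  The way back from generation to smallness is long because a directed poset is demanded, where the
  elements of a functor form only a category. The poset is obtained by placing all representing
  spaces as subspaces inside one power of the generator. Vectors of \<open>X U\<close> then have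
  supporting subspaces, and pseudo-inverses show that the kernels and preimages that are needed
  support them again.

  Arrows are treated through their underlying functions. Those that depend on choices (out of a
  quotient, out of a colimit, diagonal fillers) are given as additive relations.\<close>

lemma small_elts: "small (elts x)"
  by (simp add: small_def)

lemma elts_vset: "small A \<Longrightarrow> elts (vset A) = A"
  by (simp add: small_def vset_def f_inv_into_f)

lemma vset_elts: "vset (elts x) = x"
  by (rule elts_ext) (simp add: elts_vset small_elts)

lemma vset_eq_iff: "small A \<Longrightarrow> small B \<Longrightarrow> vset A = vset B \<longleftrightarrow> A = B"
  by (metis elts_vset)

lemma small_subset:
  assumes "small B" "A \<subseteq> B" shows "small A"
proof -
  obtain x where x: "B = elts x" using assms(1) by (auto simp: small_def)
  obtain z where "elts ` elts z = Pow (elts x)" using elts_Pow[of x] by (rule exE)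
  then have "A \<in> elts ` elts z" using assms x by auto
  then show ?thesis by (auto simp: small_def)
qed

lemma small_UN:
  fixes A :: "'u::grothendieck_universe set" and B :: "'u \<Rightarrow> 'u set"
  assumes "small A" "\<And>i. i \<in> A \<Longrightarrow> small (B i)" shows "small (\<Union>i\<in>A. B i)"
proof -
  obtain z where z: "elts z = (\<Union>i\<in>elts (vset A). elts (vset (B i)))"
    using elts_UN[where x = "vset A" and f = "\<lambda>i. vset (B i)"] by blast
  have "(\<Union>i\<in>elts (vset A). elts (vset (B i))) = (\<Union>i\<in>A. B i)"
    using assms by (simp add: elts_vset)
  then show ?thesis using z small_elts[of z] by simp
qed

lemma small_pair: "small {x, y}"
  using elts_pair[of x y] by (metis small_elts)

lemma small_single: "small {x}"
  using small_pair[of x x] by simp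

lemma small_image: "small A \<Longrightarrow> small (f ` A)"
  for A :: "'u::grothendieck_universe set" and f :: "'u \<Rightarrow> 'u"
  using small_UN[of A "\<lambda>i. {f i}", OF _ small_single] by (simp add: UNION_singleton_eq_range)

text \<open>\<open>vset\<close> inverts \<open>elts\<close>, so the powerset axiom yields a small
  set of codes for the subsets. Sets of graphs and the index set of the colimit below are bounded by
  it.\<close>

lemma small_vset_Pow:
  assumes "small A" shows "small (vset ` Pow A)"
proof -
  obtain z where z: "elts ` elts z = Pow (elts (vset A))" using elts_Pow[of "vset A"] by (rule exE)
  have "vset ` Pow A = vset ` elts ` elts z" using z by (simp add: elts_vset assms)
  also have "\<dots> = elts z" by (simp add: image_image vset_elts)
  finally show ?thesis using small_elts by metis
qed

text \<open>Binary products are indexed by a two-element set of members of the universe; this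
  provides the two indices.\<close>

lemma ex_distinct: "\<exists>a b :: 'u::grothendieck_universe. a \<noteq> b"
proof -
  obtain x :: 'u where "infinite (elts x)" using elts_infinite by blast
  then show ?thesis by (metis finite.emptyI finite_insert finite_subset insertI1 subsetI)
qed

lemma kpair_eq_iff: "kpair a b = kpair c d \<longleftrightarrow> a = c \<and> b = d"
proof -
  have "kpair a b = kpair c d \<longleftrightarrow> {{a}, {a, b}} = {{c}, {c, d}}"
  proof
    assume "kpair a b = kpair c d"
    then have "{vset {a}, vset {a, b}} = {vset {c}, vset {c, d}}"
      by (simp add: kpair_def vset_eq_iff small_pair)
    then have "elts ` {vset {a}, vset {a, b}} = elts ` {vset {c}, vset {c, d}}" by simp
    then show "{{a}, {a, b}} = {{c}, {c, d}}"
      by (simp add: elts_vset small_single small_pair)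
  next
    assume "{{a}, {a, b}} = {{c}, {c, d}}"
    then have "vset ` {{a}, {a, b}} = vset ` {{c}, {c, d}}" by simp
    then show "kpair a b = kpair c d" by (simp add: kpair_def)
  qed
  then show ?thesis by (auto simp: doubleton_eq_iff)
qed

lemma small_kpairs: "small A \<Longrightarrow> small B \<Longrightarrow> small (\<Union>x\<in>A. \<Union>y\<in>B. {kpair x y})"
  by (intro small_UN small_single)

lemma elts_graph: "small A \<Longrightarrow> elts (graph A f) = (\<lambda>x. kpair x (f x)) ` A"
  by (simp add: graph_def elts_vset small_image)

lemma graph_app_graph: "small A \<Longrightarrow> x \<in> A \<Longrightarrow> graph_app (graph A f) x = f x"
  by (auto simp: graph_app_def elts_graph kpair_eq_iff image_iff)

lemma graph_eq_iff: "small A \<Longrightarrow> graph A f = graph A g \<longleftrightarrow> (\<forall>x\<in>A. f x = g x)"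
  by (metis (no_types, lifting) graph_app_graph graph_def image_cong)

lemma graph_cong: "(\<And>x. x \<in> A \<Longrightarrow> f x = g x) \<Longrightarrow> graph A f = graph A g"
  by (simp add: graph_def cong: image_cong)

text \<open>A graph codes a subset of the small set of pairs \<open>kpair x y\<close> with
  \<open>y \<in> B x\<close>. This bounds the carriers of products and thereby of
  hom-spaces.\<close>

lemma small_graphs:
  assumes "small A" "\<And>i. i \<in> A \<Longrightarrow> small (B i)"
  shows "small (graph A ` (\<Pi>\<^sub>E i\<in>A. B i))"
proof (rule small_subset)
  show "small (vset ` Pow (\<Union>x\<in>A. \<Union>y\<in>B x. {kpair x y}))"
    using assms by (intro small_vset_Pow small_UN small_single)
  show "graph A ` (\<Pi>\<^sub>E i\<in>A. B i) \<subseteq> vset ` Pow (\<Union>x\<in>A. \<Union>y\<in>B x. {kpair x y})"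
    unfolding graph_def by (auto simp: PiE_iff)
qed

section \<open>Linear algebra\<close>

context abelian_group
begin

lemma minus_add_cancel: "x \<in> carrier G \<Longrightarrow> y \<in> carrier G \<Longrightarrow> (x \<ominus> y) \<oplus> y = x"
  by (simp add: a_minus_def a_assoc l_neg)

lemma minus_self: "x \<in> carrier G \<Longrightarrow> x \<ominus> x = \<zero>"
  by (simp add: a_minus_def r_neg)

lemma minus_eq_zero_iff: "x \<in> carrier G \<Longrightarrow> y \<in> carrier G \<Longrightarrow> x \<ominus> y = \<zero> \<longleftrightarrow> x = y"
  by (metis l_zero minus_add_cancel minus_self)

lemma add_minus_add:
  "x \<in> carrier G \<Longrightarrow> y \<in> carrier G \<Longrightarrow> x' \<in> carrier G \<Longrightarrow> y' \<in> carrier G \<Longrightarrow>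
    (x \<oplus> x') \<ominus> (y \<oplus> y') = (x \<ominus> y) \<oplus> (x' \<ominus> y')"
  by (simp add: a_minus_def minus_add a_ac)

lemma minus_zero_right: "x \<in> carrier G \<Longrightarrow> x \<ominus> \<zero> = x"
  by (simp add: a_minus_def)

lemma minus_trans:
  "x \<in> carrier G \<Longrightarrow> y \<in> carrier G \<Longrightarrow> z \<in> carrier G \<Longrightarrow> (x \<ominus> y) \<oplus> (y \<ominus> z) = x \<ominus> z"
  by (simp add: a_minus_def a_ac r_neg1 r_neg2)

lemma add_minus_cancel: "x \<in> carrier G \<Longrightarrow> y \<in> carrier G \<Longrightarrow> (x \<oplus> y) \<ominus> y = x"
  by (simp add: a_minus_def a_assoc r_neg)

lemma minus_minus_self: "x \<in> carrier G \<Longrightarrow> y \<in> carrier G \<Longrightarrow> x \<ominus> (x \<ominus> y) = y"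
  by (simp add: a_minus_def minus_add r_neg1 r_neg2)

end

text \<open>Apart from the existence of negatives the module laws are equations, so they pass along
  a map \<open>q\<close> onto the carrier that is compatible with the operations. No law is assumed
  for \<open>N\<close>, which makes this the way to see that a quotient is a module.\<close>

lemma module_image:
  fixes M :: "('k, 'a) module" and N :: "('k, 'b) module"
  assumes M: "module K M" and q: "carrier N = q ` carrier M" and z: "\<zero>\<^bsub>N\<^esub> = q \<zero>\<^bsub>M\<^esub>"
    and add: "\<And>x y. x \<in> carrier M \<Longrightarrow> y \<in> carrier M \<Longrightarrow> q x \<oplus>\<^bsub>N\<^esub> q y = q (x \<oplus>\<^bsub>M\<^esub> y)"
    and smult: "\<And>a x. a \<in> carrier K \<Longrightarrow> x \<in> carrier M \<Longrightarrow> a \<odot>\<^bsub>N\<^esub> q x = q (a \<odot>\<^bsub>M\<^esub> x)"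
  shows "module K N"
proof -
  interpret M: module K M by fact
  show ?thesis
  proof (rule moduleI)
    show "cring K" by (rule M.R.cring_axioms)
    show "abelian_group N"
    proof (rule abelian_groupI)
      fix x assume "x \<in> carrier N"
      then obtain x' where "x' \<in> carrier M" "x = q x'" using q by auto
      then show "\<exists>y\<in>carrier N. y \<oplus>\<^bsub>N\<^esub> x = \<zero>\<^bsub>N\<^esub>"
        by (intro bexI[of _ "q (\<ominus>\<^bsub>M\<^esub> x')"]) (auto simp: add z q M.M.l_neg)
    qed (auto simp: q z add M.M.a_ac)
  qed (auto simp: q add smult M.smult_l_distr M.smult_r_distr M.smult_assoc1)
qed

locale vect = field K for K :: "'k ring"
begin

abbreviation VO :: "('k, 'u::grothendieck_universe) vs set" where "VO \<equiv> Obj (Vect K)"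
abbreviation FO :: "('k, 'u::grothendieck_universe) vfunctor set" where "FO \<equiv> Obj (Vect_Vect K)"
abbreviation lin :: "('k, 'u) vs \<Rightarrow> ('k, 'u) vs \<Rightarrow> ('u \<Rightarrow> 'u) set" where "lin \<equiv> linear_maps K"
abbreviation mor :: "('k, 'u::grothendieck_universe) vfunctor \<Rightarrow> ('k, 'u) vfunctor \<Rightarrow> ('k, 'u) vnat set"
  where "mor \<equiv> Hom (Vect_Vect K)"
abbreviation el :: "('k, 'u) vfunctor \<Rightarrow> ('k, 'u) vs \<Rightarrow> 'u set" where "el X V \<equiv> carrier (omap X V)"

text \<open>Negatives are multiples by the scalar minus one, so closure under scaling covers
  them.\<close>

lemma submodI:
  assumes "module K M" "H \<subseteq> carrier M" "\<zero>\<^bsub>M\<^esub> \<in> H"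
    and "\<And>x y. x \<in> H \<Longrightarrow> y \<in> H \<Longrightarrow> x \<oplus>\<^bsub>M\<^esub> y \<in> H"
    and "\<And>a x. a \<in> carrier K \<Longrightarrow> x \<in> H \<Longrightarrow> a \<odot>\<^bsub>M\<^esub> x \<in> H"
  shows "submodule H K M"
proof -
  interpret M: module K M by fact
  show ?thesis
  proof (rule M.submoduleI)
    fix a assume "a \<in> H"
    then show "\<ominus>\<^bsub>M\<^esub> a \<in> H" using assms(5)[of "\<ominus>\<^bsub>K\<^esub> \<one>\<^bsub>K\<^esub>" a] assms(2) M.smult_l_minus[of "\<one>\<^bsub>K\<^esub>" a] by auto
  qed (use assms in auto)
qed

lemma submodD:
  assumes "submodule H K M" "module K M"
  shows "H \<subseteq> carrier M" "\<zero>\<^bsub>M\<^esub> \<in> H"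
    "\<And>x y. x \<in> H \<Longrightarrow> y \<in> H \<Longrightarrow> x \<oplus>\<^bsub>M\<^esub> y \<in> H"
    "\<And>x y. x \<in> H \<Longrightarrow> y \<in> H \<Longrightarrow> x \<ominus>\<^bsub>M\<^esub> y \<in> H"
    "\<And>a x. a \<in> carrier K \<Longrightarrow> x \<in> H \<Longrightarrow> a \<odot>\<^bsub>M\<^esub> x \<in> H"
proof -
  interpret M: module K M by fact
  note E = M.submoduleE[OF assms(1)]
  show "H \<subseteq> carrier M" by (rule E(1))
  show a: "x \<oplus>\<^bsub>M\<^esub> y \<in> H" if "x \<in> H" "y \<in> H" for x y using that E by blast
  then show m: "x \<ominus>\<^bsub>M\<^esub> y \<in> H" if "x \<in> H" "y \<in> H" for x y using that E(3) by (simp add: a_minus_def)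
  show "a \<odot>\<^bsub>M\<^esub> x \<in> H" if "a \<in> carrier K" "x \<in> H" for a x using that E by blast
  obtain x where x: "x \<in> H" using E(2) by auto
  then have "x \<ominus>\<^bsub>M\<^esub> x = \<zero>\<^bsub>M\<^esub>" using E(1) by (intro M.M.minus_self) auto
  then show "\<zero>\<^bsub>M\<^esub> \<in> H" using m x by metis
qed

lemma submod_module: "submodule H K M \<Longrightarrow> module K M \<Longrightarrow> module K (M\<lparr>carrier := H\<rparr>)"
  by (rule submodule.submodule_is_module)

lemma submod_carrier: "module K M \<Longrightarrow> submodule (carrier M) K M"
  by (rule module.carrier_is_submodule)

lemma submod_zero: 
  assumes "module K M" shows "submodule {\<zero>\<^bsub>M\<^esub>} K M"
proof -
  interpret M: module K M by fact
  show ?thesis by (rule submodI) (use assms in auto)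
qed

lemma linI:
  assumes "f \<in> extensional (carrier V)" "\<And>x. x \<in> carrier V \<Longrightarrow> f x \<in> carrier W"
    "\<And>x y. x \<in> carrier V \<Longrightarrow> y \<in> carrier V \<Longrightarrow> f (x \<oplus>\<^bsub>V\<^esub> y) = f x \<oplus>\<^bsub>W\<^esub> f y"
    "\<And>a x. a \<in> carrier K \<Longrightarrow> x \<in> carrier V \<Longrightarrow> f (a \<odot>\<^bsub>V\<^esub> x) = a \<odot>\<^bsub>W\<^esub> f x"
  shows "f \<in> lin V W"
  using assms by (auto simp: linear_maps_def PiE_iff)

lemma linI_restrict:
  assumes "module K V" "\<And>x. x \<in> carrier V \<Longrightarrow> f x \<in> carrier W"
    "\<And>x y. x \<in> carrier V \<Longrightarrow> y \<in> carrier V \<Longrightarrow> f (x \<oplus>\<^bsub>V\<^esub> y) = f x \<oplus>\<^bsub>W\<^esub> f y"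
    "\<And>a x. a \<in> carrier K \<Longrightarrow> x \<in> carrier V \<Longrightarrow> f (a \<odot>\<^bsub>V\<^esub> x) = a \<odot>\<^bsub>W\<^esub> f x"
  shows "(\<lambda>x\<in>carrier V. f x) \<in> lin V W"
proof -
  interpret V: module K V by fact
  show ?thesis by (rule linI) (auto simp: assms)
qed

lemma
  assumes "f \<in> lin V W"
  shows lin_ext: "f \<in> extensional (carrier V)"
    and lin_closed: "\<And>x. x \<in> carrier V \<Longrightarrow> f x \<in> carrier W"
    and lin_plus: "\<And>x y. x \<in> carrier V \<Longrightarrow> y \<in> carrier V \<Longrightarrow> f (x \<oplus>\<^bsub>V\<^esub> y) = f x \<oplus>\<^bsub>W\<^esub> f y"
    and lin_scale: "\<And>a x. a \<in> carrier K \<Longrightarrow> x \<in> carrier V \<Longrightarrow> f (a \<odot>\<^bsub>V\<^esub> x) = a \<odot>\<^bsub>W\<^esub> f x"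
  using assms by (auto simp: linear_maps_def PiE_iff)

lemma
  assumes "f \<in> lin V W" "module K V" "module K W"
  shows lin_zero: "f \<zero>\<^bsub>V\<^esub> = \<zero>\<^bsub>W\<^esub>"
    and lin_minus: "\<And>x y. x \<in> carrier V \<Longrightarrow> y \<in> carrier V \<Longrightarrow> f (x \<ominus>\<^bsub>V\<^esub> y) = f x \<ominus>\<^bsub>W\<^esub> f y"
proof -
  interpret V: module K V by fact
  interpret W: module K W by fact
  note l = lin_closed[OF assms(1)] lin_plus[OF assms(1)] lin_scale[OF assms(1)]
  have "f (\<zero>\<^bsub>K\<^esub> \<odot>\<^bsub>V\<^esub> \<zero>\<^bsub>V\<^esub>) = \<zero>\<^bsub>W\<^esub>" by (simp add: l del: V.smult_l_null V.smult_r_null)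
  then show "f \<zero>\<^bsub>V\<^esub> = \<zero>\<^bsub>W\<^esub>" by simp
  show "f (x \<ominus>\<^bsub>V\<^esub> y) = f x \<ominus>\<^bsub>W\<^esub> f y" if "x \<in> carrier V" "y \<in> carrier V" for x y
    by (metis V.M.minus_add_cancel V.M.minus_closed W.M.add_minus_cancel l(1,2) that)
qed

lemma lin_compose:
  assumes "f \<in> lin V W" "g \<in> lin W Z" "module K V"
  shows "compose (carrier V) g f \<in> lin V Z"
  unfolding compose_def
  by (rule linI_restrict)
    (simp_all add: assms(3) lin_closed[OF assms(1)] lin_closed[OF assms(2)] lin_plus[OF assms(1)] lin_plus[OF assms(2)]
      lin_scale[OF assms(1)] lin_scale[OF assms(2)])

lemma lin_id: "module K V \<Longrightarrow> (\<lambda>x\<in>carrier V. x) \<in> lin V V"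
  by (rule linI_restrict) auto

lemma lin_incl: "module K V \<Longrightarrow> submodule H K V \<Longrightarrow> (\<lambda>x\<in>H. x) \<in> lin (V\<lparr>carrier := H\<rparr>) V"
  using linI_restrict[of "V\<lparr>carrier := H\<rparr>" "\<lambda>x. x" V] submod_module submodD(1)[of H V] by auto

lemma lin_null:
  assumes "module K V" "module K W" shows "(\<lambda>x\<in>carrier V. \<zero>\<^bsub>W\<^esub>) \<in> lin V W"
proof -
  interpret W: module K W by fact
  show ?thesis using assms by (intro linI_restrict) auto
qed

lemma lin_sum:
  assumes f: "f \<in> lin V W" and g: "g \<in> lin V W" and "module K V" "module K W"
  shows "(\<lambda>x\<in>carrier V. f x \<oplus>\<^bsub>W\<^esub> g x) \<in> lin V W"
proof -
  interpret V: module K V by fact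
  interpret W: module K W by fact
  note l = lin_closed[OF f] lin_plus[OF f] lin_scale[OF f] lin_closed[OF g] lin_plus[OF g] lin_scale[OF g]
  show ?thesis
    by (rule linI_restrict) (simp_all add: assms l W.smult_r_distr W.M.a_ac)
qed

lemma lin_smultiple:
  assumes f: "f \<in> lin V W" and a: "a \<in> carrier K" and "module K V" "module K W"
  shows "(\<lambda>x\<in>carrier V. a \<odot>\<^bsub>W\<^esub> f x) \<in> lin V W"
proof -
  interpret V: module K V by fact
  interpret W: module K W by fact
  note l = lin_closed[OF f] lin_plus[OF f] lin_scale[OF f]
  have "a \<odot>\<^bsub>W\<^esub> (b \<odot>\<^bsub>W\<^esub> x) = b \<odot>\<^bsub>W\<^esub> (a \<odot>\<^bsub>W\<^esub> x)" if "b \<in> carrier K" "x \<in> carrier W" for b x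
    using that a by (metis W.smult_assoc1 m_comm)
  then show ?thesis
    by (intro linI_restrict) (simp_all add: assms l W.smult_r_distr)
qed

lemma lin_diff:
  assumes f: "f \<in> lin V W" and g: "g \<in> lin V W" and "module K V" "module K W"
  shows "(\<lambda>x\<in>carrier V. f x \<ominus>\<^bsub>W\<^esub> g x) \<in> lin V W"
proof -
  interpret W: module K W by fact
  have "(\<lambda>x\<in>carrier V. f x \<oplus>\<^bsub>W\<^esub> (\<lambda>x\<in>carrier V. (\<ominus>\<^bsub>K\<^esub> \<one>\<^bsub>K\<^esub>) \<odot>\<^bsub>W\<^esub> g x) x) \<in> lin V W"
    using assms by (intro lin_sum lin_smultiple) auto
  also have "(\<lambda>x\<in>carrier V. f x \<oplus>\<^bsub>W\<^esub> (\<lambda>x\<in>carrier V. (\<ominus>\<^bsub>K\<^esub> \<one>\<^bsub>K\<^esub>) \<odot>\<^bsub>W\<^esub> g x) x) =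
      (\<lambda>x\<in>carrier V. f x \<ominus>\<^bsub>W\<^esub> g x)"
    using lin_closed[OF g] by (auto simp: a_minus_def W.smult_l_minus)
  finally show ?thesis .
qed

lemma kernel_submod:
  assumes f: "f \<in> lin V W" and "module K V" "module K W"
  shows "submodule {x \<in> carrier V. f x = \<zero>\<^bsub>W\<^esub>} K V"
proof -
  interpret V: module K V by fact
  interpret W: module K W by fact
  show ?thesis
    by (rule submodI)
      (auto simp: assms lin_zero[OF f] lin_plus[OF f] lin_scale[OF f])
qed

lemma image_submod:
  assumes f: "f \<in> lin V W" and "module K V" "module K W"
  shows "submodule (f ` carrier V) K W"
proof -
  interpret V: module K V by fact
  interpret W: module K W by fact
  show ?thesis
  proof (rule submodI)
    show "\<zero>\<^bsub>W\<^esub> \<in> f ` carrier V" using lin_zero[OF f] assms by (metis V.M.zero_closed imageI)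
    show "x \<oplus>\<^bsub>W\<^esub> y \<in> f ` carrier V" if "x \<in> f ` carrier V" "y \<in> f ` carrier V" for x y
      using that lin_plus[OF f, symmetric] by auto
    show "a \<odot>\<^bsub>W\<^esub> x \<in> f ` carrier V" if "a \<in> carrier K" "x \<in> f ` carrier V" for a x
      using that lin_scale[OF f, symmetric] by auto
  qed (use lin_closed[OF f] assms in auto)
qed

section \<open>Complements of subspaces and pseudo-inverses of linear maps\<close>

lemma submod_Union_chain:
  assumes "module K M" "C \<noteq> {}" "\<And>H. H \<in> C \<Longrightarrow> submodule H K M"
    "\<And>H H'. H \<in> C \<Longrightarrow> H' \<in> C \<Longrightarrow> \<exists>G\<in>C. H \<subseteq> G \<and> H' \<subseteq> G"
  shows "submodule (\<Union>C) K M"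
proof (rule submodI)
  show "\<Union>C \<subseteq> carrier M" using submodD(1)[OF assms(3) assms(1)] by blast
  show "\<zero>\<^bsub>M\<^esub> \<in> \<Union>C" using submodD(2)[OF assms(3) assms(1)] assms(2) by blast
  show "x \<oplus>\<^bsub>M\<^esub> y \<in> \<Union>C" if xy: "x \<in> \<Union>C" "y \<in> \<Union>C" for x y
  proof -
    obtain H H' where H: "H \<in> C" "x \<in> H" "H' \<in> C" "y \<in> H'" using xy by auto
    then obtain G where "G \<in> C" "H \<subseteq> G" "H' \<subseteq> G" using assms(4) by blast
    then show ?thesis using H submodD(3)[OF assms(3)[of G] assms(1)] by blast
  qed
  show "a \<odot>\<^bsub>M\<^esub> x \<in> \<Union>C" if "a \<in> carrier K" "x \<in> \<Union>C" for a x
    using that submodD(5)[OF assms(3) assms(1)] by blast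
qed (rule assms(1))

text \<open>Zorn's lemma gives a submodule \<open>C\<close> that is maximal among those meeting
  \<open>H\<close> only in zero. A vector \<open>x\<close> outside \<open>C + H\<close> would allow
  \<open>C\<close> to be enlarged by the line through \<open>x\<close>, because nonzero scalars are
  invertible; maximality then puts \<open>x\<close> into \<open>C\<close>, a contradiction.\<close>

lemma complement:
  assumes M: "module K M" and H: "submodule H K M"
  obtains C where "submodule C K M" "C \<inter> H = {\<zero>\<^bsub>M\<^esub>}"
    "\<And>x. x \<in> carrier M \<Longrightarrow> \<exists>c\<in>C. \<exists>h\<in>H. x = c \<oplus>\<^bsub>M\<^esub> h"
proof -
  interpret M: module K M by fact
  note H' = submodD[OF H M]
  let ?A = "{C. submodule C K M \<and> C \<inter> H = {\<zero>\<^bsub>M\<^esub>}}"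
  have "\<exists>C\<in>?A. \<forall>X\<in>?A. C \<subseteq> X \<longrightarrow> X = C"
  proof (rule subset_Zorn_nonempty)
    show "?A \<noteq> {}" using submod_zero[OF M] H'(2) by auto
    fix \<C> assume c: "\<C> \<noteq> {}" "subset.chain ?A \<C>"
    have "submodule (\<Union>\<C>) K M"
    proof (rule submod_Union_chain)
      fix H H' assume "H \<in> \<C>" "H' \<in> \<C>"
      then have "H \<subseteq> H' \<or> H' \<subseteq> H" using c(2) by (simp add: subset_chain_def)
      then show "\<exists>G\<in>\<C>. H \<subseteq> G \<and> H' \<subseteq> G" using \<open>H \<in> \<C>\<close> \<open>H' \<in> \<C>\<close> by blast
    next
      show "submodule H K M" if "H \<in> \<C>" for H using c(2) that by (auto simp: subset_chain_def)
    qed (fact M c(1))+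
    then show "\<Union>\<C> \<in> ?A" using c by (auto simp: subset_chain_def)
  qed
  then obtain C where C: "submodule C K M" "C \<inter> H = {\<zero>\<^bsub>M\<^esub>}"
    and max: "\<And>X. submodule X K M \<Longrightarrow> X \<inter> H = {\<zero>\<^bsub>M\<^esub>} \<Longrightarrow> C \<subseteq> X \<Longrightarrow> X = C" by auto
  note C' = submodD[OF C(1) M]
  have "\<exists>c\<in>C. \<exists>h\<in>H. x = c \<oplus>\<^bsub>M\<^esub> h" if x: "x \<in> carrier M" for x
  proof (rule ccontr)
    assume no: "\<not> ?thesis"
    let ?X = "{c \<oplus>\<^bsub>M\<^esub> a \<odot>\<^bsub>M\<^esub> x | c a. c \<in> C \<and> a \<in> carrier K}"
    have inX: "\<And>c a. c \<in> C \<Longrightarrow> a \<in> carrier K \<Longrightarrow> c \<oplus>\<^bsub>M\<^esub> a \<odot>\<^bsub>M\<^esub> x \<in> ?X" by blast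
    have cc: "\<And>c. c \<in> C \<Longrightarrow> c \<in> carrier M" using C' by auto
    have "submodule ?X K M"
    proof (rule submodI)
      show "?X \<subseteq> carrier M" using x cc by auto
      show "\<zero>\<^bsub>M\<^esub> \<in> ?X" using inX[of "\<zero>\<^bsub>M\<^esub>" "\<zero>\<^bsub>K\<^esub>"] C'(2) x by auto
      show "y \<oplus>\<^bsub>M\<^esub> z \<in> ?X" if y: "y \<in> ?X" and z: "z \<in> ?X" for y z
      proof -
        obtain c a d b where yz: "y = c \<oplus>\<^bsub>M\<^esub> a \<odot>\<^bsub>M\<^esub> x" "z = d \<oplus>\<^bsub>M\<^esub> b \<odot>\<^bsub>M\<^esub> x" and
          m: "c \<in> C" "d \<in> C" "a \<in> carrier K" "b \<in> carrier K" using y z by auto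
        then have "y \<oplus>\<^bsub>M\<^esub> z = (c \<oplus>\<^bsub>M\<^esub> d) \<oplus>\<^bsub>M\<^esub> (a \<oplus>\<^bsub>K\<^esub> b) \<odot>\<^bsub>M\<^esub> x"
          using x by (simp add: cc M.smult_l_distr M.M.a_ac)
        then show ?thesis using inX C'(3) m by auto
      qed
      show "b \<odot>\<^bsub>M\<^esub> y \<in> ?X" if b: "b \<in> carrier K" and y: "y \<in> ?X" for b y
      proof -
        obtain c a where yz: "y = c \<oplus>\<^bsub>M\<^esub> a \<odot>\<^bsub>M\<^esub> x" and m: "c \<in> C" "a \<in> carrier K" using y by auto
        then have "b \<odot>\<^bsub>M\<^esub> y = b \<odot>\<^bsub>M\<^esub> c \<oplus>\<^bsub>M\<^esub> (b \<otimes>\<^bsub>K\<^esub> a) \<odot>\<^bsub>M\<^esub> x"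
          using x b by (simp add: cc M.smult_r_distr M.smult_assoc1)
        then show ?thesis using inX C'(5) m b by auto
      qed
    qed (rule M)
    moreover have "?X \<inter> H = {\<zero>\<^bsub>M\<^esub>}"
    proof -
      have "c \<oplus>\<^bsub>M\<^esub> a \<odot>\<^bsub>M\<^esub> x = \<zero>\<^bsub>M\<^esub>" if h: "c \<oplus>\<^bsub>M\<^esub> a \<odot>\<^bsub>M\<^esub> x \<in> H" and m: "c \<in> C" "a \<in> carrier K" for c a
      proof (cases "a = \<zero>\<^bsub>K\<^esub>")
        case True
        then show ?thesis using h m x C(2) cc by auto
      next
        \<comment> \<open>Dividing \<open>c + a x \<in> H\<close> by the unit \<open>a\<close>
          writes \<open>x\<close> as a member of \<open>C\<close> plus a member of \<open>H\<close>,
          which \<open>no\<close> excludes.\<close>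
        case False
        then have u: "a \<in> Units K" using m field_Units by auto
        let ?h = "c \<oplus>\<^bsub>M\<^esub> a \<odot>\<^bsub>M\<^esub> x"
        have "a \<odot>\<^bsub>M\<^esub> x = (\<ominus>\<^bsub>M\<^esub> c) \<oplus>\<^bsub>M\<^esub> ?h" using m x cc by (simp add: M.M.r_neg1)
        then have "inv\<^bsub>K\<^esub> a \<odot>\<^bsub>M\<^esub> (a \<odot>\<^bsub>M\<^esub> x) = inv\<^bsub>K\<^esub> a \<odot>\<^bsub>M\<^esub> (\<ominus>\<^bsub>M\<^esub> c) \<oplus>\<^bsub>M\<^esub> inv\<^bsub>K\<^esub> a \<odot>\<^bsub>M\<^esub> ?h"
          using m x cc u M.smult_r_distr[of "inv\<^bsub>K\<^esub> a" "\<ominus>\<^bsub>M\<^esub> c" ?h] by simp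
        moreover have "inv\<^bsub>K\<^esub> a \<odot>\<^bsub>M\<^esub> (a \<odot>\<^bsub>M\<^esub> x) = x"
          using u m x by (simp flip: M.smult_assoc1)
        moreover have "inv\<^bsub>K\<^esub> a \<odot>\<^bsub>M\<^esub> (\<ominus>\<^bsub>M\<^esub> c) \<in> C"
          using C' m u M.submoduleE(3)[OF C(1)] by auto
        moreover have "inv\<^bsub>K\<^esub> a \<odot>\<^bsub>M\<^esub> ?h \<in> H" using H' h u by auto
        ultimately show ?thesis using no by auto
      qed
      moreover have "\<zero>\<^bsub>M\<^esub> \<in> ?X" using inX[of "\<zero>\<^bsub>M\<^esub>" "\<zero>\<^bsub>K\<^esub>"] C'(2) x by auto
      ultimately show ?thesis using H'(2) by blast
    qed
    moreover have "C \<subseteq> ?X"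
    proof
      fix c assume "c \<in> C" then show "c \<in> ?X" using inX[of c "\<zero>\<^bsub>K\<^esub>"] x cc by auto
    qed
    ultimately have "?X = C" using max by blast
    moreover have "x \<in> ?X" using inX[of "\<zero>\<^bsub>M\<^esub>" "\<one>\<^bsub>K\<^esub>"] C'(2) x by auto
    ultimately have "x \<in> C" by blast
    then show False using no H'(2) x by (metis M.M.r_zero)
  qed
  then show ?thesis using C that by blast
qed

text \<open>With \<open>C\<close> a complement of the kernel of \<open>f\<close> and
  \<open>D\<close> a complement of its image, \<open>f\<close> maps \<open>C\<close> isomorphically
  onto the image. The map \<open>g\<close> inverts this isomorphism and is zero on \<open>D\<close>;
  in one formula, \<open>g w\<close> is the only \<open>c \<in> C\<close> with
  \<open>w - f c \<in> D\<close>, which is the relation \<open>R\<close>. As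
  \<open>f x - f (g (f x))\<close> lies both in \<open>D\<close> and in the image, it
  vanishes.\<close>

lemma pseudo_inverse:
  assumes f: "f \<in> lin V W" and V: "module K V" and W: "module K W"
  obtains g where "g \<in> lin W V" "\<And>x. x \<in> carrier V \<Longrightarrow> f (g (f x)) = f x"
proof -
  interpret V: module K V by fact
  interpret W: module K W by fact
  note fl = lin_closed[OF f] lin_plus[OF f] lin_scale[OF f]
  obtain C where C: "submodule C K V" "C \<inter> {x \<in> carrier V. f x = \<zero>\<^bsub>W\<^esub>} = {\<zero>\<^bsub>V\<^esub>}"
    "\<And>x. x \<in> carrier V \<Longrightarrow> \<exists>c\<in>C. \<exists>h\<in>{x \<in> carrier V. f x = \<zero>\<^bsub>W\<^esub>}. x = c \<oplus>\<^bsub>V\<^esub> h"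
    by (rule complement[OF V kernel_submod[OF f V W]]) blast
  obtain D where D: "submodule D K W" "D \<inter> f ` carrier V = {\<zero>\<^bsub>W\<^esub>}"
    "\<And>x. x \<in> carrier W \<Longrightarrow> \<exists>d\<in>D. \<exists>h\<in>f ` carrier V. x = d \<oplus>\<^bsub>W\<^esub> h"
    by (rule complement[OF W image_submod[OF f V W]]) blast
  note C' = submodD[OF C(1) V] and D' = submodD[OF D(1) W]
  have Cc: "\<And>c. c \<in> C \<Longrightarrow> c \<in> carrier V" and Dc: "\<And>c. c \<in> D \<Longrightarrow> c \<in> carrier W" using C' D' by auto
  define R where "R w c \<longleftrightarrow> c \<in> C \<and> w \<ominus>\<^bsub>W\<^esub> f c \<in> D" for w c
  have ex: "\<exists>c. R w c" if w: "w \<in> carrier W" for w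
  proof -
    obtain d x where d: "d \<in> D" "x \<in> carrier V" "w = d \<oplus>\<^bsub>W\<^esub> f x" using D(3)[OF w] by auto
    obtain c h where c: "c \<in> C" "h \<in> carrier V" "f h = \<zero>\<^bsub>W\<^esub>" "x = c \<oplus>\<^bsub>V\<^esub> h" using C(3)[OF d(2)] by auto
    have "f x = f c" using c by (simp add: fl Cc)
    then have "w \<ominus>\<^bsub>W\<^esub> f c = d" using d Dc c Cc fl by (simp add: W.M.add_minus_cancel)
    then show ?thesis using c d by (auto simp: R_def)
  qed
  have un: "c = c'" if R: "R w c" "R w c'" and w: "w \<in> carrier W" for w c c'
  proof -
    have c: "c \<in> C" "c' \<in> C" "c \<in> carrier V" "c' \<in> carrier V" using R Cc by (auto simp: R_def)
    \<comment> \<open>The difference of the two members of \<open>D\<close> is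
      \<open>f (c' - c)\<close>, which is also in the image and hence zero; so \<open>c' - c\<close>
      lies in \<open>C\<close> and in the kernel.\<close>
    have "(w \<ominus>\<^bsub>W\<^esub> f c) \<ominus>\<^bsub>W\<^esub> (w \<ominus>\<^bsub>W\<^esub> f c') \<in> D" using R D' by (auto simp: R_def)
    also have "(w \<ominus>\<^bsub>W\<^esub> f c) \<ominus>\<^bsub>W\<^esub> (w \<ominus>\<^bsub>W\<^esub> f c') = f c' \<ominus>\<^bsub>W\<^esub> f c"
      using c w fl by (simp add: a_minus_def W.M.minus_add W.M.a_ac W.M.r_neg1 W.M.r_neg2)
    also have "\<dots> = f (c' \<ominus>\<^bsub>V\<^esub> c)" using c lin_minus[OF f V W] by simp
    finally have "f (c' \<ominus>\<^bsub>V\<^esub> c) = \<zero>\<^bsub>W\<^esub>" using D(2) c by auto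
    then have "c' \<ominus>\<^bsub>V\<^esub> c = \<zero>\<^bsub>V\<^esub>" using C(2) C'(4) c by auto
    then show ?thesis using c V.M.minus_eq_zero_iff by auto
  qed
  define g where "g = (\<lambda>w\<in>carrier W. THE c. R w c)"
  have gR: "R w (g w)" if "w \<in> carrier W" for w
    unfolding g_def using that ex[OF that] un theI[of "R w"] by (simp, metis)
  have gu: "g w = c" if "R w c" "w \<in> carrier W" for w c using un gR that by blast
  have gC: "g w \<in> C" "g w \<in> carrier V" "w \<ominus>\<^bsub>W\<^esub> f (g w) \<in> D" if "w \<in> carrier W" for w
    using gR[OF that] Cc by (auto simp: R_def)
  have "g \<in> lin W V"
  proof (rule linI)
    fix x y assume xy: "x \<in> carrier W" "y \<in> carrier W"
    have "x \<oplus>\<^bsub>W\<^esub> y \<ominus>\<^bsub>W\<^esub> f (g x \<oplus>\<^bsub>V\<^esub> g y) = (x \<ominus>\<^bsub>W\<^esub> f (g x)) \<oplus>\<^bsub>W\<^esub> (y \<ominus>\<^bsub>W\<^esub> f (g y))"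
      using xy gC fl by (simp add: W.M.add_minus_add)
    then have "R (x \<oplus>\<^bsub>W\<^esub> y) (g x \<oplus>\<^bsub>V\<^esub> g y)"
      using gC xy C' D' by (simp add: R_def)
    then show "g (x \<oplus>\<^bsub>W\<^esub> y) = g x \<oplus>\<^bsub>V\<^esub> g y" using gu xy by auto
  next
    fix a x assume ax: "a \<in> carrier K" "x \<in> carrier W"
    have "a \<odot>\<^bsub>W\<^esub> x \<ominus>\<^bsub>W\<^esub> f (a \<odot>\<^bsub>V\<^esub> g x) = a \<odot>\<^bsub>W\<^esub> (x \<ominus>\<^bsub>W\<^esub> f (g x))"
      using ax gC fl by (simp add: a_minus_def W.smult_r_distr W.smult_r_minus)
    then have "R (a \<odot>\<^bsub>W\<^esub> x) (a \<odot>\<^bsub>V\<^esub> g x)"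
      using gC ax C' D' by (simp add: R_def)
    then show "g (a \<odot>\<^bsub>W\<^esub> x) = a \<odot>\<^bsub>V\<^esub> g x" using gu ax by auto
  next
    show "g \<in> extensional (carrier W)" by (simp add: g_def)
  qed (rule gC(2))
  moreover have "f (g (f x)) = f x" if x: "x \<in> carrier V" for x
  proof -
    have "f x \<ominus>\<^bsub>W\<^esub> f (g (f x)) \<in> D" using gC x fl by auto
    moreover have "f x \<ominus>\<^bsub>W\<^esub> f (g (f x)) = f (x \<ominus>\<^bsub>V\<^esub> g (f x))" using x gC fl lin_minus[OF f V W] by auto
    ultimately have "f x \<ominus>\<^bsub>W\<^esub> f (g (f x)) = \<zero>\<^bsub>W\<^esub>" using D(2) gC x fl by auto
    then show ?thesis using W.M.minus_eq_zero_iff gC x fl by auto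
  qed
  ultimately show ?thesis using that by blast
qed

end

section \<open>Small vector spaces\<close>

text \<open>The fields are filled exactly as in \<open>hom_space\<close>, so that a hom-space is
  literally a carrier update of a power of its target.\<close>

definition prod_space :: "'u::grothendieck_universe set \<Rightarrow> ('u \<Rightarrow> ('k, 'u) vs) \<Rightarrow> ('k, 'u) vs" where
  "prod_space I M =
     \<lparr>carrier = graph I ` (\<Pi>\<^sub>E i\<in>I. carrier (M i)),
      monoid.mult = (\<lambda>_ _. undefined),
      one = undefined,
      zero = graph I (\<lambda>i. \<zero>\<^bsub>M i\<^esub>),
      add = (\<lambda>p q. graph I (\<lambda>i. graph_app p i \<oplus>\<^bsub>M i\<^esub> graph_app q i)),
      smult = (\<lambda>a p. graph I (\<lambda>i. a \<odot>\<^bsub>M i\<^esub> graph_app p i))\<rparr>"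

definition coset :: "('k, 'u::grothendieck_universe) vs \<Rightarrow> 'u set \<Rightarrow> 'u \<Rightarrow> 'u" where
  "coset M N x = vset (N +>\<^bsub>M\<^esub> x)"

lemma graph_prodI: "(\<And>i. i \<in> I \<Longrightarrow> f i \<in> carrier (M i)) \<Longrightarrow> graph I f \<in> carrier (prod_space I M)"
  unfolding prod_space_def by (simp, rule image_eqI[of _ _ "\<lambda>i\<in>I. f i"]) (auto intro: graph_cong)

lemma prod_app: "small I \<Longrightarrow> p \<in> carrier (prod_space I M) \<Longrightarrow> i \<in> I \<Longrightarrow> graph_app p i \<in> carrier (M i)"
  by (auto simp: prod_space_def graph_app_graph)

lemma prod_graph_app: "small I \<Longrightarrow> p \<in> carrier (prod_space I M) \<Longrightarrow> graph I (graph_app p) = p"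
  by (auto simp: prod_space_def graph_app_graph graph_eq_iff)

lemma prod_space_eqI:
  "small I \<Longrightarrow> p \<in> carrier (prod_space I M) \<Longrightarrow> q \<in> carrier (prod_space I M) \<Longrightarrow>
    (\<And>i. i \<in> I \<Longrightarrow> graph_app p i = graph_app q i) \<Longrightarrow> p = q"
  by (auto simp: prod_space_def graph_app_graph graph_eq_iff)

lemma prod_ops:
  assumes "small I" "i \<in> I"
  shows "graph_app (p \<oplus>\<^bsub>prod_space I M\<^esub> q) i = graph_app p i \<oplus>\<^bsub>M i\<^esub> graph_app q i"
    and "graph_app (a \<odot>\<^bsub>prod_space I M\<^esub> p) i = a \<odot>\<^bsub>M i\<^esub> graph_app p i"
    and "graph_app \<zero>\<^bsub>prod_space I M\<^esub> i = \<zero>\<^bsub>M i\<^esub>"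
  using assms by (simp_all add: prod_space_def graph_app_graph)

context vect
begin

lemma VO_iff: "V \<in> VO \<longleftrightarrow> module K V \<and> small (carrier V)"
  by (simp add: Vect_def)

lemma VO_module: "V \<in> VO \<Longrightarrow> module K V"
  by (simp add: Vect_def)

lemma VO_small: "V \<in> VO \<Longrightarrow> small (carrier V)"
  by (simp add: Vect_def)

lemma Arr_Vect_iff:
  "(V, W, f) \<in> Arr (Vect K) \<longleftrightarrow> V \<in> VO \<and> W \<in> VO \<and> f \<in> lin V W"
  by (auto simp: Vect_def)

lemma Vect_simps [simp]:
  "Dom (Vect K) (V, W, f) = V" "Cod (Vect K) (V, W, f) = W"
  "Comp (Vect K) (W', Z, g) (V, W, f) = (V, Z, compose (carrier V) g f)"
  "Ident (Vect K) V = (V, V, \<lambda>x\<in>carrier V. x)"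
  by (simp_all add: Vect_def)

lemma Arr_VectE:
  assumes "t \<in> Arr (Vect K)"
  obtains V W f where "t = (V, W, f)" "V \<in> VO" "W \<in> VO" "f \<in> lin V W"
  using assms by (auto simp: Vect_def)

lemma Hom_Vect_iff:
  "(V, W, f) \<in> Hom (Vect K) V' W' \<longleftrightarrow>
    V' = V \<and> W' = W \<and> V \<in> VO \<and> W \<in> VO \<and> f \<in> lin V W"
  by (auto simp: Hom_def Arr_Vect_iff)

lemma sub_VO: "V \<in> VO \<Longrightarrow> submodule H K V \<Longrightarrow> V\<lparr>carrier := H\<rparr> \<in> VO"
  using submod_module[of H V] submodD(1)[of H V] small_subset by (auto simp: VO_iff)

lemma prod_VO:
  assumes I: "small I" and M: "\<And>i. i \<in> I \<Longrightarrow> M i \<in> VO"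
  shows "prod_space I M \<in> VO"
proof -
  have mod: "module K (M i)" if "i \<in> I" for i using M[OF that] by (rule VO_module)
  let ?P = "prod_space I M"
  note app = prod_app[OF I, where M = M] and ops = prod_ops[OF I] and eqI = prod_space_eqI[OF I, where M = M]
  have cl: "p \<oplus>\<^bsub>?P\<^esub> q \<in> carrier ?P" if "p \<in> carrier ?P" "q \<in> carrier ?P" for p q
  proof -
    have "graph_app p i \<oplus>\<^bsub>M i\<^esub> graph_app q i \<in> carrier (M i)" if i: "i \<in> I" for i
    proof -
      interpret Mi: module K "M i" by (rule mod[OF i])
      show ?thesis using app[of p i] app[of q i] i \<open>p \<in> carrier ?P\<close> \<open>q \<in> carrier ?P\<close> by simp
    qed
    then have "graph I (\<lambda>i. graph_app p i \<oplus>\<^bsub>M i\<^esub> graph_app q i) \<in> carrier ?P" by (rule graph_prodI)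
    then show ?thesis by (simp add: prod_space_def)
  qed
  have cz: "\<zero>\<^bsub>?P\<^esub> \<in> carrier ?P"
  proof -
    have "\<zero>\<^bsub>M i\<^esub> \<in> carrier (M i)" if i: "i \<in> I" for i
    proof -
      interpret Mi: module K "M i" by (rule mod[OF i])
      show ?thesis by simp
    qed
    then have "graph I (\<lambda>i. \<zero>\<^bsub>M i\<^esub>) \<in> carrier ?P" by (rule graph_prodI)
    then show ?thesis by (simp add: prod_space_def)
  qed
  have cs: "a \<odot>\<^bsub>?P\<^esub> p \<in> carrier ?P" if "p \<in> carrier ?P" "a \<in> carrier K" for p a
  proof -
    have "a \<odot>\<^bsub>M i\<^esub> graph_app p i \<in> carrier (M i)" if i: "i \<in> I" for i
    proof -
      interpret Mi: module K "M i" by (rule mod[OF i])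
      show ?thesis using app[of p i] i \<open>p \<in> carrier ?P\<close> \<open>a \<in> carrier K\<close> by simp
    qed
    then have "graph I (\<lambda>i. a \<odot>\<^bsub>M i\<^esub> graph_app p i) \<in> carrier ?P" by (rule graph_prodI)
    then show ?thesis by (simp add: prod_space_def)
  qed
  have "abelian_group ?P"
  proof (rule abelian_groupI)
    fix x y z assume x: "x \<in> carrier ?P" and y: "y \<in> carrier ?P" and z: "z \<in> carrier ?P"
    show "(x \<oplus>\<^bsub>?P\<^esub> y) \<oplus>\<^bsub>?P\<^esub> z = x \<oplus>\<^bsub>?P\<^esub> (y \<oplus>\<^bsub>?P\<^esub> z)"
    proof (rule eqI)
      fix i assume i: "i \<in> I"
      interpret Mi: module K "M i" by (rule mod[OF i])
      show "graph_app ((x \<oplus>\<^bsub>?P\<^esub> y) \<oplus>\<^bsub>?P\<^esub> z) i = graph_app (x \<oplus>\<^bsub>?P\<^esub> (y \<oplus>\<^bsub>?P\<^esub> z)) i"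
        using app x y z i by (simp add: ops Mi.M.a_assoc)
    qed (intro cl x y z)+
  next
    fix x y assume x: "x \<in> carrier ?P" and y: "y \<in> carrier ?P"
    show "x \<oplus>\<^bsub>?P\<^esub> y = y \<oplus>\<^bsub>?P\<^esub> x"
    proof (rule eqI)
      fix i assume i: "i \<in> I"
      interpret Mi: module K "M i" by (rule mod[OF i])
      show "graph_app (x \<oplus>\<^bsub>?P\<^esub> y) i = graph_app (y \<oplus>\<^bsub>?P\<^esub> x) i"
        using app x y i by (simp add: ops Mi.M.a_comm)
    qed (intro cl x y)+
  next
    fix x assume x: "x \<in> carrier ?P"
    show "\<zero>\<^bsub>?P\<^esub> \<oplus>\<^bsub>?P\<^esub> x = x"
    proof (rule eqI)
      fix i assume i: "i \<in> I"
      interpret Mi: module K "M i" by (rule mod[OF i])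
      show "graph_app (\<zero>\<^bsub>?P\<^esub> \<oplus>\<^bsub>?P\<^esub> x) i = graph_app x i"
        using app x i by (simp add: ops)
    qed (intro cl x cz)+
    show "\<exists>y\<in>carrier ?P. y \<oplus>\<^bsub>?P\<^esub> x = \<zero>\<^bsub>?P\<^esub>"
    proof (rule bexI)
      show c: "(\<ominus>\<^bsub>K\<^esub> \<one>\<^bsub>K\<^esub>) \<odot>\<^bsub>?P\<^esub> x \<in> carrier ?P" by (intro cs x) simp
      show "(\<ominus>\<^bsub>K\<^esub> \<one>\<^bsub>K\<^esub>) \<odot>\<^bsub>?P\<^esub> x \<oplus>\<^bsub>?P\<^esub> x = \<zero>\<^bsub>?P\<^esub>"
      proof (rule eqI)
        fix i assume i: "i \<in> I"
        interpret Mi: module K "M i" by (rule mod[OF i])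
        show "graph_app ((\<ominus>\<^bsub>K\<^esub> \<one>\<^bsub>K\<^esub>) \<odot>\<^bsub>?P\<^esub> x \<oplus>\<^bsub>?P\<^esub> x) i = graph_app \<zero>\<^bsub>?P\<^esub> i"
          using app x i by (simp add: ops Mi.smult_l_minus Mi.M.l_neg)
      qed (intro cl x cz c)+
    qed
  qed (fact cl cz)+
  then have "module K ?P"
  proof (intro moduleI)
    fix a b x assume a: "a \<in> carrier K" "b \<in> carrier K" and x: "x \<in> carrier ?P"
    show "(a \<oplus>\<^bsub>K\<^esub> b) \<odot>\<^bsub>?P\<^esub> x = a \<odot>\<^bsub>?P\<^esub> x \<oplus>\<^bsub>?P\<^esub> b \<odot>\<^bsub>?P\<^esub> x"
    proof (rule eqI)
      fix i assume i: "i \<in> I"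
      interpret Mi: module K "M i" by (rule mod[OF i])
      show "graph_app ((a \<oplus>\<^bsub>K\<^esub> b) \<odot>\<^bsub>?P\<^esub> x) i = graph_app (a \<odot>\<^bsub>?P\<^esub> x \<oplus>\<^bsub>?P\<^esub> b \<odot>\<^bsub>?P\<^esub> x) i"
        using app x i a by (simp add: ops Mi.smult_l_distr)
    qed (intro cl cs x a add.m_closed)+
    show "(a \<otimes>\<^bsub>K\<^esub> b) \<odot>\<^bsub>?P\<^esub> x = a \<odot>\<^bsub>?P\<^esub> (b \<odot>\<^bsub>?P\<^esub> x)"
    proof (rule eqI)
      fix i assume i: "i \<in> I"
      interpret Mi: module K "M i" by (rule mod[OF i])
      show "graph_app ((a \<otimes>\<^bsub>K\<^esub> b) \<odot>\<^bsub>?P\<^esub> x) i = graph_app (a \<odot>\<^bsub>?P\<^esub> (b \<odot>\<^bsub>?P\<^esub> x)) i"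
        using app x i a by (simp add: ops Mi.smult_assoc1)
    qed (intro cl cs x a m_closed)+
  next
    fix a x y assume a: "a \<in> carrier K" and x: "x \<in> carrier ?P" and y: "y \<in> carrier ?P"
    show "a \<odot>\<^bsub>?P\<^esub> (x \<oplus>\<^bsub>?P\<^esub> y) = a \<odot>\<^bsub>?P\<^esub> x \<oplus>\<^bsub>?P\<^esub> a \<odot>\<^bsub>?P\<^esub> y"
    proof (rule eqI)
      fix i assume i: "i \<in> I"
      interpret Mi: module K "M i" by (rule mod[OF i])
      show "graph_app (a \<odot>\<^bsub>?P\<^esub> (x \<oplus>\<^bsub>?P\<^esub> y)) i = graph_app (a \<odot>\<^bsub>?P\<^esub> x \<oplus>\<^bsub>?P\<^esub> a \<odot>\<^bsub>?P\<^esub> y) i"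
        using app x y i a by (simp add: ops Mi.smult_r_distr)
    qed (intro cl cs x y a)+
  next
    fix x assume x: "x \<in> carrier ?P"
    show "\<one>\<^bsub>K\<^esub> \<odot>\<^bsub>?P\<^esub> x = x"
    proof (rule eqI)
      fix i assume i: "i \<in> I"
      interpret Mi: module K "M i" by (rule mod[OF i])
      show "graph_app (\<one>\<^bsub>K\<^esub> \<odot>\<^bsub>?P\<^esub> x) i = graph_app x i"
        using app x i by (simp add: ops)
    qed (intro cs x one_closed)+
  qed (auto intro: cs cring_axioms)
  moreover have "small (carrier ?P)"
    using small_graphs[OF I, of "\<lambda>i. carrier (M i)"] M by (simp add: prod_space_def VO_small)
  ultimately show ?thesis by (simp add: VO_iff)
qed

lemma prod_proj_lin:
  assumes "small I" "\<And>i. i \<in> I \<Longrightarrow> M i \<in> VO" "i \<in> I"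
  shows "(\<lambda>p\<in>carrier (prod_space I M). graph_app p i) \<in> lin (prod_space I M) (M i)"
  by (rule linI_restrict) (use assms prod_VO[OF assms(1,2)] in \<open>auto simp: prod_app prod_ops VO_iff\<close>)

lemma prod_tuple_lin:
  assumes "small I" "\<And>i. i \<in> I \<Longrightarrow> M i \<in> VO" "module K V"
    and f: "\<And>i. i \<in> I \<Longrightarrow> f i \<in> lin V (M i)"
  shows "(\<lambda>x\<in>carrier V. graph I (\<lambda>i. f i x)) \<in> lin V (prod_space I M)"
proof -
  interpret V: module K V by fact
  note l = lin_closed[OF f] lin_plus[OF f] lin_scale[OF f]
  show ?thesis
  proof (rule linI_restrict)
    fix x y assume xy: "x \<in> carrier V" "y \<in> carrier V"
    show "graph I (\<lambda>i. f i (x \<oplus>\<^bsub>V\<^esub> y)) = graph I (\<lambda>i. f i x) \<oplus>\<^bsub>prod_space I M\<^esub> graph I (\<lambda>i. f i y)"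
      using assms(1) xy l by (simp add: prod_space_def graph_eq_iff graph_app_graph)
  next
    fix a x assume ax: "a \<in> carrier K" "x \<in> carrier V"
    show "graph I (\<lambda>i. f i (a \<odot>\<^bsub>V\<^esub> x)) = a \<odot>\<^bsub>prod_space I M\<^esub> graph I (\<lambda>i. f i x)"
      using assms(1) ax l by (simp add: prod_space_def graph_eq_iff graph_app_graph)
  qed (auto intro: graph_prodI l assms(3))
qed

section \<open>Spaces of linear maps as small vector spaces\<close>

lemma hom_space_eq:
  "hom_space K V W = (prod_space (carrier V) (\<lambda>_. W))\<lparr>carrier := graph (carrier V) ` lin V W\<rparr>"
  by (simp add: hom_space_def prod_space_def)

lemma hom_ops:
  assumes "small (carrier V)" "x \<in> carrier V"
  shows "graph_app (p \<oplus>\<^bsub>hom_space K V W\<^esub> q) x = graph_app p x \<oplus>\<^bsub>W\<^esub> graph_app q x"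
    and "graph_app (a \<odot>\<^bsub>hom_space K V W\<^esub> p) x = a \<odot>\<^bsub>W\<^esub> graph_app p x"
    and "graph_app \<zero>\<^bsub>hom_space K V W\<^esub> x = \<zero>\<^bsub>W\<^esub>"
  using assms by (simp_all add: hom_space_def graph_app_graph)

text \<open>Decodes a graph. The restriction to \<open>carrier V\<close> makes the result
  extensional, as membership in \<open>linear_maps\<close> requires.\<close>

definition hom_fun :: "('k, 'u::grothendieck_universe) vs \<Rightarrow> 'u \<Rightarrow> 'u \<Rightarrow> 'u" where
  "hom_fun V p = (\<lambda>x\<in>carrier V. graph_app p x)"

lemma hom_fun_graph:
  "small (carrier V) \<Longrightarrow> f \<in> lin V W \<Longrightarrow> hom_fun V (graph (carrier V) f) = f"
  by (rule extensionalityI[of _ "carrier V"]) (auto simp: hom_fun_def graph_app_graph lin_ext)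

lemma hom_fun_lin:
  "small (carrier V) \<Longrightarrow> p \<in> carrier (hom_space K V W) \<Longrightarrow> hom_fun V p \<in> lin V W"
  by (auto simp: hom_space_def hom_fun_graph)

lemma graph_hom_fun:
  "small (carrier V) \<Longrightarrow> p \<in> carrier (hom_space K V W) \<Longrightarrow> graph (carrier V) (hom_fun V p) = p"
  by (auto simp: hom_space_def hom_fun_graph)

lemma graph_in_hom_space: "f \<in> lin V W \<Longrightarrow> graph (carrier V) f \<in> carrier (hom_space K V W)"
  by (simp add: hom_space_def)

lemma hom_fun_ops:
  shows "small (carrier V) \<Longrightarrow> hom_fun V (p \<oplus>\<^bsub>hom_space K V W\<^esub> q) = (\<lambda>x\<in>carrier V. hom_fun V p x \<oplus>\<^bsub>W\<^esub> hom_fun V q x)"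
    and "small (carrier V) \<Longrightarrow> hom_fun V (a \<odot>\<^bsub>hom_space K V W\<^esub> p) = (\<lambda>x\<in>carrier V. a \<odot>\<^bsub>W\<^esub> hom_fun V p x)"
    and "small (carrier V) \<Longrightarrow> hom_fun V \<zero>\<^bsub>hom_space K V W\<^esub> = (\<lambda>x\<in>carrier V. \<zero>\<^bsub>W\<^esub>)"
  by (auto simp: hom_fun_def hom_ops)

text \<open>The linear maps form a subspace of the power of \<open>W\<close> indexed by the vectors
  of \<open>V\<close>, so the laws and the smallness come from \<open>prod_VO\<close> and
  \<open>sub_VO\<close>.\<close>

lemma hom_space_VO:
  assumes V: "V \<in> VO" and W: "W \<in> VO"
  shows "hom_space K V W \<in> VO"
proof -
  note v = VO_module[OF V] VO_module[OF W] VO_small[OF V]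
  let ?P = "prod_space (carrier V) (\<lambda>_. W)"
  have P: "?P \<in> VO" using v(3) W by (intro prod_VO)
  have "submodule (graph (carrier V) ` lin V W) K ?P"
  proof (rule submodI)
    show "graph (carrier V) ` lin V W \<subseteq> carrier ?P"
      by (auto intro: graph_prodI lin_closed)
    show "\<zero>\<^bsub>?P\<^esub> \<in> graph (carrier V) ` lin V W"
      using lin_null[OF v(1,2)]
      by (rule rev_image_eqI) (simp add: prod_space_def graph_eq_iff v)
    show "x \<oplus>\<^bsub>?P\<^esub> y \<in> graph (carrier V) ` lin V W"
      if xy: "x \<in> graph (carrier V) ` lin V W" "y \<in> graph (carrier V) ` lin V W" for x y
    proof -
      obtain f g where fg: "f \<in> lin V W" "g \<in> lin V W"
        "x = graph (carrier V) f" "y = graph (carrier V) g" using xy by auto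
      show ?thesis
        using lin_sum[OF fg(1,2) v(1,2)]
        by (rule rev_image_eqI) (simp add: prod_space_def graph_eq_iff v fg graph_app_graph)
    qed
    show "a \<odot>\<^bsub>?P\<^esub> x \<in> graph (carrier V) ` lin V W"
      if a: "a \<in> carrier K" and x: "x \<in> graph (carrier V) ` lin V W" for a x
    proof -
      obtain f where fg: "f \<in> lin V W" "x = graph (carrier V) f" using x by auto
      show ?thesis
        using lin_smultiple[OF fg(1) a v(1,2)]
        by (rule rev_image_eqI) (simp add: prod_space_def graph_eq_iff v fg graph_app_graph)
    qed
  qed (rule VO_module[OF P])
  then show ?thesis unfolding hom_space_eq by (rule sub_VO[OF P])
qed

lemma submod_abelian_subgroup:
  assumes "submodule N K M" "module K M" shows "abelian_subgroup N M"
proof -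
  interpret M: module K M by fact
  show ?thesis
    using submodule.axioms(1)[OF assms(1)]
    by (intro abelian_subgroupI3 additive_subgroup.intro M.M.abelian_group_axioms)
qed

section \<open>Cosets and quotient spaces\<close>

context
  fixes M :: "('k, 'u::grothendieck_universe) vs" and N
  assumes M: "M \<in> VO" and N: "submodule N K M"
begin

lemma elts_coset: "x \<in> carrier M \<Longrightarrow> elts (coset M N x) = N +>\<^bsub>M\<^esub> x"
proof -
  assume x: "x \<in> carrier M"
  interpret M: module K M by (rule VO_module[OF M])
  have "N +>\<^bsub>M\<^esub> x \<subseteq> carrier M"
    using M.M.a_r_coset_subset_G[OF submodD(1)[OF N VO_module[OF M]] x] .
  then show ?thesis unfolding coset_def using VO_small[OF M] elts_vset small_subset by blast
qed

lemma mem_coset_iff: "x \<in> carrier M \<Longrightarrow> y \<in> N +>\<^bsub>M\<^esub> x \<longleftrightarrow> y \<in> carrier M \<and> y \<ominus>\<^bsub>M\<^esub> x \<in> N"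
proof -
  assume x: "x \<in> carrier M"
  interpret abelian_subgroup N M by (rule submod_abelian_subgroup[OF N VO_module[OF M]])
  show ?thesis
    using x a_rcos_module[OF x] a_elemrcos_carrier[OF x] by (auto simp: a_minus_def)
qed

lemma coset_eq_iff:
  assumes x: "x \<in> carrier M" and y: "y \<in> carrier M"
  shows "coset M N x = coset M N y \<longleftrightarrow> x \<ominus>\<^bsub>M\<^esub> y \<in> N"
proof -
  interpret abelian_subgroup N M by (rule submod_abelian_subgroup[OF N VO_module[OF M]])
  have "coset M N x = coset M N y \<longleftrightarrow> N +>\<^bsub>M\<^esub> x = N +>\<^bsub>M\<^esub> y"
    by (metis elts_coset coset_def x y)
  also have "\<dots> \<longleftrightarrow> x \<in> N +>\<^bsub>M\<^esub> y"
    using a_rcos_self[OF x] a_repr_independence'[of x y] y by auto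
  finally show ?thesis using mem_coset_iff x y by simp
qed

lemma quotient_carrier: "carrier (quotient_space M N) = coset M N ` carrier M"
  by (auto simp: quotient_space_def coset_def A_RCOSETS_def RCOSETS_def a_r_coset_def)

text \<open>All cosets in the union coincide, because \<open>u\<close> respects congruence. The
  formula for scaling in \<open>quotient_space\<close> and the one for arrows in
  \<open>quotient_functor\<close> are unions of this shape; therefore \<open>u\<close> is just a
  function here.\<close>

lemma quotient_map_coset:
  assumes x: "x \<in> carrier M" and L: "L \<in> VO" and N': "submodule N' K L"
    and u: "\<And>y. y \<in> carrier M \<Longrightarrow> u y \<in> carrier L"
    "\<And>y. y \<in> carrier M \<Longrightarrow> y \<ominus>\<^bsub>M\<^esub> x \<in> N \<Longrightarrow> u y \<ominus>\<^bsub>L\<^esub> u x \<in> N'"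
  shows "vset (\<Union>y\<in>elts (coset M N x). N' +>\<^bsub>L\<^esub> u y) = coset L N' (u x)"
proof -
  interpret M: abelian_subgroup N M by (rule submod_abelian_subgroup[OF N VO_module[OF M]])
  interpret L: abelian_subgroup N' L by (rule submod_abelian_subgroup[OF N' VO_module[OF L]])
  have "N' +>\<^bsub>L\<^esub> u y = N' +>\<^bsub>L\<^esub> u x" if "y \<in> N +>\<^bsub>M\<^esub> x" for y
  proof -
    have y: "y \<in> carrier M" "y \<ominus>\<^bsub>M\<^esub> x \<in> N" using that mem_coset_iff[OF x] by auto
    have "u y \<in> N' +>\<^bsub>L\<^esub> u x"
      using L.a_rcos_module_rev[OF u(1)[OF x] u(1)[OF y(1)]] u(2)[OF y] by (simp add: a_minus_def)
    then show ?thesis using L.a_repr_independence'[OF _ u(1)[OF x]] by simp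
  qed
  moreover have "x \<in> N +>\<^bsub>M\<^esub> x" by (rule M.a_rcos_self[OF x])
  ultimately have "(\<Union>y\<in>elts (coset M N x). N' +>\<^bsub>L\<^esub> u y) = N' +>\<^bsub>L\<^esub> u x"
    unfolding elts_coset[OF x] by blast
  then show ?thesis by (simp add: coset_def)
qed

lemma quotient_ops:
  shows "x \<in> carrier M \<Longrightarrow> y \<in> carrier M \<Longrightarrow>
      coset M N x \<oplus>\<^bsub>quotient_space M N\<^esub> coset M N y = coset M N (x \<oplus>\<^bsub>M\<^esub> y)"
    and "a \<in> carrier K \<Longrightarrow> x \<in> carrier M \<Longrightarrow>
      a \<odot>\<^bsub>quotient_space M N\<^esub> coset M N x = coset M N (a \<odot>\<^bsub>M\<^esub> x)"
    and "\<zero>\<^bsub>quotient_space M N\<^esub> = coset M N \<zero>\<^bsub>M\<^esub>"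
proof -
  interpret Mm: module K M by (rule VO_module[OF M])
  interpret M: abelian_subgroup N M by (rule submod_abelian_subgroup[OF N VO_module[OF M]])
  note N' = submodD[OF N VO_module[OF M]]
  show "coset M N x \<oplus>\<^bsub>quotient_space M N\<^esub> coset M N y = coset M N (x \<oplus>\<^bsub>M\<^esub> y)"
    if "x \<in> carrier M" "y \<in> carrier M" for x y
    using M.a_rcos_sum[OF that] elts_coset that by (simp add: quotient_space_def) (simp add: coset_def)
  show "a \<odot>\<^bsub>quotient_space M N\<^esub> coset M N x = coset M N (a \<odot>\<^bsub>M\<^esub> x)"
    if a: "a \<in> carrier K" and x: "x \<in> carrier M" for a x
  proof -
    have "a \<odot>\<^bsub>M\<^esub> y \<ominus>\<^bsub>M\<^esub> a \<odot>\<^bsub>M\<^esub> x \<in> N" if y: "y \<in> carrier M" "y \<ominus>\<^bsub>M\<^esub> x \<in> N" for y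
    proof -
      have "a \<odot>\<^bsub>M\<^esub> y \<ominus>\<^bsub>M\<^esub> a \<odot>\<^bsub>M\<^esub> x = a \<odot>\<^bsub>M\<^esub> (y \<ominus>\<^bsub>M\<^esub> x)"
        using a x y by (simp add: a_minus_def Mm.smult_r_distr Mm.smult_r_minus)
      then show ?thesis using N'(5)[OF a y(2)] by simp
    qed
    then show ?thesis
      using quotient_map_coset[OF x M N, of "\<lambda>y. a \<odot>\<^bsub>M\<^esub> y"] a by (simp add: quotient_space_def)
  qed
  show "\<zero>\<^bsub>quotient_space M N\<^esub> = coset M N \<zero>\<^bsub>M\<^esub>"
    using N'(2) M.a_rcos_const[of "\<zero>\<^bsub>M\<^esub>"] by (simp add: quotient_space_def coset_def)
qed

lemma quotient_VO: "quotient_space M N \<in> VO"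
proof -
  have "module K (quotient_space M N)"
    by (rule module_image[OF VO_module[OF M], where q = "coset M N"])
      (simp_all add: quotient_carrier quotient_ops)
  moreover have "small (carrier (quotient_space M N))"
    unfolding quotient_carrier by (rule small_image[OF VO_small[OF M]])
  ultimately show ?thesis by (simp add: VO_iff)
qed

lemma quotient_map_lin: "(\<lambda>x\<in>carrier M. coset M N x) \<in> lin M (quotient_space M N)"
  by (rule linI_restrict[OF VO_module[OF M]]) (simp_all add: quotient_carrier quotient_ops)

lemma coset_eq_zero_iff: "x \<in> carrier M \<Longrightarrow> coset M N x = \<zero>\<^bsub>quotient_space M N\<^esub> \<longleftrightarrow> x \<in> N"
proof -
  interpret Mm: module K M by (rule VO_module[OF M])
  assume x: "x \<in> carrier M"
  then show ?thesis using coset_eq_iff[OF x, of "\<zero>\<^bsub>M\<^esub>"] by (simp add: quotient_ops Mm.M.minus_zero_right)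
qed

end

end

section \<open>Additive functors and their arrows\<close>

text \<open>The underlying function of the image of a linear map, without the source and target that
  \<open>amap\<close> carries along; \<open>cmp\<close> does the same for components of natural
  transformations. The later arguments are about elements.\<close>

definition act ::
  "('k, 'u) vfunctor \<Rightarrow> ('k, 'u) vs \<Rightarrow> ('k, 'u) vs \<Rightarrow> ('u \<Rightarrow> 'u) \<Rightarrow> 'u \<Rightarrow> 'u" where
  "act X V W f = snd (snd (amap X (V, W, f)))"

definition cmp :: "('k, 'u) vnat \<Rightarrow> ('k, 'u) vs \<Rightarrow> 'u \<Rightarrow> 'u" where
  "cmp t V = snd (snd (snd (snd t) V))"

text \<open>Restricting to the objects and arrows of \<open>Vect K\<close> settles the
  extensionality clauses of \<open>is_functor\<close> once, for every functor that is brought into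
  this form.\<close>

definition mkfun ::
  "'k ring \<Rightarrow> (('k, 'u::grothendieck_universe) vs \<Rightarrow> ('k, 'u) vs) \<Rightarrow>
     (('k, 'u) vs \<Rightarrow> ('k, 'u) vs \<Rightarrow> ('u \<Rightarrow> 'u) \<Rightarrow> 'u \<Rightarrow> 'u) \<Rightarrow> ('k, 'u) vfunctor" where
  "mkfun K om ac =
     \<lparr>omap = (\<lambda>W\<in>Obj (Vect K). om W),
      amap = (\<lambda>t\<in>Arr (Vect K). case t of (V, W, f) \<Rightarrow> (om V, om W, ac V W f))\<rparr>"

context vect
begin

definition mknat ::
  "('k, 'u::grothendieck_universe) vfunctor \<Rightarrow> ('k, 'u) vfunctor \<Rightarrow>
     (('k, 'u) vs \<Rightarrow> 'u \<Rightarrow> 'u) \<Rightarrow> ('k, 'u) vnat" where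
  "mknat X Y \<tau> =
     (X, Y, \<lambda>V\<in>VO. (omap X V, omap Y V, \<lambda>x\<in>el X V. \<tau> V x))"

lemma FO_iff: "X \<in> FO \<longleftrightarrow> is_functor (Vect K) (Vect K) X \<and> additive_functor K X"
  by (simp add: Vect_Vect_def functor_category_def)

context
  fixes X :: "('k, 'u::grothendieck_universe) vfunctor"
  assumes X: "X \<in> FO"
begin

lemma F_VO: "V \<in> VO \<Longrightarrow> omap X V \<in> VO"
  using X by (auto simp: FO_iff is_functor_def)

lemma F_hom:
  assumes "V \<in> VO" "W \<in> VO" "f \<in> lin V W"
  shows "amap X (V, W, f) \<in> Hom (Vect K) (omap X V) (omap X W)"
proof -
  have "(V, W, f) \<in> Arr (Vect K)" using assms by (simp add: Arr_Vect_iff)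
  moreover have "\<forall>t\<in>Arr (Vect K). amap X t \<in> Hom (Vect K) (omap X (Dom (Vect K) t)) (omap X (Cod (Vect K) t))"
    using X by (simp add: FO_iff is_functor_def)
  ultimately show ?thesis by force
qed

lemma F_module: "V \<in> VO \<Longrightarrow> module K (omap X V)"
  by (intro VO_module F_VO)

context
  fixes V W :: "('k, 'u) vs" and f
  assumes V: "V \<in> VO" and W: "W \<in> VO" and f: "f \<in> lin V W"
begin

lemma F_amap: "amap X (V, W, f) = (omap X V, omap X W, act X V W f)"
  using F_hom[OF V W f] by (cases "amap X (V, W, f)") (auto simp: Hom_Vect_iff act_def)

lemma F_lin: "act X V W f \<in> lin (omap X V) (omap X W)"
  using F_hom[OF V W f] by (simp add: F_amap Hom_Vect_iff)

lemma F_closed: "x \<in> el X V \<Longrightarrow> act X V W f x \<in> el X W"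
  by (rule lin_closed[OF F_lin])

lemma F_comp:
  assumes Z: "Z \<in> VO" and g: "g \<in> lin W Z" and x: "x \<in> el X V"
  shows "act X V Z (compose (carrier V) g f) x = act X W Z g (act X V W f x)"
proof -
  have "(V, W, f) \<in> Arr (Vect K)" "(W, Z, g) \<in> Arr (Vect K)"
    using V W f Z g by (auto simp: Arr_Vect_iff)
  then have "amap X (Comp (Vect K) (W, Z, g) (V, W, f)) = Comp (Vect K) (amap X (W, Z, g)) (amap X (V, W, f))"
    using X unfolding FO_iff is_functor_def by force
  moreover have "act X V Z (compose (carrier V) g f) = snd (snd (amap X (Comp (Vect K) (W, Z, g) (V, W, f))))"
    by (simp add: act_def)
  moreover have "amap X (W, Z, g) = (omap X W, omap X Z, act X W Z g)"
    using F_hom[OF W Z g] by (cases "amap X (W, Z, g)") (auto simp: Hom_Vect_iff act_def)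
  ultimately show ?thesis using x by (simp add: F_amap compose_eq)
qed

lemma F_add_map:
  assumes g: "g \<in> lin V W" and x: "x \<in> el X V"
  shows "act X V W (\<lambda>x\<in>carrier V. f x \<oplus>\<^bsub>W\<^esub> g x) x = act X V W f x \<oplus>\<^bsub>omap X W\<^esub> act X V W g x"
proof -
  have "amap X (lin_add (V, W, f) (V, W, g)) = lin_add (amap X (V, W, f)) (amap X (V, W, g))"
  proof -
    have "additive_functor K X" using X by (simp add: FO_iff)
    moreover have "(V, W, f) \<in> Hom (Vect K) V W" "(V, W, g) \<in> Hom (Vect K) V W"
      using V W f g by (simp_all add: Hom_Vect_iff)
    ultimately show ?thesis using V W unfolding additive_functor_def by blast
  qed
  moreover have "amap X (V, W, g) = (omap X V, omap X W, act X V W g)"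
    using F_hom[OF V W g] by (cases "amap X (V, W, g)") (auto simp: Hom_Vect_iff act_def)
  ultimately have s: "amap X (V, W, \<lambda>x\<in>carrier V. f x \<oplus>\<^bsub>W\<^esub> g x) =
      (omap X V, omap X W, \<lambda>x\<in>el X V. act X V W f x \<oplus>\<^bsub>omap X W\<^esub> act X V W g x)"
    by (simp add: F_amap lin_add_def)
  show ?thesis unfolding act_def[of X V W "\<lambda>x\<in>carrier V. f x \<oplus>\<^bsub>W\<^esub> g x"] s using x by simp
qed

lemma F_smult_map:
  assumes a: "a \<in> carrier K" and x: "x \<in> el X V"
  shows "act X V W (\<lambda>x\<in>carrier V. a \<odot>\<^bsub>W\<^esub> f x) x = a \<odot>\<^bsub>omap X W\<^esub> act X V W f x"
proof -
  have "amap X (lin_smult a (V, W, f)) = lin_smult a (amap X (V, W, f))"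
  proof -
    have "additive_functor K X" using X by (simp add: FO_iff)
    moreover have "(V, W, f) \<in> Hom (Vect K) V W"
      using V W f by (simp add: Hom_Vect_iff)
    ultimately show ?thesis using V W a unfolding additive_functor_def by blast
  qed
  then have s: "amap X (V, W, \<lambda>x\<in>carrier V. a \<odot>\<^bsub>W\<^esub> f x) =
      (omap X V, omap X W, \<lambda>x\<in>el X V. a \<odot>\<^bsub>omap X W\<^esub> act X V W f x)"
    by (simp add: F_amap lin_smult_def)
  show ?thesis unfolding act_def[of X V W "\<lambda>x\<in>carrier V. a \<odot>\<^bsub>W\<^esub> f x"] s using x by simp
qed

end

lemma F_id: "V \<in> VO \<Longrightarrow> x \<in> el X V \<Longrightarrow> act X V V (\<lambda>x\<in>carrier V. x) x = x"
proof -
  assume V: "V \<in> VO" and x: "x \<in> el X V"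
  have "amap X (Ident (Vect K) V) = Ident (Vect K) (omap X V)"
    using X V by (auto simp: FO_iff is_functor_def)
  then show ?thesis using x by (simp add: act_def)
qed

text \<open>The zero map equals its own multiple by the scalar zero, and \<open>X\<close> respects
  scalars.\<close>

lemma F_null_map:
  assumes V: "V \<in> VO" and W: "W \<in> VO" and x: "x \<in> el X V"
  shows "act X V W (\<lambda>x\<in>carrier V. \<zero>\<^bsub>W\<^esub>) x = \<zero>\<^bsub>omap X W\<^esub>"
proof -
  interpret W: module K W by (rule VO_module[OF W])
  interpret XW: module K "omap X W" by (rule F_module[OF W])
  have f: "(\<lambda>x\<in>carrier V. \<zero>\<^bsub>W\<^esub>) \<in> lin V W"
    by (intro lin_null VO_module V W)
  have "(\<lambda>x\<in>carrier V. \<zero>\<^bsub>K\<^esub> \<odot>\<^bsub>W\<^esub> (\<lambda>x\<in>carrier V. \<zero>\<^bsub>W\<^esub>) x) = (\<lambda>x\<in>carrier V. \<zero>\<^bsub>W\<^esub>)" by auto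
  then have "act X V W (\<lambda>x\<in>carrier V. \<zero>\<^bsub>W\<^esub>) x = \<zero>\<^bsub>K\<^esub> \<odot>\<^bsub>omap X W\<^esub> act X V W (\<lambda>x\<in>carrier V. \<zero>\<^bsub>W\<^esub>) x"
    using F_smult_map[OF V W f zero_closed x] by presburger
  then show ?thesis using F_closed[OF V W f x] by simp
qed

text \<open>Additivity applied to \<open>f = (f - g) + g\<close>.\<close>

lemma F_diff_map:
  assumes V: "V \<in> VO" and W: "W \<in> VO"
    and f: "f \<in> lin V W" and g: "g \<in> lin V W" and x: "x \<in> el X V"
  shows "act X V W (\<lambda>x\<in>carrier V. f x \<ominus>\<^bsub>W\<^esub> g x) x = act X V W f x \<ominus>\<^bsub>omap X W\<^esub> act X V W g x"
proof -
  interpret W: module K W by (rule VO_module[OF W])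
  interpret XW: module K "omap X W" by (rule F_module[OF W])
  note m = VO_module[OF V] VO_module[OF W]
  let ?h = "\<lambda>x\<in>carrier V. f x \<ominus>\<^bsub>W\<^esub> g x"
  have h: "?h \<in> lin V W" by (rule lin_diff[OF f g m])
  have "(\<lambda>x\<in>carrier V. ?h x \<oplus>\<^bsub>W\<^esub> g x) = f"
    by (rule extensionalityI[of _ "carrier V"])
      (auto simp: lin_ext[OF f] W.M.minus_add_cancel lin_closed[OF f] lin_closed[OF g])
  then have "act X V W f x = act X V W ?h x \<oplus>\<^bsub>omap X W\<^esub> act X V W g x"
    using F_add_map[OF V W h g x] by simp
  then show ?thesis
    using F_closed[OF V W h x] F_closed[OF V W g x] by (simp add: XW.M.add_minus_cancel)
qed

end

section \<open>Functors and natural transformations from pointwise data\<close>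

lemma mkfun_FO:
  fixes om :: "('k, 'u::grothendieck_universe) vs \<Rightarrow> ('k, 'u) vs"
  assumes om: "\<And>V. V \<in> VO \<Longrightarrow> om V \<in> VO"
    and lin: "\<And>V W f. V \<in> VO \<Longrightarrow> W \<in> VO \<Longrightarrow> f \<in> lin V W \<Longrightarrow>
      ac V W f \<in> lin (om V) (om W)"
    and id: "\<And>V x. V \<in> VO \<Longrightarrow> x \<in> carrier (om V) \<Longrightarrow> ac V V (\<lambda>x\<in>carrier V. x) x = x"
    and comp: "\<And>V W Z f g x. V \<in> VO \<Longrightarrow> W \<in> VO \<Longrightarrow> Z \<in> VO \<Longrightarrow>
      f \<in> lin V W \<Longrightarrow> g \<in> lin W Z \<Longrightarrow> x \<in> carrier (om V) \<Longrightarrow>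
      ac V Z (compose (carrier V) g f) x = ac W Z g (ac V W f x)"
    and add: "\<And>V W f g x. V \<in> VO \<Longrightarrow> W \<in> VO \<Longrightarrow>
      f \<in> lin V W \<Longrightarrow> g \<in> lin V W \<Longrightarrow> x \<in> carrier (om V) \<Longrightarrow>
      ac V W (\<lambda>x\<in>carrier V. f x \<oplus>\<^bsub>W\<^esub> g x) x = ac V W f x \<oplus>\<^bsub>om W\<^esub> ac V W g x"
    and smult: "\<And>V W f a x. V \<in> VO \<Longrightarrow> W \<in> VO \<Longrightarrow>
      f \<in> lin V W \<Longrightarrow> a \<in> carrier K \<Longrightarrow> x \<in> carrier (om V) \<Longrightarrow>
      ac V W (\<lambda>x\<in>carrier V. a \<odot>\<^bsub>W\<^esub> f x) x = a \<odot>\<^bsub>om W\<^esub> ac V W f x"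
  shows "mkfun K om ac \<in> FO"
proof -
  have am: "amap (mkfun K om ac) (V, W, f) = (om V, om W, ac V W f)"
    if "V \<in> VO" "W \<in> VO" "f \<in> lin V W" for V W f
    using that by (simp add: mkfun_def Arr_Vect_iff)
  have o: "omap (mkfun K om ac) V = om V" if "V \<in> VO" for V
    using that by (simp add: mkfun_def)
  have "is_functor (Vect K) (Vect K) (mkfun K om ac)"
    unfolding is_functor_def
  proof (intro conjI ballI impI)
    show "omap (mkfun K om ac) \<in> VO \<rightarrow>\<^sub>E VO" using om by (auto simp: mkfun_def)
    show "amap (mkfun K om ac) \<in> extensional (Arr (Vect K))" by (simp add: mkfun_def)
    show "amap (mkfun K om ac) t \<in> Hom (Vect K) (omap (mkfun K om ac) (Dom (Vect K) t)) (omap (mkfun K om ac) (Cod (Vect K) t))"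
      if "t \<in> Arr (Vect K)" for t
      using that by (elim Arr_VectE) (simp add: am o Hom_Vect_iff om lin)
    show "amap (mkfun K om ac) (Ident (Vect K) V) = Ident (Vect K) (omap (mkfun K om ac) V)"
      if V: "V \<in> VO" for V
    proof -
      have l: "(\<lambda>x\<in>carrier V. x) \<in> lin V V" by (intro lin_id VO_module V)
      then show ?thesis using V lin[OF V V l] id[OF V]
        by (auto simp: am o intro!: extensionalityI[of _ "carrier (om V)"] dest: lin_ext)
    qed
    show "amap (mkfun K om ac) (Comp (Vect K) t s) = Comp (Vect K) (amap (mkfun K om ac) t) (amap (mkfun K om ac) s)"
      if sA: "s \<in> Arr (Vect K)" and tA: "t \<in> Arr (Vect K)" and st: "Cod (Vect K) s = Dom (Vect K) t" for s t
    proof -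
      obtain V W f where s: "s = (V, W, f)" "V \<in> VO" "W \<in> VO" "f \<in> lin V W"
        using sA by (rule Arr_VectE) blast
      obtain Z g where t: "t = (W, Z, g)" "Z \<in> VO" "g \<in> lin W Z"
        using tA by (rule Arr_VectE) (use st s in auto)
      have l: "compose (carrier V) g f \<in> lin V Z" using s t by (intro lin_compose VO_module)
      have "ac V Z (compose (carrier V) g f) = compose (carrier (om V)) (ac W Z g) (ac V W f)"
        using lin[OF s(2) t(2) l] comp s t
        by (intro extensionalityI[of _ "carrier (om V)"]) (auto simp: compose_eq dest: lin_ext)
      then show ?thesis using s t l by (simp add: am)
    qed
  qed
  moreover have "additive_functor K (mkfun K om ac)"
    unfolding additive_functor_def
  proof (intro ballI conjI)
    fix V W :: "('k, 'u) vs" and s assume V: "V \<in> VO" and W: "W \<in> VO" and s: "s \<in> Hom (Vect K) V W"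
    obtain f where f: "s = (V, W, f)" "f \<in> lin V W" using s by (cases s) (auto simp: Hom_Vect_iff)
    { fix t assume "t \<in> Hom (Vect K) V W"
      then obtain g where g: "t = (V, W, g)" "g \<in> lin V W" by (cases t) (auto simp: Hom_Vect_iff)
      have l: "(\<lambda>x\<in>carrier V. f x \<oplus>\<^bsub>W\<^esub> g x) \<in> lin V W"
        using f g V W by (intro lin_sum VO_module)
      show "amap (mkfun K om ac) (lin_add s t) = lin_add (amap (mkfun K om ac) s) (amap (mkfun K om ac) t)"
        using lin[OF V W l] add f g V W l
        by (auto simp: am lin_add_def intro!: extensionalityI[of _ "carrier (om V)"] dest: lin_ext)
    }
    fix a assume a: "a \<in> carrier K"
    have l: "(\<lambda>x\<in>carrier V. a \<odot>\<^bsub>W\<^esub> f x) \<in> lin V W"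
      using f a V W by (intro lin_smultiple VO_module)
    show "amap (mkfun K om ac) (lin_smult a s) = lin_smult a (amap (mkfun K om ac) s)"
      using lin[OF V W l] smult f a V W l
      by (auto simp: am lin_smult_def intro!: extensionalityI[of _ "carrier (om V)"] dest: lin_ext)
  qed
  ultimately show ?thesis by (simp add: FO_iff)
qed

lemma mkfun_omap: "V \<in> VO \<Longrightarrow> omap (mkfun K om ac) V = om V"
  by (simp add: mkfun_def)

lemma mkfun_act:
  "V \<in> VO \<Longrightarrow> W \<in> VO \<Longrightarrow> f \<in> lin V W \<Longrightarrow> act (mkfun K om ac) V W f = ac V W f"
  by (simp add: mkfun_def Arr_Vect_iff act_def)

lemma VV_simps [simp]: "Dom (Vect_Vect K) (X, Y, \<eta>) = X" "Cod (Vect_Vect K) (X, Y, \<eta>) = Y"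
  by (simp_all add: Vect_Vect_def functor_category_def)

lemma VV_Hom_iff:
  "t \<in> mor X Y \<longleftrightarrow> (\<exists>\<eta>. t = (X, Y, \<eta>) \<and> X \<in> FO \<and> Y \<in> FO \<and>
    is_natural (Vect K) (Vect K) X Y \<eta>)"
  by (auto simp: Hom_def Vect_Vect_def functor_category_def)

lemma
  assumes "t \<in> mor X Y"
  shows Hom_dom: "X \<in> FO"
    and Hom_cod: "Y \<in> FO"
    and Hom_mknat: "t = mknat X Y (cmp t)"
    and cmp_lin: "V \<in> VO \<Longrightarrow> cmp t V \<in> lin (omap X V) (omap Y V)"
    and cmp_natural: "V \<in> VO \<Longrightarrow> W \<in> VO \<Longrightarrow> f \<in> lin V W \<Longrightarrow>
      x \<in> el X V \<Longrightarrow> cmp t W (act X V W f x) = act Y V W f (cmp t V x)"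
proof -
  obtain \<eta> where t: "t = (X, Y, \<eta>)" and X: "X \<in> FO" and Y: "Y \<in> FO"
    and n: "is_natural (Vect K) (Vect K) X Y \<eta>" using assms by (auto simp: VV_Hom_iff)
  show "X \<in> FO" "Y \<in> FO" by fact+
  have \<eta>H: "\<eta> V \<in> Hom (Vect K) (omap X V) (omap Y V)" if "V \<in> VO" for V
    using n that by (auto simp: is_natural_def)
  have \<eta>: "\<eta> V = (omap X V, omap Y V, cmp t V)" if "V \<in> VO" for V
    using \<eta>H[OF that] by (cases "\<eta> V") (auto simp: Hom_Vect_iff t cmp_def)
  have l: "cmp t V \<in> lin (omap X V) (omap Y V)" if "V \<in> VO" for V
    using \<eta>H[OF that] \<eta>[OF that] by (simp add: Hom_Vect_iff)
  then show "V \<in> VO \<Longrightarrow> cmp t V \<in> lin (omap X V) (omap Y V)" .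
  have "\<eta> = (\<lambda>V\<in>VO. (omap X V, omap Y V, \<lambda>x\<in>el X V. cmp t V x))"
    by (rule extensionalityI[of _ "VO"])
      (use n lin_ext[OF l] in \<open>auto simp: is_natural_def \<eta> extensional_restrict\<close>)
  then show "t = mknat X Y (cmp t)" by (simp add: t mknat_def)
  assume V: "V \<in> VO" and W: "W \<in> VO" and f: "f \<in> lin V W"
    and x: "x \<in> el X V"
  have "(V, W, f) \<in> Arr (Vect K)" using V W f by (simp add: Arr_Vect_iff)
  then have "Comp (Vect K) (\<eta> W) (amap X (V, W, f)) = Comp (Vect K) (amap Y (V, W, f)) (\<eta> V)"
    using n unfolding is_natural_def by fastforce
  then have "compose (el X V) (cmp t W) (act X V W f) = compose (el X V) (act Y V W f) (cmp t V)"
    by (simp add: \<eta>[OF V] \<eta>[OF W] F_amap[OF X V W f] F_amap[OF Y V W f])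
  then have "compose (el X V) (cmp t W) (act X V W f) x = compose (el X V) (act Y V W f) (cmp t V) x"
    by simp
  then show "cmp t W (act X V W f x) = act Y V W f (cmp t V x)"
    using x by (simp add: compose_eq)
qed

lemma cmp_closed:
  "t \<in> mor X Y \<Longrightarrow> V \<in> VO \<Longrightarrow> x \<in> el X V \<Longrightarrow> cmp t V x \<in> el Y V"
  by (rule lin_closed[OF cmp_lin])

lemma cmp_mknat: "V \<in> VO \<Longrightarrow> x \<in> el X V \<Longrightarrow> cmp (mknat X Y \<tau>) V x = \<tau> V x"
  by (simp add: cmp_def mknat_def)

lemma Hom_eqI:
  assumes "s \<in> mor X Y" "t \<in> mor X Y"
    "\<And>V x. V \<in> VO \<Longrightarrow> x \<in> el X V \<Longrightarrow> cmp s V x = cmp t V x"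
  shows "s = t"
proof -
  have "mknat X Y (cmp s) = mknat X Y (cmp t)" using assms(3) by (simp add: mknat_def cong: restrict_cong)
  then show ?thesis using Hom_mknat[OF assms(1)] Hom_mknat[OF assms(2)] by simp
qed

lemma mknat_Hom:
  assumes X: "X \<in> FO" and Y: "Y \<in> FO"
    and lin: "\<And>V. V \<in> VO \<Longrightarrow> (\<lambda>x\<in>el X V. \<tau> V x) \<in> lin (omap X V) (omap Y V)"
    and nat: "\<And>V W f x. V \<in> VO \<Longrightarrow> W \<in> VO \<Longrightarrow> f \<in> lin V W \<Longrightarrow>
      x \<in> el X V \<Longrightarrow> \<tau> W (act X V W f x) = act Y V W f (\<tau> V x)"
  shows "mknat X Y \<tau> \<in> mor X Y"
proof -
  let ?\<eta> = "\<lambda>V\<in>VO. (omap X V, omap Y V, \<lambda>x\<in>el X V. \<tau> V x)"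
  have "is_natural (Vect K) (Vect K) X Y ?\<eta>"
    unfolding is_natural_def
  proof (intro conjI ballI)
    show "?\<eta> \<in> extensional (VO)" by simp
    show "?\<eta> V \<in> Hom (Vect K) (omap X V) (omap Y V)" if "V \<in> VO" for V
      using that lin by (simp add: Hom_Vect_iff F_VO[OF X] F_VO[OF Y])
    show "Comp (Vect K) (?\<eta> (Cod (Vect K) t)) (amap X t) = Comp (Vect K) (amap Y t) (?\<eta> (Dom (Vect K) t))"
      if tA: "t \<in> Arr (Vect K)" for t
    proof -
      obtain V W f where t: "t = (V, W, f)" and V: "V \<in> VO" and W: "W \<in> VO"
        and f: "f \<in> lin V W" using tA by (rule Arr_VectE) blast
      show ?thesis
        using V W by (simp add: t F_amap[OF X V W f] F_amap[OF Y V W f])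
          (auto simp: compose_def nat[OF V W f] F_closed[OF X V W f] intro!: restrict_ext)
    qed
  qed
  then show ?thesis using X Y by (simp add: mknat_def VV_Hom_iff)
qed

lemma
  fixes X Y :: "('k, 'u::grothendieck_universe) vfunctor"
  assumes t: "t \<in> mor X Y" and s: "s \<in> mor Y Z"
  shows VV_comp_Hom: "Comp (Vect_Vect K) s t \<in> mor X Z"
    and cmp_Comp: "V \<in> VO \<Longrightarrow> x \<in> el X V \<Longrightarrow>
      cmp (Comp (Vect_Vect K) s t) V x = cmp s V (cmp t V x)"
proof -
  note X = Hom_dom[OF t] and Y = Hom_cod[OF t] and Z = Hom_cod[OF s]
  have "Comp (Vect_Vect K) (mknat Y Z (cmp s)) (mknat X Y (cmp t)) = mknat X Z (\<lambda>V x. cmp s V (cmp t V x))"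
    using cmp_closed[OF t]
    by (auto simp: Vect_Vect_def functor_category_def mknat_def compose_def intro!: restrict_ext)
  then have e: "Comp (Vect_Vect K) s t = mknat X Z (\<lambda>V x. cmp s V (cmp t V x))"
    using Hom_mknat[OF t] Hom_mknat[OF s] by simp
  show "Comp (Vect_Vect K) s t \<in> mor X Z"
    unfolding e
  proof (rule mknat_Hom[OF X Z])
    fix V :: "('k, 'u) vs" assume V: "V \<in> VO"
    show "(\<lambda>x\<in>el X V. cmp s V (cmp t V x)) \<in> lin (omap X V) (omap Z V)"
      using lin_compose[OF cmp_lin[OF t V] cmp_lin[OF s V] F_module[OF X V]] by (simp add: compose_def)
  qed (simp add: cmp_natural[OF t] cmp_natural[OF s] cmp_closed[OF t])
  show "cmp (Comp (Vect_Vect K) s t) V x = cmp s V (cmp t V x)"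
    if "V \<in> VO" "x \<in> el X V"
    using that by (simp add: e cmp_mknat)
qed

lemma
  assumes X: "X \<in> FO"
  shows VV_Ident_Hom: "Ident (Vect_Vect K) X \<in> mor X X"
    and cmp_Ident: "V \<in> VO \<Longrightarrow> x \<in> el X V \<Longrightarrow> cmp (Ident (Vect_Vect K) X) V x = x"
proof -
  have e: "Ident (Vect_Vect K) X = mknat X X (\<lambda>V x. x)"
    by (auto simp: Vect_Vect_def functor_category_def mknat_def)
  show "Ident (Vect_Vect K) X \<in> mor X X"
    unfolding e by (rule mknat_Hom[OF X X]) (auto intro: lin_id F_module[OF X])
  show "V \<in> VO \<Longrightarrow> x \<in> el X V \<Longrightarrow> cmp (Ident (Vect_Vect K) X) V x = x"
    by (simp add: e cmp_mknat)
qed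

text \<open>A total additive relation is a function as soon as zero is related only to zero, since
  the difference of two pairs over one \<open>x\<close> is a pair over zero. This serves for arrows
  whose value depends on a choice: a representative of a coset, a stage of a colimit, an
  approximation modulo torsion.\<close>

lemma hom_of_relation:
  fixes X Y :: "('k, 'u::grothendieck_universe) vfunctor"
  assumes X: "X \<in> FO" and Y: "Y \<in> FO"
    and sub: "\<And>V x y. V \<in> VO \<Longrightarrow> R V x y \<Longrightarrow> x \<in> el X V \<and> y \<in> el Y V"
    and tot: "\<And>V x. V \<in> VO \<Longrightarrow> x \<in> el X V \<Longrightarrow> \<exists>y. R V x y"
    and add: "\<And>V x y x' y'. V \<in> VO \<Longrightarrow> R V x y \<Longrightarrow> R V x' y' \<Longrightarrow>
      R V (x \<oplus>\<^bsub>omap X V\<^esub> x') (y \<oplus>\<^bsub>omap Y V\<^esub> y')"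
    and smult: "\<And>V x y a. V \<in> VO \<Longrightarrow> R V x y \<Longrightarrow> a \<in> carrier K \<Longrightarrow>
      R V (a \<odot>\<^bsub>omap X V\<^esub> x) (a \<odot>\<^bsub>omap Y V\<^esub> y)"
    and act: "\<And>V W f x y. V \<in> VO \<Longrightarrow> W \<in> VO \<Longrightarrow> f \<in> lin V W \<Longrightarrow>
      R V x y \<Longrightarrow> R W (act X V W f x) (act Y V W f y)"
    and single: "\<And>V y. V \<in> VO \<Longrightarrow> R V \<zero>\<^bsub>omap X V\<^esub> y \<Longrightarrow> y = \<zero>\<^bsub>omap Y V\<^esub>"
  obtains t where "t \<in> mor X Y"
    "\<And>V x y. V \<in> VO \<Longrightarrow> x \<in> el X V \<Longrightarrow> R V x y \<longleftrightarrow> y = cmp t V x"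
proof -
  define \<tau> where "\<tau> V x = (SOME y. R V x y)" for V x
  have R\<tau>: "R V x (\<tau> V x)" if "V \<in> VO" "x \<in> el X V" for V x
    unfolding \<tau>_def using tot[OF that] by (rule someI_ex)
  have uniq: "y = y'" if V: "V \<in> VO" and R: "R V x y" "R V x y'" for V x y y'
  proof -
    interpret XV: module K "omap X V" by (rule F_module[OF X V])
    interpret YV: module K "omap Y V" by (rule F_module[OF Y V])
    have c: "x \<in> el X V" "y \<in> el Y V" "y' \<in> el Y V"
      using sub[OF V] R by auto
    \<comment> \<open>The difference is formed with the scalar minus one, because the assumptions on
      \<open>R\<close> speak of sums and multiples.\<close>
    have "R V (x \<oplus>\<^bsub>omap X V\<^esub> (\<ominus>\<^bsub>K\<^esub> \<one>\<^bsub>K\<^esub>) \<odot>\<^bsub>omap X V\<^esub> x) (y \<oplus>\<^bsub>omap Y V\<^esub> (\<ominus>\<^bsub>K\<^esub> \<one>\<^bsub>K\<^esub>) \<odot>\<^bsub>omap Y V\<^esub> y')"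
      by (intro add smult V R) simp
    then have "y \<oplus>\<^bsub>omap Y V\<^esub> (\<ominus>\<^bsub>K\<^esub> \<one>\<^bsub>K\<^esub>) \<odot>\<^bsub>omap Y V\<^esub> y' = \<zero>\<^bsub>omap Y V\<^esub>"
      using c by (intro single[OF V]) (simp add: XV.smult_l_minus XV.M.r_neg)
    then have "y \<ominus>\<^bsub>omap Y V\<^esub> y' = \<zero>\<^bsub>omap Y V\<^esub>" using c by (simp add: YV.smult_l_minus a_minus_def)
    then show ?thesis using c YV.M.minus_eq_zero_iff by auto
  qed
  let ?t = "mknat X Y \<tau>"
  have "?t \<in> mor X Y"
  proof (rule mknat_Hom[OF X Y])
    fix V :: "('k, 'u) vs" assume V: "V \<in> VO"
    interpret XV: module K "omap X V" by (rule F_module[OF X V])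
    show "(\<lambda>x\<in>el X V. \<tau> V x) \<in> lin (omap X V) (omap Y V)"
    proof (rule linI_restrict[OF F_module[OF X V]])
      fix x assume x: "x \<in> el X V"
      show "\<tau> V x \<in> el Y V" using sub[OF V R\<tau>[OF V x]] by simp
      show "\<tau> V (a \<odot>\<^bsub>omap X V\<^esub> x) = a \<odot>\<^bsub>omap Y V\<^esub> \<tau> V x" if "a \<in> carrier K" for a
        using uniq[OF V R\<tau>[OF V] smult[OF V R\<tau>[OF V x]]] that x by simp
      show "\<tau> V (x \<oplus>\<^bsub>omap X V\<^esub> y) = \<tau> V x \<oplus>\<^bsub>omap Y V\<^esub> \<tau> V y" if "y \<in> el X V" for y
        using uniq[OF V R\<tau>[OF V] add[OF V R\<tau>[OF V x] R\<tau>[OF V that]]] that x by simp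
    qed
    fix W f x assume W: "W \<in> VO" and f: "f \<in> lin V W" and x: "x \<in> el X V"
    show "\<tau> W (act X V W f x) = act Y V W f (\<tau> V x)"
      using uniq[OF W R\<tau>[OF W F_closed[OF X V W f x]] act[OF V W f R\<tau>[OF V x]]] .
  qed
  moreover have "R V x y \<longleftrightarrow> y = cmp ?t V x" if "V \<in> VO" "x \<in> el X V" for V x y
    using R\<tau>[OF that] uniq that by (auto simp: cmp_mknat)
  ultimately show ?thesis using that by blast
qed

end

section \<open>Constructions of functors\<close>

context vect
begin

definition subfun ::
  "('k, 'u::grothendieck_universe) vfunctor \<Rightarrow> (('k, 'u) vs \<Rightarrow> 'u set) \<Rightarrow> bool" where
  "subfun X N \<longleftrightarrow> (\<forall>V\<in>VO. submodule (N V) K (omap X V)) \<and>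
     (\<forall>V\<in>VO. \<forall>W\<in>VO. \<forall>f\<in>lin V W. \<forall>x\<in>N V. act X V W f x \<in> N W)"

definition sub_functor ::
  "('k, 'u::grothendieck_universe) vfunctor \<Rightarrow> (('k, 'u) vs \<Rightarrow> 'u set) \<Rightarrow> ('k, 'u) vfunctor" where
  "sub_functor X N = mkfun K (\<lambda>W. (omap X W)\<lparr>carrier := N W\<rparr>) (\<lambda>V W f. \<lambda>x\<in>N V. act X V W f x)"

definition prod_functor ::
  "'u::grothendieck_universe set \<Rightarrow> ('u \<Rightarrow> ('k, 'u) vfunctor) \<Rightarrow> ('k, 'u) vfunctor" where
  "prod_functor I X = mkfun K (\<lambda>W. prod_space I (\<lambda>i. omap (X i) W))
     (\<lambda>V W f. \<lambda>p\<in>carrier (prod_space I (\<lambda>i. omap (X i) V)). graph I (\<lambda>i. act (X i) V W f (graph_app p i)))"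

subsection \<open>Representables\<close>

lemma Yoneda_mkfun:
  "Yoneda K V = mkfun K (hom_space K V)
    (\<lambda>W W' g. \<lambda>p\<in>carrier (hom_space K V W). graph (carrier V) (\<lambda>x. g (graph_app p x)))"
  by (simp add: Yoneda_def mkfun_def)

context
  fixes V :: "('k, 'u::grothendieck_universe) vs"
  assumes V: "V \<in> VO"
begin

lemma graph_comp:
  "graph (carrier V) (\<lambda>x. g (graph_app p x)) = graph (carrier V) (compose (carrier V) g (hom_fun V p))"
  by (rule graph_cong) (simp add: compose_def hom_fun_def)

lemma hom_fun_comp:
  assumes "p \<in> carrier (hom_space K V W)" "g \<in> lin W W'"
  shows "hom_fun V (graph (carrier V) (\<lambda>x. g (graph_app p x))) = compose (carrier V) g (hom_fun V p)"
  unfolding graph_comp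
  by (rule hom_fun_graph[OF VO_small[OF V], where W = W'])
    (intro lin_compose[OF hom_fun_lin[OF VO_small[OF V] assms(1)] assms(2) VO_module[OF V]])

lemma hom_eqI:
  "p \<in> carrier (hom_space K V W) \<Longrightarrow> q \<in> carrier (hom_space K V W) \<Longrightarrow> hom_fun V p = hom_fun V q \<Longrightarrow> p = q"
  using graph_hom_fun[OF VO_small[OF V]] by metis

lemma comp_hom_space:
  assumes "p \<in> carrier (hom_space K V W)" "g \<in> lin W W'"
  shows "graph (carrier V) (\<lambda>x. g (graph_app p x)) \<in> carrier (hom_space K V W')"
  unfolding graph_comp
  by (intro graph_in_hom_space lin_compose[OF hom_fun_lin[OF VO_small[OF V] assms(1)] assms(2) VO_module[OF V]])

lemma Yoneda_FO: "Yoneda K V \<in> FO"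
  unfolding Yoneda_mkfun
proof (rule mkfun_FO)
  note sm = VO_small[OF V]
  show "hom_space K V W \<in> VO" if "W \<in> VO" for W using V that by (rule hom_space_VO)
  fix W :: "('k, 'u) vs" assume W: "W \<in> VO"
  note H = VO_module[OF hom_space_VO[OF V W]]
  interpret H: module K "hom_space K V W" by (rule H)
  have cl: "hom_fun V p x \<in> carrier W" if "p \<in> carrier (hom_space K V W)" "x \<in> carrier V" for p x
    using lin_closed[OF hom_fun_lin[OF sm that(1)] that(2)] .
  have ga: "graph_app p x \<in> carrier W" if "p \<in> carrier (hom_space K V W)" "x \<in> carrier V" for p x
    using cl[OF that] that by (simp add: hom_fun_def)
  show "(\<lambda>p\<in>carrier (hom_space K V W). graph (carrier V) (\<lambda>x. (\<lambda>x\<in>carrier W. x) (graph_app p x))) p = p"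
    if p: "p \<in> carrier (hom_space K V W)" for p
  proof -
    have "graph (carrier V) (\<lambda>x. (\<lambda>x\<in>carrier W. x) (graph_app p x)) = graph (carrier V) (hom_fun V p)"
      by (rule graph_cong) (simp add: ga[OF p] hom_fun_def)
    then show ?thesis using p by (simp add: graph_hom_fun[OF sm])
  qed
  fix W' f assume W': "W' \<in> VO" and f: "f \<in> lin W W'"
  show "(\<lambda>p\<in>carrier (hom_space K V W). graph (carrier V) (\<lambda>x. f (graph_app p x)))
      \<in> lin (hom_space K V W) (hom_space K V W')"
  proof (rule linI_restrict[OF H])
    fix p q assume p: "p \<in> carrier (hom_space K V W)" and q: "q \<in> carrier (hom_space K V W)"
    show "graph (carrier V) (\<lambda>x. f (graph_app (p \<oplus>\<^bsub>hom_space K V W\<^esub> q) x)) =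
        graph (carrier V) (\<lambda>x. f (graph_app p x)) \<oplus>\<^bsub>hom_space K V W'\<^esub> graph (carrier V) (\<lambda>x. f (graph_app q x))"
      using p q by (simp add: hom_space_def graph_eq_iff sm graph_app_graph lin_plus[OF f]
          ga[unfolded hom_space_def, simplified])
  next
    fix a p assume a: "a \<in> carrier K" and p: "p \<in> carrier (hom_space K V W)"
    show "graph (carrier V) (\<lambda>x. f (graph_app (a \<odot>\<^bsub>hom_space K V W\<^esub> p) x)) =
        a \<odot>\<^bsub>hom_space K V W'\<^esub> graph (carrier V) (\<lambda>x. f (graph_app p x))"
      using p a by (simp add: hom_space_def graph_eq_iff sm graph_app_graph lin_scale[OF f]
          ga[unfolded hom_space_def, simplified])
  qed (rule comp_hom_space[OF _ f])
  fix p assume p: "p \<in> carrier (hom_space K V W)"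
  show "(\<lambda>p\<in>carrier (hom_space K V W). graph (carrier V) (\<lambda>x. compose (carrier W) g f (graph_app p x))) p =
    (\<lambda>p\<in>carrier (hom_space K V W'). graph (carrier V) (\<lambda>x. g (graph_app p x)))
      ((\<lambda>p\<in>carrier (hom_space K V W). graph (carrier V) (\<lambda>x. f (graph_app p x))) p)"
    if g: "g \<in> lin W' Z" for Z g
    using p by (simp add: comp_hom_space[OF p f] graph_eq_iff sm graph_app_graph compose_eq ga[OF p])
  show "(\<lambda>p\<in>carrier (hom_space K V W). graph (carrier V) (\<lambda>x. (\<lambda>x\<in>carrier W. f x \<oplus>\<^bsub>W'\<^esub> g x) (graph_app p x))) p =
      (\<lambda>p\<in>carrier (hom_space K V W). graph (carrier V) (\<lambda>x. f (graph_app p x))) p \<oplus>\<^bsub>hom_space K V W'\<^esub>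
      (\<lambda>p\<in>carrier (hom_space K V W). graph (carrier V) (\<lambda>x. g (graph_app p x))) p" for g
    using p by (simp add: hom_space_def graph_eq_iff sm graph_app_graph ga[unfolded hom_space_def, simplified])
  show "(\<lambda>p\<in>carrier (hom_space K V W). graph (carrier V) (\<lambda>x. (\<lambda>x\<in>carrier W. a \<odot>\<^bsub>W'\<^esub> f x) (graph_app p x))) p =
      a \<odot>\<^bsub>hom_space K V W'\<^esub> (\<lambda>p\<in>carrier (hom_space K V W). graph (carrier V) (\<lambda>x. f (graph_app p x))) p" for a
    using p by (simp add: hom_space_def graph_eq_iff sm graph_app_graph ga[unfolded hom_space_def, simplified])
qed

lemma Yoneda_omap: "W \<in> VO \<Longrightarrow> omap (Yoneda K V) W = hom_space K V W"
  by (simp add: Yoneda_def)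

lemma Yoneda_act:
  assumes "W \<in> VO" "W' \<in> VO" "g \<in> lin W W'" "p \<in> carrier (hom_space K V W)"
  shows "hom_fun V (act (Yoneda K V) W W' g p) = compose (carrier V) g (hom_fun V p)"
  using assms by (simp add: Yoneda_mkfun mkfun_act hom_fun_comp)

text \<open>The arrow that the Yoneda lemma attaches to a vector \<open>x\<close> of
  \<open>X V\<close>; it sends the identity of \<open>V\<close> to \<open>x\<close>.\<close>

definition yoneda_arrow :: "('k, 'u) vfunctor \<Rightarrow> 'u \<Rightarrow> ('k, 'u) vnat" where
  "yoneda_arrow X x = mknat (Yoneda K V) X (\<lambda>W p. act X V W (hom_fun V p) x)"

context
  fixes X :: "('k, 'u) vfunctor" and x
  assumes X: "X \<in> FO" and x: "x \<in> el X V"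
begin

lemma yoneda_arrow_Hom: "yoneda_arrow X x \<in> mor (Yoneda K V) X"
  unfolding yoneda_arrow_def
proof (rule mknat_Hom[OF Yoneda_FO X])
  note sm = VO_small[OF V]
  fix W :: "('k, 'u) vs" assume W: "W \<in> VO"
  interpret H: module K "hom_space K V W" by (rule VO_module[OF hom_space_VO[OF V W]])
  have l: "hom_fun V p \<in> lin V W" if "p \<in> carrier (hom_space K V W)" for p
    by (rule hom_fun_lin[OF sm that])
  show "(\<lambda>p\<in>el (Yoneda K V) W. act X V W (hom_fun V p) x) \<in> lin (omap (Yoneda K V) W) (omap X W)"
    unfolding Yoneda_omap[OF W]
  proof (rule linI_restrict)
    fix p assume p: "p \<in> carrier (hom_space K V W)"
    show "act X V W (hom_fun V p) x \<in> el X W" by (rule F_closed[OF X V W l[OF p] x])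
    show "act X V W (hom_fun V (a \<odot>\<^bsub>hom_space K V W\<^esub> p)) x = a \<odot>\<^bsub>omap X W\<^esub> act X V W (hom_fun V p) x"
      if "a \<in> carrier K" for a
      by (simp add: hom_fun_ops[OF sm] F_smult_map[OF X V W l[OF p] that x])
    show "act X V W (hom_fun V (p \<oplus>\<^bsub>hom_space K V W\<^esub> q)) x =
        act X V W (hom_fun V p) x \<oplus>\<^bsub>omap X W\<^esub> act X V W (hom_fun V q) x"
      if "q \<in> carrier (hom_space K V W)" for q
      by (simp add: hom_fun_ops[OF sm] F_add_map[OF X V W l[OF p] l[OF that] x])
  qed (rule H.module_axioms)
  fix Z g p assume Z: "Z \<in> VO" and g: "g \<in> lin W Z" and p: "p \<in> el (Yoneda K V) W"
  then show "act X V Z (hom_fun V (act (Yoneda K V) W Z g p)) x = act X W Z g (act X V W (hom_fun V p) x)"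
    using F_comp[OF X V W l Z g x] by (simp add: Yoneda_omap[OF W] Yoneda_act[OF W Z g])
qed

lemma cmp_yoneda_arrow:
  "W \<in> VO \<Longrightarrow> p \<in> carrier (hom_space K V W) \<Longrightarrow>
    cmp (yoneda_arrow X x) W p = act X V W (hom_fun V p) x"
  unfolding yoneda_arrow_def by (rule cmp_mknat) (simp_all add: Yoneda_omap)

lemma cmp_yoneda_arrow_graph:
  "W \<in> VO \<Longrightarrow> f \<in> lin V W \<Longrightarrow>
    cmp (yoneda_arrow X x) W (graph (carrier V) f) = act X V W f x"
  by (simp add: cmp_yoneda_arrow graph_in_hom_space hom_fun_graph VO_small[OF V])

end

abbreviation "gid \<equiv> graph (carrier V) (\<lambda>x\<in>carrier V. x)"

lemma gid: "gid \<in> carrier (hom_space K V V)"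
  by (intro graph_in_hom_space lin_id VO_module V)

lemma Yoneda_act_id:
  assumes "W \<in> VO" "g \<in> lin V W"
  shows "act (Yoneda K V) V W g gid = graph (carrier V) g"
proof -
  have "act (Yoneda K V) V W g gid = graph (carrier V) (\<lambda>x. g (graph_app gid x))"
    using assms V gid by (simp add: Yoneda_mkfun mkfun_act)
  also have "\<dots> = graph (carrier V) g"
    by (rule graph_cong) (simp add: graph_app_graph VO_small[OF V])
  finally show ?thesis .
qed

text \<open>Naturality along the linear map coded by \<open>p\<close>, applied to the identity of
  \<open>V\<close>. An arrow out of a representable is thus determined by one vector.\<close>

lemma yoneda_at_id:
  assumes t: "t \<in> mor (Yoneda K V) X" and W: "W \<in> VO" and p: "p \<in> carrier (hom_space K V W)"
  shows "cmp t W p = act X V W (hom_fun V p) (cmp t V gid)"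
  using cmp_natural[OF t V W hom_fun_lin[OF VO_small[OF V] p], of gid] gid
  by (simp add: Yoneda_omap V Yoneda_act_id[OF W hom_fun_lin[OF VO_small[OF V] p]] graph_hom_fun[OF VO_small[OF V] p])

end

subsection \<open>Subfunctors, quotients and products\<close>

context
  fixes X :: "('k, 'u::grothendieck_universe) vfunctor" and N
  assumes X: "X \<in> FO" and N: "subfun X N"
begin

lemma subfun_submod: "V \<in> VO \<Longrightarrow> submodule (N V) K (omap X V)"
  using N by (simp add: subfun_def)

lemma subfun_act:
  "V \<in> VO \<Longrightarrow> W \<in> VO \<Longrightarrow> f \<in> lin V W \<Longrightarrow> x \<in> N V \<Longrightarrow> act X V W f x \<in> N W"
  using N by (simp add: subfun_def)

lemma subfun_D:
  assumes "V \<in> VO"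
  shows "x \<in> N V \<Longrightarrow> x \<in> el X V" "\<zero>\<^bsub>omap X V\<^esub> \<in> N V"
    "\<And>x y. x \<in> N V \<Longrightarrow> y \<in> N V \<Longrightarrow> x \<oplus>\<^bsub>omap X V\<^esub> y \<in> N V"
    "\<And>x y. x \<in> N V \<Longrightarrow> y \<in> N V \<Longrightarrow> x \<ominus>\<^bsub>omap X V\<^esub> y \<in> N V"
    "\<And>a x. a \<in> carrier K \<Longrightarrow> x \<in> N V \<Longrightarrow> a \<odot>\<^bsub>omap X V\<^esub> x \<in> N V"
  using submodD[OF subfun_submod[OF assms] F_module[OF X assms]] by auto

lemma sub_functor_FO: "sub_functor X N \<in> FO"
  unfolding sub_functor_def
proof (rule mkfun_FO)
  show "(omap X V)\<lparr>carrier := N V\<rparr> \<in> VO" if "V \<in> VO" for V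
    using F_VO[OF X that] subfun_submod[OF that] by (rule sub_VO)
  fix V W :: "('k, 'u) vs" and f assume V: "V \<in> VO" and W: "W \<in> VO" and f: "f \<in> lin V W"
  note l = lin_plus[OF F_lin[OF X V W f]] lin_scale[OF F_lin[OF X V W f]]
  interpret NV: module K "(omap X V)\<lparr>carrier := N V\<rparr>"
    by (rule submod_module[OF subfun_submod[OF V] F_module[OF X V]])
  show "(\<lambda>x\<in>N V. act X V W f x) \<in> lin ((omap X V)\<lparr>carrier := N V\<rparr>) ((omap X W)\<lparr>carrier := N W\<rparr>)"
    by (rule linI) (simp_all add: subfun_act[OF V W f] l subfun_D[OF V])
qed (auto simp: F_id[OF X] F_comp[OF X] F_add_map[OF X] F_smult_map[OF X] subfun_D subfun_act)

lemma sub_functor_omap: "V \<in> VO \<Longrightarrow> omap (sub_functor X N) V = (omap X V)\<lparr>carrier := N V\<rparr>"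
  by (simp add: sub_functor_def mkfun_omap)

lemma sub_functor_act:
  "V \<in> VO \<Longrightarrow> W \<in> VO \<Longrightarrow> f \<in> lin V W \<Longrightarrow> x \<in> N V \<Longrightarrow>
    act (sub_functor X N) V W f x = act X V W f x"
  by (simp add: sub_functor_def mkfun_act)

lemma quotient_functor_mkfun:
  "quotient_functor K X N = mkfun K (\<lambda>W. quotient_space (omap X W) (N W))
    (\<lambda>V W f. \<lambda>p\<in>carrier (quotient_space (omap X V) (N V)). vset (\<Union>x\<in>elts p. N W +>\<^bsub>omap X W\<^esub> act X V W f x))"
  unfolding quotient_functor_def mkfun_def
  by (auto intro!: restrict_ext elim!: Arr_VectE simp: F_amap[OF X])

lemma quotient_functor_omap:
  "V \<in> VO \<Longrightarrow> omap (quotient_functor K X N) V = quotient_space (omap X V) (N V)"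
  by (simp add: quotient_functor_def)

lemma quotient_action_coset:
  assumes V: "V \<in> VO" and W: "W \<in> VO" and f: "f \<in> lin V W"
    and x: "x \<in> el X V"
  shows "vset (\<Union>x\<in>elts (coset (omap X V) (N V) x). N W +>\<^bsub>omap X W\<^esub> act X V W f x) =
    coset (omap X W) (N W) (act X V W f x)"
proof (rule quotient_map_coset[OF F_VO[OF X V] subfun_submod[OF V] x F_VO[OF X W] subfun_submod[OF W]])
  fix y assume y: "y \<in> el X V"
  show "act X V W f y \<in> el X W" by (rule F_closed[OF X V W f y])
  assume "y \<ominus>\<^bsub>omap X V\<^esub> x \<in> N V"
  from subfun_act[OF V W f this]
  show "act X V W f y \<ominus>\<^bsub>omap X W\<^esub> act X V W f x \<in> N W"
    by (simp add: lin_minus[OF F_lin[OF X V W f] F_module[OF X V] F_module[OF X W] y x])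
qed

lemma
  shows quotient_functor_FO: "quotient_functor K X N \<in> FO"
    and quotient_functor_act: "V \<in> VO \<Longrightarrow> W \<in> VO \<Longrightarrow> f \<in> lin V W \<Longrightarrow>
      x \<in> el X V \<Longrightarrow>
      act (quotient_functor K X N) V W f (coset (omap X V) (N V) x) = coset (omap X W) (N W) (act X V W f x)"
proof -
  let ?ac = "\<lambda>V W f. \<lambda>p\<in>carrier (quotient_space (omap X V) (N V)). vset (\<Union>x\<in>elts p. N W +>\<^bsub>omap X W\<^esub> act X V W f x)"
  have car: "carrier (quotient_space (omap X V) (N V)) = coset (omap X V) (N V) ` el X V"
    if "V \<in> VO" for V by (rule quotient_carrier[OF F_VO[OF X that] subfun_submod[OF that]])
  have ac: "?ac V W f (coset (omap X V) (N V) x) = coset (omap X W) (N W) (act X V W f x)"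
    if "V \<in> VO" "W \<in> VO" "f \<in> lin V W" "x \<in> el X V" for V W f x
    using quotient_action_coset[OF that] car[OF that(1)] that by simp
  show "quotient_functor K X N \<in> FO"
    unfolding quotient_functor_mkfun
  proof (rule mkfun_FO)
    fix V :: "('k, 'u) vs" assume V: "V \<in> VO"
    note qV = quotient_ops[OF F_VO[OF X V] subfun_submod[OF V]]
    show "quotient_space (omap X V) (N V) \<in> VO" by (rule quotient_VO[OF F_VO[OF X V] subfun_submod[OF V]])
    { fix x assume "x \<in> carrier (quotient_space (omap X V) (N V))"
      then obtain y where y: "y \<in> el X V" "x = coset (omap X V) (N V) y" using car[OF V] by auto
      have "?ac V V (\<lambda>x\<in>carrier V. x) x = coset (omap X V) (N V) (act X V V (\<lambda>x\<in>carrier V. x) y)"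
        unfolding y(2) by (rule ac[OF V V lin_id[OF VO_module[OF V]] y(1)])
      then show "?ac V V (\<lambda>x\<in>carrier V. x) x = x" using F_id[OF X V y(1)] y by simp }
    fix W f assume W: "W \<in> VO" and f: "f \<in> lin V W"
    note qW = quotient_ops[OF F_VO[OF X W] subfun_submod[OF W]]
    interpret XV: module K "omap X V" by (rule F_module[OF X V])
    interpret QV: module K "quotient_space (omap X V) (N V)"
      by (rule VO_module[OF quotient_VO[OF F_VO[OF X V] subfun_submod[OF V]]])
    note FL = F_closed[OF X V W f] lin_plus[OF F_lin[OF X V W f]] lin_scale[OF F_lin[OF X V W f]]
    show "?ac V W f \<in> lin (quotient_space (omap X V) (N V)) (quotient_space (omap X W) (N W))"
    proof (rule linI)
      fix x assume "x \<in> carrier (quotient_space (omap X V) (N V))"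
      then obtain y where y: "y \<in> el X V" "x = coset (omap X V) (N V) y" using car[OF V] by auto
      show "?ac V W f x \<in> carrier (quotient_space (omap X W) (N W))"
        unfolding y(2) ac[OF V W f y(1)] using FL(1)[OF y(1)] car[OF W] by simp
      show "?ac V W f (a \<odot>\<^bsub>quotient_space (omap X V) (N V)\<^esub> x) = a \<odot>\<^bsub>quotient_space (omap X W) (N W)\<^esub> ?ac V W f x"
        if a: "a \<in> carrier K" for a
        unfolding y(2) ac[OF V W f y(1)] qV(2)[OF a y(1)] ac[OF V W f XV.smult_closed[OF a y(1)]]
        using FL y(1) a by (simp add: qW)
      fix x' assume "x' \<in> carrier (quotient_space (omap X V) (N V))"
      then obtain y' where y': "y' \<in> el X V" "x' = coset (omap X V) (N V) y'" using car[OF V] by auto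
      show "?ac V W f (x \<oplus>\<^bsub>quotient_space (omap X V) (N V)\<^esub> x') = ?ac V W f x \<oplus>\<^bsub>quotient_space (omap X W) (N W)\<^esub> ?ac V W f x'"
        unfolding y(2) y'(2) ac[OF V W f y(1)] ac[OF V W f y'(1)] qV(1)[OF y(1) y'(1)]
          ac[OF V W f XV.M.add.m_closed[OF y(1) y'(1)]]
        using FL y(1) y'(1) by (simp add: qW)
    qed simp
    fix x assume "x \<in> carrier (quotient_space (omap X V) (N V))"
    then obtain y where y: "y \<in> el X V" "x = coset (omap X V) (N V) y" using car[OF V] by auto
    show "?ac V Z (compose (carrier V) g f) x = ?ac W Z g (?ac V W f x)"
      if Z: "Z \<in> VO" and g: "g \<in> lin W Z" for Z g
      unfolding y(2) ac[OF V W f y(1)] ac[OF W Z g FL(1)[OF y(1)]]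
        ac[OF V Z lin_compose[OF f g VO_module[OF V]] y(1)] F_comp[OF X V W f Z g y(1)] ..
    show "?ac V W (\<lambda>x\<in>carrier V. f x \<oplus>\<^bsub>W\<^esub> g x) x = ?ac V W f x \<oplus>\<^bsub>quotient_space (omap X W) (N W)\<^esub> ?ac V W g x"
      if g: "g \<in> lin V W" for g
      unfolding y(2) ac[OF V W f y(1)] ac[OF V W g y(1)] ac[OF V W lin_sum[OF f g VO_module[OF V] VO_module[OF W]] y(1)]
        F_add_map[OF X V W f g y(1)] using FL(1)[OF y(1)] F_closed[OF X V W g y(1)] by (simp add: qW)
    show "?ac V W (\<lambda>x\<in>carrier V. a \<odot>\<^bsub>W\<^esub> f x) x = a \<odot>\<^bsub>quotient_space (omap X W) (N W)\<^esub> ?ac V W f x"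
      if a: "a \<in> carrier K" for a
      unfolding y(2) ac[OF V W f y(1)] ac[OF V W lin_smultiple[OF f a VO_module[OF V] VO_module[OF W]] y(1)]
        F_smult_map[OF X V W f a y(1)] using FL(1)[OF y(1)] a by (simp add: qW)
  qed
  assume V: "V \<in> VO" and W: "W \<in> VO" and f: "f \<in> lin V W"
    and x: "x \<in> el X V"
  show "act (quotient_functor K X N) V W f (coset (omap X V) (N V) x) = coset (omap X W) (N W) (act X V W f x)"
    unfolding quotient_functor_mkfun mkfun_act[OF V W f] by (rule ac[OF V W f x])
qed

definition quotient_arrow :: "('k, 'u) vnat" where
  "quotient_arrow = mknat X (quotient_functor K X N) (\<lambda>V. coset (omap X V) (N V))"

lemma quotient_arrow_Hom: "quotient_arrow \<in> mor X (quotient_functor K X N)"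
  unfolding quotient_arrow_def
proof (rule mknat_Hom[OF X quotient_functor_FO])
  fix V :: "('k, 'u) vs" assume V: "V \<in> VO"
  show "(\<lambda>x\<in>el X V. coset (omap X V) (N V) x) \<in> lin (omap X V) (omap (quotient_functor K X N) V)"
    using quotient_map_lin[OF F_VO[OF X V] subfun_submod[OF V]] by (simp add: quotient_functor_omap V)
qed (simp add: quotient_functor_act)

lemma cmp_quotient_arrow:
  "V \<in> VO \<Longrightarrow> x \<in> el X V \<Longrightarrow> cmp quotient_arrow V x = coset (omap X V) (N V) x"
  by (simp add: quotient_arrow_def cmp_mknat)

lemma quotient_functor_carrier:
  "V \<in> VO \<Longrightarrow>
    el (quotient_functor K X N) V = coset (omap X V) (N V) ` el X V"
  using quotient_carrier[OF F_VO[OF X] subfun_submod] by (simp add: quotient_functor_omap)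

lemma quotient_functor_ops:
  assumes V: "V \<in> VO"
  shows "x \<in> el X V \<Longrightarrow> y \<in> el X V \<Longrightarrow>
      coset (omap X V) (N V) x \<oplus>\<^bsub>omap (quotient_functor K X N) V\<^esub> coset (omap X V) (N V) y =
        coset (omap X V) (N V) (x \<oplus>\<^bsub>omap X V\<^esub> y)"
    and "a \<in> carrier K \<Longrightarrow> x \<in> el X V \<Longrightarrow>
      a \<odot>\<^bsub>omap (quotient_functor K X N) V\<^esub> coset (omap X V) (N V) x = coset (omap X V) (N V) (a \<odot>\<^bsub>omap X V\<^esub> x)"
    and "\<zero>\<^bsub>omap (quotient_functor K X N) V\<^esub> = coset (omap X V) (N V) \<zero>\<^bsub>omap X V\<^esub>"
    and "x \<in> el X V \<Longrightarrow> coset (omap X V) (N V) x = \<zero>\<^bsub>omap (quotient_functor K X N) V\<^esub> \<longleftrightarrow> x \<in> N V"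
    and "x \<in> el X V \<Longrightarrow> y \<in> el X V \<Longrightarrow>
      coset (omap X V) (N V) x = coset (omap X V) (N V) y \<longleftrightarrow> x \<ominus>\<^bsub>omap X V\<^esub> y \<in> N V"
  using quotient_ops[OF F_VO[OF X V] subfun_submod[OF V]] coset_eq_zero_iff[OF F_VO[OF X V] subfun_submod[OF V]]
    coset_eq_iff[OF F_VO[OF X V] subfun_submod[OF V]]
  by (simp_all add: quotient_functor_omap V)

text \<open>The factor sends the class of \<open>x\<close> to \<open>cmp t V x\<close>. As a
  relation it needs no chosen representatives, and \<open>ker\<close> is what makes it single-valued
  at zero.\<close>

lemma quotient_factor:
  assumes t: "t \<in> mor X Y"
    and ker: "\<And>V x. V \<in> VO \<Longrightarrow> x \<in> N V \<Longrightarrow> cmp t V x = \<zero>\<^bsub>omap Y V\<^esub>"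
  shows "\<exists>!g. g \<in> mor (quotient_functor K X N) Y \<and> Comp (Vect_Vect K) g quotient_arrow = t"
proof -
  note Y = Hom_cod[OF t]
  let ?R = "\<lambda>V p y. \<exists>x\<in>el X V. p = coset (omap X V) (N V) x \<and> y = cmp t V x"
  obtain g where g: "g \<in> mor (quotient_functor K X N) Y"
    and gR: "\<And>V x y. V \<in> VO \<Longrightarrow> x \<in> el (quotient_functor K X N) V \<Longrightarrow> ?R V x y \<longleftrightarrow> y = cmp g V x"
  proof (rule hom_of_relation[OF quotient_functor_FO Y, where R = ?R])
    fix V :: "('k, 'u) vs" assume V: "V \<in> VO"
    note cl = cmp_closed[OF t V] and l = lin_plus[OF cmp_lin[OF t V]] lin_scale[OF cmp_lin[OF t V]]
    interpret XV: module K "omap X V" by (rule F_module[OF X V])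
    show "p \<in> el (quotient_functor K X N) V \<and> y \<in> el Y V" if "?R V p y" for p y
      using that cl by (auto simp: quotient_functor_carrier[OF V])
    show "\<exists>y. ?R V p y" if "p \<in> el (quotient_functor K X N) V" for p
      using that by (auto simp: quotient_functor_carrier[OF V])
    show "?R V (p \<oplus>\<^bsub>omap (quotient_functor K X N) V\<^esub> p') (y \<oplus>\<^bsub>omap Y V\<^esub> y')" if R: "?R V p y" "?R V p' y'" for p y p' y'
    proof -
      obtain x x' where "x \<in> el X V" "p = coset (omap X V) (N V) x" "y = cmp t V x"
        "x' \<in> el X V" "p' = coset (omap X V) (N V) x'" "y' = cmp t V x'" using R by blast
      then show ?thesis by (intro bexI[of _ "x \<oplus>\<^bsub>omap X V\<^esub> x'"]) (simp_all add: quotient_functor_ops[OF V] l)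
    qed
    show "?R V (a \<odot>\<^bsub>omap (quotient_functor K X N) V\<^esub> p) (a \<odot>\<^bsub>omap Y V\<^esub> y)" if R: "?R V p y" and a: "a \<in> carrier K" for p y a
    proof -
      obtain x where "x \<in> el X V" "p = coset (omap X V) (N V) x" "y = cmp t V x" using R by blast
      then show ?thesis using a by (intro bexI[of _ "a \<odot>\<^bsub>omap X V\<^esub> x"]) (simp_all add: quotient_functor_ops[OF V] l)
    qed
    show "?R W (act (quotient_functor K X N) V W f p) (act Y V W f y)"
      if W: "W \<in> VO" and f: "f \<in> lin V W" and R: "?R V p y" for W f p y
    proof -
      obtain x where "x \<in> el X V" "p = coset (omap X V) (N V) x" "y = cmp t V x" using R by blast
      then show ?thesis
        by (intro bexI[of _ "act X V W f x"])
          (simp_all add: quotient_functor_act[OF V W f] cmp_natural[OF t V W f] F_closed[OF X V W f])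
    qed
    show "y = \<zero>\<^bsub>omap Y V\<^esub>" if R: "?R V \<zero>\<^bsub>omap (quotient_functor K X N) V\<^esub> y" for y
    proof -
      obtain x where x: "x \<in> el X V" "coset (omap X V) (N V) x = \<zero>\<^bsub>omap (quotient_functor K X N) V\<^esub>" "y = cmp t V x"
        using R by metis
      then show ?thesis using ker[OF V] by (simp add: quotient_functor_ops(4)[OF V])
    qed
  qed blast
  have gq: "cmp g V (coset (omap X V) (N V) x) = cmp t V x" if "V \<in> VO" "x \<in> el X V" for V x
    using gR[OF that(1), of "coset (omap X V) (N V) x" "cmp t V x"] that by (auto simp: quotient_functor_carrier)
  show ?thesis
  proof (rule ex1I[of _ g], intro conjI)
    show "g \<in> mor (quotient_functor K X N) Y" by (rule g)
    show "Comp (Vect_Vect K) g quotient_arrow = t"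
      by (rule Hom_eqI[OF VV_comp_Hom[OF quotient_arrow_Hom g] t])
        (simp add: cmp_Comp[OF quotient_arrow_Hom g] cmp_quotient_arrow gq)
    fix h assume h: "h \<in> mor (quotient_functor K X N) Y \<and> Comp (Vect_Vect K) h quotient_arrow = t"
    show "h = g"
    proof (rule Hom_eqI[OF conjunct1[OF h] g])
      fix V :: "('k, 'u) vs" and p assume V: "V \<in> VO" and p: "p \<in> el (quotient_functor K X N) V"
      then obtain x where x: "x \<in> el X V" "p = coset (omap X V) (N V) x"
        by (auto simp: quotient_functor_carrier)
      have "cmp h V p = cmp (Comp (Vect_Vect K) h quotient_arrow) V x"
        using cmp_Comp[OF quotient_arrow_Hom conjunct1[OF h] V x(1)] x V by (simp add: cmp_quotient_arrow)
      then show "cmp h V p = cmp g V p" using h x V by (simp add: gq)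
    qed
  qed
qed

end

lemma subfunI:
  assumes "X \<in> FO"
    and "\<And>V x. V \<in> VO \<Longrightarrow> x \<in> N V \<Longrightarrow> x \<in> el X V"
    and "\<And>V. V \<in> VO \<Longrightarrow> \<zero>\<^bsub>omap X V\<^esub> \<in> N V"
    and "\<And>V x y. V \<in> VO \<Longrightarrow> x \<in> N V \<Longrightarrow> y \<in> N V \<Longrightarrow> x \<oplus>\<^bsub>omap X V\<^esub> y \<in> N V"
    and "\<And>V a x. V \<in> VO \<Longrightarrow> a \<in> carrier K \<Longrightarrow> x \<in> N V \<Longrightarrow> a \<odot>\<^bsub>omap X V\<^esub> x \<in> N V"
    and "\<And>V W f x. V \<in> VO \<Longrightarrow> W \<in> VO \<Longrightarrow> f \<in> lin V W \<Longrightarrow> x \<in> N V \<Longrightarrow>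
      act X V W f x \<in> N W"
  shows "subfun X N"
  unfolding subfun_def using assms F_module[OF assms(1)] by (auto intro!: submodI)

context
  fixes I :: "'u::grothendieck_universe set" and X :: "'u \<Rightarrow> ('k, 'u) vfunctor"
  assumes I: "small I" and X: "\<And>i. i \<in> I \<Longrightarrow> X i \<in> FO"
begin

lemma prod_functor_omap: "V \<in> VO \<Longrightarrow> omap (prod_functor I X) V = prod_space I (\<lambda>i. omap (X i) V)"
  by (simp add: prod_functor_def mkfun_omap)

lemma prod_functor_act:
  assumes "V \<in> VO" "W \<in> VO" "f \<in> lin V W"
    "p \<in> el (prod_functor I X) V" "i \<in> I"
  shows "graph_app (act (prod_functor I X) V W f p) i = act (X i) V W f (graph_app p i)"
  using assms I by (simp add: prod_functor_omap) (simp add: prod_functor_def mkfun_act graph_app_graph)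

lemma prod_functor_FO: "prod_functor I X \<in> FO"
  unfolding prod_functor_def
proof (rule mkfun_FO)
  have VO: "omap (X i) V \<in> VO" if "i \<in> I" "V \<in> VO" for i V
    by (rule F_VO[OF X[OF that(1)] that(2)])
  let ?P = "\<lambda>V. prod_space I (\<lambda>i. omap (X i) V)"
  show P: "?P V \<in> VO" if "V \<in> VO" for V using that by (intro prod_VO I VO)
  fix V :: "('k, 'u) vs" assume V: "V \<in> VO"
  note app = prod_app[OF I]
  show "(\<lambda>p\<in>carrier (?P V). graph I (\<lambda>i. act (X i) V V (\<lambda>x\<in>carrier V. x) (graph_app p i))) p = p"
    if p: "p \<in> carrier (?P V)" for p
  proof -
    have "graph I (\<lambda>i. act (X i) V V (\<lambda>x\<in>carrier V. x) (graph_app p i)) = graph I (graph_app p)"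
      by (rule graph_cong) (rule F_id[OF X V app[OF p]])
    then show ?thesis using p by (simp add: prod_graph_app[OF I])
  qed
  fix W f assume W: "W \<in> VO" and f: "f \<in> lin V W"
  have fl: "act (X i) V W f \<in> lin (omap (X i) V) (omap (X i) W)" if "i \<in> I" for i
    using F_lin[OF X[OF that] V W f] .
  have cl: "graph I (\<lambda>i. act (X i) V W f (graph_app p i)) \<in> carrier (?P W)" if "p \<in> carrier (?P V)" for p
    using app[OF that] lin_closed[OF fl] by (intro graph_prodI) auto
  interpret P: module K "?P V" by (rule VO_module[OF P[OF V]])
  show "(\<lambda>p\<in>carrier (?P V). graph I (\<lambda>i. act (X i) V W f (graph_app p i))) \<in> lin (?P V) (?P W)"
  proof (rule linI_restrict[OF VO_module[OF P[OF V]] cl])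
    fix p q assume p: "p \<in> carrier (?P V)" and q: "q \<in> carrier (?P V)"
    show "graph I (\<lambda>i. act (X i) V W f (graph_app (p \<oplus>\<^bsub>?P V\<^esub> q) i)) =
        graph I (\<lambda>i. act (X i) V W f (graph_app p i)) \<oplus>\<^bsub>?P W\<^esub> graph I (\<lambda>i. act (X i) V W f (graph_app q i))"
      using app[OF p] app[OF q] lin_plus[OF fl] by (simp add: prod_space_def graph_eq_iff I graph_app_graph)
  next
    fix a p assume a: "a \<in> carrier K" and p: "p \<in> carrier (?P V)"
    show "graph I (\<lambda>i. act (X i) V W f (graph_app (a \<odot>\<^bsub>?P V\<^esub> p) i)) =
        a \<odot>\<^bsub>?P W\<^esub> graph I (\<lambda>i. act (X i) V W f (graph_app p i))"
      using app[OF p] a lin_scale[OF fl] by (simp add: prod_space_def graph_eq_iff I graph_app_graph)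
  qed
  fix p assume p: "p \<in> carrier (?P V)"
  show "(\<lambda>p\<in>carrier (?P V). graph I (\<lambda>i. act (X i) V Z (compose (carrier V) g f) (graph_app p i))) p =
      (\<lambda>p\<in>carrier (?P W). graph I (\<lambda>i. act (X i) W Z g (graph_app p i)))
        ((\<lambda>p\<in>carrier (?P V). graph I (\<lambda>i. act (X i) V W f (graph_app p i))) p)"
    if Z: "Z \<in> VO" and g: "g \<in> lin W Z" for Z g
    using p cl[OF p] F_comp[OF X V W f Z g app[OF p]] by (simp add: graph_eq_iff I graph_app_graph)
  show "(\<lambda>p\<in>carrier (?P V). graph I (\<lambda>i. act (X i) V W (\<lambda>x\<in>carrier V. f x \<oplus>\<^bsub>W\<^esub> g x) (graph_app p i))) p =
      (\<lambda>p\<in>carrier (?P V). graph I (\<lambda>i. act (X i) V W f (graph_app p i))) p \<oplus>\<^bsub>?P W\<^esub>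
      (\<lambda>p\<in>carrier (?P V). graph I (\<lambda>i. act (X i) V W g (graph_app p i))) p"
    if g: "g \<in> lin V W" for g
    using p F_add_map[OF X V W f g app[OF p]] by (simp add: prod_space_def graph_eq_iff I graph_app_graph)
  show "(\<lambda>p\<in>carrier (?P V). graph I (\<lambda>i. act (X i) V W (\<lambda>x\<in>carrier V. a \<odot>\<^bsub>W\<^esub> f x) (graph_app p i))) p =
      a \<odot>\<^bsub>?P W\<^esub> (\<lambda>p\<in>carrier (?P V). graph I (\<lambda>i. act (X i) V W f (graph_app p i))) p"
    if a: "a \<in> carrier K" for a
    using p F_smult_map[OF X V W f a app[OF p]] by (simp add: prod_space_def graph_eq_iff I graph_app_graph)
qed

end

end

section \<open>Small functors\<close>

context vect
begin

definition generated :: "('k, 'u::grothendieck_universe) vfunctor \<Rightarrow> ('k, 'u) vs \<Rightarrow> bool" where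
  "generated X V \<longleftrightarrow> V \<in> VO \<and>
     (\<forall>W\<in>VO. \<forall>x\<in>el X W. \<exists>f\<in>lin V W. \<exists>v\<in>el X V. x = act X V W f v)"

lemma generatedD:
  assumes "generated X V" "W \<in> VO" "x \<in> el X W"
  obtains f v where "f \<in> lin V W" "v \<in> el X V" "x = act X V W f v"
  using assms unfolding generated_def by blast

lemma generated_VO: "generated X V \<Longrightarrow> V \<in> VO"
  by (simp add: generated_def)

text \<open>Let \<open>x = X f v\<close> lie in the subfunctor and let \<open>f h f = f\<close>.
  Then \<open>X h x\<close> lies in the subfunctor at \<open>V\<close>, and
  \<open>X f (X h x) = X (f h f) v = x\<close>. So the same \<open>V\<close> generates, although
  \<open>v\<close> itself need not lie in the subfunctor.\<close>

lemma generated_sub: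
  assumes X: "X \<in> FO" and N: "subfun X N" and g: "generated X V"
  shows "generated (sub_functor X N) V"
  unfolding generated_def
proof (intro conjI ballI)
  show V: "V \<in> VO" using g by (rule generated_VO)
  fix W x assume W: "W \<in> VO" and "x \<in> el (sub_functor X N) W"
  then have x: "x \<in> N W" by (simp add: sub_functor_omap[OF X N])
  obtain f v where f: "f \<in> lin V W" and v: "v \<in> el X V" "x = act X V W f v"
    by (rule generatedD[OF g W subfun_D(1)[OF X N W x]])
  obtain h where h: "h \<in> lin W V" "\<And>x. x \<in> carrier V \<Longrightarrow> f (h (f x)) = f x"
    by (rule pseudo_inverse[OF f VO_module[OF V] VO_module[OF W]]) blast
  have hx: "act X W V h x \<in> N V" by (rule subfun_act[OF X N W V h(1) x])
  have fh: "compose (carrier W) f h \<in> lin W W" by (rule lin_compose[OF h(1) f VO_module[OF W]])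
  have e: "compose (carrier V) (compose (carrier W) f h) f = f"
    by (rule extensionalityI[of _ "carrier V"])
      (auto simp: compose_eq lin_ext[OF f] lin_closed[OF f] h(2))
  have "act X V W f (act X W V h x) = act X W W (compose (carrier W) f h) x"
    using F_comp[OF X W V h(1) W f subfun_D(1)[OF X N W x]] by simp
  also have "\<dots> = act X V W f v"
    using F_comp[OF X V W f W fh v(1)] by (simp add: e v(2))
  finally show "\<exists>f\<in>lin V W. \<exists>v\<in>el (sub_functor X N) V. x = act (sub_functor X N) V W f v"
    using f hx v by (intro bexI[of _ f] bexI[of _ "act X W V h x"])
      (simp_all add: sub_functor_act[OF X N V W f] sub_functor_omap[OF X N V])
qed

lemma generated_quotient:
  assumes X: "X \<in> FO" and N: "subfun X N" and g: "generated X V"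
  shows "generated (quotient_functor K X N) V"
  unfolding generated_def
proof (intro conjI ballI)
  show V: "V \<in> VO" using g by (rule generated_VO)
  fix W p assume W: "W \<in> VO" and "p \<in> el (quotient_functor K X N) W"
  then obtain x where x: "x \<in> el X W" "p = coset (omap X W) (N W) x"
    by (auto simp: quotient_functor_carrier[OF X N])
  obtain f v where f: "f \<in> lin V W" and v: "v \<in> el X V" "x = act X V W f v"
    by (rule generatedD[OF g W x(1)])
  then show "\<exists>f\<in>lin V W. \<exists>v\<in>el (quotient_functor K X N) V. p = act (quotient_functor K X N) V W f v"
    using x by (intro bexI[of _ f] bexI[of _ "coset (omap X V) (N V) v"])
      (simp_all add: quotient_functor_act[OF X N V W f] quotient_functor_carrier[OF X N V])
qed

definition prod_inj :: "'u::grothendieck_universe set \<Rightarrow> ('u \<Rightarrow> ('k, 'u) vs) \<Rightarrow> 'u \<Rightarrow> 'u \<Rightarrow> 'u" where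
  "prod_inj I M i = (\<lambda>x\<in>carrier (M i). graph I (\<lambda>j. if j = i then x else \<zero>\<^bsub>M j\<^esub>))"

lemma prod_inj_lin:
  assumes I: "small I" and M: "\<And>i. i \<in> I \<Longrightarrow> M i \<in> VO" and i: "i \<in> I"
  shows "prod_inj I M i \<in> lin (M i) (prod_space I M)"
proof -
  let ?f = "\<lambda>j. if j = i then (\<lambda>x\<in>carrier (M i). x) else (\<lambda>x\<in>carrier (M i). \<zero>\<^bsub>M j\<^esub>)"
  have "(\<lambda>x\<in>carrier (M i). graph I (\<lambda>j. ?f j x)) \<in> lin (M i) (prod_space I M)"
    by (rule prod_tuple_lin[OF I M VO_module[OF M[OF i]]])
      (use i M in \<open>auto intro!: lin_id lin_null VO_module\<close>)
  also have "(\<lambda>x\<in>carrier (M i). graph I (\<lambda>j. ?f j x)) = prod_inj I M i"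
    unfolding prod_inj_def by (intro restrict_ext graph_cong) auto
  finally show ?thesis .
qed

lemma prod_inj_app:
  "small I \<Longrightarrow> x \<in> carrier (M i) \<Longrightarrow> j \<in> I \<Longrightarrow> graph_app (prod_inj I M i x) j = (if j = i then x else \<zero>\<^bsub>M j\<^esub>)"
  by (simp add: prod_inj_def graph_app_graph)

text \<open>If the coordinate of \<open>p\<close> at \<open>i\<close> is the image of
  \<open>v i\<close> under \<open>f i\<close>, let \<open>F\<close> be the sum of the maps
  \<open>f i\<close> after the projections, and let \<open>?q\<close> have as coordinate at
  \<open>i\<close> the image of \<open>v i\<close> under the inclusion of \<open>V i\<close>. Since
  \<open>F\<close> after the inclusion of \<open>V i\<close> is \<open>f i\<close>, it carries
  \<open>?q\<close> to \<open>p\<close>. The sum makes sense because there are only two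
  factors.\<close>

lemma generated_prod:
  fixes X :: "'u::grothendieck_universe \<Rightarrow> ('k, 'u) vfunctor"
  assumes ab: "a \<noteq> b" and X: "\<And>i. i \<in> {a, b} \<Longrightarrow> X i \<in> FO"
    and g: "\<And>i. i \<in> {a, b} \<Longrightarrow> generated (X i) (V i)"
  shows "generated (prod_functor {a, b} X) (prod_space {a, b} V)"
  unfolding generated_def
proof (intro conjI ballI)
  let ?I = "{a, b}" and ?V = "prod_space {a, b} V" and ?X = "prod_functor {a, b} X"
  have I: "small ?I" by (rule small_pair)
  have Vi: "\<And>i. i \<in> ?I \<Longrightarrow> V i \<in> VO" using g generated_VO by blast
  show V: "?V \<in> VO" by (rule prod_VO[OF I Vi])
  note PX = prod_functor_FO[of ?I X, OF I X]
  fix W p assume W: "W \<in> VO" and p: "p \<in> el ?X W"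
  have p': "p \<in> carrier (prod_space ?I (\<lambda>i. omap (X i) W))"
    using p prod_functor_omap[of ?I X, OF I X W] by simp
  have "\<exists>f v. f \<in> lin (V i) W \<and> v \<in> el (X i) (V i) \<and> graph_app p i = act (X i) (V i) W f v"
    if i: "i \<in> ?I" for i
    by (rule generatedD[OF g[OF i] W prod_app[OF I p' i]]) blast
  then obtain f v where f: "\<And>i. i \<in> ?I \<Longrightarrow> f i \<in> lin (V i) W"
    and v: "\<And>i. i \<in> ?I \<Longrightarrow> v i \<in> el (X i) (V i)"
      "\<And>i. i \<in> ?I \<Longrightarrow> graph_app p i = act (X i) (V i) W (f i) (v i)" by metis
  interpret W: module K W by (rule VO_module[OF W])
  have pr: "(\<lambda>q\<in>carrier ?V. graph_app q i) \<in> lin ?V (V i)" if "i \<in> ?I" for i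
    by (rule prod_proj_lin[OF I Vi that])
  have fp: "compose (carrier ?V) (f i) (\<lambda>q\<in>carrier ?V. graph_app q i) \<in> lin ?V W" if "i \<in> ?I" for i
    by (rule lin_compose[OF pr[OF that] f[OF that] VO_module[OF V]])
  let ?F = "\<lambda>q\<in>carrier ?V. compose (carrier ?V) (f a) (\<lambda>q\<in>carrier ?V. graph_app q a) q \<oplus>\<^bsub>W\<^esub>
    compose (carrier ?V) (f b) (\<lambda>q\<in>carrier ?V. graph_app q b) q"
  have F: "?F \<in> lin ?V W"
    by (rule lin_sum[OF fp fp VO_module[OF V] VO_module[OF W]]) simp_all
  have inj: "prod_inj ?I V i \<in> lin (V i) ?V" if "i \<in> ?I" for i
    by (rule prod_inj_lin[OF I Vi that])
  have Fi: "compose (carrier (V i)) ?F (prod_inj ?I V i) = f i" if i: "i \<in> ?I" for i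
  proof (rule extensionalityI[of _ "carrier (V i)"])
    fix x assume x: "x \<in> carrier (V i)"
    have z: "f j \<zero>\<^bsub>V j\<^esub> = \<zero>\<^bsub>W\<^esub>" if "j \<in> ?I" for j
      by (rule lin_zero[OF f[OF that] VO_module[OF Vi[OF that]] VO_module[OF W]])
    have c: "f i x \<in> carrier W" by (rule lin_closed[OF f[OF i] x])
    show "compose (carrier (V i)) ?F (prod_inj ?I V i) x = f i x"
      using i ab x c z[of a] z[of b] lin_closed[OF inj[OF i] x]
      by (auto simp: compose_eq prod_inj_app[OF small_pair])
  qed (auto simp: lin_ext[OF f[OF i]])
  let ?q = "graph ?I (\<lambda>i. act (X i) (V i) ?V (prod_inj ?I V i) (v i))"
  have q: "?q \<in> el ?X ?V"
  proof -
    have "?q \<in> carrier (prod_space ?I (\<lambda>i. omap (X i) ?V))"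
      by (rule graph_prodI) (rule F_closed[OF X Vi V inj v(1)])
    then show ?thesis using prod_functor_omap[of ?I X, OF I X V] by simp
  qed
  have "act ?X ?V W ?F ?q = p"
  proof (rule prod_space_eqI[OF I])
    show "act ?X ?V W ?F ?q \<in> carrier (prod_space ?I (\<lambda>i. omap (X i) W))"
      using F_closed[OF PX V W F q] prod_functor_omap[of ?I X, OF I X W] by simp
    fix i assume i: "i \<in> ?I"
    have "graph_app (act ?X ?V W ?F ?q) i = act (X i) ?V W ?F (graph_app ?q i)"
      by (rule prod_functor_act[OF I X V W F q i])
    also have "\<dots> = act (X i) (V i) W (compose (carrier (V i)) ?F (prod_inj ?I V i)) (v i)"
      using i F_comp[OF X[OF i] Vi[OF i] V inj[OF i] W F v(1)[OF i]] by (simp only: graph_app_graph[OF I])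
    finally show "graph_app (act ?X ?V W ?F ?q) i = graph_app p i"
      using i by (simp only: Fi v(2))
  qed (rule p')
  then show "\<exists>f\<in>lin ?V W. \<exists>v\<in>el ?X ?V. p = act ?X ?V W f v"
    using F q by blast
qed

subsection \<open>Small functors are generated at one vector space\<close>

lemma sub_arrow:
  fixes X :: "('k, 'u::grothendieck_universe) vfunctor"
  assumes X: "X \<in> FO" and N: "subfun X N"
  shows "mknat (sub_functor X N) X (\<lambda>V x. x) \<in> mor (sub_functor X N) X"
proof (rule mknat_Hom[OF sub_functor_FO[OF X N] X])
  fix V :: "('k, 'u) vs" assume V: "V \<in> VO"
  show "(\<lambda>x\<in>el (sub_functor X N) V. x) \<in> lin (omap (sub_functor X N) V) (omap X V)"
    using lin_incl[OF F_module[OF X V] subfun_submod[OF X N V]] by (simp add: sub_functor_omap[OF X N V])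
qed (simp add: sub_functor_act[OF X N] sub_functor_omap[OF X N])

lemma lift_sub:
  fixes X :: "('k, 'u::grothendieck_universe) vfunctor"
  assumes N: "subfun X N" and t: "t \<in> mor Z X"
    and im: "\<And>V z. V \<in> VO \<Longrightarrow> z \<in> el Z V \<Longrightarrow> cmp t V z \<in> N V"
  shows "mknat Z (sub_functor X N) (cmp t) \<in> mor Z (sub_functor X N)"
proof -
  note Z = Hom_dom[OF t] and X = Hom_cod[OF t]
  show ?thesis
  proof (rule mknat_Hom[OF Z sub_functor_FO[OF X N]])
    fix V :: "('k, 'u) vs" assume V: "V \<in> VO"
    show "(\<lambda>x\<in>el Z V. cmp t V x) \<in> lin (omap Z V) (omap (sub_functor X N) V)"
      by (rule linI_restrict[OF F_module[OF Z V]])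
        (simp_all add: sub_functor_omap[OF X N V] im[OF V] lin_plus[OF cmp_lin[OF t V]] lin_scale[OF cmp_lin[OF t V]])
  qed (simp add: sub_functor_act[OF X N] cmp_natural[OF t] im)
qed

lemma poset_category_simps [simp]:
  "Obj (poset_category I r) = I" "Arr (poset_category I r) = r"
  "Dom (poset_category I r) = fst" "Cod (poset_category I r) = snd"
  "Ident (poset_category I r) i = (i, i)" "Comp (poset_category I r) g f = (fst f, snd g)"
  by (simp_all add: poset_category_def)

text \<open>The subfunctor of the elements that come from the diagram receives the cocone, so the identity
  of the colimit factors through it.\<close>

lemma directed_colimit_covers:
  fixes X :: "('k, 'u::grothendieck_universe) vfunctor"
  assumes dir: "directed_poset I r" and D: "is_functor (poset_category I r) (Vect_Vect K) D"
    and col: "is_colimit (poset_category I r) (Vect_Vect K) D X \<gamma>"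
    and W: "W \<in> VO" and x: "x \<in> el X W"
  shows "\<exists>i\<in>I. \<exists>p\<in>el (omap D i) W. x = cmp (\<gamma> i) W p"
proof -
  have X: "X \<in> FO" and \<gamma>: "\<And>i. i \<in> I \<Longrightarrow> \<gamma> i \<in> mor (omap D i) X"
    and \<gamma>c: "\<And>i j. (i, j) \<in> r \<Longrightarrow> Comp (Vect_Vect K) (\<gamma> j) (amap D (i, j)) = \<gamma> i"
    using col by (force simp: is_colimit_def is_cocone_def)+
  have univ: "\<And>y \<delta>. is_cocone (poset_category I r) (Vect_Vect K) D y \<delta> \<Longrightarrow>
      \<exists>!h. h \<in> mor X y \<and> (\<forall>j\<in>I. Comp (Vect_Vect K) h (\<gamma> j) = \<delta> j)"
    using col by (simp add: is_colimit_def)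
  have Dr: "amap D (i, j) \<in> mor (omap D i) (omap D j)" if "(i, j) \<in> r" for i j
    using D that by (force simp: is_functor_def)
  have rI: "i \<in> I" "j \<in> I" if "(i, j) \<in> r" for i j using dir that by (auto simp: directed_poset_def)
  have DF: "omap D i \<in> FO" if "i \<in> I" for i by (rule Hom_dom[OF \<gamma>[OF that]])
  define N where "N W = {x. \<exists>i\<in>I. \<exists>p\<in>el (omap D i) W. x = cmp (\<gamma> i) W p}" for W
  have up: "cmp (\<gamma> i) W p = cmp (\<gamma> j) W (cmp (amap D (i, j)) W p)"
    if "(i, j) \<in> r" "W \<in> VO" "p \<in> el (omap D i) W" for i j W p
    using cmp_Comp[OF Dr[OF that(1)] \<gamma>[OF rI(2)[OF that(1)]] that(2,3)] \<gamma>c[OF that(1)] by simp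
  have N: "subfun X N"
  proof (rule subfunI[OF X])
    fix V :: "('k, 'u) vs" assume V: "V \<in> VO"
    show "x \<in> el X V" if "x \<in> N V" for x
      using that cmp_closed[OF \<gamma> V] by (auto simp: N_def)
    obtain i where i: "i \<in> I" using dir by (auto simp: directed_poset_def)
    interpret DV: module K "omap (omap D i) V" by (rule F_module[OF DF[OF i] V])
    have "cmp (\<gamma> i) V \<zero>\<^bsub>omap (omap D i) V\<^esub> = \<zero>\<^bsub>omap X V\<^esub>"
      by (rule lin_zero[OF cmp_lin[OF \<gamma>[OF i] V] F_module[OF DF[OF i] V] F_module[OF X V]])
    then show "\<zero>\<^bsub>omap X V\<^esub> \<in> N V" using i DV.M.zero_closed unfolding N_def by force
    show "a \<odot>\<^bsub>omap X V\<^esub> x \<in> N V" if a: "a \<in> carrier K" and "x \<in> N V" for a x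
    proof -
      obtain i p where i: "i \<in> I" and p: "p \<in> el (omap D i) V" "x = cmp (\<gamma> i) V p"
        using \<open>x \<in> N V\<close> by (auto simp: N_def)
      interpret DV: module K "omap (omap D i) V" by (rule F_module[OF DF[OF i] V])
      have "a \<odot>\<^bsub>omap X V\<^esub> x = cmp (\<gamma> i) V (a \<odot>\<^bsub>omap (omap D i) V\<^esub> p)"
        using lin_scale[OF cmp_lin[OF \<gamma>[OF i] V] a p(1)] p(2) by simp
      then show ?thesis using i DV.smult_closed[OF a p(1)] unfolding N_def by blast
    qed
    show "x \<oplus>\<^bsub>omap X V\<^esub> y \<in> N V" if "x \<in> N V" and "y \<in> N V" for x y
    proof -
      obtain i p where i: "i \<in> I" and p: "p \<in> el (omap D i) V" "x = cmp (\<gamma> i) V p"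
        using \<open>x \<in> N V\<close> by (auto simp: N_def)
      obtain j q where j: "j \<in> I" and q: "q \<in> el (omap D j) V" "y = cmp (\<gamma> j) V q"
        using \<open>y \<in> N V\<close> by (auto simp: N_def)
      obtain k where k: "k \<in> I" "(i, k) \<in> r" "(j, k) \<in> r" using dir i j unfolding directed_poset_def by blast
      interpret DV: module K "omap (omap D k) V" by (rule F_module[OF DF[OF k(1)] V])
      let ?p = "cmp (amap D (i, k)) V p" and ?q = "cmp (amap D (j, k)) V q"
      have c: "?p \<in> el (omap D k) V" "?q \<in> el (omap D k) V"
        using cmp_closed[OF Dr[OF k(2)] V p(1)] cmp_closed[OF Dr[OF k(3)] V q(1)] .
      have "x \<oplus>\<^bsub>omap X V\<^esub> y = cmp (\<gamma> k) V (?p \<oplus>\<^bsub>omap (omap D k) V\<^esub> ?q)"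
        using lin_plus[OF cmp_lin[OF \<gamma>[OF k(1)] V] c] up[OF k(2) V p(1)] up[OF k(3) V q(1)] p(2) q(2) by simp
      then show ?thesis using k(1) DV.M.add.m_closed[OF c] unfolding N_def by blast
    qed
    show "act X V W f x \<in> N W" if W: "W \<in> VO" and f: "f \<in> lin V W" and "x \<in> N V" for W f x
    proof -
      obtain i p where i: "i \<in> I" and p: "p \<in> el (omap D i) V" "x = cmp (\<gamma> i) V p"
        using \<open>x \<in> N V\<close> by (auto simp: N_def)
      have "act X V W f x = cmp (\<gamma> i) W (act (omap D i) V W f p)"
        using cmp_natural[OF \<gamma>[OF i] V W f p(1)] p(2) by simp
      then show ?thesis using i F_closed[OF DF[OF i] V W f p(1)] unfolding N_def by blast
    qed
  qed
  let ?S = "sub_functor X N"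
  let ?\<delta> = "\<lambda>i. mknat (omap D i) ?S (cmp (\<gamma> i))"
  let ?inc = "mknat ?S X (\<lambda>V x. x)"
  note inc = sub_arrow[OF X N] and SF = sub_functor_FO[OF X N]
  have \<delta>: "?\<delta> i \<in> mor (omap D i) ?S" if "i \<in> I" for i
    by (rule lift_sub[OF N \<gamma>[OF that]]) (use that in \<open>auto simp: N_def\<close>)
  have "is_cocone (poset_category I r) (Vect_Vect K) D ?S ?\<delta>"
    unfolding is_cocone_def
  proof (intro conjI ballI)
    show "?\<delta> i \<in> mor (omap D i) ?S" if "i \<in> Obj (poset_category I r)" for i
      using that by (intro \<delta>) simp
    fix u assume "u \<in> Arr (poset_category I r)"
    then obtain i j where u: "u = (i, j)" and ij: "(i, j) \<in> r" by (cases u) auto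
    note Dij = Dr[OF ij] and i = rI(1)[OF ij] and j = rI(2)[OF ij]
    have "Comp (Vect_Vect K) (?\<delta> j) (amap D (i, j)) = ?\<delta> i"
      by (rule Hom_eqI[OF VV_comp_Hom[OF Dij \<delta>[OF j]] \<delta>[OF i]])
        (simp add: cmp_Comp[OF Dij \<delta>[OF j]] cmp_mknat cmp_closed[OF Dij] up[OF ij])
    then show "Comp (Vect_Vect K) (?\<delta> (Cod (poset_category I r) u)) (amap D u) = ?\<delta> (Dom (poset_category I r) u)"
      by (simp add: u)
  qed (rule SF)
  from univ[OF this] obtain h where h: "h \<in> mor X ?S"
    and h\<gamma>: "\<And>j. j \<in> I \<Longrightarrow> Comp (Vect_Vect K) h (\<gamma> j) = ?\<delta> j" by blast
  have "\<exists>!g. g \<in> mor X X \<and> (\<forall>j\<in>I. Comp (Vect_Vect K) g (\<gamma> j) = \<gamma> j)"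
    using col by (intro univ) (simp add: is_colimit_def)
  moreover have "Comp (Vect_Vect K) ?inc h \<in> mor X X" by (rule VV_comp_Hom[OF h inc])
  moreover have "Comp (Vect_Vect K) (Comp (Vect_Vect K) ?inc h) (\<gamma> j) = \<gamma> j" if j: "j \<in> I" for j
  proof (rule Hom_eqI[OF VV_comp_Hom[OF \<gamma>[OF j] VV_comp_Hom[OF h inc]] \<gamma>[OF j]])
    fix V :: "('k, 'u) vs" and p assume V: "V \<in> VO" and p: "p \<in> el (omap D j) V"
    have c: "cmp (\<gamma> j) V p \<in> el X V" by (rule cmp_closed[OF \<gamma>[OF j] V p])
    have "cmp h V (cmp (\<gamma> j) V p) = cmp (?\<delta> j) V p"
      using cmp_Comp[OF \<gamma>[OF j] h V p] h\<gamma>[OF j] by simp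
    then show "cmp (Comp (Vect_Vect K) (Comp (Vect_Vect K) ?inc h) (\<gamma> j)) V p = cmp (\<gamma> j) V p"
      using cmp_closed[OF h V c] cmp_closed[OF \<delta>[OF j] V p]
      by (simp add: cmp_Comp[OF \<gamma>[OF j] VV_comp_Hom[OF h inc] V p] cmp_Comp[OF h inc V c] cmp_mknat V p)
  qed
  moreover have "Comp (Vect_Vect K) (Ident (Vect_Vect K) X) (\<gamma> j) = \<gamma> j" if j: "j \<in> I" for j
    by (rule Hom_eqI[OF VV_comp_Hom[OF \<gamma>[OF j] VV_Ident_Hom[OF X]] \<gamma>[OF j]])
      (simp add: cmp_Comp[OF \<gamma>[OF j] VV_Ident_Hom[OF X]] cmp_Ident[OF X] cmp_closed[OF \<gamma>[OF j]])
  ultimately have "Comp (Vect_Vect K) ?inc h = Ident (Vect_Vect K) X"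
    using VV_Ident_Hom[OF X] by blast
  then have "x = cmp (Comp (Vect_Vect K) ?inc h) W x" by (simp add: cmp_Ident[OF X W x])
  also have "\<dots> = cmp h W x" using cmp_closed[OF h W x] by (simp add: cmp_Comp[OF h inc W x] cmp_mknat W)
  also have "\<dots> \<in> N W" using cmp_closed[OF h W x] by (simp add: sub_functor_omap[OF X N W])
  finally show ?thesis by (simp add: N_def)
qed

text \<open>Each vector of \<open>X\<close> comes from a stage \<open>Yoneda K (V i)\<close> and so
  is \<open>X f v\<close>, with \<open>v\<close> the image of the identity of \<open>V i\<close>. As
  the diagram is small, the product of all \<open>V i\<close> is a small space with every
  \<open>V i\<close> as a retract, and it generates for all stages at once.\<close>

lemma small_functor_generated:
  fixes X :: "('k, 'u::grothendieck_universe) vfunctor"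
  assumes "small_functor K X" shows "\<exists>V. generated X V"
proof -
  obtain I :: "'u set" and r D \<gamma> where I: "small I" and dir: "directed_poset I r"
    and D: "is_functor (poset_category I r) (Vect_Vect K) D"
    and rep: "\<forall>i\<in>I. \<exists>V\<in>VO. omap D i = Yoneda K V"
    and col: "is_colimit (poset_category I r) (Vect_Vect K) D X \<gamma>"
    using assms unfolding small_functor_def by blast
  obtain V where V: "\<And>i. i \<in> I \<Longrightarrow> V i \<in> VO" and DV: "\<And>i. i \<in> I \<Longrightarrow> omap D i = Yoneda K (V i)"
    using rep by metis
  have \<gamma>: "\<gamma> i \<in> mor (Yoneda K (V i)) X" if "i \<in> I" for i
    using col that by (simp add: is_colimit_def is_cocone_def DV)
  have X: "X \<in> FO" using col by (simp add: is_colimit_def is_cocone_def)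
  let ?V = "prod_space I V"
  have P: "?V \<in> VO" by (rule prod_VO[OF I V])
  have "\<exists>f\<in>lin ?V W. \<exists>v\<in>el X ?V. x = act X ?V W f v"
    if W: "W \<in> VO" and x: "x \<in> el X W" for W x
  proof -
    obtain i p where i: "i \<in> I" and "p \<in> el (omap D i) W" and xp: "x = cmp (\<gamma> i) W p"
      using directed_colimit_covers[OF dir D col W x] by blast
    then have p: "p \<in> carrier (hom_space K (V i) W)" by (simp add: DV Yoneda_omap[OF V[OF i] W])
    let ?f = "hom_fun (V i) p" and ?v = "cmp (\<gamma> i) (V i) (graph (carrier (V i)) (\<lambda>x\<in>carrier (V i). x))"
    have v: "?v \<in> el X (V i)"
      using gid[OF V[OF i]] by (intro cmp_closed[OF \<gamma>[OF i] V[OF i]]) (simp add: Yoneda_omap V i)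
    have f: "?f \<in> lin (V i) W" by (rule hom_fun_lin[OF VO_small[OF V[OF i]] p])
    have xe: "x = act X (V i) W ?f ?v" unfolding xp by (rule yoneda_at_id[OF V[OF i] \<gamma>[OF i] W p])
    note j = prod_inj_lin[OF I V i] and pr = prod_proj_lin[OF I V i]
    let ?g = "compose (carrier ?V) ?f (\<lambda>p\<in>carrier ?V. graph_app p i)"
    have g: "?g \<in> lin ?V W" by (rule lin_compose[OF pr f VO_module[OF P]])
    have "compose (carrier (V i)) ?g (prod_inj I V i) = ?f"
      by (rule extensionalityI[of _ "carrier (V i)"])
        (auto simp: compose_eq lin_ext[OF f] lin_closed[OF j] prod_inj_app[where M = V, OF I _ i])
    then have "x = act X ?V W ?g (act X (V i) ?V (prod_inj I V i) ?v)"
      using F_comp[OF X V[OF i] P j W g v] xe by simp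
    then show ?thesis using g F_closed[OF X V[OF i] P j v] by blast
  qed
  then have "generated X ?V" using P by (simp add: generated_def)
  then show ?thesis by blast
qed

subsection \<open>Directed colimits of representables\<close>

text \<open>The diagram is contravariant in the spaces: \<open>p i j\<close> goes from
  \<open>V j\<close> to \<open>V i\<close> and induces an arrow from \<open>Yoneda K (V i)\<close>
  to \<open>Yoneda K (V j)\<close>. The vectors \<open>e i\<close> are the cocone in Yoneda form.
  \<open>gen\<close> says that it is jointly surjective, and \<open>ker\<close> that whatever dies
  in \<open>X\<close> dies already at a later stage. This is the pointwise description of a directed
  colimit, from which the universal property in the functor category is derived.\<close>

lemma directed_union_small_functor:
  fixes X :: "('k, 'u::grothendieck_universe) vfunctor" and V :: "'u \<Rightarrow> ('k, 'u) vs"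
  assumes X: "X \<in> FO" and I: "small I" and dir: "directed_poset I r"
    and V: "\<And>i. i \<in> I \<Longrightarrow> V i \<in> VO"
    and p: "\<And>i j. (i, j) \<in> r \<Longrightarrow> p i j \<in> lin (V j) (V i)"
    and pid: "\<And>i. i \<in> I \<Longrightarrow> p i i = (\<lambda>x\<in>carrier (V i). x)"
    and pcomp: "\<And>i j k. (i, j) \<in> r \<Longrightarrow> (j, k) \<in> r \<Longrightarrow> p i k = compose (carrier (V k)) (p i j) (p j k)"
    and e: "\<And>i. i \<in> I \<Longrightarrow> e i \<in> el X (V i)"
    and pe: "\<And>i j. (i, j) \<in> r \<Longrightarrow> act X (V j) (V i) (p i j) (e j) = e i"
    and gen: "\<And>W x. W \<in> VO \<Longrightarrow> x \<in> el X W \<Longrightarrow>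
      \<exists>i\<in>I. \<exists>f\<in>lin (V i) W. x = act X (V i) W f (e i)"
    and ker: "\<And>i W f. i \<in> I \<Longrightarrow> W \<in> VO \<Longrightarrow> f \<in> lin (V i) W \<Longrightarrow>
      act X (V i) W f (e i) = \<zero>\<^bsub>omap X W\<^esub> \<Longrightarrow> \<exists>j. (i, j) \<in> r \<and> (\<forall>h\<in>carrier (V j). f (p i j h) = \<zero>\<^bsub>W\<^esub>)"
  shows "small_functor K X"
proof -
  have rI: "i \<in> I" "j \<in> I" if "(i, j) \<in> r" for i j using dir that by (auto simp: directed_poset_def)
  have rrefl: "(i, i) \<in> r" if "i \<in> I" for i
    using dir that by (auto simp: directed_poset_def partial_order_on_def preorder_on_def refl_on_def)
  have rtrans: "(i, k) \<in> r" if "(i, j) \<in> r" "(j, k) \<in> r" for i j k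
    using dir that by (auto simp: directed_poset_def partial_order_on_def preorder_on_def dest: transD)
  note sm = VO_small[OF V]
  let ?Y = "\<lambda>i. Yoneda K (V i)"
  have YF: "?Y i \<in> FO" if "i \<in> I" for i by (rule Yoneda_FO[OF V[OF that]])
  have Yo: "omap (?Y i) W = hom_space K (V i) W" if "i \<in> I" "W \<in> VO" for i W
    by (rule Yoneda_omap[OF V[OF that(1)] that(2)])
  have YC: "hom_fun (V i) q \<in> lin (V i) W" if "i \<in> I" "q \<in> carrier (hom_space K (V i) W)" for i q W
    by (rule hom_fun_lin[OF sm[OF that(1)] that(2)])
  have pY: "graph (carrier (V j)) (p i j) \<in> el (?Y j) (V i)" if "(i, j) \<in> r" for i j
    using graph_in_hom_space[OF p[OF that]] by (simp add: Yo rI[OF that] V)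
  \<comment> \<open>Precomposition with \<open>p i j\<close>, in Yoneda form.\<close>
  let ?D = "\<lambda>i j. yoneda_arrow (V i) (?Y j) (graph (carrier (V j)) (p i j))"
  have DH: "?D i j \<in> mor (?Y i) (?Y j)" if "(i, j) \<in> r" for i j
    by (rule yoneda_arrow_Hom[OF V YF pY[OF that]]) (use rI[OF that] in auto)
  have Dc: "cmp (?D i j) W q \<in> carrier (hom_space K (V j) W)"
    "hom_fun (V j) (cmp (?D i j) W q) = compose (carrier (V j)) (hom_fun (V i) q) (p i j)"
    if ij: "(i, j) \<in> r" and W: "W \<in> VO" and q: "q \<in> carrier (hom_space K (V i) W)" for i j W q
  proof -
    note i = rI(1)[OF ij] and j = rI(2)[OF ij]
    show "cmp (?D i j) W q \<in> carrier (hom_space K (V j) W)"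
      using cmp_closed[OF DH[OF ij] W] q by (simp add: Yo i j W)
    have "graph (carrier (V j)) (p i j) \<in> carrier (hom_space K (V j) (V i))"
      by (rule graph_in_hom_space[OF p[OF ij]])
    then show "hom_fun (V j) (cmp (?D i j) W q) = compose (carrier (V j)) (hom_fun (V i) q) (p i j)"
      by (simp add: cmp_yoneda_arrow[OF V[OF i] YF[OF j] pY[OF ij] W q]
          Yoneda_act[OF V[OF j] V[OF i] W YC[OF i q]] hom_fun_graph[OF sm[OF j] p[OF ij]])
  qed
  let ?DD = "\<lparr>omap = (\<lambda>i\<in>I. ?Y i), amap = (\<lambda>u\<in>r. ?D (fst u) (snd u))\<rparr>"
  have DD: "is_functor (poset_category I r) (Vect_Vect K) ?DD"
    unfolding is_functor_def
  proof (intro conjI ballI impI)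
    show "omap ?DD \<in> Obj (poset_category I r) \<rightarrow>\<^sub>E FO" using YF by auto
    show "amap ?DD \<in> extensional (Arr (poset_category I r))" by simp
    show "amap ?DD u \<in> mor (omap ?DD (Dom (poset_category I r) u)) (omap ?DD (Cod (poset_category I r) u))"
      if "u \<in> Arr (poset_category I r)" for u
      using that DH[of "fst u" "snd u"] rI[of "fst u" "snd u"] by simp
    show "amap ?DD (Ident (poset_category I r) i) = Ident (Vect_Vect K) (omap ?DD i)"
      if "i \<in> Obj (poset_category I r)" for i
    proof -
      have i: "i \<in> I" using that by simp
      have "?D i i = Ident (Vect_Vect K) (?Y i)"
      proof (rule Hom_eqI[OF DH[OF rrefl[OF i]] VV_Ident_Hom[OF YF[OF i]]])
        fix W :: "('k, 'u) vs" and q assume W: "W \<in> VO" and "q \<in> el (?Y i) W"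
        then have q: "q \<in> carrier (hom_space K (V i) W)" by (simp add: Yo i)
        have "compose (carrier (V i)) (hom_fun (V i) q) (\<lambda>x\<in>carrier (V i). x) = hom_fun (V i) q"
          by (auto simp: compose_def hom_fun_def)
        then have "cmp (?D i i) W q = q"
          by (intro hom_eqI[OF V[OF i] Dc(1)[OF rrefl[OF i] W q] q]) (simp add: Dc(2)[OF rrefl[OF i] W q, unfolded pid[OF i]] pid[OF i])
        then show "cmp (?D i i) W q = cmp (Ident (Vect_Vect K) (?Y i)) W q"
          using q by (simp add: cmp_Ident[OF YF[OF i] W] Yo i W)
      qed
      then show ?thesis using i rrefl[OF i] by simp
    qed
    show "amap ?DD (Comp (poset_category I r) v u) = Comp (Vect_Vect K) (amap ?DD v) (amap ?DD u)"
      if uv: "u \<in> Arr (poset_category I r)" "v \<in> Arr (poset_category I r)"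
        "Cod (poset_category I r) u = Dom (poset_category I r) v" for u v
    proof -
      obtain i j k where u: "u = (i, j)" "v = (j, k)" and ij: "(i, j) \<in> r" and jk: "(j, k) \<in> r"
        using uv by (cases u; cases v) auto
      note ik = rtrans[OF ij jk]
      have "?D i k = Comp (Vect_Vect K) (?D j k) (?D i j)"
      proof (rule Hom_eqI[OF DH[OF ik] VV_comp_Hom[OF DH[OF ij] DH[OF jk]]])
        fix W :: "('k, 'u) vs" and q assume W: "W \<in> VO" and q': "q \<in> el (?Y i) W"
        then have q: "q \<in> carrier (hom_space K (V i) W)" by (simp add: Yo rI[OF ij])
        have "compose (carrier (V k)) (hom_fun (V i) q) (p i k) =
            compose (carrier (V k)) (compose (carrier (V j)) (hom_fun (V i) q) (p i j)) (p j k)"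
          unfolding pcomp[OF ij jk]
          by (auto simp: compose_def lin_closed[OF p[OF jk]])
        then have "cmp (?D i k) W q = cmp (?D j k) W (cmp (?D i j) W q)"
          by (intro hom_eqI[OF V[OF rI(2)[OF jk]] Dc(1)[OF ik W q] Dc(1)[OF jk W Dc(1)[OF ij W q]]])
            (simp add: Dc(2)[OF ik W q] Dc(2)[OF jk W Dc(1)[OF ij W q]] Dc(2)[OF ij W q])
        then show "cmp (?D i k) W q = cmp (Comp (Vect_Vect K) (?D j k) (?D i j)) W q"
          by (simp add: cmp_Comp[OF DH[OF ij] DH[OF jk] W q'])
      qed
      then show ?thesis using ij jk ik by (simp add: u)
    qed
  qed
  let ?\<gamma> = "\<lambda>i. yoneda_arrow (V i) X (e i)"
  have \<gamma>H: "?\<gamma> i \<in> mor (?Y i) X" if "i \<in> I" for i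
    by (rule yoneda_arrow_Hom[OF V[OF that] X e[OF that]])
  have \<gamma>c: "cmp (?\<gamma> i) W q = act X (V i) W (hom_fun (V i) q) (e i)"
    if "i \<in> I" "W \<in> VO" "q \<in> carrier (hom_space K (V i) W)" for i W q
    by (rule cmp_yoneda_arrow[OF V[OF that(1)] X e[OF that(1)] that(2,3)])
  have "is_colimit (poset_category I r) (Vect_Vect K) ?DD X ?\<gamma>"
    unfolding is_colimit_def
  proof (intro conjI allI impI)
    show "is_cocone (poset_category I r) (Vect_Vect K) ?DD X ?\<gamma>"
      unfolding is_cocone_def
    proof (intro conjI ballI)
      show "?\<gamma> i \<in> mor (omap ?DD i) X" if "i \<in> Obj (poset_category I r)" for i
        using that \<gamma>H by simp
      fix u assume "u \<in> Arr (poset_category I r)"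
      then obtain i j where u: "u = (i, j)" and ij: "(i, j) \<in> r" by (cases u) auto
      note i = rI(1)[OF ij] and j = rI(2)[OF ij]
      have "Comp (Vect_Vect K) (?\<gamma> j) (?D i j) = ?\<gamma> i"
      proof (rule Hom_eqI[OF VV_comp_Hom[OF DH[OF ij] \<gamma>H[OF j]] \<gamma>H[OF i]])
        fix W :: "('k, 'u) vs" and q assume W: "W \<in> VO" and q': "q \<in> el (?Y i) W"
        then have q: "q \<in> carrier (hom_space K (V i) W)" by (simp add: Yo i)
        show "cmp (Comp (Vect_Vect K) (?\<gamma> j) (?D i j)) W q = cmp (?\<gamma> i) W q"
          by (simp add: cmp_Comp[OF DH[OF ij] \<gamma>H[OF j] W q'] \<gamma>c[OF j W Dc(1)[OF ij W q]] \<gamma>c[OF i W q] Dc(2)[OF ij W q]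
              F_comp[OF X V[OF j] V[OF i] p[OF ij] W YC[OF i q] e[OF j]] pe[OF ij])
      qed
      then show "Comp (Vect_Vect K) (?\<gamma> (Cod (poset_category I r) u)) (amap ?DD u) = ?\<gamma> (Dom (poset_category I r) u)"
        using ij by (simp add: u)
    qed (rule X)
    fix Z \<delta> assume co: "is_cocone (poset_category I r) (Vect_Vect K) ?DD Z \<delta>"
    have Z: "Z \<in> FO" using co by (simp add: is_cocone_def)
    have \<delta>: "\<delta> i \<in> mor (?Y i) Z" if "i \<in> I" for i
      using co that by (simp add: is_cocone_def)
    have \<delta>D: "Comp (Vect_Vect K) (\<delta> j) (?D i j) = \<delta> i" if "(i, j) \<in> r" for i j
      using co that by (force simp: is_cocone_def)
    \<comment> \<open>By Yoneda the competing cocone is a family of vectors \<open>z i\<close> of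
      \<open>Z (V i)\<close> compatible along \<open>p\<close>. The mediating arrow must send
      \<open>X f (e i)\<close> to \<open>Z f (z i)\<close>, which is the relation \<open>?R\<close>
      below.\<close>
    define z where "z i = cmp (\<delta> i) (V i) (graph (carrier (V i)) (\<lambda>x\<in>carrier (V i). x))" for i
    note gidY = gid[OF V]
    have z: "z i \<in> el Z (V i)" if "i \<in> I" for i
      unfolding z_def using gidY[OF that] by (intro cmp_closed[OF \<delta>[OF that] V[OF that]]) (simp add: Yo that V)
    have \<delta>z: "cmp (\<delta> i) W q = act Z (V i) W (hom_fun (V i) q) (z i)"
      if "i \<in> I" "W \<in> VO" "q \<in> carrier (hom_space K (V i) W)" for i W q
      unfolding z_def by (rule yoneda_at_id[OF V[OF that(1)] \<delta>[OF that(1)] that(2,3)])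
    have pz: "act Z (V j) (V i) (p i j) (z j) = z i" if ij: "(i, j) \<in> r" for i j
    proof -
      note i = rI(1)[OF ij] and j = rI(2)[OF ij]
      let ?g = "graph (carrier (V i)) (\<lambda>x\<in>carrier (V i). x)"
      have "compose (carrier (V j)) (hom_fun (V i) ?g) (p i j) = p i j"
        by (rule extensionalityI[of _ "carrier (V j)"])
          (auto simp: compose_eq lin_ext[OF p[OF ij]] lin_closed[OF p[OF ij]]
            hom_fun_graph[OF sm[OF i] lin_id[OF VO_module[OF V[OF i]]]])
      then have "hom_fun (V j) (cmp (?D i j) (V i) ?g) = p i j"
        using Dc(2)[OF ij V[OF i] gidY[OF i]] by simp
      moreover have "z i = cmp (\<delta> j) (V i) (cmp (?D i j) (V i) ?g)"
        unfolding z_def using cmp_Comp[OF DH[OF ij] \<delta>[OF j] V[OF i], of ?g] gidY[OF i]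
        by (simp add: \<delta>D[OF ij] Yo i V)
      ultimately show ?thesis
        using \<delta>z[OF j V[OF i] Dc(1)[OF ij V[OF i] gidY[OF i]]] by simp
    qed
    let ?R = "\<lambda>W x y. \<exists>i\<in>I. \<exists>f\<in>lin (V i) W. x = act X (V i) W f (e i) \<and> y = act Z (V i) W f (z i)"
    \<comment> \<open>A pair in the relation moves to a later stage by precomposition with
      \<open>p i k\<close>; directedness then brings two pairs to a common stage, where they can be
      added.\<close>
    have Rup: "\<exists>g\<in>lin (V k) W. act X (V i) W f (e i) = act X (V k) W g (e k) \<and>
        act Z (V i) W f (z i) = act Z (V k) W g (z k)"
      if ik: "(i, k) \<in> r" and W: "W \<in> VO" and f: "f \<in> lin (V i) W" for i k W f
    proof -
      note i = rI(1)[OF ik] and k = rI(2)[OF ik]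
      have "compose (carrier (V k)) f (p i k) \<in> lin (V k) W"
        by (rule lin_compose[OF p[OF ik] f VO_module[OF V[OF k]]])
      moreover have "act X (V i) W f (e i) = act X (V k) W (compose (carrier (V k)) f (p i k)) (e k)"
        using F_comp[OF X V[OF k] V[OF i] p[OF ik] W f e[OF k]] pe[OF ik] by simp
      moreover have "act Z (V i) W f (z i) = act Z (V k) W (compose (carrier (V k)) f (p i k)) (z k)"
        using F_comp[OF Z V[OF k] V[OF i] p[OF ik] W f z[OF k]] pz[OF ik] by simp
      ultimately show ?thesis by blast
    qed
    obtain h where h: "h \<in> mor X Z"
      and hR: "\<And>W x y. W \<in> VO \<Longrightarrow> x \<in> el X W \<Longrightarrow> ?R W x y \<longleftrightarrow> y = cmp h W x"
    proof (rule hom_of_relation[OF X Z, where R = ?R])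
      fix W :: "('k, 'u) vs" assume W: "W \<in> VO"
      show "x \<in> el X W \<and> y \<in> el Z W" if "?R W x y" for x y
        using that F_closed[OF X V W _ e] F_closed[OF Z V W _ z] by blast
      show "\<exists>y. ?R W x y" if "x \<in> el X W" for x
        using gen[OF W that] by blast
      show "?R W (x \<oplus>\<^bsub>omap X W\<^esub> x') (y \<oplus>\<^bsub>omap Z W\<^esub> y')" if R: "?R W x y" "?R W x' y'" for x y x' y'
      proof -
        obtain i f where i: "i \<in> I" and f: "f \<in> lin (V i) W"
          and xy: "x = act X (V i) W f (e i)" "y = act Z (V i) W f (z i)" using R(1) by blast
        obtain j g where j: "j \<in> I" and g: "g \<in> lin (V j) W"
          and xy': "x' = act X (V j) W g (e j)" "y' = act Z (V j) W g (z j)" using R(2) by blast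
        obtain k where k: "k \<in> I" "(i, k) \<in> r" "(j, k) \<in> r" using dir i j unfolding directed_poset_def by blast
        obtain f' where f': "f' \<in> lin (V k) W" "x = act X (V k) W f' (e k)" "y = act Z (V k) W f' (z k)"
          using Rup[OF k(2) W f] xy by auto
        obtain g' where g': "g' \<in> lin (V k) W" "x' = act X (V k) W g' (e k)" "y' = act Z (V k) W g' (z k)"
          using Rup[OF k(3) W g] xy' by auto
        let ?f = "\<lambda>x\<in>carrier (V k). f' x \<oplus>\<^bsub>W\<^esub> g' x"
        have "?f \<in> lin (V k) W" by (rule lin_sum[OF f'(1) g'(1) VO_module[OF V[OF k(1)]] VO_module[OF W]])
        moreover have "x \<oplus>\<^bsub>omap X W\<^esub> x' = act X (V k) W ?f (e k)" "y \<oplus>\<^bsub>omap Z W\<^esub> y' = act Z (V k) W ?f (z k)"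
          using F_add_map[OF X V[OF k(1)] W f'(1) g'(1) e[OF k(1)]] F_add_map[OF Z V[OF k(1)] W f'(1) g'(1) z[OF k(1)]]
            f' g' by simp_all
        ultimately show ?thesis using k(1) by blast
      qed
      show "?R W (a \<odot>\<^bsub>omap X W\<^esub> x) (a \<odot>\<^bsub>omap Z W\<^esub> y)" if R: "?R W x y" and a: "a \<in> carrier K" for x y a
      proof -
        obtain i f where i: "i \<in> I" and f: "f \<in> lin (V i) W"
          and xy: "x = act X (V i) W f (e i)" "y = act Z (V i) W f (z i)" using R by blast
        have "(\<lambda>x\<in>carrier (V i). a \<odot>\<^bsub>W\<^esub> f x) \<in> lin (V i) W"
          by (rule lin_smultiple[OF f a VO_module[OF V[OF i]] VO_module[OF W]])
        moreover note F_smult_map[OF X V[OF i] W f a e[OF i], symmetric] F_smult_map[OF Z V[OF i] W f a z[OF i], symmetric]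
        ultimately show ?thesis using i xy by blast
      qed
      show "?R W' (act X W W' g x) (act Z W W' g y)"
        if W': "W' \<in> VO" and g: "g \<in> lin W W'" and R: "?R W x y" for W' g x y
      proof -
        obtain i f where i: "i \<in> I" and f: "f \<in> lin (V i) W"
          and xy: "x = act X (V i) W f (e i)" "y = act Z (V i) W f (z i)" using R by blast
        have "compose (carrier (V i)) g f \<in> lin (V i) W'"
          by (rule lin_compose[OF f g VO_module[OF V[OF i]]])
        moreover note F_comp[OF X V[OF i] W f W' g e[OF i], symmetric] F_comp[OF Z V[OF i] W f W' g z[OF i], symmetric]
        ultimately show ?thesis using i xy by blast
      qed
      show "y = \<zero>\<^bsub>omap Z W\<^esub>" if R: "?R W \<zero>\<^bsub>omap X W\<^esub> y" for y
      proof -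
        obtain i f where i: "i \<in> I" and f: "f \<in> lin (V i) W"
          and xy: "\<zero>\<^bsub>omap X W\<^esub> = act X (V i) W f (e i)" "y = act Z (V i) W f (z i)" using R by blast
        \<comment> \<open>If \<open>X f (e i)\<close> is zero, then \<open>f\<close> after
          \<open>p i j\<close> is the zero map for some later \<open>j\<close>. As
          \<open>z i\<close> is the image of \<open>z j\<close> under \<open>p i j\<close>, the
          value in \<open>Z\<close> is zero too.\<close>
        obtain j where ij: "(i, j) \<in> r" and fp: "\<And>h. h \<in> carrier (V j) \<Longrightarrow> f (p i j h) = \<zero>\<^bsub>W\<^esub>"
          using ker[OF i W f xy(1)[symmetric]] by blast
        note j = rI(2)[OF ij]
        have "compose (carrier (V j)) f (p i j) = (\<lambda>x\<in>carrier (V j). \<zero>\<^bsub>W\<^esub>)"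
          using fp by (auto simp: compose_def)
        then show ?thesis
          using F_comp[OF Z V[OF j] V[OF i] p[OF ij] W f z[OF j]] F_null_map[OF Z V[OF j] W z[OF j]] xy pz[OF ij] by simp
      qed
    qed blast
    have h\<gamma>: "Comp (Vect_Vect K) h (?\<gamma> i) = \<delta> i" if i: "i \<in> I" for i
    proof (rule Hom_eqI[OF VV_comp_Hom[OF \<gamma>H[OF i] h] \<delta>[OF i]])
      fix W :: "('k, 'u) vs" and q assume W: "W \<in> VO" and q': "q \<in> el (?Y i) W"
      then have q: "q \<in> carrier (hom_space K (V i) W)" by (simp add: Yo i)
      have "?R W (cmp (?\<gamma> i) W q) (cmp (\<delta> i) W q)"
        using i YC[OF i q] \<gamma>c[OF i W q] \<delta>z[OF i W q] by blast
      then show "cmp (Comp (Vect_Vect K) h (?\<gamma> i)) W q = cmp (\<delta> i) W q"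
        using hR[OF W cmp_closed[OF \<gamma>H[OF i] W q']] by (simp add: cmp_Comp[OF \<gamma>H[OF i] h W q'])
    qed
    show "\<exists>!h. h \<in> mor X Z \<and> (\<forall>j\<in>Obj (poset_category I r). Comp (Vect_Vect K) h (?\<gamma> j) = \<delta> j)"
    proof (rule ex1I[of _ h])
      show "h \<in> mor X Z \<and> (\<forall>j\<in>Obj (poset_category I r). Comp (Vect_Vect K) h (?\<gamma> j) = \<delta> j)"
        using h h\<gamma> by simp
      fix h' assume h': "h' \<in> mor X Z \<and> (\<forall>j\<in>Obj (poset_category I r). Comp (Vect_Vect K) h' (?\<gamma> j) = \<delta> j)"
      show "h' = h"
      proof (rule Hom_eqI[OF conjunct1[OF h'] h])
        fix W :: "('k, 'u) vs" and x assume W: "W \<in> VO" and x: "x \<in> el X W"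
        obtain i f where i: "i \<in> I" and f: "f \<in> lin (V i) W" and xf: "x = act X (V i) W f (e i)"
          using gen[OF W x] by blast
        let ?q = "graph (carrier (V i)) f"
        have q: "?q \<in> el (?Y i) W" using graph_in_hom_space[OF f] by (simp add: Yo i W)
        have xq: "x = cmp (?\<gamma> i) W ?q"
          using cmp_yoneda_arrow_graph[OF V[OF i] X e[OF i] W f] xf by simp
        have "Comp (Vect_Vect K) h' (?\<gamma> i) = Comp (Vect_Vect K) h (?\<gamma> i)" using h' h\<gamma> i by simp
        then show "cmp h' W x = cmp h W x"
          unfolding xq using cmp_Comp[OF \<gamma>H[OF i] conjunct1[OF h'] W q] cmp_Comp[OF \<gamma>H[OF i] h W q] by simp
      qed
    qed
  qed
  then show ?thesis
    unfolding small_functor_def using I dir DD V by (intro exI[of _ I] exI[of _ r] exI[of _ ?DD] exI[of _ ?\<gamma>]) auto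
qed

section \<open>Supporting subspaces of the vectors of an additive functor\<close>

lemma retraction:
  assumes U: "module K U" and H: "submodule H K U"
  shows "\<exists>k\<in>lin U (U\<lparr>carrier := H\<rparr>). \<forall>h\<in>H. k h = h"
proof -
  \<comment> \<open>A pseudo-inverse of the inclusion is a left inverse, the inclusion being
    injective.\<close>
  obtain k where k: "k \<in> lin U (U\<lparr>carrier := H\<rparr>)"
    "\<And>x. x \<in> carrier (U\<lparr>carrier := H\<rparr>) \<Longrightarrow> (\<lambda>x\<in>H. x) (k ((\<lambda>x\<in>H. x) x)) = (\<lambda>x\<in>H. x) x"
    by (rule pseudo_inverse[OF lin_incl[OF U H] submod_module[OF H U] U]) blast
  have "k h = h" if "h \<in> H" for h
    using k(2)[of h] lin_closed[OF k(1), of h] submodD(1)[OF H U] that by auto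
  then show ?thesis using k(1) by blast
qed

text \<open>An additive functor on vector spaces is exact, hence preserves monomorphisms; \<open>supp X U x H\<close>
  says that \<open>x\<close> lies in the subspace \<open>X H\<close> of \<open>X U\<close>.\<close>

definition supp :: "('k, 'u::grothendieck_universe) vfunctor \<Rightarrow> ('k, 'u) vs \<Rightarrow> 'u \<Rightarrow> 'u set \<Rightarrow> bool" where
  "supp X U x H \<longleftrightarrow> submodule H K U \<and>
     (\<exists>y\<in>el X (U\<lparr>carrier := H\<rparr>). act X (U\<lparr>carrier := H\<rparr>) U (\<lambda>x\<in>H. x) y = x)"

context
  fixes X :: "('k, 'u::grothendieck_universe) vfunctor" and U :: "('k, 'u) vs"
  assumes X: "X \<in> FO" and U: "U \<in> VO"
begin

text \<open>\<open>X\<close> carries a retraction of \<open>U\<close> onto \<open>H\<close> to a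
  left inverse of the map in question.\<close>

lemma act_incl_inj:
  assumes H: "submodule H K U" and y: "y \<in> el X (U\<lparr>carrier := H\<rparr>)"
    and y': "y' \<in> el X (U\<lparr>carrier := H\<rparr>)"
    and eq: "act X (U\<lparr>carrier := H\<rparr>) U (\<lambda>x\<in>H. x) y = act X (U\<lparr>carrier := H\<rparr>) U (\<lambda>x\<in>H. x) y'"
  shows "y = y'"
proof -
  let ?H = "U\<lparr>carrier := H\<rparr>"
  have HV: "?H \<in> VO" by (rule sub_VO[OF U H])
  have incl: "(\<lambda>x\<in>H. x) \<in> lin ?H U" by (rule lin_incl[OF VO_module[OF U] H])
  obtain k where k: "k \<in> lin U ?H" "\<And>h. h \<in> H \<Longrightarrow> k h = h"
    using retraction[OF VO_module[OF U] H] by blast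
  have "compose (carrier ?H) k (\<lambda>x\<in>H. x) = (\<lambda>x\<in>carrier ?H. x)" by (auto simp: compose_def k(2))
  then have "act X U ?H k (act X ?H U (\<lambda>x\<in>H. x) z) = z" if "z \<in> el X ?H" for z
    using F_comp[OF X HV U incl HV k(1) that] F_id[OF X HV that] by simp
  from this[OF y] this[OF y'] eq show ?thesis by metis
qed

text \<open>\<open>q\<close> factors through \<open>H\<close>, so \<open>x = X q x\<close> is the
  image of a vector of \<open>X H\<close>.\<close>

lemma supp_range:
  assumes H: "submodule H K U" and q: "q \<in> lin U U" and qH: "\<And>x. x \<in> carrier U \<Longrightarrow> q x \<in> H"
    and x: "x \<in> el X U" and qx: "act X U U q x = x"
  shows "supp X U x H"
proof -
  let ?H = "U\<lparr>carrier := H\<rparr>"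
  have HV: "?H \<in> VO" by (rule sub_VO[OF U H])
  have incl: "(\<lambda>x\<in>H. x) \<in> lin ?H U" by (rule lin_incl[OF VO_module[OF U] H])
  have q': "q \<in> lin U ?H"
    by (rule linI) (simp_all add: lin_ext[OF q] qH lin_plus[OF q] lin_scale[OF q])
  have "compose (carrier U) (\<lambda>x\<in>H. x) q = q"
    by (rule extensionalityI[of _ "carrier U"]) (auto simp: compose_eq qH lin_ext[OF q])
  then have "act X ?H U (\<lambda>x\<in>H. x) (act X U ?H q x) = x"
    using F_comp[OF X U HV q' U incl x] qx by simp
  then show ?thesis unfolding supp_def using H F_closed[OF X U HV q' x] by blast
qed

lemma submod_trans:
  assumes "submodule H K U" "submodule G K (U\<lparr>carrier := H\<rparr>)" shows "submodule G K U"
  using submodD[OF assms(2) submod_module[OF assms(1) VO_module[OF U]]] submodD(1)[OF assms(1) VO_module[OF U]]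
  by (intro submodI VO_module U) auto

text \<open>Left exactness of \<open>X\<close>, read inside \<open>U\<close>. With
  \<open>f g f = f\<close>, the map that sends \<open>h\<close> to \<open>h - g (f h)\<close> takes
  values in the kernel of \<open>f\<close>, and because \<open>X f y\<close> is zero the action of
  this map on \<open>y\<close> is the same as that of the inclusion of \<open>H\<close>.\<close>

lemma supp_kernel:
  assumes H: "submodule H K U" and y: "y \<in> el X (U\<lparr>carrier := H\<rparr>)"
    and W: "W \<in> VO" and f: "f \<in> lin (U\<lparr>carrier := H\<rparr>) W"
    and fy: "act X (U\<lparr>carrier := H\<rparr>) W f y = \<zero>\<^bsub>omap X W\<^esub>"
  shows "supp X U (act X (U\<lparr>carrier := H\<rparr>) U (\<lambda>x\<in>H. x) y) {h \<in> H. f h = \<zero>\<^bsub>W\<^esub>}"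
proof -
  let ?H = "U\<lparr>carrier := H\<rparr>" and ?G = "{h \<in> H. f h = \<zero>\<^bsub>W\<^esub>}"
  have HV: "?H \<in> VO" by (rule sub_VO[OF U H])
  interpret H: module K ?H by (rule VO_module[OF HV])
  interpret U: module K U by (rule VO_module[OF U])
  interpret W: module K W by (rule VO_module[OF W])
  have HU: "\<And>h. h \<in> H \<Longrightarrow> h \<in> carrier U" using submodD(1)[OF H VO_module[OF U]] by auto
  have incl: "(\<lambda>x\<in>H. x) \<in> lin ?H U" by (rule lin_incl[OF VO_module[OF U] H])
  have "submodule ?G K ?H" using kernel_submod[OF f VO_module[OF HV] VO_module[OF W]] by simp
  then have G: "submodule ?G K U" by (rule submod_trans[OF H])
  let ?GV = "U\<lparr>carrier := ?G\<rparr>"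
  have GV: "?GV \<in> VO" by (rule sub_VO[OF U G])
  have inclG: "(\<lambda>x\<in>?G. x) \<in> lin ?GV U" by (rule lin_incl[OF VO_module[OF U] G])
  obtain g where g: "g \<in> lin W ?H" "\<And>x. x \<in> carrier ?H \<Longrightarrow> f (g (f x)) = f x"
    by (rule pseudo_inverse[OF f VO_module[OF HV] VO_module[OF W]]) blast
  have gf: "compose (carrier ?H) g f \<in> lin ?H ?H" by (rule lin_compose[OF f g(1) VO_module[OF HV]])
  have igf: "compose (carrier ?H) (\<lambda>x\<in>H. x) (compose (carrier ?H) g f) \<in> lin ?H U"
    by (rule lin_compose[OF gf incl VO_module[OF HV]])
  let ?q = "\<lambda>x\<in>carrier ?H. (\<lambda>x\<in>H. x) x \<ominus>\<^bsub>U\<^esub> compose (carrier ?H) (\<lambda>x\<in>H. x) (compose (carrier ?H) g f) x"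
  have q: "?q \<in> lin ?H U" by (rule lin_diff[OF incl igf VO_module[OF HV] VO_module[OF U]])
  have gfH: "g (f h) \<in> H" if "h \<in> H" for h
    using lin_closed[OF g(1) lin_closed[OF f]] that by simp
  have qe: "?q h = h \<ominus>\<^bsub>U\<^esub> g (f h)" if "h \<in> H" for h using that gfH[OF that] by (simp add: compose_eq)
  have qG: "?q h \<in> ?G" if h: "h \<in> H" for h
  proof -
    \<comment> \<open>Negatives are chosen inside the carrier, so subtraction in the subspace has to
      be compared with subtraction in \<open>U\<close>.\<close>
    have d: "h \<ominus>\<^bsub>U\<^esub> g (f h) = h \<ominus>\<^bsub>?H\<^esub> g (f h)"
    proof -
      have "(h \<ominus>\<^bsub>?H\<^esub> g (f h)) \<oplus>\<^bsub>?H\<^esub> g (f h) = h" using h gfH[OF h] by (intro H.M.minus_add_cancel) auto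
      then have "(h \<ominus>\<^bsub>?H\<^esub> g (f h)) \<oplus>\<^bsub>U\<^esub> g (f h) = h" by simp
      moreover have "(h \<ominus>\<^bsub>?H\<^esub> g (f h)) \<in> carrier U" using H.M.minus_closed[of h "g (f h)"] h gfH[OF h] HU by simp
      ultimately show ?thesis using U.M.add_minus_cancel[of "h \<ominus>\<^bsub>?H\<^esub> g (f h)" "g (f h)"] HU[OF gfH[OF h]] by simp
    qed
    have "f (h \<ominus>\<^bsub>?H\<^esub> g (f h)) = f h \<ominus>\<^bsub>W\<^esub> f (g (f h))"
      using h gfH[OF h] by (intro lin_minus[OF f VO_module[OF HV] VO_module[OF W]]) auto
    also have "\<dots> = \<zero>\<^bsub>W\<^esub>" using g(2)[of h] h lin_closed[OF f, of h] by (simp add: W.M.minus_self)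
    finally show ?thesis unfolding qe[OF h] d using H.M.minus_closed[of h "g (f h)"] h gfH[OF h] by simp
  qed
  have q': "?q \<in> lin ?H ?GV"
  proof (rule linI)
    show "?q \<in> extensional (carrier ?H)" by simp
    show "?q x \<in> carrier ?GV" if "x \<in> carrier ?H" for x using qG[of x] that by simp
    show "?q (x \<oplus>\<^bsub>?H\<^esub> y) = ?q x \<oplus>\<^bsub>?GV\<^esub> ?q y" if "x \<in> carrier ?H" "y \<in> carrier ?H" for x y
      using lin_plus[OF q that] by simp
    show "?q (a \<odot>\<^bsub>?H\<^esub> x) = a \<odot>\<^bsub>?GV\<^esub> ?q x" if "a \<in> carrier K" "x \<in> carrier ?H" for a x
      using lin_scale[OF q that] by simp
  qed
  have "compose (carrier ?H) (\<lambda>x\<in>?G. x) ?q = ?q"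
  proof (rule extensionalityI[of _ "carrier ?H"])
    fix h assume h: "h \<in> carrier ?H"
    then have "h \<in> H" by simp
    have "compose (carrier ?H) (\<lambda>x\<in>?G. x) ?q h = (\<lambda>x\<in>?G. x) (?q h)" by (rule compose_eq[OF h])
    also have "\<dots> = ?q h" by (rule restrict_apply'[OF qG[OF \<open>h \<in> H\<close>]])
    finally show "compose (carrier ?H) (\<lambda>x\<in>?G. x) ?q h = ?q h" .
  qed simp_all
  then have "act X ?GV U (\<lambda>x\<in>?G. x) (act X ?H ?GV ?q y) = act X ?H U ?q y"
    using F_comp[OF X HV GV q' U inclG y] by simp
  also have "\<dots> = act X ?H U (\<lambda>x\<in>H. x) y \<ominus>\<^bsub>omap X U\<^esub>
      act X ?H U (compose (carrier ?H) (\<lambda>x\<in>H. x) (compose (carrier ?H) g f)) y"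
    by (rule F_diff_map[OF X HV U incl igf y])
  also have "act X ?H U (compose (carrier ?H) (\<lambda>x\<in>H. x) (compose (carrier ?H) g f)) y = \<zero>\<^bsub>omap X U\<^esub>"
    using F_comp[OF X HV HV gf U incl y] F_comp[OF X HV W f HV g(1) y]
      lin_zero[OF F_lin[OF X W HV g(1)] F_module[OF X W] F_module[OF X HV]]
      lin_zero[OF F_lin[OF X HV U incl] F_module[OF X HV] F_module[OF X U]] by (simp add: fy)
  also have "act X ?H U (\<lambda>x\<in>H. x) y \<ominus>\<^bsub>omap X U\<^esub> \<zero>\<^bsub>omap X U\<^esub> = act X ?H U (\<lambda>x\<in>H. x) y"
  proof -
    interpret XU: module K "omap X U" by (rule F_module[OF X U])
    show ?thesis by (rule XU.M.minus_zero_right) (rule F_closed[OF X HV U incl y])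
  qed
  finally show ?thesis unfolding supp_def using G F_closed[OF X HV GV q' y] by blast
qed

text \<open>Let \<open>k\<close> be a retraction of \<open>U\<close> onto \<open>H\<close>. On
  \<open>H'\<close> the map \<open>g - k g\<close> vanishes exactly at the \<open>h\<close> with
  \<open>g h \<in> H\<close>, and \<open>X\<close> of it kills the vector of \<open>X H'\<close>
  that represents \<open>x'\<close>, since \<open>X k\<close> fixes \<open>x = X g x'\<close>. So
  \<open>supp_kernel\<close> applies. Upper bounds in the index poset of the colimit are built in
  this way.\<close>

lemma supp_preimage:
  assumes x: "supp X U x H" and x': "supp X U x' H'" and g: "g \<in> lin U U"
    and gx: "act X U U g x' = x"
  shows "supp X U x' {h \<in> H'. g h \<in> H}"
proof -
  have H: "submodule H K U" and H': "submodule H' K U" using x x' by (auto simp: supp_def)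
  let ?H = "U\<lparr>carrier := H\<rparr>" and ?H' = "U\<lparr>carrier := H'\<rparr>"
  obtain y where y: "y \<in> el X ?H" "act X ?H U (\<lambda>x\<in>H. x) y = x" using x by (auto simp: supp_def)
  obtain y' where y': "y' \<in> el X ?H'" "act X ?H' U (\<lambda>x\<in>H'. x) y' = x'" using x' by (auto simp: supp_def)
  have HV: "?H \<in> VO" and HV': "?H' \<in> VO" by (rule sub_VO[OF U H], rule sub_VO[OF U H'])
  interpret U: module K U by (rule VO_module[OF U])
  interpret XU: module K "omap X U" by (rule F_module[OF X U])
  have HU: "\<And>h. h \<in> H \<Longrightarrow> h \<in> carrier U" "\<And>h. h \<in> H' \<Longrightarrow> h \<in> carrier U"
    using submodD(1)[OF H VO_module[OF U]] submodD(1)[OF H' VO_module[OF U]] by auto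
  have incl: "(\<lambda>x\<in>H. x) \<in> lin ?H U" "(\<lambda>x\<in>H'. x) \<in> lin ?H' U"
    by (rule lin_incl[OF VO_module[OF U] H], rule lin_incl[OF VO_module[OF U] H'])
  obtain k where k: "k \<in> lin U ?H" "\<And>h. h \<in> H \<Longrightarrow> k h = h"
    using retraction[OF VO_module[OF U] H] by blast
  let ?k = "compose (carrier U) (\<lambda>x\<in>H. x) k" and ?g = "compose (carrier ?H') g (\<lambda>x\<in>H'. x)"
  have k': "?k \<in> lin U U" by (rule lin_compose[OF k(1) incl(1) VO_module[OF U]])
  have kH: "k u \<in> H" if "u \<in> carrier U" for u using lin_closed[OF k(1) that] by simp
  have ke: "?k u = k u" if "u \<in> carrier U" for u using that kH[OF that] by (simp add: compose_eq)
  have g': "?g \<in> lin ?H' U" by (rule lin_compose[OF incl(2) g VO_module[OF HV']])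
  have kg: "compose (carrier ?H') ?k ?g \<in> lin ?H' U" by (rule lin_compose[OF g' k' VO_module[OF HV']])
  let ?f = "\<lambda>h\<in>carrier ?H'. ?g h \<ominus>\<^bsub>U\<^esub> compose (carrier ?H') ?k ?g h"
  have f: "?f \<in> lin ?H' U" by (rule lin_diff[OF g' kg VO_module[OF HV'] VO_module[OF U]])
  have gy: "act X ?H' U ?g y' = x" using F_comp[OF X HV' U incl(2) U g y'(1)] y'(2) gx by simp
  have xU: "x \<in> el X U" using F_closed[OF X HV U incl(1) y(1)] y(2) by simp
  have "compose (carrier ?H) ?k (\<lambda>x\<in>H. x) = (\<lambda>x\<in>H. x)"
    by (rule extensionalityI[of _ "carrier ?H"]) (auto simp: compose_eq ke HU k(2))
  then have kx: "act X U U ?k x = x" using F_comp[OF X HV U incl(1) U k' y(1)] y(2) by simp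
  have "act X ?H' U ?f y' = act X ?H' U ?g y' \<ominus>\<^bsub>omap X U\<^esub> act X ?H' U (compose (carrier ?H') ?k ?g) y'"
    by (rule F_diff_map[OF X HV' U g' kg y'(1)])
  also have "\<dots> = \<zero>\<^bsub>omap X U\<^esub>"
    by (simp only: F_comp[OF X HV' U g' U k' y'(1)] gy kx XU.M.minus_self[OF xU])
  finally have "supp X U (act X ?H' U (\<lambda>x\<in>H'. x) y') {h \<in> H'. ?f h = \<zero>\<^bsub>U\<^esub>}"
    by (rule supp_kernel[OF H' y'(1) U f])
  moreover have "{h \<in> H'. ?f h = \<zero>\<^bsub>U\<^esub>} = {h \<in> H'. g h \<in> H}"
  proof -
    have "?f h = \<zero>\<^bsub>U\<^esub> \<longleftrightarrow> g h \<in> H" if h: "h \<in> H'" for h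
    proof -
      have gh: "g h \<in> carrier U" by (rule lin_closed[OF g HU(2)[OF h]])
      have fe: "?f h = g h \<ominus>\<^bsub>U\<^esub> k (g h)" using h gh by (simp add: compose_eq kH)
      have "g h = k (g h) \<longleftrightarrow> g h \<in> H" using k(2)[of "g h"] kH[OF gh] by metis
      then show ?thesis unfolding fe U.M.minus_eq_zero_iff[OF gh HU(1)[OF kH[OF gh]]] .
    qed
    then show ?thesis by blast
  qed
  ultimately show ?thesis using y'(2) by metis
qed

end

lemma lin_finsum:
  assumes f: "f \<in> lin V W" and V: "module K V" and W: "module K W" and "finite s"
    and "\<And>a. a \<in> s \<Longrightarrow> x a \<in> carrier V"
  shows "f (finsum V x s) = finsum W (\<lambda>a. f (x a)) s"
proof -
  interpret V: module K V by fact
  interpret W: module K W by fact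
  from \<open>finite s\<close> assms(5) show ?thesis
  proof (induction s rule: finite_induct)
    case empty
    show ?case by (simp add: lin_zero[OF f V W])
  next
    case (insert a s)
    have c: "x \<in> s \<rightarrow> carrier V" "x a \<in> carrier V" using insert.prems by auto
    then have c': "(\<lambda>a. f (x a)) \<in> s \<rightarrow> carrier W" "f (x a) \<in> carrier W" using lin_closed[OF f] by auto
    show ?case
      using insert c c' lin_plus[OF f c(2) V.M.finsum_closed[OF c(1)]]
      by (simp add: V.M.finsum_insert W.M.finsum_insert)
  qed
qed

text \<open>
  With \<open>U = V\<^sup>A\<close> for \<open>A = X V\<close>, let \<open>R s\<close> be the restriction of \<open>U\<close> to the coordinates in a finite
  \<open>s \<subseteq> A\<close> and \<open>v s \<in> X U\<close> the sum of the images of the \<open>a \<in> s\<close> under the coordinate inclusions \<open>e a\<close>.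
  Then \<open>X\<close> is the colimit of the representables at the subspaces \<open>H \<subseteq> R s U\<close> with \<open>v s \<in> X H\<close>,
  indexed by the pairs \<open>(s, H)\<close> coded as \<open>kpair\<close>s.
\<close>

lemma generated_small_functor:
  fixes X :: "('k, 'u::grothendieck_universe) vfunctor"
  assumes X: "X \<in> FO" and g: "generated X V"
  shows "small_functor K X"
proof -
  have V: "V \<in> VO" by (rule generated_VO[OF g])
  define A where "A = el X V"
  have A: "small A" unfolding A_def by (rule VO_small[OF F_VO[OF X V]])
  define U where "U = prod_space A (\<lambda>_. V)"
  have U: "U \<in> VO" unfolding U_def by (intro prod_VO A V)
  interpret V: module K V by (rule VO_module[OF V])
  interpret XU: module K "omap X U" by (rule F_module[OF X U])
  define R where "R s = (\<lambda>p\<in>carrier U. graph A (\<lambda>a. if a \<in> s then graph_app p a else \<zero>\<^bsub>V\<^esub>))" for s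
  have R: "R s \<in> lin U U" for s
  proof -
    let ?f = "\<lambda>a. if a \<in> s then (\<lambda>p\<in>carrier U. graph_app p a) else (\<lambda>p\<in>carrier U. \<zero>\<^bsub>V\<^esub>)"
    have "(\<lambda>p\<in>carrier U. graph A (\<lambda>a. ?f a p)) \<in> lin U (prod_space A (\<lambda>_. V))"
    proof (rule prod_tuple_lin[OF A V VO_module[OF U]])
      show "?f a \<in> lin U V" if "a \<in> A" for a
        using prod_proj_lin[OF A, of "\<lambda>_. V", OF V that] lin_null[OF VO_module[OF U] VO_module[OF V]]
        by (simp add: U_def)
    qed
    also have "(\<lambda>p\<in>carrier U. graph A (\<lambda>a. ?f a p)) = R s"
      unfolding R_def by (intro restrict_ext graph_cong) auto
    finally show ?thesis by (simp add: U_def)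
  qed
  have Rc: "R s p \<in> carrier U" if "p \<in> carrier U" for s p by (rule lin_closed[OF R that])
  have Ra: "graph_app (R s p) a = (if a \<in> s then graph_app p a else \<zero>\<^bsub>V\<^esub>)" if "p \<in> carrier U" "a \<in> A" for s p a
    using that by (simp add: R_def graph_app_graph A)
  have UeqI: "p = q" if "p \<in> carrier U" "q \<in> carrier U" "\<And>a. a \<in> A \<Longrightarrow> graph_app p a = graph_app q a" for p q
    using prod_space_eqI[OF A] that unfolding U_def by blast
  have RR: "R s (R t p) = R s p" if "s \<subseteq> t" "p \<in> carrier U" for s t p
    by (rule UeqI) (use that in \<open>auto simp: Rc Ra\<close>)
  define e where "e a = prod_inj A (\<lambda>_. V) a" for a
  have e: "e a \<in> lin V U" if "a \<in> A" for a
    unfolding e_def U_def using prod_inj_lin[OF A, of "\<lambda>_. V", OF V that] .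
  have ea: "graph_app (e a x) b = (if b = a then x else \<zero>\<^bsub>V\<^esub>)" if "x \<in> carrier V" "b \<in> A" for a b x
    unfolding e_def using prod_inj_app[OF A, of x "\<lambda>_. V"] that by simp
  define w where "w a = act X V U (e a) a" for a
  have w: "w a \<in> el X U" if "a \<in> A" for a
    unfolding w_def using F_closed[OF X V U e[OF that]] that by (simp add: A_def)
  have Rw: "act X U U (R s) (w a) = (if a \<in> s then w a else \<zero>\<^bsub>omap X U\<^esub>)" if a: "a \<in> A" for s a
  proof -
    have aV: "a \<in> el X V" using a by (simp add: A_def)
    have "compose (carrier V) (R s) (e a) = (if a \<in> s then e a else (\<lambda>x\<in>carrier V. \<zero>\<^bsub>U\<^esub>))"
    proof (rule extensionalityI[of _ "carrier V"])
      fix x assume x: "x \<in> carrier V"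
      have ex: "e a x \<in> carrier U" by (rule lin_closed[OF e[OF a] x])
      interpret U: module K U by (rule VO_module[OF U])
      have "R s (e a x) = (if a \<in> s then e a x else \<zero>\<^bsub>U\<^esub>)"
      proof (rule UeqI)
        fix b assume b: "b \<in> A"
        have "graph_app \<zero>\<^bsub>U\<^esub> b = \<zero>\<^bsub>V\<^esub>" unfolding U_def using prod_ops(3)[OF A b, of "\<lambda>_. V"] by simp
        then show "graph_app (R s (e a x)) b = graph_app (if a \<in> s then e a x else \<zero>\<^bsub>U\<^esub>) b"
          using b x by (auto simp: Ra[OF ex b] ea a)
      qed (use ex Rc in auto)
      then show "compose (carrier V) (R s) (e a) x = (if a \<in> s then e a else (\<lambda>x\<in>carrier V. \<zero>\<^bsub>U\<^esub>)) x"
        using x by (simp add: compose_eq)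
    qed (use lin_ext[OF e[OF a]] in auto)
    then show ?thesis
      unfolding w_def using F_comp[OF X V U e[OF a] U R aV, of s] F_null_map[OF X V U aV] by (simp split: if_splits)
  qed
  define v where "v s = finsum (omap X U) w s" for s
  have v: "v s \<in> el X U" if "s \<subseteq> A" for s
    unfolding v_def by (rule XU.M.finsum_closed) (use w that in auto)
  \<comment> \<open>Restriction to fewer coordinates drops summands: \<open>R s\<close> fixes
    \<open>w a\<close> for \<open>a \<in> s\<close> and kills it otherwise.\<close>
  have Rv: "act X U U (R s) (v t) = v s" if st: "s \<subseteq> t" "t \<subseteq> A" "finite t" for s t
  proof -
    have wt: "w a \<in> el X U" if "a \<in> t" for a using w that st by auto
    have "act X U U (R s) (v t) = finsum (omap X U) (\<lambda>a. act X U U (R s) (w a)) t"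
      unfolding v_def by (rule lin_finsum[OF F_lin[OF X U U R] F_module[OF X U] F_module[OF X U] st(3) wt])
    also have "\<dots> = finsum (omap X U) w s"
      by (rule XU.M.add.finprod_mono_neutral_cong_right[OF st(3,1)]) (use st Rw wt in auto)
    finally show ?thesis by (simp add: v_def)
  qed
  \<comment> \<open>\<open>R s\<close> is idempotent, so the condition on \<open>h\<close> places
    \<open>H\<close> inside its range. It makes \<open>R s\<close> the identity on \<open>H\<close>,
    which gives reflexivity and antisymmetry of the order below.\<close>
  define J where "J = {(s, H). finite s \<and> s \<subseteq> A \<and> (\<forall>h\<in>H. R s h = h) \<and> supp X U (v s) H}"
  have JH: "submodule H K U" if "(s, H) \<in> J" for s H using that by (simp add: J_def supp_def)
  have JU: "h \<in> carrier U" if "(s, H) \<in> J" "h \<in> H" for s H h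
    using submodD(1)[OF JH[OF that(1)] VO_module[OF U]] that by auto
  have Jsm: "small s" "small H" if "(s, H) \<in> J" for s H
    using that A small_subset[OF A] small_subset[OF VO_small[OF U]] JU[OF that] by (auto simp: J_def)
  \<comment> \<open>Later pairs have more coordinates, and restriction of coordinates sends their
    subspace into the earlier one. The transition maps \<open>?p i j\<close> are these
    restrictions.\<close>
  define le where "le P Q \<longleftrightarrow> fst P \<subseteq> fst Q \<and> R (fst P) ` snd Q \<subseteq> snd P" for P Q :: "'u set \<times> 'u set"
  define c where "c P = kpair (vset (fst P)) (vset (snd P))" for P :: "'u set \<times> 'u set"
  have cinj: "inj_on c J"
  proof (rule inj_onI)
    fix P Q assume "P \<in> J" "Q \<in> J" and eq: "c P = c Q"
    then have "(fst P, snd P) \<in> J" "(fst Q, snd Q) \<in> J" by simp_all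
    note P = Jsm[OF this(1)] and Q = Jsm[OF this(2)]
    have "vset (fst P) = vset (fst Q)" "vset (snd P) = vset (snd Q)"
      using eq by (simp_all add: c_def kpair_eq_iff)
    then show "P = Q" by (simp add: vset_eq_iff P Q prod_eq_iff)
  qed
  define I where "I = c ` J"
  define d where "d = inv_into J c"
  have d: "d i \<in> J" "c (d i) = i" if "i \<in> I" for i
    using that unfolding d_def I_def by (auto simp: inv_into_into f_inv_into_f)
  have dc: "d (c P) = P" if "P \<in> J" for P unfolding d_def using cinj that by simp
  have I: "small I"
  proof (rule small_subset)
    show "small (\<Union>x\<in>vset ` Pow A. \<Union>y\<in>vset ` Pow (carrier U). {kpair x y})"
      by (intro small_kpairs small_vset_Pow A VO_small U)
    show "I \<subseteq> (\<Union>x\<in>vset ` Pow A. \<Union>y\<in>vset ` Pow (carrier U). {kpair x y})"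
      using JU by (fastforce simp: I_def c_def J_def)
  qed
  define r where "r = {(i, j). i \<in> I \<and> j \<in> I \<and> le (d i) (d j)}"
  have le_refl: "le P P" if "P \<in> J" for P using that by (auto simp: le_def J_def)
  have le_trans: "le P Z" if PQ: "le P Q" and QZ: "le Q Z" and Z: "Z \<in> J" for P Q Z
  proof -
    have "R (fst P) h \<in> snd P" if h: "h \<in> snd Z" for h
    proof -
      have "h \<in> carrier U" using JU[of "fst Z" "snd Z" h] Z h by simp
      then have "R (fst P) h = R (fst P) (R (fst Q) h)" using PQ by (simp add: RR le_def)
      also have "\<dots> \<in> snd P"
      proof -
        have "R (fst Q) h \<in> snd Q" using QZ h by (auto simp: le_def)
        then show ?thesis using PQ by (auto simp: le_def)
      qed
      finally show ?thesis .
    qed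
    then show ?thesis using PQ QZ by (auto simp: le_def)
  qed
  have le_antisym: "P = Q" if PQ: "le P Q" "le Q P" and J: "P \<in> J" "Q \<in> J" for P Q
  proof -
    have s: "fst P = fst Q" using PQ by (auto simp: le_def)
    have "R (fst P) h = h" if "h \<in> snd P" for h using J that by (auto simp: J_def split_beta)
    moreover have "R (fst P) h = h" if "h \<in> snd Q" for h using J that s by (auto simp: J_def split_beta)
    ultimately have "snd P = snd Q" using PQ s by (auto simp: le_def image_subset_iff)
    then show ?thesis using s by (simp add: prod_eq_iff)
  qed
  \<comment> \<open>The bound has the coordinates \<open>s \<union> t\<close> and, among the vectors
    fixed by \<open>R (s \<union> t)\<close>, all those that restrict into both given subspaces. By
    \<open>supp_range\<close> the vector \<open>v (s \<union> t)\<close> is supported on the fixed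
    vectors, and two uses of \<open>supp_preimage\<close> cut this down to the bound.\<close>
  have ub: "\<exists>Z\<in>J. le P Z \<and> le Q Z" if PJ: "P \<in> J" "Q \<in> J" for P Q
  proof -
    obtain s H t G where P: "P = (s, H)" and Q: "Q = (t, G)" by (cases P; cases Q)
    have sH: "finite s" "s \<subseteq> A" "supp X U (v s) H" and tG: "finite t" "t \<subseteq> A" "supp X U (v t) G"
      using PJ by (auto simp: J_def P Q)
    let ?u = "s \<union> t"
    have u: "finite ?u" "?u \<subseteq> A" using sH tG by auto
    let ?H0 = "{h \<in> carrier U. R ?u h \<ominus>\<^bsub>U\<^esub> h = \<zero>\<^bsub>U\<^esub>}"
    interpret U: module K U by (rule VO_module[OF U])
    have H0: "?H0 = {h \<in> carrier U. R ?u h = h}"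
      using U.M.minus_eq_zero_iff Rc by auto
    \<comment> \<open>Written as the kernel of a linear map, the set of fixed vectors is seen to be
      a submodule.\<close>
    have "?H0 = {h \<in> carrier U. (\<lambda>h\<in>carrier U. R ?u h \<ominus>\<^bsub>U\<^esub> (\<lambda>h\<in>carrier U. h) h) h = \<zero>\<^bsub>U\<^esub>}" by auto
    then have "submodule ?H0 K U"
      using kernel_submod[OF lin_diff[OF R lin_id[OF VO_module[OF U]] VO_module[OF U] VO_module[OF U]]
          VO_module[OF U] VO_module[OF U], of ?u] by simp
    then have "supp X U (v ?u) {h \<in> carrier U. R ?u h = h}"
      unfolding H0 by (rule supp_range[OF X U _ R _ v[OF u(2)] Rv[OF subset_refl u(2,1)]]) (auto simp: Rc RR)
    from supp_preimage[OF X U tG(3) supp_preimage[OF X U sH(3) this R Rv[OF _ u(2,1)]] R Rv[OF _ u(2,1)]]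
    have su: "supp X U (v ?u) {h \<in> {h \<in> {h \<in> carrier U. R ?u h = h}. R s h \<in> H}. R t h \<in> G}" by blast
    let ?Z = "(?u, {h \<in> {h \<in> {h \<in> carrier U. R ?u h = h}. R s h \<in> H}. R t h \<in> G})"
    have "?Z \<in> J" using u su by (auto simp: J_def)
    moreover have "le P ?Z" "le Q ?Z" by (auto simp: le_def P Q)
    ultimately show ?thesis by blast
  qed
  let ?Vi = "\<lambda>i. U\<lparr>carrier := snd (d i)\<rparr>"
  let ?p = "\<lambda>i j. \<lambda>h\<in>snd (d j). R (fst (d i)) h"
  have dJ: "(fst (d i), snd (d i)) \<in> J" if "i \<in> I" for i using d(1)[OF that] by simp
  have ViS: "submodule (snd (d i)) K U" if "i \<in> I" for i by (rule JH[OF dJ[OF that]])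
  have Vi: "?Vi i \<in> VO" if "i \<in> I" for i by (rule sub_VO[OF U ViS[OF that]])
  have incl: "(\<lambda>h\<in>snd (d i). h) \<in> lin (?Vi i) U" if "i \<in> I" for i
    by (rule lin_incl[OF VO_module[OF U] ViS[OF that]])
  have "\<exists>y. y \<in> el X (?Vi i) \<and> act X (?Vi i) U (\<lambda>h\<in>snd (d i). h) y = v (fst (d i))" if "i \<in> I" for i
    using dJ[OF that] by (auto simp: J_def supp_def)
  then obtain x where x: "\<And>i. i \<in> I \<Longrightarrow> x i \<in> el X (?Vi i)"
    and xv: "\<And>i. i \<in> I \<Longrightarrow> act X (?Vi i) U (\<lambda>h\<in>snd (d i). h) (x i) = v (fst (d i))" by metis
  have dom: "h \<in> carrier U" if "i \<in> I" "h \<in> snd (d i)" for i h by (rule JU[OF dJ[OF that(1)] that(2)])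
  have fixd: "R (fst (d i)) h = h" if "i \<in> I" "h \<in> snd (d i)" for i h
    using dJ[OF that(1)] that(2) by (auto simp: J_def)
  have p: "?p i j \<in> lin (?Vi j) (?Vi i)" if ij: "(i, j) \<in> r" for i j
  proof -
    have i: "i \<in> I" and j: "j \<in> I" and l: "le (d i) (d j)" using ij by (auto simp: r_def)
    show ?thesis
      using linI_restrict[OF VO_module[OF Vi[OF j]], of "R (fst (d i))" "?Vi i"] l dom[OF j]
      by (simp add: lin_plus[OF R] lin_scale[OF R] le_def image_subset_iff)
  qed
  show ?thesis
  proof (rule directed_union_small_functor[OF X I, where V = ?Vi and r = r and p = ?p and e = x])
    show "directed_poset I r"
      unfolding directed_poset_def partial_order_on_def preorder_on_def
    proof (intro conjI ballI)
      show "refl_on I r" using le_refl d by (auto simp: refl_on_def r_def)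
      show "trans r"
      proof (rule transI)
        fix i j k assume "(i, j) \<in> r" "(j, k) \<in> r"
        then have "i \<in> I" "k \<in> I" "le (d i) (d j)" "le (d j) (d k)" by (auto simp: r_def)
        then show "(i, k) \<in> r" using le_trans[of "d i" "d j" "d k"] d(1) by (simp add: r_def)
      qed
      show "antisym r"
      proof (rule antisymI)
        fix i j assume "(i, j) \<in> r" "(j, i) \<in> r"
        then have "d i = d j" "i \<in> I" "j \<in> I" using le_antisym d by (auto simp: r_def)
        then show "i = j" using d(2) by metis
      qed
      \<comment> \<open>The pair of no coordinates and the zero subspace: \<open>R {}\<close> is the
        zero map and fixes \<open>v {}\<close>.\<close>
      show "I \<noteq> {}"
      proof -
        interpret U: module K U by (rule VO_module[OF U])
        have R0: "R {} h = \<zero>\<^bsub>U\<^esub>" if "h \<in> carrier U" for h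
          by (rule UeqI) (use that Rc[OF that] U.M.zero_closed prod_ops(3)[OF A, of _ "\<lambda>_. V"] in \<open>auto simp: Ra U_def\<close>)
        have "supp X U (v {}) {\<zero>\<^bsub>U\<^esub>}"
          by (rule supp_range[OF X U submod_zero[OF VO_module[OF U]] R[of "{}"] _ v Rv]) (auto simp: R0)
        then have "({}, {\<zero>\<^bsub>U\<^esub>}) \<in> J" by (simp add: J_def R0)
        then show ?thesis by (auto simp: I_def)
      qed
      fix i j assume i: "i \<in> I" and j: "j \<in> I"
      obtain Z where Z: "Z \<in> J" "le (d i) Z" "le (d j) Z" using ub[OF d(1)[OF i] d(1)[OF j]] by blast
      then have "c Z \<in> I" "(i, c Z) \<in> r" "(j, c Z) \<in> r" using i j by (auto simp: r_def I_def dc)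
      then show "\<exists>k\<in>I. (i, k) \<in> r \<and> (j, k) \<in> r" by blast
    qed (auto simp: r_def)
    show "?Vi i \<in> VO" if "i \<in> I" for i by (rule Vi[OF that])
    show "?p i j \<in> lin (?Vi j) (?Vi i)" if "(i, j) \<in> r" for i j by (rule p[OF that])
    show "?p i i = (\<lambda>x\<in>carrier (?Vi i). x)" if "i \<in> I" for i
      using fixd[OF that] by auto
    show "?p i k = compose (carrier (?Vi k)) (?p i j) (?p j k)" if ij: "(i, j) \<in> r" and jk: "(j, k) \<in> r" for i j k
    proof -
      have "R (fst (d i)) (R (fst (d j)) h) = R (fst (d i)) h" if "h \<in> snd (d k)" for h
        using ij jk dom[of k h] that by (intro RR) (auto simp: r_def le_def)
      moreover have "R (fst (d j)) h \<in> snd (d j)" if "h \<in> snd (d k)" for h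
        using jk that by (auto simp: r_def le_def)
      ultimately show ?thesis by (auto simp: compose_def)
    qed
    show "x i \<in> el X (?Vi i)" if "i \<in> I" for i by (rule x[OF that])
    show "act X (?Vi j) (?Vi i) (?p i j) (x j) = x i" if ij: "(i, j) \<in> r" for i j
    proof -
      have i: "i \<in> I" and j: "j \<in> I" and l: "le (d i) (d j)" using ij by (auto simp: r_def)
      note pij = p[OF ij]
      have c: "act X (?Vi j) (?Vi i) (?p i j) (x j) \<in> el X (?Vi i)"
        by (rule F_closed[OF X Vi[OF j] Vi[OF i] pij x[OF j]])
      \<comment> \<open>Both vectors are compared after inclusion into \<open>U\<close>, which is
        injective by \<open>act_incl_inj\<close>; there the claim becomes \<open>Rv\<close>.\<close>
      have eq: "compose (carrier (?Vi j)) (\<lambda>h\<in>snd (d i). h) (?p i j) =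
          compose (carrier (?Vi j)) (R (fst (d i))) (\<lambda>h\<in>snd (d j). h)"
        using l by (auto simp: compose_def le_def intro!: restrict_ext)
      have "act X (?Vi i) U (\<lambda>h\<in>snd (d i). h) (act X (?Vi j) (?Vi i) (?p i j) (x j)) =
          act X U U (R (fst (d i))) (v (fst (d j)))"
        using F_comp[OF X Vi[OF j] Vi[OF i] pij U incl[OF i] x[OF j]]
          F_comp[OF X Vi[OF j] U incl[OF j] U R x[OF j], of "fst (d i)"] xv[OF j] by (simp only: eq)
      also have "\<dots> = v (fst (d i))"
        by (rule Rv) (use l dJ[OF j] in \<open>auto simp: le_def J_def\<close>)
      finally show ?thesis using act_incl_inj[OF X U ViS[OF i] c x[OF i]] xv[OF i] by simp
    qed
    show "\<exists>i\<in>I. \<exists>f\<in>lin (?Vi i) W. y = act X (?Vi i) W f (x i)"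
      if W: "W \<in> VO" and y: "y \<in> el X W" for W y
    proof -
      obtain f a where f: "f \<in> lin V W" and a': "a \<in> el X V" and ya: "y = act X V W f a"
        by (rule generatedD[OF g W y])
      have a: "a \<in> A" using a' by (simp add: A_def)
      \<comment> \<open>A vector \<open>X f a\<close> already comes from the single coordinate
        \<open>a\<close>. The projection to this coordinate is a left inverse of \<open>e a\<close>,
        so \<open>f\<close> after the projection carries \<open>w a\<close>, which is
        \<open>v {a}\<close>, to \<open>X f a\<close>.\<close>
      let ?H = "R {a} ` carrier U"
      have sH: "submodule ?H K U" by (rule image_submod[OF R VO_module[OF U] VO_module[OF U]])
      have "supp X U (v {a}) ?H"
        by (rule supp_range[OF X U sH R _ v Rv]) (use a in auto)
      then have PJ: "({a}, ?H) \<in> J" using a by (auto simp: J_def RR)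
      define i where "i = c ({a}, ?H)"
      have i: "i \<in> I" and di: "d i = ({a}, ?H)" using PJ by (auto simp: i_def I_def dc)
      have pr: "(\<lambda>p\<in>carrier U. graph_app p a) \<in> lin U V"
        using prod_proj_lin[OF A, of "\<lambda>_. V", OF V a] by (simp add: U_def)
      have fp: "compose (carrier U) f (\<lambda>p\<in>carrier U. graph_app p a) \<in> lin U W"
        by (rule lin_compose[OF pr f VO_module[OF U]])
      let ?fi = "compose (carrier (?Vi i)) (compose (carrier U) f (\<lambda>p\<in>carrier U. graph_app p a)) (\<lambda>h\<in>snd (d i). h)"
      have fi: "?fi \<in> lin (?Vi i) W" by (rule lin_compose[OF incl[OF i] fp VO_module[OF Vi[OF i]]])
      have "compose (carrier V) (compose (carrier U) f (\<lambda>p\<in>carrier U. graph_app p a)) (e a) = f"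
        by (rule extensionalityI[of _ "carrier V"])
          (auto simp: compose_eq lin_ext[OF f] lin_closed[OF e[OF a]] ea a)
      then have "y = act X U W (compose (carrier U) f (\<lambda>p\<in>carrier U. graph_app p a)) (w a)"
        using F_comp[OF X V U e[OF a] W fp a'] ya by (simp add: w_def)
      also have "w a = v {a}" unfolding v_def using w[OF a] by simp
      also have "\<dots> = act X (?Vi i) U (\<lambda>h\<in>snd (d i). h) (x i)" using xv[OF i] by (simp add: di)
      also have "act X U W (compose (carrier U) f (\<lambda>p\<in>carrier U. graph_app p a)) \<dots> = act X (?Vi i) W ?fi (x i)"
        by (rule F_comp[OF X Vi[OF i] U incl[OF i] W fp x[OF i], symmetric])
      finally show ?thesis using i fi by blast
    qed
    show "\<exists>j. (i, j) \<in> r \<and> (\<forall>h\<in>carrier (?Vi j). f (?p i j h) = \<zero>\<^bsub>W\<^esub>)"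
      if i: "i \<in> I" and W: "W \<in> VO" and f: "f \<in> lin (?Vi i) W"
        and fx: "act X (?Vi i) W f (x i) = \<zero>\<^bsub>omap X W\<^esub>" for i W f
    proof -
      \<comment> \<open>Keeping the coordinates and shrinking the subspace to the kernel of
        \<open>f\<close> gives a later pair, by \<open>supp_kernel\<close>; on it \<open>f\<close>
        vanishes outright.\<close>
      let ?Z = "(fst (d i), {h \<in> snd (d i). f h = \<zero>\<^bsub>W\<^esub>})"
      have "supp X U (v (fst (d i))) {h \<in> snd (d i). f h = \<zero>\<^bsub>W\<^esub>}"
        using supp_kernel[OF X U ViS[OF i] x[OF i] W f fx] xv[OF i] by simp
      then have Z: "?Z \<in> J" using dJ[OF i] by (auto simp: J_def)
      have "le (d i) ?Z" using fixd[OF i] by (auto simp: le_def)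
      then have "(i, c ?Z) \<in> r" using Z i by (simp add: r_def dc I_def)
      moreover have "f (?p i (c ?Z) h) = \<zero>\<^bsub>W\<^esub>" if "h \<in> carrier (?Vi (c ?Z))" for h
        using that fixd[OF i] by (simp add: dc[OF Z])
      ultimately show ?thesis by blast
    qed
  qed
qed

end

section \<open>Epi-reflective subcategories from universal arrows\<close>

text \<open>The record \<open>category\<close> carries no laws. Stating them here keeps the two
  criteria that follow independent of functors and their elements.\<close>

locale cat =
  fixes C :: "('o, 'a) category"
  assumes Arr_objs: "f \<in> Arr C \<Longrightarrow> Dom C f \<in> Obj C \<and> Cod C f \<in> Obj C"
    and Ident_Hom: "a \<in> Obj C \<Longrightarrow> Ident C a \<in> Hom C a a"
    and Comp_Hom: "f \<in> Hom C a b \<Longrightarrow> g \<in> Hom C b c \<Longrightarrow> Comp C g f \<in> Hom C a c"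
    and Comp_Ident: "f \<in> Hom C a b \<Longrightarrow> Comp C f (Ident C a) = f"
    and Ident_Comp: "f \<in> Hom C a b \<Longrightarrow> Comp C (Ident C b) f = f"
    and Comp_assoc: "f \<in> Hom C a b \<Longrightarrow> g \<in> Hom C b c \<Longrightarrow> h \<in> Hom C c d \<Longrightarrow>
      Comp C h (Comp C g f) = Comp C (Comp C h g) f"
begin

lemma Hom_Arr: "f \<in> Hom C a b \<Longrightarrow> f \<in> Arr C" "f \<in> Hom C a b \<Longrightarrow> Dom C f = a" "f \<in> Hom C a b \<Longrightarrow> Cod C f = b"
  by (simp_all add: Hom_def)

lemma Arr_Hom: "f \<in> Arr C \<Longrightarrow> f \<in> Hom C (Dom C f) (Cod C f)"
  by (simp add: Hom_def)

text \<open>Universal arrows from all objects assemble into a left adjoint: on arrows it is the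
  unique factorization \<open>l\<close>, and uniqueness yields functoriality.\<close>

lemma epi_reflectiveI:
  assumes S: "S \<subseteq> Obj C" and r: "\<And>c. c \<in> Obj C \<Longrightarrow> r c \<in> S"
    and \<eta>: "\<And>c. c \<in> Obj C \<Longrightarrow> \<eta> c \<in> Hom C c (r c)"
    and univ: "\<And>c d f. c \<in> Obj C \<Longrightarrow> d \<in> S \<Longrightarrow> f \<in> Hom C c d \<Longrightarrow> \<exists>!g. g \<in> Hom C (r c) d \<and> Comp C g (\<eta> c) = f"
    and ep: "\<And>c. c \<in> Obj C \<Longrightarrow> epi C (\<eta> c)"
  shows "epi_reflective C S"
proof -
  let ?D = "full_subcategory C S"
  have D: "Obj ?D = S" "Dom ?D = Dom C" "Cod ?D = Cod C" "Comp ?D = Comp C" "Ident ?D = Ident C"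
    "Arr ?D = {f \<in> Arr C. Dom C f \<in> S \<and> Cod C f \<in> S}" by (simp_all add: full_subcategory_def)
  have DH: "Hom ?D a b = Hom C a b" if "a \<in> S" "b \<in> S" for a b
    using that by (auto simp: Hom_def D)
  define l where "l f = (THE g. g \<in> Hom C (r (Dom C f)) (r (Cod C f)) \<and> Comp C g (\<eta> (Dom C f)) = Comp C (\<eta> (Cod C f)) f)" for f
  have l: "l f \<in> Hom C (r a) (r b)" "Comp C (l f) (\<eta> a) = Comp C (\<eta> b) f" if f: "f \<in> Hom C a b" for f a b
  proof -
    have ab: "a \<in> Obj C" "b \<in> Obj C" using Arr_objs f by (auto simp: Hom_def)
    have "\<exists>!g. g \<in> Hom C (r a) (r b) \<and> Comp C g (\<eta> a) = Comp C (\<eta> b) f"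
      by (rule univ[OF ab(1) r[OF ab(2)] Comp_Hom[OF f \<eta>[OF ab(2)]]])
    from theI'[OF this] show "l f \<in> Hom C (r a) (r b)" "Comp C (l f) (\<eta> a) = Comp C (\<eta> b) f"
      unfolding l_def Hom_Arr(2)[OF f] Hom_Arr(3)[OF f] by auto
  qed
  have l_eq: "l f = g" if f: "f \<in> Hom C a b" and g: "g \<in> Hom C (r a) (r b)" "Comp C g (\<eta> a) = Comp C (\<eta> b) f" for f g a b
  proof -
    have ab: "a \<in> Obj C" "b \<in> Obj C" using Arr_objs f by (auto simp: Hom_def)
    show ?thesis
      using univ[OF ab(1) r[OF ab(2)] Comp_Hom[OF f \<eta>[OF ab(2)]]] l[OF f] g by blast
  qed
  let ?L = "\<lparr>omap = (\<lambda>c\<in>Obj C. r c), amap = (\<lambda>f\<in>Arr C. l f)\<rparr>"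
  have L: "is_functor C ?D ?L"
    unfolding is_functor_def
  proof (intro conjI ballI impI)
    show "omap ?L \<in> Obj C \<rightarrow>\<^sub>E Obj ?D" using r by (simp add: D)
    show "amap ?L \<in> extensional (Arr C)" by simp
    show "amap ?L f \<in> Hom ?D (omap ?L (Dom C f)) (omap ?L (Cod C f))" if "f \<in> Arr C" for f
      using that l(1)[OF Arr_Hom[OF that]] Arr_objs[OF that] r by (simp add: DH)
    show "amap ?L (Ident C c) = Ident ?D (omap ?L c)" if c: "c \<in> Obj C" for c
    proof -
      have rc: "r c \<in> Obj C" using r[OF c] S by auto
      have "l (Ident C c) = Ident C (r c)"
        by (rule l_eq[OF Ident_Hom[OF c] Ident_Hom[OF rc]]) (simp add: Ident_Comp[OF \<eta>[OF c]] Comp_Ident[OF \<eta>[OF c]])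
      then show ?thesis using c Hom_Arr(1)[OF Ident_Hom[OF c]] by (simp add: D)
    qed
    show "amap ?L (Comp C g f) = Comp ?D (amap ?L g) (amap ?L f)"
      if f: "f \<in> Arr C" and g: "g \<in> Arr C" and fg: "Cod C f = Dom C g" for f g
    proof -
      have fH: "f \<in> Hom C (Dom C f) (Dom C g)" and gH: "g \<in> Hom C (Dom C g) (Cod C g)"
        using Arr_Hom[OF f] Arr_Hom[OF g] fg by auto
      note o = Arr_objs[OF f, THEN conjunct1] Arr_objs[OF g, THEN conjunct1] Arr_objs[OF g, THEN conjunct2]
      have "Comp C (Comp C (l g) (l f)) (\<eta> (Dom C f)) = Comp C (\<eta> (Cod C g)) (Comp C g f)"
        using Comp_assoc[OF \<eta>[OF o(1)] l(1)[OF fH] l(1)[OF gH]] l(2)[OF fH] l(2)[OF gH]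
          Comp_assoc[OF fH \<eta>[OF o(2)] l(1)[OF gH]] Comp_assoc[OF fH gH \<eta>[OF o(3)]] by simp
      then have "l (Comp C g f) = Comp C (l g) (l f)"
        by (intro l_eq[OF Comp_Hom[OF fH gH]] Comp_Hom[OF l(1)[OF fH] l(1)[OF gH]])
      then show ?thesis using f g Hom_Arr(1)[OF Comp_Hom[OF fH gH]] by (simp add: D)
    qed
  qed
  let ?G = "identity_functor ?D"
  have G: "is_functor ?D C ?G"
    unfolding is_functor_def identity_functor_def
  proof (intro conjI ballI impI)
    show "amap \<lparr>omap = \<lambda>c\<in>Obj ?D. c, amap = \<lambda>f\<in>Arr ?D. f\<rparr> (Ident ?D c) =
        Ident C (omap \<lparr>omap = \<lambda>c\<in>Obj ?D. c, amap = \<lambda>f\<in>Arr ?D. f\<rparr> c)" if "c \<in> Obj ?D" for c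
      using that S Ident_Hom[of c] by (auto simp: D Hom_def)
    show "amap \<lparr>omap = \<lambda>c\<in>Obj ?D. c, amap = \<lambda>f\<in>Arr ?D. f\<rparr> (Comp ?D g f) =
        Comp C (amap \<lparr>omap = \<lambda>c\<in>Obj ?D. c, amap = \<lambda>f\<in>Arr ?D. f\<rparr> g) (amap \<lparr>omap = \<lambda>c\<in>Obj ?D. c, amap = \<lambda>f\<in>Arr ?D. f\<rparr> f)"
      if "f \<in> Arr ?D" "g \<in> Arr ?D" "Cod ?D f = Dom ?D g" for f g
      using that Comp_Hom[of f "Dom C f" "Cod C f" g "Cod C g"] by (auto simp: D Hom_def)
  qed (use S in \<open>auto simp: D Hom_def\<close>)
  let ?\<eta> = "\<lambda>c\<in>Obj C. \<eta> c"
  have n: "is_natural C C (identity_functor C) (compose_functor C ?G ?L) ?\<eta>"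
    unfolding is_natural_def
  proof (intro conjI ballI)
    show "?\<eta> c \<in> Hom C (omap (identity_functor C) c) (omap (compose_functor C ?G ?L) c)" if "c \<in> Obj C" for c
      using that \<eta> r by (simp add: identity_functor_def compose_functor_def compose_eq D)
    show "Comp C (?\<eta> (Cod C f)) (amap (identity_functor C) f) = Comp C (amap (compose_functor C ?G ?L) f) (?\<eta> (Dom C f))"
      if f: "f \<in> Arr C" for f
    proof -
      note fH = Arr_Hom[OF f] and o = Arr_objs[OF f]
      have "l f \<in> Arr ?D" using l(1)[OF fH] r o by (auto simp: D Hom_def)
      then show ?thesis using l(2)[OF fH] f o
        by (simp add: identity_functor_def compose_functor_def compose_eq)
    qed
  qed simp
  have "left_adjoint C ?D ?L ?G ?\<eta>"
    unfolding left_adjoint_def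
  proof (intro conjI ballI L G n)
    fix c d f assume c: "c \<in> Obj C" and d: "d \<in> Obj ?D" and f: "f \<in> Hom C c (omap ?G d)"
    have d': "d \<in> S" and f': "f \<in> Hom C c d" using d f by (auto simp: D identity_functor_def)
    have "g \<in> Hom ?D (omap ?L c) d \<and> Comp C (amap ?G g) (?\<eta> c) = f \<longleftrightarrow> g \<in> Hom C (r c) d \<and> Comp C g (\<eta> c) = f" for g
      using c r[OF c] d' by (auto simp: DH identity_functor_def D Hom_def)
    then show "\<exists>!g. g \<in> Hom ?D (omap ?L c) d \<and> Comp C (amap ?G g) (?\<eta> c) = f"
      using univ[OF c d' f'] by simp
  qed
  then show ?thesis unfolding epi_reflective_def using S ep by (intro conjI exI[of _ ?L] exI[of _ ?\<eta>]) auto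
qed

text \<open>The factorization \<open>f = m e\<close> of an \<open>f\<close> orthogonal to one of the classes has \<open>e\<close> or \<open>m\<close>
  invertible.\<close>

lemma orthogonal_factorization_systemI:
  assumes sub: "\<E> \<subseteq> Arr C" "\<M> \<subseteq> Arr C"
    and orth: "\<And>e m. e \<in> \<E> \<Longrightarrow> m \<in> \<M> \<Longrightarrow> orthogonal C e m"
    and fact: "\<And>f. f \<in> Arr C \<Longrightarrow> \<exists>e\<in>\<E>. \<exists>m\<in>\<M>. Cod C e = Dom C m \<and> f = Comp C m e"
    and iso: "\<And>f g a b. f \<in> Hom C a b \<Longrightarrow> g \<in> Hom C b a \<Longrightarrow> Comp C g f = Ident C a \<Longrightarrow> Comp C f g = Ident C b \<Longrightarrow>
      f \<in> \<E> \<and> f \<in> \<M>"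
    and comp: "three_for_two C \<E>" "three_for_two C \<M>"
  shows "orthogonal_factorization_system C \<E> \<M>"
proof -
  have orthD: "\<exists>!h. h \<in> Hom C b c \<and> Comp C h e = l \<and> Comp C m h = k"
    if "orthogonal C e m" "e \<in> Hom C a b" "m \<in> Hom C c d" "l \<in> Hom C a c" "k \<in> Hom C b d" "Comp C m l = Comp C k e"
    for e m a b c d l k
    using that by (simp add: orthogonal_def Hom_Arr)
  have M: "f \<in> \<M>" if f: "f \<in> Arr C" and o: "\<And>e. e \<in> \<E> \<Longrightarrow> orthogonal C e f" for f
  proof -
    obtain e m where em: "e \<in> \<E>" "m \<in> \<M>" "Cod C e = Dom C m" "f = Comp C m e" using fact[OF f] by blast
    let ?a = "Dom C e" and ?p = "Cod C e" and ?b = "Cod C m"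
    have e: "e \<in> Hom C ?a ?p" and m: "m \<in> Hom C ?p ?b" using em sub by (auto simp: Hom_def)
    have f': "f \<in> Hom C ?a ?b" unfolding em(4) by (rule Comp_Hom[OF e m])
    have ap: "?a \<in> Obj C" "?p \<in> Obj C" using Arr_objs e by (auto simp: Hom_def)
    have "\<exists>!h. h \<in> Hom C ?p ?a \<and> Comp C h e = Ident C ?a \<and> Comp C f h = m"
      by (rule orthD[OF o[OF em(1)] e f' Ident_Hom[OF ap(1)] m]) (simp add: Comp_Ident[OF f'] flip: em(4))
    then obtain h where h: "h \<in> Hom C ?p ?a" "Comp C h e = Ident C ?a" "Comp C f h = m" by blast
    \<comment> \<open>The identity of the middle object and \<open>e h\<close> are both diagonals of
      the commutative square from \<open>e\<close> to \<open>m\<close> with sides \<open>e\<close>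
      and \<open>m\<close>, so \<open>h\<close> is a two-sided inverse of \<open>e\<close>. Hence
      \<open>e\<close> lies in \<open>\<M>\<close>, and with it \<open>f = m e\<close>. The argument
      for \<open>\<E>\<close> is dual.\<close>
    have "\<exists>!k. k \<in> Hom C ?p ?p \<and> Comp C k e = e \<and> Comp C m k = m"
      by (rule orthD[OF orth[OF em(1,2)] e m e m]) simp
    moreover have "Comp C (Comp C e h) e = e" using Comp_assoc[OF e h(1) e] h(2) Comp_Ident[OF e] by simp
    moreover have "Comp C m (Comp C e h) = m" using Comp_assoc[OF h(1) e m] h(3) em(4) by simp
    moreover have "Comp C (Ident C ?p) e = e" "Comp C m (Ident C ?p) = m"
      by (rule Ident_Comp[OF e], rule Comp_Ident[OF m])
    ultimately have "Comp C e h = Ident C ?p" using Comp_Hom[OF h(1) e] Ident_Hom[OF ap(2)] by blast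
    then have "e \<in> \<M>" using iso[OF e h(1,2)] by simp
    then show ?thesis using comp(2) em sub unfolding three_for_two_def by blast
  qed
  have E: "f \<in> \<E>" if f: "f \<in> Arr C" and o: "\<And>m. m \<in> \<M> \<Longrightarrow> orthogonal C f m" for f
  proof -
    obtain e m where em: "e \<in> \<E>" "m \<in> \<M>" "Cod C e = Dom C m" "f = Comp C m e" using fact[OF f] by blast
    let ?a = "Dom C e" and ?p = "Cod C e" and ?b = "Cod C m"
    have e: "e \<in> Hom C ?a ?p" and m: "m \<in> Hom C ?p ?b" using em sub by (auto simp: Hom_def)
    have f': "f \<in> Hom C ?a ?b" unfolding em(4) by (rule Comp_Hom[OF e m])
    have bp: "?b \<in> Obj C" "?p \<in> Obj C" using Arr_objs[OF Hom_Arr(1)[OF m]] em(3) by simp_all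
    have "\<exists>!h. h \<in> Hom C ?b ?p \<and> Comp C h f = e \<and> Comp C m h = Ident C ?b"
      by (rule orthD[OF o[OF em(2)] f' m e Ident_Hom[OF bp(1)]]) (simp add: Ident_Comp[OF f'] flip: em(4))
    then obtain h where h: "h \<in> Hom C ?b ?p" "Comp C h f = e" "Comp C m h = Ident C ?b" by blast
    have "\<exists>!k. k \<in> Hom C ?p ?p \<and> Comp C k e = e \<and> Comp C m k = m"
      by (rule orthD[OF orth[OF em(1,2)] e m e m]) simp
    moreover have "Comp C (Comp C h m) e = e" using Comp_assoc[OF e m h(1)] h(2) em(4) by simp
    moreover have "Comp C m (Comp C h m) = m" using Comp_assoc[OF m h(1) m] h(3) Ident_Comp[OF m] by simp
    moreover have "Comp C (Ident C ?p) e = e" "Comp C m (Ident C ?p) = m"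
      by (rule Ident_Comp[OF e], rule Comp_Ident[OF m])
    ultimately have "Comp C h m = Ident C ?p" using Comp_Hom[OF m h(1)] Ident_Hom[OF bp(2)] by blast
    then have "m \<in> \<E>" using iso[OF m h(1) _ h(3)] by simp
    then show ?thesis using comp(1) em sub unfolding three_for_two_def by blast
  qed
  show ?thesis
    unfolding orthogonal_factorization_system_def
    using sub orth fact M E by blast
qed

end

section \<open>Zero objects and zero arrows\<close>

context vect
begin

lemma Ind_simps [simp]:
  "Obj (Ind_Vect_op K) = {X \<in> FO. small_functor K X}"
  "Dom (Ind_Vect_op K) = Dom (Vect_Vect K)" "Cod (Ind_Vect_op K) = Cod (Vect_Vect K)"
  "Ident (Ind_Vect_op K) = Ident (Vect_Vect K)" "Comp (Ind_Vect_op K) = Comp (Vect_Vect K)"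
  by (simp_all add: Ind_Vect_op_def full_subcategory_def)

lemma Ind_Hom_iff:
  "t \<in> Hom (Ind_Vect_op K) X Y \<longleftrightarrow> t \<in> mor X Y \<and> small_functor K X \<and> small_functor K Y"
  using Hom_dom[of t X Y] Hom_cod[of t X Y]
  by (auto simp: Hom_def Ind_Vect_op_def full_subcategory_def)

lemma cat_Ind: "cat (Ind_Vect_op K)"
proof
  fix t assume "t \<in> Arr (Ind_Vect_op K)"
  then show "Dom (Ind_Vect_op K) t \<in> Obj (Ind_Vect_op K) \<and> Cod (Ind_Vect_op K) t \<in> Obj (Ind_Vect_op K)"
    by (auto simp: Ind_Vect_op_def full_subcategory_def)
next
  fix X assume "X \<in> Obj (Ind_Vect_op K)"
  then show "Ident (Ind_Vect_op K) X \<in> Hom (Ind_Vect_op K) X X"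
    by (simp add: Ind_Hom_iff VV_Ident_Hom)
next
  fix s t X Y Z assume "t \<in> Hom (Ind_Vect_op K) X Y" "s \<in> Hom (Ind_Vect_op K) Y Z"
  then show "Comp (Ind_Vect_op K) s t \<in> Hom (Ind_Vect_op K) X Z"
    by (auto simp: Ind_Hom_iff intro: VV_comp_Hom)
next
  fix t X Y assume "t \<in> Hom (Ind_Vect_op K) X Y"
  then have t: "t \<in> mor X Y" by (simp add: Ind_Hom_iff)
  note I = VV_Ident_Hom[OF Hom_dom[OF t]] VV_Ident_Hom[OF Hom_cod[OF t]]
  show "Comp (Ind_Vect_op K) t (Ident (Ind_Vect_op K) X) = t"
    using Hom_eqI[OF VV_comp_Hom[OF I(1) t] t] by (simp add: cmp_Comp[OF I(1) t] cmp_Ident[OF Hom_dom[OF t]])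
  show "Comp (Ind_Vect_op K) (Ident (Ind_Vect_op K) Y) t = t"
    using Hom_eqI[OF VV_comp_Hom[OF t I(2)] t]
    by (simp add: cmp_Comp[OF t I(2)] cmp_Ident[OF Hom_cod[OF t]] cmp_closed[OF t])
next
  fix r s t X Y Z Z' assume "t \<in> Hom (Ind_Vect_op K) X Y" "s \<in> Hom (Ind_Vect_op K) Y Z" "r \<in> Hom (Ind_Vect_op K) Z Z'"
  then have t: "t \<in> mor X Y" and s: "s \<in> mor Y Z" and r: "r \<in> mor Z Z'"
    by (simp_all add: Ind_Hom_iff)
  note c = VV_comp_Hom[OF t s] VV_comp_Hom[OF s r]
  show "Comp (Ind_Vect_op K) r (Comp (Ind_Vect_op K) s t) = Comp (Ind_Vect_op K) (Comp (Ind_Vect_op K) r s) t"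
    using Hom_eqI[OF VV_comp_Hom[OF c(1) r] VV_comp_Hom[OF t c(2)]]
    by (simp add: cmp_Comp[OF c(1) r] cmp_Comp[OF t c(2)] cmp_Comp[OF t s] cmp_Comp[OF s r] cmp_closed[OF t])
qed

lemma null_arrow_Hom:
  assumes X: "X \<in> FO" and Y: "Y \<in> FO"
  shows "mknat X Y (\<lambda>V x. \<zero>\<^bsub>omap Y V\<^esub>) \<in> mor X Y"
  by (rule mknat_Hom[OF X Y])
    (simp_all add: lin_null[OF F_module[OF X] F_module[OF Y]] lin_zero[OF F_lin[OF Y] F_module[OF Y] F_module[OF Y]])

definition zero_functor :: "('k, 'u::grothendieck_universe) vfunctor \<Rightarrow> bool" where
  "zero_functor Z \<longleftrightarrow> Z \<in> FO \<and> (\<forall>V\<in>VO. el Z V = {\<zero>\<^bsub>omap Z V\<^esub>})"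

text \<open>With a single endomorphism the identity equals the zero endomorphism, so every vector is
  zero. A zero object satisfies this in the full functor category and in the category of small
  functors alike.\<close>

lemma zero_functorI:
  fixes Z :: "('k, 'u::grothendieck_universe) vfunctor"
  assumes Z: "Z \<in> FO" and uniq: "\<exists>!t. t \<in> mor Z Z"
  shows "zero_functor Z"
  unfolding zero_functor_def
proof (intro conjI ballI Z)
  fix V :: "('k, 'u) vs" assume V: "V \<in> VO"
  interpret ZV: module K "omap Z V" by (rule F_module[OF Z V])
  have e: "mknat Z Z (\<lambda>V x. \<zero>\<^bsub>omap Z V\<^esub>) = Ident (Vect_Vect K) Z"
    using uniq VV_Ident_Hom[OF Z] null_arrow_Hom[OF Z Z] by blast
  have "x = \<zero>\<^bsub>omap Z V\<^esub>" if x: "x \<in> el Z V" for x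
    using cmp_Ident[OF Z V x] cmp_mknat[OF V x, of Z "\<lambda>V x. \<zero>\<^bsub>omap Z V\<^esub>"] by (simp add: e)
  then show "el Z V = {\<zero>\<^bsub>omap Z V\<^esub>}" using ZV.M.zero_closed by blast
qed

lemma zero_functor_Hom_unique:
  assumes Z: "zero_functor Z" and X: "X \<in> FO"
  shows "\<exists>!t. t \<in> mor X Z" "\<exists>!t. t \<in> mor Z X"
proof -
  have ZF: "Z \<in> FO" and ZV: "\<And>V. V \<in> VO \<Longrightarrow> el Z V = {\<zero>\<^bsub>omap Z V\<^esub>}"
    using Z by (auto simp: zero_functor_def)
  have "s = t" if s: "s \<in> mor X Z" and t: "t \<in> mor X Z" for s t
    using cmp_closed[OF s] cmp_closed[OF t] ZV by (intro Hom_eqI[OF s t]) simp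
  then show "\<exists>!t. t \<in> mor X Z" using null_arrow_Hom[OF X ZF] by blast
  have "s = t" if s: "s \<in> mor Z X" and t: "t \<in> mor Z X" for s t
    using ZV by (intro Hom_eqI[OF s t])
      (simp add: lin_zero[OF cmp_lin[OF s] F_module[OF ZF] F_module[OF X]] lin_zero[OF cmp_lin[OF t] F_module[OF ZF] F_module[OF X]])
  then show "\<exists>!t. t \<in> mor Z X" using null_arrow_Hom[OF ZF X] by blast
qed

lemma zero_object_VV_iff: "zero_object (Vect_Vect K) Z \<longleftrightarrow> zero_functor Z"
proof
  assume z: "zero_object (Vect_Vect K) Z"
  then have Z: "Z \<in> FO" by (simp add: zero_object_def)
  then have "\<exists>!t. t \<in> mor Z Z" using z unfolding zero_object_def by blast
  then show "zero_functor Z" by (rule zero_functorI[OF Z])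
next
  assume "zero_functor Z"
  then show "zero_object (Vect_Vect K) Z"
    using zero_functor_Hom_unique[of Z] by (simp add: zero_object_def zero_functor_def)
qed

lemma zero_object_Ind_iff: "zero_object (Ind_Vect_op K) Z \<longleftrightarrow> zero_functor Z \<and> small_functor K Z"
proof
  assume z: "zero_object (Ind_Vect_op K) Z"
  then have Z: "Z \<in> FO" "small_functor K Z" by (auto simp: zero_object_def)
  then have "\<exists>!t. t \<in> Hom (Ind_Vect_op K) Z Z" using z unfolding zero_object_def by auto
  then have "\<exists>!t. t \<in> mor Z Z" using Z by (simp add: Ind_Hom_iff)
  then show "zero_functor Z \<and> small_functor K Z" using zero_functorI Z by blast
next
  assume "zero_functor Z \<and> small_functor K Z"
  then show "zero_object (Ind_Vect_op K) Z"
    using zero_functor_Hom_unique[of Z] by (simp add: zero_object_def Ind_Hom_iff zero_functor_def)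
qed

lemma
  assumes X: "X \<in> FO"
  shows carrier_subfun: "subfun X (\<lambda>V. el X V)"
    and zero_subfun: "subfun X (\<lambda>V. {\<zero>\<^bsub>omap X V\<^esub>})"
  unfolding subfun_def
  by (auto simp: submod_carrier submod_zero F_module[OF X] F_closed[OF X]
      lin_zero[OF F_lin[OF X] F_module[OF X] F_module[OF X]])

text \<open>A zero object made from \<open>X\<close> itself, so that it is generated whenever
  \<open>X\<close> is. Arrows out of \<open>X\<close> that vanish on all vectors factor through
  it.\<close>

lemma zero_functor_quotient:
  fixes X :: "('k, 'u::grothendieck_universe) vfunctor"
  assumes X: "X \<in> FO"
  shows "zero_functor (quotient_functor K X (\<lambda>V. el X V))"
  unfolding zero_functor_def
proof (intro conjI ballI)
  note N = carrier_subfun[OF X]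
  show "quotient_functor K X (\<lambda>V. el X V) \<in> FO" by (rule quotient_functor_FO[OF X N])
  fix V :: "('k, 'u) vs" assume V: "V \<in> VO"
  interpret XV: module K "omap X V" by (rule F_module[OF X V])
  have "coset (omap X V) (el X V) x = \<zero>\<^bsub>omap (quotient_functor K X (\<lambda>V. el X V)) V\<^esub>"
    if "x \<in> el X V" for x
    using quotient_functor_ops(4)[OF X N V that] that by simp
  then show "el (quotient_functor K X (\<lambda>V. el X V)) V =
      {\<zero>\<^bsub>omap (quotient_functor K X (\<lambda>V. el X V)) V\<^esub>}"
    unfolding quotient_functor_carrier[OF X N V] using XV.M.zero_closed by force
qed

lemma zero_arrow_iff:
  fixes X :: "('k, 'u::grothendieck_universe) vfunctor"
  assumes t: "t \<in> mor X Y"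
  shows "zero_arrow (Vect_Vect K) t \<longleftrightarrow>
    (\<forall>V\<in>VO. \<forall>x\<in>el X V. cmp t V x = \<zero>\<^bsub>omap Y V\<^esub>)"
proof
  note X = Hom_dom[OF t] and Y = Hom_cod[OF t]
  have XY: "Dom (Vect_Vect K) t = X" "Cod (Vect_Vect K) t = Y" using t by (auto simp: Hom_def)
  { assume "zero_arrow (Vect_Vect K) t"
    then obtain Z r s where Z: "zero_functor Z" and s: "s \<in> mor X Z" and r: "r \<in> mor Z Y"
      and trs: "t = Comp (Vect_Vect K) r s"
      unfolding zero_arrow_def zero_object_VV_iff XY by blast
    have ZF: "Z \<in> FO" using Z by (simp add: zero_functor_def)
    show "\<forall>V\<in>VO. \<forall>x\<in>el X V. cmp t V x = \<zero>\<^bsub>omap Y V\<^esub>"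
    proof (intro ballI)
      fix V :: "('k, 'u) vs" and x assume V: "V \<in> VO" and x: "x \<in> el X V"
      have "cmp s V x = \<zero>\<^bsub>omap Z V\<^esub>" using cmp_closed[OF s V x] Z V by (simp add: zero_functor_def)
      then show "cmp t V x = \<zero>\<^bsub>omap Y V\<^esub>"
        by (simp add: trs cmp_Comp[OF s r V x] lin_zero[OF cmp_lin[OF r V] F_module[OF ZF V] F_module[OF Y V]])
    qed }
  assume z: "\<forall>V\<in>VO. \<forall>x\<in>el X V. cmp t V x = \<zero>\<^bsub>omap Y V\<^esub>"
  let ?Z = "quotient_functor K X (\<lambda>V. el X V)"
  have Z: "zero_functor ?Z" by (rule zero_functor_quotient[OF X])
  then have ZF: "?Z \<in> FO" by (simp add: zero_functor_def)
  note s = null_arrow_Hom[OF X ZF] and r = null_arrow_Hom[OF ZF Y]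
  have "t = Comp (Vect_Vect K) (mknat ?Z Y (\<lambda>V x. \<zero>\<^bsub>omap Y V\<^esub>)) (mknat X ?Z (\<lambda>V x. \<zero>\<^bsub>omap ?Z V\<^esub>))"
  proof (rule Hom_eqI[OF t VV_comp_Hom[OF s r]])
    fix V :: "('k, 'u) vs" and x assume V: "V \<in> VO" and x: "x \<in> el X V"
    show "cmp t V x = cmp (Comp (Vect_Vect K) (mknat ?Z Y (\<lambda>V x. \<zero>\<^bsub>omap Y V\<^esub>)) (mknat X ?Z (\<lambda>V x. \<zero>\<^bsub>omap ?Z V\<^esub>))) V x"
      using z V x cmp_closed[OF s V x] by (simp add: cmp_Comp[OF s r V x] cmp_mknat[OF V])
  qed
  then show "zero_arrow (Vect_Vect K) t"
    unfolding zero_arrow_def zero_object_VV_iff XY using Z r s by blast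
qed

section \<open>Closed subfunctors and the torsion subfunctor\<close>

context
  fixes EE :: "(('k, 'u::grothendieck_universe) vs \<times> 'u set set) set"
  assumes E: "\<forall>(V, \<F>)\<in>EE. V \<in> VO \<and> subspace_filter K V \<F>"
begin

text \<open>These are the maps whose graphs form the subfunctor that is divided out of
  \<open>Yoneda K V\<close> for the pair \<open>(V, \<F>)\<close>.\<close>

definition kills :: "('k, 'u) vs \<Rightarrow> 'u set set \<Rightarrow> ('k, 'u) vs \<Rightarrow> ('u \<Rightarrow> 'u) \<Rightarrow> bool" where
  "kills V \<F> W f \<longleftrightarrow> f \<in> lin V W \<and> (\<exists>H\<in>\<F>. \<forall>x\<in>H. f x = \<zero>\<^bsub>W\<^esub>)"

text \<open>\<open>N\<close> is closed iff \<open>X / N\<close> is free: by the Yoneda lemma an arrow from the quotient attached to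
  \<open>(V, \<F>)\<close> to \<open>Y\<close> is a vector of \<open>Y V\<close> annihilated by all \<open>f\<close> with \<open>kills V \<F> W f\<close>.\<close>

definition closed :: "('k, 'u) vfunctor \<Rightarrow> (('k, 'u) vs \<Rightarrow> 'u set) \<Rightarrow> bool" where
  "closed X N \<longleftrightarrow> subfun X N \<and>
     (\<forall>V \<F> x. (V, \<F>) \<in> EE \<longrightarrow> x \<in> el X V \<longrightarrow>
        (\<forall>W\<in>VO. \<forall>f. kills V \<F> W f \<longrightarrow> act X V W f x \<in> N W) \<longrightarrow> x \<in> N V)"

definition torsion :: "('k, 'u) vfunctor \<Rightarrow> ('k, 'u) vs \<Rightarrow> 'u set" where
  "torsion X W = {x \<in> el X W. \<forall>N. closed X N \<longrightarrow> x \<in> N W}"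

lemma E_VO: "(V, \<F>) \<in> EE \<Longrightarrow> V \<in> VO"
  and E_filter: "(V, \<F>) \<in> EE \<Longrightarrow> subspace_filter K V \<F>"
  using E by auto

lemma closed_subfun: "closed X N \<Longrightarrow> subfun X N"
  by (simp add: closed_def)

lemma closedD:
  "closed X N \<Longrightarrow> (V, \<F>) \<in> EE \<Longrightarrow> x \<in> el X V \<Longrightarrow>
    (\<And>W f. W \<in> VO \<Longrightarrow> kills V \<F> W f \<Longrightarrow> act X V W f x \<in> N W) \<Longrightarrow> x \<in> N V"
  unfolding closed_def by blast

lemma torsion_least: "closed X N \<Longrightarrow> x \<in> torsion X W \<Longrightarrow> x \<in> N W"
  by (simp add: torsion_def)

lemma kills_lin: "kills V \<F> W f \<Longrightarrow> f \<in> lin V W"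
  by (simp add: kills_def)

lemma closed_torsion:
  assumes X: "X \<in> FO"
  shows "closed X (torsion X)"
  unfolding closed_def
proof (intro conjI allI impI)
  show "subfun X (torsion X)"
  proof (rule subfunI[OF X])
    fix V :: "('k, 'u) vs" assume V: "V \<in> VO"
    interpret XV: module K "omap X V" by (rule F_module[OF X V])
    note D = subfun_D[OF X closed_subfun V]
    show "x \<in> el X V" if "x \<in> torsion X V" for x using that by (simp add: torsion_def)
    show "\<zero>\<^bsub>omap X V\<^esub> \<in> torsion X V" by (simp add: torsion_def D)
    show "x \<oplus>\<^bsub>omap X V\<^esub> y \<in> torsion X V" if "x \<in> torsion X V" "y \<in> torsion X V" for x y
      using that by (simp add: torsion_def D)
    show "a \<odot>\<^bsub>omap X V\<^esub> x \<in> torsion X V" if "a \<in> carrier K" "x \<in> torsion X V" for a x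
      using that by (simp add: torsion_def D)
    show "act X V W f x \<in> torsion X W"
      if "W \<in> VO" "f \<in> lin V W" "x \<in> torsion X V" for W f x
      using that F_closed[OF X V] subfun_act[OF X closed_subfun V] by (simp add: torsion_def)
  qed
  fix V \<F> x assume EV: "(V, \<F>) \<in> EE" and x: "x \<in> el X V"
    and t: "\<forall>W\<in>VO. \<forall>f. kills V \<F> W f \<longrightarrow> act X V W f x \<in> torsion X W"
  have "x \<in> N V" if N: "closed X N" for N
    by (rule closedD[OF N EV x]) (use t torsion_least[OF N] in blast)
  then show "x \<in> torsion X V" using x by (simp add: torsion_def)
qed

lemma torsion_subfun: "X \<in> FO \<Longrightarrow> subfun X (torsion X)"
  by (intro closed_subfun closed_torsion)

lemma torsion_carrier: "x \<in> torsion X W \<Longrightarrow> x \<in> el X W"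
  by (simp add: torsion_def)

text \<open>By naturality the closure test at \<open>x\<close> in \<open>X\<close> becomes the test
  at its image in \<open>Y\<close>. Applied to \<open>torsion Y\<close>, this shows that arrows
  preserve torsion.\<close>

lemma closed_vimage:
  assumes t: "t \<in> mor X Y" and N: "closed Y N"
  shows "closed X (\<lambda>W. {x \<in> el X W. cmp t W x \<in> N W})"
  unfolding closed_def
proof (intro conjI allI impI)
  note X = Hom_dom[OF t] and Y = Hom_cod[OF t]
  show "subfun X (\<lambda>W. {x \<in> el X W. cmp t W x \<in> N W})"
  proof (rule subfunI[OF X])
    fix V :: "('k, 'u) vs" assume V: "V \<in> VO"
    interpret XV: module K "omap X V" by (rule F_module[OF X V])
    note D = subfun_D[OF Y closed_subfun[OF N] V]
    note l = lin_plus[OF cmp_lin[OF t V]] lin_scale[OF cmp_lin[OF t V]]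
      lin_zero[OF cmp_lin[OF t V] F_module[OF X V] F_module[OF Y V]]
    let ?S = "\<lambda>W. {x \<in> el X W. cmp t W x \<in> N W}"
    show "x \<in> el X V" if "x \<in> ?S V" for x using that by simp
    show "\<zero>\<^bsub>omap X V\<^esub> \<in> ?S V" by (simp add: D l)
    show "x \<oplus>\<^bsub>omap X V\<^esub> y \<in> ?S V" if "x \<in> ?S V" "y \<in> ?S V" for x y
      using that by (simp add: D l)
    show "a \<odot>\<^bsub>omap X V\<^esub> x \<in> ?S V" if "a \<in> carrier K" "x \<in> ?S V" for a x
      using that by (simp add: D l)
    show "act X V W f x \<in> ?S W" if "W \<in> VO" "f \<in> lin V W" "x \<in> ?S V" for W f x
      using that F_closed[OF X V that(1,2)] subfun_act[OF Y closed_subfun[OF N] V that(1,2)]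
      by (simp add: cmp_natural[OF t V])
  qed
  fix V \<F> x assume EV: "(V, \<F>) \<in> EE" and x: "x \<in> el X V"
    and a: "\<forall>W\<in>VO. \<forall>f. kills V \<F> W f \<longrightarrow> act X V W f x \<in> {x \<in> el X W. cmp t W x \<in> N W}"
  note V = E_VO[OF EV]
  have "cmp t V x \<in> N V"
  proof (rule closedD[OF N EV cmp_closed[OF t V x]])
    fix W f assume W: "W \<in> VO" and f: "kills V \<F> W f"
    then have "cmp t W (act X V W f x) \<in> N W" using a by blast
    then show "act Y V W f (cmp t V x) \<in> N W" by (simp add: cmp_natural[OF t V W kills_lin[OF f] x])
  qed
  then show "x \<in> {x \<in> el X V. cmp t V x \<in> N V}" using x by simp
qed

lemma torsion_map:
  assumes "t \<in> mor X Y" "x \<in> torsion X W"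
  shows "cmp t W x \<in> torsion Y W"
  using torsion_least[OF closed_vimage[OF assms(1) closed_torsion[OF Hom_cod[OF assms(1)]]] assms(2)] by simp

text \<open>The torsion subfunctor is idempotent because free objects are closed under extensions.\<close>

lemma torsion_torsion:
  assumes X: "X \<in> FO" and W: "W \<in> VO" and x: "x \<in> torsion X W"
  shows "x \<in> torsion (sub_functor X (torsion X)) W"
proof -
  let ?S = "sub_functor X (torsion X)"
  note T = torsion_subfun[OF X]
  note S = sub_functor_FO[OF X T]
  have TS: "y \<in> torsion X V" if "V \<in> VO" "y \<in> torsion ?S V" for V y
    using torsion_carrier[OF that(2)] by (simp add: sub_functor_omap[OF X T that(1)])
  \<comment> \<open>By minimality of \<open>torsion X\<close> it is enough that the torsion of
    \<open>?S\<close> is closed in \<open>X\<close>. A vector that passes the test for it also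
    passes the test for \<open>torsion X\<close>, hence lies in \<open>?S\<close>, where the test
    can be applied once more.\<close>
  have "closed X (torsion ?S)"
    unfolding closed_def
  proof (intro conjI allI impI)
    show "subfun X (torsion ?S)"
    proof (rule subfunI[OF X])
      fix V :: "('k, 'u) vs" assume V: "V \<in> VO"
      note D = subfun_D[OF S torsion_subfun[OF S] V, unfolded sub_functor_omap[OF X T V], simplified]
      show "y \<in> el X V" if "y \<in> torsion ?S V" for y using torsion_carrier[OF TS[OF V that]] .
      show "\<zero>\<^bsub>omap X V\<^esub> \<in> torsion ?S V" by (rule D)
      show "y \<oplus>\<^bsub>omap X V\<^esub> z \<in> torsion ?S V" if "y \<in> torsion ?S V" "z \<in> torsion ?S V" for y z
        using that by (rule D)
      show "a \<odot>\<^bsub>omap X V\<^esub> y \<in> torsion ?S V" if "a \<in> carrier K" "y \<in> torsion ?S V" for a y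
        using that by (rule D)
      show "act X V W f y \<in> torsion ?S W" if "W \<in> VO" "f \<in> lin V W" "y \<in> torsion ?S V" for W f y
        using subfun_act[OF S torsion_subfun[OF S] V that] sub_functor_act[OF X T V that(1,2) TS[OF V that(3)]] by simp
    qed
    fix V \<F> y assume EV: "(V, \<F>) \<in> EE" and y: "y \<in> el X V"
      and a: "\<forall>W\<in>VO. \<forall>f. kills V \<F> W f \<longrightarrow> act X V W f y \<in> torsion ?S W"
    note V = E_VO[OF EV]
    have yT: "y \<in> torsion X V"
      by (rule closedD[OF closed_torsion[OF X] EV y]) (use a TS in blast)
    show "y \<in> torsion ?S V"
    proof (rule closedD[OF closed_torsion[OF S] EV])
      show "y \<in> el ?S V" using yT by (simp add: sub_functor_omap[OF X T V])
      fix W f assume W: "W \<in> VO" and f: "kills V \<F> W f"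
      then show "act ?S V W f y \<in> torsion ?S W"
        using a by (simp add: sub_functor_act[OF X T V W kills_lin[OF f] yT])
    qed
  qed
  then show ?thesis using x by (rule torsion_least)
qed

subsection \<open>Free objects\<close>

definition filter_kernel :: "('k, 'u) vs \<Rightarrow> 'u set set \<Rightarrow> ('k, 'u) vs \<Rightarrow> 'u set" where
  "filter_kernel V \<F> W = (\<Union>H\<in>\<F>. vanishing_maps K V H W)"

lemma filter_kernel_iff:
  assumes EV: "(V, \<F>) \<in> EE" and W: "W \<in> VO"
  shows "p \<in> filter_kernel V \<F> W \<longleftrightarrow> p \<in> carrier (hom_space K V W) \<and> kills V \<F> W (hom_fun V p)"
proof
  note sm = VO_small[OF E_VO[OF EV]]
  show "p \<in> carrier (hom_space K V W) \<and> kills V \<F> W (hom_fun V p)" if "p \<in> filter_kernel V \<F> W"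
    using that by (auto simp: filter_kernel_def vanishing_maps_def kills_def hom_fun_graph[OF sm] graph_in_hom_space) blast
  assume p: "p \<in> carrier (hom_space K V W) \<and> kills V \<F> W (hom_fun V p)"
  have "p = graph (carrier V) (hom_fun V p)" by (rule graph_hom_fun[OF sm conjunct1[OF p], symmetric])
  then show "p \<in> filter_kernel V \<F> W" using p unfolding filter_kernel_def vanishing_maps_def kills_def by blast
qed

text \<open>A sum of maps vanishing on \<open>H\<close> and on \<open>H'\<close> vanishes on
  \<open>H \<inter> H'\<close>, so the union over the filter is directed.\<close>

lemma filter_kernel_subfun:
  assumes EV: "(V, \<F>) \<in> EE"
  shows "subfun (Yoneda K V) (filter_kernel V \<F>)"
proof (rule subfunI[OF Yoneda_FO[OF E_VO[OF EV]]])
  note V = E_VO[OF EV] and Fi = E_filter[OF EV, unfolded subspace_filter_def]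
  note Fi_ne = Fi[THEN conjunct1] and Fi_sub = Fi[THEN conjunct2, THEN conjunct1]
    and Fi_Int = Fi[THEN conjunct2, THEN conjunct2, THEN conjunct1]
  note sm = VO_small[OF V]
  fix W :: "('k, 'u) vs" assume W: "W \<in> VO"
  note o = Yoneda_omap[OF V W]
  interpret HW: module K "hom_space K V W" by (rule VO_module[OF hom_space_VO[OF V W]])
  interpret W: module K W by (rule VO_module[OF W])
  have HV: "x \<in> carrier V" if "H \<in> \<F>" "x \<in> H" for H x
  proof -
    have "submodule H K V" using Fi_sub that(1) by (rule bspec)
    from submodD(1)[OF this VO_module[OF V]] show ?thesis using that(2) by (rule subsetD)
  qed
  show "p \<in> el (Yoneda K V) W" if "p \<in> filter_kernel V \<F> W" for p
    using that by (simp add: filter_kernel_iff[OF EV W] o)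
  have ex: "\<exists>H\<in>\<F>. \<forall>x\<in>H. hom_fun V p x = \<zero>\<^bsub>W\<^esub>" if "p \<in> filter_kernel V \<F> W" for p
    using that by (simp add: filter_kernel_iff[OF EV W] kills_def)
  obtain H where "H \<in> \<F>" using Fi_ne by blast
  then show "\<zero>\<^bsub>omap (Yoneda K V) W\<^esub> \<in> filter_kernel V \<F> W"
    using lin_null[OF VO_module[OF V] VO_module[OF W]] HV
    by (auto simp: filter_kernel_iff[OF EV W] o hom_fun_ops[OF sm] kills_def intro!: bexI[of _ H])
  show "p \<oplus>\<^bsub>omap (Yoneda K V) W\<^esub> q \<in> filter_kernel V \<F> W" if p: "p \<in> filter_kernel V \<F> W" and q: "q \<in> filter_kernel V \<F> W" for p q
  proof -
    have c: "p \<in> carrier (hom_space K V W)" "q \<in> carrier (hom_space K V W)"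
      using p q by (simp_all add: filter_kernel_iff[OF EV W])
    obtain H where H: "H \<in> \<F>" "\<And>x. x \<in> H \<Longrightarrow> hom_fun V p x = \<zero>\<^bsub>W\<^esub>"
      using ex[OF p] by blast
    obtain H' where H': "H' \<in> \<F>" "\<And>x. x \<in> H' \<Longrightarrow> hom_fun V q x = \<zero>\<^bsub>W\<^esub>"
      using ex[OF q] by blast
    have "H \<inter> H' \<in> \<F>" by (rule bspec[OF bspec[OF Fi_Int H(1)] H'(1)])
    moreover have "hom_fun V (p \<oplus>\<^bsub>hom_space K V W\<^esub> q) x = \<zero>\<^bsub>W\<^esub>" if "x \<in> H \<inter> H'" for x
      using that H(2) H'(2) HV[OF H(1)] by (simp add: hom_fun_ops[OF sm])
    ultimately have "\<exists>H\<in>\<F>. \<forall>x\<in>H. hom_fun V (p \<oplus>\<^bsub>hom_space K V W\<^esub> q) x = \<zero>\<^bsub>W\<^esub>" by blast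
    then show ?thesis
      using hom_fun_lin[OF sm HW.M.add.m_closed[OF c]] c by (simp add: filter_kernel_iff[OF EV W] o kills_def)
  qed
  show "a \<odot>\<^bsub>omap (Yoneda K V) W\<^esub> p \<in> filter_kernel V \<F> W" if a: "a \<in> carrier K" and p: "p \<in> filter_kernel V \<F> W" for a p
  proof -
    have c: "p \<in> carrier (hom_space K V W)" using p by (simp add: filter_kernel_iff[OF EV W])
    obtain H where H: "H \<in> \<F>" "\<And>x. x \<in> H \<Longrightarrow> hom_fun V p x = \<zero>\<^bsub>W\<^esub>"
      using ex[OF p] by blast
    have "hom_fun V (a \<odot>\<^bsub>hom_space K V W\<^esub> p) x = \<zero>\<^bsub>W\<^esub>" if "x \<in> H" for x
      using that H(2) HV[OF H(1)] a by (simp add: hom_fun_ops[OF sm])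
    then show ?thesis
      using hom_fun_lin[OF sm HW.smult_closed[OF a c]] c H(1) a by (auto simp: filter_kernel_iff[OF EV W] o kills_def)
  qed
  show "act (Yoneda K V) W W' f p \<in> filter_kernel V \<F> W'"
    if W': "W' \<in> VO" and f: "f \<in> lin W W'" and p: "p \<in> filter_kernel V \<F> W" for W' f p
  proof -
    have c: "p \<in> carrier (hom_space K V W)" using p by (simp add: filter_kernel_iff[OF EV W])
    have c': "act (Yoneda K V) W W' f p \<in> carrier (hom_space K V W')"
      using F_closed[OF Yoneda_FO[OF V] W W' f] c by (simp add: o Yoneda_omap[OF V W'])
    obtain H where H: "H \<in> \<F>" "\<And>x. x \<in> H \<Longrightarrow> hom_fun V p x = \<zero>\<^bsub>W\<^esub>"
      using ex[OF p] by blast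
    have "compose (carrier V) f (hom_fun V p) x = \<zero>\<^bsub>W'\<^esub>" if "x \<in> H" for x
      using that H(2) HV[OF H(1)] lin_zero[OF f VO_module[OF W] VO_module[OF W']] by (simp add: compose_eq)
    then show ?thesis
      using c' H(1) lin_compose[OF hom_fun_lin[OF sm c] f VO_module[OF V]]
      by (auto simp: filter_kernel_iff[OF EV W'] kills_def Yoneda_act[OF V W W' f c])
  qed
qed

lemma Q_eq: "\<Q> K EE = {quotient_functor K (Yoneda K V) (filter_kernel V \<F>) | V \<F>. (V, \<F>) \<in> EE}"
  unfolding \<Q>_def filter_kernel_def ..

lemma free_iff_closed:
  "X \<in> free_objects K (\<Q> K EE) \<longleftrightarrow> X \<in> Obj (Ind_Vect_op K) \<and> closed X (\<lambda>V. {\<zero>\<^bsub>omap X V\<^esub>})"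
proof
  assume free: "X \<in> free_objects K (\<Q> K EE)"
  then have XI: "X \<in> Obj (Ind_Vect_op K)" by (simp add: free_objects_def)
  then have X: "X \<in> FO" by simp
  have "x = \<zero>\<^bsub>omap X V\<^esub>" if EV: "(V, \<F>) \<in> EE" and x: "x \<in> el X V"
    and k: "\<And>W f. W \<in> VO \<Longrightarrow> kills V \<F> W f \<Longrightarrow> act X V W f x = \<zero>\<^bsub>omap X W\<^esub>" for V \<F> x
  proof -
    note V = E_VO[OF EV]
    note Y = Yoneda_FO[OF V] and S = filter_kernel_subfun[OF EV] and y = yoneda_arrow_Hom[OF V X x]
    let ?q = "quotient_arrow (Yoneda K V) (filter_kernel V \<F>)"
    \<comment> \<open>By assumption on \<open>x\<close>, the arrow attached to it kills the
      subfunctor that is divided out, so it factors through a member of \<open>\<Q>\<close>.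
      Freeness makes the factor \<open>g\<close> zero, and \<open>x\<close> is the value of
      \<open>g\<close> at the class of the identity.\<close>
    obtain g where g: "g \<in> mor (quotient_functor K (Yoneda K V) (filter_kernel V \<F>)) X"
      and gq: "Comp (Vect_Vect K) g ?q = yoneda_arrow V X x"
    proof -
      have "cmp (yoneda_arrow V X x) W p = \<zero>\<^bsub>omap X W\<^esub>" if "W \<in> VO" "p \<in> filter_kernel V \<F> W" for W p
        using that k by (simp add: filter_kernel_iff[OF EV] cmp_yoneda_arrow[OF V X x])
      then show ?thesis using quotient_factor[OF Y S y] that by blast
    qed
    have "zero_arrow (Vect_Vect K) g" using free g EV unfolding free_objects_def Q_eq by blast
    then have gz: "cmp g W z = \<zero>\<^bsub>omap X W\<^esub>"
      if "W \<in> VO" "z \<in> el (quotient_functor K (Yoneda K V) (filter_kernel V \<F>)) W" for W z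
      using that zero_arrow_iff[OF g] by blast
    note q = quotient_arrow_Hom[OF Y S]
    have gidY: "gid V \<in> el (Yoneda K V) V" using gid[OF V] by (simp add: Yoneda_omap[OF V V])
    have "x = cmp (yoneda_arrow V X x) V (gid V)"
      by (simp add: cmp_yoneda_arrow_graph[OF V X x V lin_id[OF VO_module[OF V]]] F_id[OF X V x])
    also have "\<dots> = cmp g V (cmp ?q V (gid V))"
      by (simp add: cmp_Comp[OF q g V gidY] flip: gq)
    also have "\<dots> = \<zero>\<^bsub>omap X V\<^esub>" by (rule gz[OF V cmp_closed[OF q V gidY]])
    finally show ?thesis .
  qed
  then have "closed X (\<lambda>V. {\<zero>\<^bsub>omap X V\<^esub>})" unfolding closed_def using zero_subfun[OF X] by blast
  then show "X \<in> Obj (Ind_Vect_op K) \<and> closed X (\<lambda>V. {\<zero>\<^bsub>omap X V\<^esub>})" using XI by simp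
next
  assume a: "X \<in> Obj (Ind_Vect_op K) \<and> closed X (\<lambda>V. {\<zero>\<^bsub>omap X V\<^esub>})"
  then have X: "X \<in> FO" and cl: "closed X (\<lambda>V. {\<zero>\<^bsub>omap X V\<^esub>})" by simp_all
  have "zero_arrow (Vect_Vect K) t" if Q: "Q \<in> \<Q> K EE" and t: "t \<in> mor Q X" for Q t
  proof -
    obtain V \<F> where EV: "(V, \<F>) \<in> EE" and Qe: "Q = quotient_functor K (Yoneda K V) (filter_kernel V \<F>)"
      using Q unfolding Q_eq by blast
    note V = E_VO[OF EV]
    note Y = Yoneda_FO[OF V] and S = filter_kernel_subfun[OF EV]
    note q = quotient_arrow_Hom[OF Y S]
    let ?q = "quotient_arrow (Yoneda K V) (filter_kernel V \<F>)"
    let ?u = "Comp (Vect_Vect K) t ?q"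
    have t': "t \<in> mor (quotient_functor K (Yoneda K V) (filter_kernel V \<F>)) X" using t Qe by simp
    have u: "?u \<in> mor (Yoneda K V) X" by (rule VV_comp_Hom[OF q t'])
    have gidY: "gid V \<in> el (Yoneda K V) V" using gid[OF V] by (simp add: Yoneda_omap[OF V V])
    \<comment> \<open>The maps in \<open>kills\<close> have graphs that become zero in the quotient,
      so they annihilate the image of the identity under \<open>?u\<close>. As zero is closed, this
      image is zero, and by Yoneda so is all of \<open>?u\<close>.\<close>
    have "cmp ?u V (gid V) \<in> {\<zero>\<^bsub>omap X V\<^esub>}"
    proof (rule closedD[OF cl EV cmp_closed[OF u V gidY]])
      fix W f assume W: "W \<in> VO" and f: "kills V \<F> W f"
      have fh: "graph (carrier V) f \<in> el (Yoneda K V) W"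
        using graph_in_hom_space[OF kills_lin[OF f]] by (simp add: Yoneda_omap[OF V W])
      have "graph (carrier V) f \<in> filter_kernel V \<F> W"
        using f graph_in_hom_space[OF kills_lin[OF f]]
        by (simp add: filter_kernel_iff[OF EV W] hom_fun_graph[OF VO_small[OF V] kills_lin[OF f]])
      then have "cmp ?q W (graph (carrier V) f) = \<zero>\<^bsub>omap (quotient_functor K (Yoneda K V) (filter_kernel V \<F>)) W\<^esub>"
        using quotient_functor_ops(4)[OF Y S W fh] by (simp add: cmp_quotient_arrow[OF Y S W fh])
      then have z: "cmp ?u W (graph (carrier V) f) = \<zero>\<^bsub>omap X W\<^esub>"
        by (simp add: cmp_Comp[OF q t' W fh] lin_zero[OF cmp_lin[OF t' W] F_module[OF quotient_functor_FO[OF Y S] W] F_module[OF X W]])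
      have "act X V W f (cmp ?u V (gid V)) = cmp ?u W (act (Yoneda K V) V W f (gid V))"
        by (rule cmp_natural[OF u V W kills_lin[OF f] gidY, symmetric])
      then show "act X V W f (cmp ?u V (gid V)) \<in> {\<zero>\<^bsub>omap X W\<^esub>}"
        by (simp add: Yoneda_act_id[OF V W kills_lin[OF f]] z)
    qed
    then have u0: "cmp ?u V (gid V) = \<zero>\<^bsub>omap X V\<^esub>" by simp
    have uz: "cmp ?u W p = \<zero>\<^bsub>omap X W\<^esub>" if W: "W \<in> VO" and p: "p \<in> carrier (hom_space K V W)" for W p
      using yoneda_at_id[OF V u W p]
        lin_zero[OF F_lin[OF X V W hom_fun_lin[OF VO_small[OF V] p]] F_module[OF X V] F_module[OF X W]] by (simp add: u0)
    have "cmp t W z = \<zero>\<^bsub>omap X W\<^esub>" if W: "W \<in> VO" and "z \<in> el Q W" for W z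
    proof -
      obtain p where p: "p \<in> el (Yoneda K V) W" "z = coset (omap (Yoneda K V) W) (filter_kernel V \<F> W) p"
        using \<open>z \<in> el Q W\<close> by (auto simp: Qe quotient_functor_carrier[OF Y S W])
      have "cmp t W z = cmp ?u W p"
        by (simp add: cmp_Comp[OF q t' W p(1)] cmp_quotient_arrow[OF Y S W p(1)] p(2))
      then show ?thesis using uz[OF W] p(1) by (simp add: Yoneda_omap[OF V W])
    qed
    then show ?thesis using zero_arrow_iff[OF t] by blast
  qed
  then show "X \<in> free_objects K (\<Q> K EE)" using a unfolding free_objects_def by blast
qed

text \<open>The zero subfunctor lies in every subfunctor, so it is closed iff it is the least closed
  one.\<close>

lemma free_iff_torsion:
  "X \<in> free_objects K (\<Q> K EE) \<longleftrightarrow>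
    X \<in> Obj (Ind_Vect_op K) \<and> (\<forall>V\<in>VO. torsion X V = {\<zero>\<^bsub>omap X V\<^esub>})"
proof -
  have "closed X (\<lambda>V. {\<zero>\<^bsub>omap X V\<^esub>}) \<longleftrightarrow> (\<forall>V\<in>VO. torsion X V = {\<zero>\<^bsub>omap X V\<^esub>})"
    if X: "X \<in> FO"
  proof
    assume cl: "closed X (\<lambda>V. {\<zero>\<^bsub>omap X V\<^esub>})"
    show "\<forall>V\<in>VO. torsion X V = {\<zero>\<^bsub>omap X V\<^esub>}"
      using torsion_least[OF cl] subfun_D(2)[OF X torsion_subfun[OF X]] by blast
  next
    assume t: "\<forall>V\<in>VO. torsion X V = {\<zero>\<^bsub>omap X V\<^esub>}"
    show "closed X (\<lambda>V. {\<zero>\<^bsub>omap X V\<^esub>})"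
      unfolding closed_def
    proof (intro conjI allI impI)
      fix V \<F> x assume EV: "(V, \<F>) \<in> EE" and x: "x \<in> el X V"
        and k: "\<forall>W\<in>VO. \<forall>f. kills V \<F> W f \<longrightarrow> act X V W f x \<in> {\<zero>\<^bsub>omap X W\<^esub>}"
      have "x \<in> torsion X V" by (rule closedD[OF closed_torsion[OF X] EV x]) (use k t in auto)
      then show "x \<in> {\<zero>\<^bsub>omap X V\<^esub>}" using t E_VO[OF EV] by simp
    qed (rule zero_subfun[OF X])
  qed
  then show ?thesis by (auto simp: free_iff_closed)
qed

abbreviation reflection :: "('k, 'u) vfunctor \<Rightarrow> ('k, 'u) vfunctor" where
  "reflection X \<equiv> quotient_functor K X (torsion X)"

text \<open>A class that the maps in \<open>kills\<close> annihilate has a representative that they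
  send into \<open>torsion X\<close>; as \<open>torsion X\<close> is closed, the representative lies
  in it and the class is zero. Smallness comes from \<open>generated_quotient\<close>.\<close>

lemma reflection_free:
  assumes "X \<in> Obj (Ind_Vect_op K)"
  shows "reflection X \<in> free_objects K (\<Q> K EE)"
proof -
  have X: "X \<in> FO" and sm: "small_functor K X" using assms by auto
  note T = torsion_subfun[OF X]
  note Q = quotient_functor_FO[OF X T]
  obtain V where "generated X V" using small_functor_generated[OF sm] by blast
  then have s: "small_functor K (reflection X)"
    using generated_quotient[OF X T] generated_small_functor[OF Q] by blast
  have "closed (reflection X) (\<lambda>V. {\<zero>\<^bsub>omap (reflection X) V\<^esub>})"
    unfolding closed_def
  proof (intro conjI allI impI)
    fix V \<F> p assume EV: "(V, \<F>) \<in> EE" and p: "p \<in> el (reflection X) V"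
      and k: "\<forall>W\<in>VO. \<forall>f. kills V \<F> W f \<longrightarrow> act (reflection X) V W f p \<in> {\<zero>\<^bsub>omap (reflection X) W\<^esub>}"
    note V = E_VO[OF EV]
    obtain x where x: "x \<in> el X V" and px: "p = coset (omap X V) (torsion X V) x"
      using p by (auto simp: quotient_functor_carrier[OF X T V])
    have "x \<in> torsion X V"
    proof (rule closedD[OF closed_torsion[OF X] EV x])
      fix W f assume W: "W \<in> VO" and f: "kills V \<F> W f"
      then have "act (reflection X) V W f p = \<zero>\<^bsub>omap (reflection X) W\<^esub>" using k by blast
      then show "act X V W f x \<in> torsion X W"
        using quotient_functor_ops(4)[OF X T W F_closed[OF X V W kills_lin[OF f] x]]
        by (simp add: px quotient_functor_act[OF X T V W kills_lin[OF f] x])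
    qed
    then show "p \<in> {\<zero>\<^bsub>omap (reflection X) V\<^esub>}" using quotient_functor_ops(4)[OF X T V x] px by simp
  qed (rule zero_subfun[OF Q])
  then show ?thesis using Q s by (simp add: free_iff_closed)
qed

text \<open>Arrows preserve torsion, so those into a free object kill \<open>torsion X\<close> and
  factor uniquely through the quotient. The unit is surjective at every space, hence epi.\<close>

lemma free_epi_reflective: "epi_reflective (Ind_Vect_op K) (free_objects K (\<Q> K EE))"
proof (rule cat.epi_reflectiveI[OF cat_Ind, where r = reflection and \<eta> = "\<lambda>X. quotient_arrow X (torsion X)"])
  show "free_objects K (\<Q> K EE) \<subseteq> Obj (Ind_Vect_op K)" by (auto simp: free_objects_def)
  fix X :: "('k, 'u) vfunctor" assume XI: "X \<in> Obj (Ind_Vect_op K)"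
  then have X: "X \<in> FO" by simp
  note T = torsion_subfun[OF X]
  note q = quotient_arrow_Hom[OF X T]
  show "reflection X \<in> free_objects K (\<Q> K EE)" by (rule reflection_free[OF XI])
  have rI: "reflection X \<in> Obj (Ind_Vect_op K)" using reflection_free[OF XI] by (simp add: free_objects_def)
  show qI: "quotient_arrow X (torsion X) \<in> Hom (Ind_Vect_op K) X (reflection X)"
    using q XI rI by (simp add: Ind_Hom_iff)
  show "\<exists>!g. g \<in> Hom (Ind_Vect_op K) (reflection X) Y \<and> Comp (Ind_Vect_op K) g (quotient_arrow X (torsion X)) = t"
    if Y: "Y \<in> free_objects K (\<Q> K EE)" and tI: "t \<in> Hom (Ind_Vect_op K) X Y" for Y t
  proof -
    have t: "t \<in> mor X Y" and "small_functor K Y" using tI by (simp_all add: Ind_Hom_iff)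
    have "cmp t V x = \<zero>\<^bsub>omap Y V\<^esub>" if "V \<in> VO" "x \<in> torsion X V" for V x
      using torsion_map[OF t that(2)] Y that(1) by (simp add: free_iff_torsion)
    then show ?thesis
      using quotient_factor[OF X T t] rI \<open>small_functor K Y\<close> by (simp add: Ind_Hom_iff)
  qed
  show "epi (Ind_Vect_op K) (quotient_arrow X (torsion X))"
    unfolding epi_def
  proof (intro conjI ballI impI)
    show "quotient_arrow X (torsion X) \<in> Arr (Ind_Vect_op K)" using qI by (simp add: Hom_def)
    fix f g assume f: "f \<in> Arr (Ind_Vect_op K)" and g: "g \<in> Arr (Ind_Vect_op K)"
      and fg: "Dom (Ind_Vect_op K) f = Cod (Ind_Vect_op K) (quotient_arrow X (torsion X)) \<and>
        Dom (Ind_Vect_op K) g = Cod (Ind_Vect_op K) (quotient_arrow X (torsion X)) \<and>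
        Cod (Ind_Vect_op K) f = Cod (Ind_Vect_op K) g \<and>
        Comp (Ind_Vect_op K) f (quotient_arrow X (torsion X)) = Comp (Ind_Vect_op K) g (quotient_arrow X (torsion X))"
    have cod: "Cod (Vect_Vect K) (quotient_arrow X (torsion X)) = reflection X" using q by (simp add: Hom_def)
    have f': "f \<in> mor (reflection X) (Cod (Vect_Vect K) f)"
      and g': "g \<in> mor (reflection X) (Cod (Vect_Vect K) f)"
      using cat.Arr_Hom[OF cat_Ind f] cat.Arr_Hom[OF cat_Ind g] fg by (simp_all add: Ind_Hom_iff cod)
    show "f = g"
    proof (rule Hom_eqI[OF f' g'])
      fix V p assume V: "V \<in> VO" and p: "p \<in> el (reflection X) V"
      obtain x where x: "x \<in> el X V" and px: "p = coset (omap X V) (torsion X V) x"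
        using p by (auto simp: quotient_functor_carrier[OF X T V])
      show "cmp f V p = cmp g V p"
        using cmp_Comp[OF q f' V x] cmp_Comp[OF q g' V x] fg by (simp add: cmp_quotient_arrow[OF X T V x] px)
    qed
  qed
qed

section \<open>The torsion theory\<close>

text \<open>\<open>torsion_equiv\<close> says that \<open>t\<close> induces an isomorphism of reflections, \<open>torsion_iso\<close> that it
  restricts to an isomorphism of torsion subfunctors.\<close>

definition torsion_equiv :: "('k, 'u) vnat \<Rightarrow> bool" where
  "torsion_equiv t \<longleftrightarrow> (\<forall>W\<in>VO.
     (\<forall>x\<in>el (Dom (Vect_Vect K) t) W.
        cmp t W x \<in> torsion (Cod (Vect_Vect K) t) W \<longrightarrow> x \<in> torsion (Dom (Vect_Vect K) t) W) \<and>
     (\<forall>y\<in>el (Cod (Vect_Vect K) t) W. \<exists>x\<in>el (Dom (Vect_Vect K) t) W.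
        y \<ominus>\<^bsub>omap (Cod (Vect_Vect K) t) W\<^esub> cmp t W x \<in> torsion (Cod (Vect_Vect K) t) W))"

definition torsion_iso :: "('k, 'u) vnat \<Rightarrow> bool" where
  "torsion_iso t \<longleftrightarrow> (\<forall>W\<in>VO.
     bij_betw (cmp t W) (torsion (Dom (Vect_Vect K) t) W) (torsion (Cod (Vect_Vect K) t) W))"

abbreviation "equivs \<equiv> {t \<in> Arr (Ind_Vect_op K). torsion_equiv t}"
abbreviation "isos \<equiv> {t \<in> Arr (Ind_Vect_op K). torsion_iso t}"

section \<open>The two classes of arrows and the 3-for-2 property\<close>

lemma Hom_Dom_Cod:
  "t \<in> mor X Y \<Longrightarrow> Dom (Vect_Vect K) t = X \<and> Cod (Vect_Vect K) t = Y"
  by (simp add: Hom_def)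

lemma torsion_equivI:
  assumes "t \<in> mor X Y"
    and "\<And>W x. W \<in> VO \<Longrightarrow> x \<in> el X W \<Longrightarrow> cmp t W x \<in> torsion Y W \<Longrightarrow> x \<in> torsion X W"
    and "\<And>W y. W \<in> VO \<Longrightarrow> y \<in> el Y W \<Longrightarrow>
      \<exists>x\<in>el X W. y \<ominus>\<^bsub>omap Y W\<^esub> cmp t W x \<in> torsion Y W"
  shows "torsion_equiv t"
  unfolding torsion_equiv_def using Hom_Dom_Cod[OF assms(1)] assms(2,3) by simp

lemma torsion_equivD:
  assumes "torsion_equiv t" "t \<in> mor X Y" "W \<in> VO"
  shows "x \<in> el X W \<Longrightarrow> cmp t W x \<in> torsion Y W \<Longrightarrow> x \<in> torsion X W"
    and "y \<in> el Y W \<Longrightarrow> \<exists>x\<in>el X W. y \<ominus>\<^bsub>omap Y W\<^esub> cmp t W x \<in> torsion Y W"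
  using assms Hom_Dom_Cod[OF assms(2)] unfolding torsion_equiv_def by simp_all

lemma torsion_iso_iff:
  "t \<in> mor X Y \<Longrightarrow>
    torsion_iso t \<longleftrightarrow> (\<forall>W\<in>VO. bij_betw (cmp t W) (torsion X W) (torsion Y W))"
  unfolding torsion_iso_def by (simp add: Hom_Dom_Cod)

lemma torsion_D:
  assumes "X \<in> FO" "V \<in> VO"
  shows "\<zero>\<^bsub>omap X V\<^esub> \<in> torsion X V"
    "\<And>x y. x \<in> torsion X V \<Longrightarrow> y \<in> torsion X V \<Longrightarrow> x \<oplus>\<^bsub>omap X V\<^esub> y \<in> torsion X V"
    "\<And>x y. x \<in> torsion X V \<Longrightarrow> y \<in> torsion X V \<Longrightarrow> x \<ominus>\<^bsub>omap X V\<^esub> y \<in> torsion X V"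
    "\<And>a x. a \<in> carrier K \<Longrightarrow> x \<in> torsion X V \<Longrightarrow> a \<odot>\<^bsub>omap X V\<^esub> x \<in> torsion X V"
    "\<And>W f x. W \<in> VO \<Longrightarrow> f \<in> lin V W \<Longrightarrow> x \<in> torsion X V \<Longrightarrow> act X V W f x \<in> torsion X W"
  using subfun_D[OF assms(1) torsion_subfun[OF assms(1)] assms(2)]
    subfun_act[OF assms(1) torsion_subfun[OF assms(1)] assms(2)] by simp_all

lemma Arr_Ind_comp:
  assumes "f \<in> Arr (Ind_Vect_op K)" "g \<in> Arr (Ind_Vect_op K)"
    "Cod (Ind_Vect_op K) f = Dom (Ind_Vect_op K) g"
  obtains X Y Z where "f \<in> mor X Y" "g \<in> mor Y Z"
    "Comp (Ind_Vect_op K) g f \<in> mor X Z" "Comp (Ind_Vect_op K) g f \<in> Arr (Ind_Vect_op K)"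
proof -
  have f: "f \<in> Hom (Ind_Vect_op K) (Dom (Vect_Vect K) f) (Dom (Vect_Vect K) g)"
    and g: "g \<in> Hom (Ind_Vect_op K) (Dom (Vect_Vect K) g) (Cod (Vect_Vect K) g)"
    using cat.Arr_Hom[OF cat_Ind assms(1)] cat.Arr_Hom[OF cat_Ind assms(2)] assms(3) by simp_all
  note gf = cat.Comp_Hom[OF cat_Ind f g]
  show ?thesis
    using that[of "Dom (Vect_Vect K) f" "Dom (Vect_Vect K) g" "Cod (Vect_Vect K) g"] f g gf
      cat.Hom_Arr(1)[OF cat_Ind gf] by (simp add: Ind_Hom_iff)
qed

text \<open>At each space this is the same property of bijections, since arrows restrict to the
  torsion parts.\<close>

lemma three_for_two_isos: "three_for_two (Ind_Vect_op K) isos"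
  unfolding three_for_two_def
proof (intro ballI impI)
  fix f g :: "('k, 'u) vnat"
  assume fA: "f \<in> Arr (Ind_Vect_op K)" and gA: "g \<in> Arr (Ind_Vect_op K)"
    and fg: "Cod (Ind_Vect_op K) f = Dom (Ind_Vect_op K) g"
  obtain X Y Z where f: "f \<in> mor X Y" and g: "g \<in> mor Y Z"
    and gf: "Comp (Ind_Vect_op K) g f \<in> mor X Z" and gfA: "Comp (Ind_Vect_op K) g f \<in> Arr (Ind_Vect_op K)"
    by (rule Arr_Ind_comp[OF fA gA fg]) blast
  let ?h = "Comp (Ind_Vect_op K) g f"
  have h: "bij_betw (cmp ?h W) (torsion X W) (torsion Z W) \<longleftrightarrow>
      bij_betw (cmp g W \<circ> cmp f W) (torsion X W) (torsion Z W)" if "W \<in> VO" for W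
    by (rule bij_betw_cong) (simp add: cmp_Comp[OF f g that] torsion_carrier)
  have im: "cmp f W ` torsion X W \<subseteq> torsion Y W" for W using torsion_map[OF f] by blast
  have "bij_betw (cmp g W) (torsion Y W) (torsion Z W) \<longleftrightarrow> bij_betw (cmp ?h W) (torsion X W) (torsion Z W)"
    if "W \<in> VO" "bij_betw (cmp f W) (torsion X W) (torsion Y W)" for W
    unfolding h[OF that(1)] by (rule bij_betw_comp_iff[OF that(2)])
  moreover have "bij_betw (cmp f W) (torsion X W) (torsion Y W) \<longleftrightarrow> bij_betw (cmp ?h W) (torsion X W) (torsion Z W)"
    if "W \<in> VO" "bij_betw (cmp g W) (torsion Y W) (torsion Z W)" for W
    unfolding h[OF that(1)] by (rule bij_betw_comp_iff2[OF that(2) im])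
  ultimately show "(f \<in> isos \<and> g \<in> isos \<longrightarrow> ?h \<in> isos) \<and> (f \<in> isos \<and> ?h \<in> isos \<longrightarrow> g \<in> isos) \<and> (g \<in> isos \<and> ?h \<in> isos \<longrightarrow> f \<in> isos)"
    unfolding mem_Collect_eq torsion_iso_iff[OF f] torsion_iso_iff[OF g] torsion_iso_iff[OF gf]
    using fA gA gfA by blast
qed

text \<open>The property of bijections for the maps induced on quotients by torsion, carried out on
  representatives. The two clauses of \<open>torsion_equiv\<close> are injectivity and surjectivity
  of such a map.\<close>

lemma three_for_two_equivs: "three_for_two (Ind_Vect_op K) equivs"
  unfolding three_for_two_def
proof (intro ballI impI)
  fix f g :: "('k, 'u) vnat"
  assume fA: "f \<in> Arr (Ind_Vect_op K)" and gA: "g \<in> Arr (Ind_Vect_op K)"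
    and fg: "Cod (Ind_Vect_op K) f = Dom (Ind_Vect_op K) g"
  obtain X Y Z where f: "f \<in> mor X Y" and g: "g \<in> mor Y Z"
    and gf: "Comp (Ind_Vect_op K) g f \<in> mor X Z" and gfA: "Comp (Ind_Vect_op K) g f \<in> Arr (Ind_Vect_op K)"
    by (rule Arr_Ind_comp[OF fA gA fg]) blast
  let ?h = "Comp (Vect_Vect K) g f"
  note gf = gf[unfolded Ind_simps(5)] and gfA = gfA[unfolded Ind_simps(5)]
  note X = Hom_dom[OF f] and Y = Hom_cod[OF f] and Z = Hom_cod[OF g]
  have h: "cmp ?h W x = cmp g W (cmp f W x)" if "W \<in> VO" "x \<in> el X W" for W x
    using cmp_Comp[OF f g that] by simp
  have "torsion_equiv ?h" if fE: "torsion_equiv f" and gE: "torsion_equiv g"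
  proof (rule torsion_equivI[OF gf])
    fix W :: "('k, 'u) vs" assume W: "W \<in> VO"
    interpret ZW: module K "omap Z W" by (rule F_module[OF Z W])
    note cf = cmp_closed[OF f W] and cg = cmp_closed[OF g W]
    show "x \<in> torsion X W" if "x \<in> el X W" "cmp ?h W x \<in> torsion Z W" for x
      using that torsion_equivD(1)[OF fE f W] torsion_equivD(1)[OF gE g W] cf by (simp add: h W)
    fix z assume z: "z \<in> el Z W"
    obtain y where y: "y \<in> el Y W" "z \<ominus>\<^bsub>omap Z W\<^esub> cmp g W y \<in> torsion Z W"
      using torsion_equivD(2)[OF gE g W z] by blast
    obtain x where x: "x \<in> el X W" "y \<ominus>\<^bsub>omap Y W\<^esub> cmp f W x \<in> torsion Y W"
      using torsion_equivD(2)[OF fE f W y(1)] by blast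
    have "cmp g W y \<ominus>\<^bsub>omap Z W\<^esub> cmp g W (cmp f W x) \<in> torsion Z W"
      using torsion_map[OF g x(2)] lin_minus[OF cmp_lin[OF g W] F_module[OF Y W] F_module[OF Z W] y(1) cf[OF x(1)]] by simp
    from torsion_D(2)[OF Z W y(2) this]
    have "z \<ominus>\<^bsub>omap Z W\<^esub> cmp ?h W x \<in> torsion Z W"
      using ZW.M.minus_trans[OF z cg[OF y(1)] cg[OF cf[OF x(1)]]] x(1) by (simp add: h W)
    then show "\<exists>x\<in>el X W. z \<ominus>\<^bsub>omap Z W\<^esub> cmp ?h W x \<in> torsion Z W" using x(1) by blast
  qed
  moreover have "torsion_equiv g" if fE: "torsion_equiv f" and hE: "torsion_equiv ?h"
  proof (rule torsion_equivI[OF g])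
    fix W :: "('k, 'u) vs" assume W: "W \<in> VO"
    interpret YW: module K "omap Y W" by (rule F_module[OF Y W])
    interpret ZW: module K "omap Z W" by (rule F_module[OF Z W])
    note cf = cmp_closed[OF f W] and cg = cmp_closed[OF g W]
    show "y \<in> torsion Y W" if y: "y \<in> el Y W" and gy: "cmp g W y \<in> torsion Z W" for y
    proof -
      obtain x where x: "x \<in> el X W" "y \<ominus>\<^bsub>omap Y W\<^esub> cmp f W x \<in> torsion Y W"
        using torsion_equivD(2)[OF fE f W y] by blast
      have "cmp g W y \<ominus>\<^bsub>omap Z W\<^esub> cmp g W (cmp f W x) \<in> torsion Z W"
        using torsion_map[OF g x(2)] lin_minus[OF cmp_lin[OF g W] F_module[OF Y W] F_module[OF Z W] y cf[OF x(1)]] by simp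
      from torsion_D(3)[OF Z W gy this] have "cmp ?h W x \<in> torsion Z W"
        using ZW.M.minus_minus_self[OF cg[OF y] cg[OF cf[OF x(1)]]] x(1) by (simp add: h W)
      then have "x \<in> torsion X W" by (rule torsion_equivD(1)[OF hE gf W x(1)])
      from torsion_D(2)[OF Y W x(2) torsion_map[OF f this]]
      show ?thesis using YW.M.minus_add_cancel[OF y cf[OF x(1)]] by simp
    qed
    fix z assume z: "z \<in> el Z W"
    obtain x where "x \<in> el X W" "z \<ominus>\<^bsub>omap Z W\<^esub> cmp ?h W x \<in> torsion Z W"
      using torsion_equivD(2)[OF hE gf W z] by blast
    then show "\<exists>y\<in>el Y W. z \<ominus>\<^bsub>omap Z W\<^esub> cmp g W y \<in> torsion Z W" using cf by (auto simp: h W)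
  qed
  moreover have "torsion_equiv f" if gE: "torsion_equiv g" and hE: "torsion_equiv ?h"
  proof (rule torsion_equivI[OF f])
    fix W :: "('k, 'u) vs" assume W: "W \<in> VO"
    interpret YW: module K "omap Y W" by (rule F_module[OF Y W])
    note cf = cmp_closed[OF f W] and cg = cmp_closed[OF g W]
    show "x \<in> torsion X W" if "x \<in> el X W" "cmp f W x \<in> torsion Y W" for x
      using torsion_equivD(1)[OF hE gf W that(1)] torsion_map[OF g that(2)] that(1) by (simp add: h W)
    fix y assume y: "y \<in> el Y W"
    obtain x where x: "x \<in> el X W" "cmp g W y \<ominus>\<^bsub>omap Z W\<^esub> cmp ?h W x \<in> torsion Z W"
      using torsion_equivD(2)[OF hE gf W cg[OF y]] by blast
    have "cmp g W (y \<ominus>\<^bsub>omap Y W\<^esub> cmp f W x) \<in> torsion Z W"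
      using x lin_minus[OF cmp_lin[OF g W] F_module[OF Y W] F_module[OF Z W] y cf[OF x(1)]] by (simp add: h W)
    then have "y \<ominus>\<^bsub>omap Y W\<^esub> cmp f W x \<in> torsion Y W"
      using torsion_equivD(1)[OF gE g W] YW.M.minus_closed[OF y cf[OF x(1)]] by blast
    then show "\<exists>x\<in>el X W. y \<ominus>\<^bsub>omap Y W\<^esub> cmp f W x \<in> torsion Y W" using x(1) by blast
  qed
  ultimately show "(f \<in> equivs \<and> g \<in> equivs \<longrightarrow> Comp (Ind_Vect_op K) g f \<in> equivs) \<and>
      (f \<in> equivs \<and> Comp (Ind_Vect_op K) g f \<in> equivs \<longrightarrow> g \<in> equivs) \<and>
      (g \<in> equivs \<and> Comp (Ind_Vect_op K) g f \<in> equivs \<longrightarrow> f \<in> equivs)"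
    unfolding Ind_simps(5) using fA gA gfA by blast
qed

text \<open>Modulo torsion every \<open>y \<in> B W\<close> is \<open>e x\<close> for some \<open>x\<close>, and the diagonal sends \<open>y\<close> to the unique
  \<open>z\<close> that is congruent to \<open>l x\<close> modulo torsion and satisfies \<open>m z = k y\<close>.\<close>

lemma orthogonal_equiv_iso:
  assumes eE: "e \<in> equivs" and mM: "m \<in> isos"
  shows "orthogonal (Ind_Vect_op K) e m"
proof -
  obtain A B where eI: "e \<in> Hom (Ind_Vect_op K) A B" and te: "torsion_equiv e"
    using eE cat.Arr_Hom[OF cat_Ind, of e] by blast
  obtain C D where mI: "m \<in> Hom (Ind_Vect_op K) C D" and tm: "torsion_iso m"
    using mM cat.Arr_Hom[OF cat_Ind, of m] by blast
  have e: "e \<in> mor A B" and m: "m \<in> mor C D"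
    and sm: "small_functor K B" "small_functor K C" using eI mI by (simp_all add: Ind_Hom_iff)
  note A = Hom_dom[OF e] and B = Hom_cod[OF e] and C = Hom_dom[OF m] and D = Hom_cod[OF m]
  have bij: "bij_betw (cmp m W) (torsion C W) (torsion D W)" if "W \<in> VO" for W
    using tm that by (simp add: torsion_iso_iff[OF m])
  have "\<exists>!h. h \<in> mor B C \<and> Comp (Vect_Vect K) h e = l \<and> Comp (Vect_Vect K) m h = k"
    if l: "l \<in> mor A C" and k: "k \<in> mor B D"
      and sq: "Comp (Vect_Vect K) m l = Comp (Vect_Vect K) k e" for l k
  proof -
    have sq': "cmp m W (cmp l W x) = cmp k W (cmp e W x)" if "W \<in> VO" "x \<in> el A W" for W x
      using cmp_Comp[OF l m that] cmp_Comp[OF e k that] sq by simp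
    let ?R = "\<lambda>W y z. y \<in> el B W \<and> z \<in> el C W \<and> cmp m W z = cmp k W y \<and>
      (\<exists>x\<in>el A W. y \<ominus>\<^bsub>omap B W\<^esub> cmp e W x \<in> torsion B W \<and> z \<ominus>\<^bsub>omap C W\<^esub> cmp l W x \<in> torsion C W)"
    obtain h where h: "h \<in> mor B C"
      and hR: "\<And>W y z. W \<in> VO \<Longrightarrow> y \<in> el B W \<Longrightarrow> ?R W y z \<longleftrightarrow> z = cmp h W y"
    proof (rule hom_of_relation[OF B C, where R = ?R])
      fix W :: "('k, 'u) vs" assume W: "W \<in> VO"
      interpret AW: module K "omap A W" by (rule F_module[OF A W])
      interpret BW: module K "omap B W" by (rule F_module[OF B W])
      interpret CW: module K "omap C W" by (rule F_module[OF C W])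
      interpret DW: module K "omap D W" by (rule F_module[OF D W])
      note mod = F_module[OF A W] F_module[OF B W] F_module[OF C W] F_module[OF D W]
      note cl = cmp_closed[OF e W] cmp_closed[OF m W] cmp_closed[OF l W] cmp_closed[OF k W]
      note pl = lin_plus[OF cmp_lin[OF e W]] lin_plus[OF cmp_lin[OF m W]] lin_plus[OF cmp_lin[OF l W]] lin_plus[OF cmp_lin[OF k W]]
      note sc = lin_scale[OF cmp_lin[OF e W]] lin_scale[OF cmp_lin[OF m W]] lin_scale[OF cmp_lin[OF l W]] lin_scale[OF cmp_lin[OF k W]]
      note mi = lin_minus[OF cmp_lin[OF m W] mod(3,4)] lin_minus[OF cmp_lin[OF k W] mod(2,4)]
      show "y \<in> el B W \<and> z \<in> el C W" if "?R W y z" for y z using that by blast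
      show "\<exists>z. ?R W y z" if y: "y \<in> el B W" for y
      proof -
        obtain x where x: "x \<in> el A W" "y \<ominus>\<^bsub>omap B W\<^esub> cmp e W x \<in> torsion B W"
          using torsion_equivD(2)[OF te e W y] by blast
        \<comment> \<open>The error \<open>k (y - e x)\<close> is torsion, so it is
          \<open>m c\<close> for a torsion vector \<open>c\<close>. Then \<open>z = c + l x\<close>
          is the required value, since \<open>m (l x) = k (e x)\<close>.\<close>
        have "cmp k W (y \<ominus>\<^bsub>omap B W\<^esub> cmp e W x) \<in> cmp m W ` torsion C W"
          using torsion_map[OF k x(2)] by (simp add: bij_betw_imp_surj_on[OF bij[OF W]])
        then obtain c where c': "cmp k W (y \<ominus>\<^bsub>omap B W\<^esub> cmp e W x) = cmp m W c" and c: "c \<in> torsion C W"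
          by (rule imageE)
        note cc = torsion_carrier[OF c]
        have "cmp m W (c \<oplus>\<^bsub>omap C W\<^esub> cmp l W x) = (cmp k W y \<ominus>\<^bsub>omap D W\<^esub> cmp k W (cmp e W x)) \<oplus>\<^bsub>omap D W\<^esub> cmp k W (cmp e W x)"
          using x cc cl y by (simp add: pl mi sq'[OF W] flip: c')
        also have "\<dots> = cmp k W y" using x cl y by (intro DW.M.minus_add_cancel) auto
        finally have "cmp m W (c \<oplus>\<^bsub>omap C W\<^esub> cmp l W x) = cmp k W y" .
        moreover have "(c \<oplus>\<^bsub>omap C W\<^esub> cmp l W x) \<ominus>\<^bsub>omap C W\<^esub> cmp l W x = c"
          using cc cl(3)[OF x(1)] by (rule CW.M.add_minus_cancel)
        ultimately have "?R W y (c \<oplus>\<^bsub>omap C W\<^esub> cmp l W x)"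
          using x c cc cl y by auto
        then show ?thesis by blast
      qed
      show "?R W (y \<oplus>\<^bsub>omap B W\<^esub> y') (z \<oplus>\<^bsub>omap C W\<^esub> z')" if R: "?R W y z" and R': "?R W y' z'" for y z y' z'
      proof -
        obtain x where x: "x \<in> el A W" "y \<ominus>\<^bsub>omap B W\<^esub> cmp e W x \<in> torsion B W"
          "z \<ominus>\<^bsub>omap C W\<^esub> cmp l W x \<in> torsion C W" using R by blast
        obtain x' where x': "x' \<in> el A W" "y' \<ominus>\<^bsub>omap B W\<^esub> cmp e W x' \<in> torsion B W"
          "z' \<ominus>\<^bsub>omap C W\<^esub> cmp l W x' \<in> torsion C W" using R' by blast
        have yz: "y \<in> el B W" "z \<in> el C W" "y' \<in> el B W" "z' \<in> el C W"
          "cmp m W z = cmp k W y" "cmp m W z' = cmp k W y'"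
          using R R' by blast+
        have "y \<oplus>\<^bsub>omap B W\<^esub> y' \<ominus>\<^bsub>omap B W\<^esub> cmp e W (x \<oplus>\<^bsub>omap A W\<^esub> x') \<in> torsion B W"
          "z \<oplus>\<^bsub>omap C W\<^esub> z' \<ominus>\<^bsub>omap C W\<^esub> cmp l W (x \<oplus>\<^bsub>omap A W\<^esub> x') \<in> torsion C W"
          using torsion_D(2)[OF B W x(2) x'(2)] torsion_D(2)[OF C W x(3) x'(3)] x(1) x'(1) yz
          by (simp_all add: pl cl BW.M.add_minus_add CW.M.add_minus_add)
        then show ?thesis using yz x(1) x'(1) by (intro conjI bexI[of _ "x \<oplus>\<^bsub>omap A W\<^esub> x'"]) (simp_all add: pl)
      qed
      show "?R W (a \<odot>\<^bsub>omap B W\<^esub> y) (a \<odot>\<^bsub>omap C W\<^esub> z)" if R: "?R W y z" and a: "a \<in> carrier K" for y z a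
      proof -
        obtain x where x: "x \<in> el A W" "y \<ominus>\<^bsub>omap B W\<^esub> cmp e W x \<in> torsion B W"
          "z \<ominus>\<^bsub>omap C W\<^esub> cmp l W x \<in> torsion C W" using R by blast
        have yz: "y \<in> el B W" "z \<in> el C W" "cmp m W z = cmp k W y" using R by blast+
        have "a \<odot>\<^bsub>omap B W\<^esub> y \<ominus>\<^bsub>omap B W\<^esub> cmp e W (a \<odot>\<^bsub>omap A W\<^esub> x) \<in> torsion B W"
          "a \<odot>\<^bsub>omap C W\<^esub> z \<ominus>\<^bsub>omap C W\<^esub> cmp l W (a \<odot>\<^bsub>omap A W\<^esub> x) \<in> torsion C W"
          using torsion_D(4)[OF B W a x(2)] torsion_D(4)[OF C W a x(3)] x(1) yz a cl
          by (simp_all add: sc a_minus_def BW.smult_r_distr CW.smult_r_distr BW.smult_r_minus CW.smult_r_minus)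
        then show ?thesis using yz x(1) a by (intro conjI bexI[of _ "a \<odot>\<^bsub>omap A W\<^esub> x"]) (simp_all add: sc)
      qed
      show "?R W' (act B W W' f y) (act C W W' f z)"
        if W': "W' \<in> VO" and f: "f \<in> lin W W'" and R: "?R W y z" for W' f y z
      proof -
        obtain x where x: "x \<in> el A W" "y \<ominus>\<^bsub>omap B W\<^esub> cmp e W x \<in> torsion B W"
          "z \<ominus>\<^bsub>omap C W\<^esub> cmp l W x \<in> torsion C W" using R by blast
        have yz: "y \<in> el B W" "z \<in> el C W" "cmp m W z = cmp k W y" using R by blast+
        have "act B W W' f y \<ominus>\<^bsub>omap B W'\<^esub> cmp e W' (act A W W' f x) \<in> torsion B W'"
          "act C W W' f z \<ominus>\<^bsub>omap C W'\<^esub> cmp l W' (act A W W' f x) \<in> torsion C W'"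
          using torsion_D(5)[OF B W W' f x(2)] torsion_D(5)[OF C W W' f x(3)] x(1) yz cl
            lin_minus[OF F_lin[OF B W W' f] F_module[OF B W] F_module[OF B W']]
            lin_minus[OF F_lin[OF C W W' f] F_module[OF C W] F_module[OF C W']]
          by (simp_all add: cmp_natural[OF e W W' f] cmp_natural[OF l W W' f])
        then show ?thesis
          using yz x(1) F_closed[OF A W W' f] F_closed[OF B W W' f] F_closed[OF C W W' f]
          by (intro conjI bexI[of _ "act A W W' f x"]) (simp_all add: cmp_natural[OF m W W' f] cmp_natural[OF k W W' f])
      qed
      \<comment> \<open>Over \<open>y = 0\<close> the vector \<open>e x\<close> is torsion, hence so
        are \<open>x\<close>, then \<open>l x\<close> and finally \<open>z\<close>. As
        \<open>m z\<close> is zero and \<open>m\<close> is injective on torsion, \<open>z\<close> is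
        zero.\<close>
      show "z = \<zero>\<^bsub>omap C W\<^esub>" if R: "?R W \<zero>\<^bsub>omap B W\<^esub> z" for z
      proof -
        obtain x where x: "x \<in> el A W" "\<zero>\<^bsub>omap B W\<^esub> \<ominus>\<^bsub>omap B W\<^esub> cmp e W x \<in> torsion B W"
          "z \<ominus>\<^bsub>omap C W\<^esub> cmp l W x \<in> torsion C W" using R by blast
        have z: "z \<in> el C W" "cmp m W z = \<zero>\<^bsub>omap D W\<^esub>"
          using R lin_zero[OF cmp_lin[OF k W] mod(2,4)] by auto
        have "cmp e W x \<in> torsion B W"
          using torsion_D(3)[OF B W torsion_D(1)[OF B W] x(2)] cl(1)[OF x(1)]
            BW.M.minus_minus_self[OF BW.M.zero_closed cl(1)[OF x(1)]] by simp
        then have "x \<in> torsion A W" by (rule torsion_equivD(1)[OF te e W x(1)])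
        from torsion_D(2)[OF C W x(3) torsion_map[OF l this]] have zT: "z \<in> torsion C W"
          using CW.M.minus_add_cancel[OF z(1) cl(3)[OF x(1)]] by simp
        have "cmp m W \<zero>\<^bsub>omap C W\<^esub> = \<zero>\<^bsub>omap D W\<^esub>" by (rule lin_zero[OF cmp_lin[OF m W] mod(3,4)])
        then show ?thesis
          using bij[OF W] zT torsion_D(1)[OF C W] z(2) unfolding bij_betw_def by (metis inj_onD)
      qed
    qed blast
    have he: "Comp (Vect_Vect K) h e = l"
    proof (rule Hom_eqI[OF VV_comp_Hom[OF e h] l])
      fix W :: "('k, 'u) vs" and x assume W: "W \<in> VO" and x: "x \<in> el A W"
      interpret BW: module K "omap B W" by (rule F_module[OF B W])
      interpret CW: module K "omap C W" by (rule F_module[OF C W])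
      have c: "cmp e W x \<in> el B W" "cmp l W x \<in> el C W"
        by (rule cmp_closed[OF e W x], rule cmp_closed[OF l W x])
      have "?R W (cmp e W x) (cmp l W x)"
        using c x torsion_D(1)[OF B W] torsion_D(1)[OF C W]
        by (intro conjI bexI[of _ x]) (simp_all add: sq'[OF W] BW.M.minus_self CW.M.minus_self)
      then show "cmp (Comp (Vect_Vect K) h e) W x = cmp l W x"
        using hR[OF W c(1)] by (simp add: cmp_Comp[OF e h W x])
    qed
    have mh: "Comp (Vect_Vect K) m h = k"
    proof (rule Hom_eqI[OF VV_comp_Hom[OF h m] k])
      fix W :: "('k, 'u) vs" and y assume W: "W \<in> VO" and y: "y \<in> el B W"
      have "?R W y (cmp h W y)" using hR[OF W y] by blast
      then show "cmp (Comp (Vect_Vect K) m h) W y = cmp k W y" by (simp add: cmp_Comp[OF h m W y])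
    qed
    show ?thesis
    proof (rule ex1I[of _ h])
      show "h \<in> mor B C \<and> Comp (Vect_Vect K) h e = l \<and> Comp (Vect_Vect K) m h = k"
        using h he mh by blast
      fix g assume a: "g \<in> mor B C \<and> Comp (Vect_Vect K) g e = l \<and> Comp (Vect_Vect K) m g = k"
      then have g: "g \<in> mor B C" and ge: "Comp (Vect_Vect K) g e = l" and mg: "Comp (Vect_Vect K) m g = k"
        by blast+
      \<comment> \<open>Any other diagonal satisfies the relation that determines
        \<open>h\<close>.\<close>
      show "g = h"
      proof (rule Hom_eqI[OF g h])
        fix W :: "('k, 'u) vs" and y assume W: "W \<in> VO" and y: "y \<in> el B W"
        obtain x where x: "x \<in> el A W" "y \<ominus>\<^bsub>omap B W\<^esub> cmp e W x \<in> torsion B W"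
          using torsion_equivD(2)[OF te e W y] by blast
        note ex = cmp_closed[OF e W x(1)]
        have "cmp m W (cmp g W y) = cmp k W y" using cmp_Comp[OF g m W y] mg by simp
        moreover have "cmp g W y \<ominus>\<^bsub>omap C W\<^esub> cmp l W x \<in> torsion C W"
        proof -
          have "cmp l W x = cmp g W (cmp e W x)" using cmp_Comp[OF e g W x(1)] ge by simp
          then show ?thesis
            using torsion_map[OF g x(2)] lin_minus[OF cmp_lin[OF g W] F_module[OF B W] F_module[OF C W] y ex] by simp
        qed
        ultimately have "?R W y (cmp g W y)" using y cmp_closed[OF g W y] x by blast
        then show "cmp g W y = cmp h W y" using hR[OF W y] by blast
      qed
    qed
  qed
  then show ?thesis
    unfolding orthogonal_def using Hom_Dom_Cod[OF e] Hom_Dom_Cod[OF m] sm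
    by (auto simp: Ind_Hom_iff)
qed

text \<open>The factorization of \<open>f : X \<rightarrow> Y\<close> goes through the pullback of the reflection of \<open>f\<close> along the
  unit at \<open>Y\<close>.\<close>

lemma equiv_iso_factorization:
  assumes fA: "f \<in> Arr (Ind_Vect_op K)"
  shows "\<exists>e\<in>equivs. \<exists>m\<in>isos. Cod (Ind_Vect_op K) e = Dom (Ind_Vect_op K) m \<and> f = Comp (Ind_Vect_op K) m e"
proof -
  obtain X Y where fI: "f \<in> Hom (Ind_Vect_op K) X Y" using cat.Arr_Hom[OF cat_Ind fA] by blast
  then have f: "f \<in> mor X Y" and sm: "small_functor K X" "small_functor K Y"
    by (simp_all add: Ind_Hom_iff)
  note X = Hom_dom[OF f] and Y = Hom_cod[OF f]
  note T = torsion_subfun[OF X]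
  let ?L = "reflection X" and ?u = "\<lambda>W. coset (omap X W) (torsion X W)"
  note L = quotient_functor_FO[OF X T]
  have Lfree: "?L \<in> free_objects K (\<Q> K EE)" using reflection_free X sm by simp
  note Lops = quotient_functor_ops[OF X T]
  obtain a b :: 'u where ab: "a \<noteq> b" using ex_distinct by blast
  \<comment> \<open>Index \<open>a\<close> stands for \<open>Y\<close> and index \<open>b\<close>
    for the reflection of \<open>X\<close>.\<close>
  let ?I = "{a, b}" and ?F = "\<lambda>i. if i = a then Y else ?L"
  have I: "small ?I" by (rule small_pair)
  have F: "?F i \<in> FO" if "i \<in> ?I" for i using Y L by simp
  let ?P = "prod_functor ?I ?F"
  have P: "?P \<in> FO" by (rule prod_functor_FO[OF I F])
  have Po: "omap ?P W = prod_space ?I (\<lambda>i. omap (?F i) W)" if "W \<in> VO" for W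
    by (rule prod_functor_omap[of ?I ?F, OF I F that])
  have Pact: "graph_app (act ?P V W g p) i = act (?F i) V W g (graph_app p i)"
    if "V \<in> VO" "W \<in> VO" "g \<in> lin V W" "p \<in> el ?P V" "i \<in> ?I" for V W g p i
    by (rule prod_functor_act[of ?I ?F, OF I F that])
  have pr: "mknat ?P (?F i) (\<lambda>W p. graph_app p i) \<in> mor ?P (?F i)" if i: "i \<in> ?I" for i
  proof (rule mknat_Hom[OF P F[OF i]])
    fix W :: "('k, 'u) vs" assume W: "W \<in> VO"
    have "omap (?F j) W \<in> VO" if "j \<in> ?I" for j by (rule F_VO[OF F[OF that] W])
    from prod_proj_lin[OF I this i]
    show "(\<lambda>p\<in>el ?P W. graph_app p i) \<in> lin (omap ?P W) (omap (?F i) W)"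
      by (simp only: Po[OF W])
  qed (rule Pact[OF _ _ _ _ i])
  let ?pa = "mknat ?P Y (\<lambda>W p. graph_app p a)" and ?pb = "mknat ?P ?L (\<lambda>W p. graph_app p b)"
  have pa: "?pa \<in> mor ?P Y" and pb: "?pb \<in> mor ?P ?L"
    using pr[of a] pr[of b] ab by simp_all
  have Peq: "p = q" if "W \<in> VO" "p \<in> el ?P W" "q \<in> el ?P W"
    "graph_app p a = graph_app q a" "graph_app p b = graph_app q b" for W p q
    using prod_space_eqI[OF I, of p "\<lambda>i. omap (?F i) W" q] that by (auto simp: Po)
  have Pmk: "graph ?I (\<lambda>i. if i = a then y else z) \<in> el ?P W"
    if "W \<in> VO" "y \<in> el Y W" "z \<in> el ?L W" for W y z
    unfolding Po[OF that(1)] by (rule graph_prodI) (use that in auto)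
  have Papp: "graph_app (graph ?I (\<lambda>i. if i = a then y else z)) a = y"
    "graph_app (graph ?I (\<lambda>i. if i = a then y else z)) b = z" for y z
    using ab by (simp_all add: graph_app_graph[OF I])
  have tuple: "mknat Z ?P (\<lambda>W x. graph ?I (\<lambda>i. if i = a then cmp s W x else cmp t W x)) \<in> mor Z ?P"
    if s: "s \<in> mor Z Y" and t: "t \<in> mor Z ?L" for Z s t
  proof (rule mknat_Hom[OF Hom_dom[OF s] P])
    note Z = Hom_dom[OF s]
    fix W :: "('k, 'u) vs" assume W: "W \<in> VO"
    have "(\<lambda>x\<in>el Z W. graph ?I (\<lambda>i. (if i = a then cmp s W else cmp t W) x)) \<in>
        lin (omap Z W) (prod_space ?I (\<lambda>i. omap (?F i) W))"
    proof (rule prod_tuple_lin[OF I _ F_module[OF Z W]])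
      show "omap (?F i) W \<in> VO" if "i \<in> ?I" for i by (rule F_VO[OF F[OF that] W])
      show "(if i = a then cmp s W else cmp t W) \<in> lin (omap Z W) (omap (?F i) W)" for i
        using cmp_lin[OF s W] cmp_lin[OF t W] by simp
    qed
    moreover have "(\<lambda>i. (if i = a then cmp s W else cmp t W) x) = (\<lambda>i. if i = a then cmp s W x else cmp t W x)" for x
      by auto
    ultimately show "(\<lambda>x\<in>el Z W. graph ?I (\<lambda>i. if i = a then cmp s W x else cmp t W x)) \<in>
        lin (omap Z W) (omap ?P W)" by (simp only: Po[OF W])
    fix W' g x assume W': "W' \<in> VO" and g: "g \<in> lin W W'" and x: "x \<in> el Z W"
    note c = Pmk[OF W cmp_closed[OF s W x] cmp_closed[OF t W x]]
    note gx = F_closed[OF Z W W' g x]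
    show "graph ?I (\<lambda>i. if i = a then cmp s W' (act Z W W' g x) else cmp t W' (act Z W W' g x)) =
        act ?P W W' g (graph ?I (\<lambda>i. if i = a then cmp s W x else cmp t W x))"
      by (rule Peq[OF W' Pmk[OF W' cmp_closed[OF s W' gx] cmp_closed[OF t W' gx]] F_closed[OF P W W' g c]])
        (use ab in \<open>simp_all add: Papp Pact[OF W W' g c] cmp_natural[OF s W W' g x] cmp_natural[OF t W W' g x]\<close>)
  qed
  \<comment> \<open>The pullback with the induced arrow of reflections unfolded: pairs of
    \<open>y\<close> and the class of some \<open>x\<close> such that \<open>y\<close> and
    \<open>f x\<close> agree modulo torsion. Asking only for the existence of \<open>x\<close>
    avoids constructing that arrow.\<close>
  define N where "N W = {p \<in> el ?P W. \<exists>x\<in>el X W. graph_app p b = ?u W x \<and>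
    graph_app p a \<ominus>\<^bsub>omap Y W\<^esub> cmp f W x \<in> torsion Y W}" for W
  have pac: "graph_app p a \<in> el Y W" if "W \<in> VO" "p \<in> el ?P W" for W p
    using cmp_closed[OF pa that] by (simp add: cmp_mknat that)
  have pbc: "graph_app p b \<in> el ?L W" if "W \<in> VO" "p \<in> el ?P W" for W p
    using cmp_closed[OF pb that] by (simp add: cmp_mknat that)
  have N: "subfun ?P N"
  proof (rule subfunI[OF P])
    fix W :: "('k, 'u) vs" assume W: "W \<in> VO"
    interpret PW: module K "omap ?P W" by (rule F_module[OF P W])
    interpret XW: module K "omap X W" by (rule F_module[OF X W])
    interpret YW: module K "omap Y W" by (rule F_module[OF Y W])
    note fl = lin_plus[OF cmp_lin[OF f W]] lin_scale[OF cmp_lin[OF f W]] lin_zero[OF cmp_lin[OF f W] F_module[OF X W] F_module[OF Y W]]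
      cmp_closed[OF f W]
    have oa: "graph_app (p \<oplus>\<^bsub>omap ?P W\<^esub> q) a = graph_app p a \<oplus>\<^bsub>omap Y W\<^esub> graph_app q a"
      "graph_app (p \<oplus>\<^bsub>omap ?P W\<^esub> q) b = graph_app p b \<oplus>\<^bsub>omap ?L W\<^esub> graph_app q b" for p q
      using prod_ops(1)[OF I, of a "\<lambda>i. omap (?F i) W" p q] prod_ops(1)[OF I, of b "\<lambda>i. omap (?F i) W" p q] ab
      by (simp_all add: Po[OF W])
    have os: "graph_app (r \<odot>\<^bsub>omap ?P W\<^esub> p) a = r \<odot>\<^bsub>omap Y W\<^esub> graph_app p a"
      "graph_app (r \<odot>\<^bsub>omap ?P W\<^esub> p) b = r \<odot>\<^bsub>omap ?L W\<^esub> graph_app p b" for r p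
      using prod_ops(2)[OF I, of a "\<lambda>i. omap (?F i) W" r p] prod_ops(2)[OF I, of b "\<lambda>i. omap (?F i) W" r p] ab
      by (simp_all add: Po[OF W])
    have oz: "graph_app \<zero>\<^bsub>omap ?P W\<^esub> a = \<zero>\<^bsub>omap Y W\<^esub>" "graph_app \<zero>\<^bsub>omap ?P W\<^esub> b = \<zero>\<^bsub>omap ?L W\<^esub>"
      using prod_ops(3)[OF I, of a "\<lambda>i. omap (?F i) W"] prod_ops(3)[OF I, of b "\<lambda>i. omap (?F i) W"] ab
      by (simp_all add: Po[OF W])
    show "p \<in> el ?P W" if "p \<in> N W" for p using that by (simp add: N_def)
    show "\<zero>\<^bsub>omap ?P W\<^esub> \<in> N W"
      unfolding N_def using torsion_D(1)[OF Y W]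
      by (auto simp: oz fl Lops(3)[OF W] YW.M.minus_self intro!: bexI[of _ "\<zero>\<^bsub>omap X W\<^esub>"])
    show "p \<oplus>\<^bsub>omap ?P W\<^esub> q \<in> N W" if p: "p \<in> N W" and q: "q \<in> N W" for p q
    proof -
      have pc: "p \<in> el ?P W" "q \<in> el ?P W" using p q by (auto simp: N_def)
      obtain x where x: "x \<in> el X W" "graph_app p b = ?u W x"
        "graph_app p a \<ominus>\<^bsub>omap Y W\<^esub> cmp f W x \<in> torsion Y W" using p by (auto simp: N_def)
      obtain y where y: "y \<in> el X W" "graph_app q b = ?u W y"
        "graph_app q a \<ominus>\<^bsub>omap Y W\<^esub> cmp f W y \<in> torsion Y W" using q by (auto simp: N_def)
      have "graph_app (p \<oplus>\<^bsub>omap ?P W\<^esub> q) a \<ominus>\<^bsub>omap Y W\<^esub> cmp f W (x \<oplus>\<^bsub>omap X W\<^esub> y) \<in> torsion Y W"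
        using torsion_D(2)[OF Y W x(3) y(3)] x(1) y(1) pac[OF W] pc by (simp add: oa fl YW.M.add_minus_add)
      moreover have "graph_app (p \<oplus>\<^bsub>omap ?P W\<^esub> q) b = ?u W (x \<oplus>\<^bsub>omap X W\<^esub> y)"
        using x y by (simp add: oa Lops(1)[OF W])
      ultimately show ?thesis
        using x(1) y(1) PW.M.add.m_closed[OF pc] XW.M.add.m_closed[OF x(1) y(1)] unfolding N_def by blast
    qed
    show "r \<odot>\<^bsub>omap ?P W\<^esub> p \<in> N W" if r: "r \<in> carrier K" and p: "p \<in> N W" for r p
    proof -
      have pc: "p \<in> el ?P W" using p by (auto simp: N_def)
      obtain x where x: "x \<in> el X W" "graph_app p b = ?u W x"
        "graph_app p a \<ominus>\<^bsub>omap Y W\<^esub> cmp f W x \<in> torsion Y W" using p by (auto simp: N_def)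
      have "graph_app (r \<odot>\<^bsub>omap ?P W\<^esub> p) a \<ominus>\<^bsub>omap Y W\<^esub> cmp f W (r \<odot>\<^bsub>omap X W\<^esub> x) \<in> torsion Y W"
        using torsion_D(4)[OF Y W r x(3)] x(1) pac[OF W pc] r
        by (simp add: os fl a_minus_def YW.smult_r_distr YW.smult_r_minus)
      moreover have "graph_app (r \<odot>\<^bsub>omap ?P W\<^esub> p) b = ?u W (r \<odot>\<^bsub>omap X W\<^esub> x)"
        using x r by (simp add: os Lops(2)[OF W])
      ultimately show ?thesis
        using PW.smult_closed[OF r pc] XW.smult_closed[OF r x(1)] unfolding N_def by blast
    qed
    show "act ?P W W' g p \<in> N W'" if W': "W' \<in> VO" and g: "g \<in> lin W W'" and p: "p \<in> N W" for W' g p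
    proof -
      have pc: "p \<in> el ?P W" using p by (auto simp: N_def)
      obtain x where x: "x \<in> el X W" "graph_app p b = ?u W x"
        "graph_app p a \<ominus>\<^bsub>omap Y W\<^esub> cmp f W x \<in> torsion Y W" using p by (auto simp: N_def)
      have ga: "graph_app (act ?P W W' g p) a = act Y W W' g (graph_app p a)"
        "graph_app (act ?P W W' g p) b = act ?L W W' g (graph_app p b)"
        using Pact[OF W W' g pc, of a] Pact[OF W W' g pc, of b] ab by simp_all
      have "graph_app (act ?P W W' g p) a \<ominus>\<^bsub>omap Y W'\<^esub> cmp f W' (act X W W' g x) \<in> torsion Y W'"
        using torsion_D(5)[OF Y W W' g x(3)] lin_minus[OF F_lin[OF Y W W' g] F_module[OF Y W] F_module[OF Y W'] pac[OF W pc] fl(4)[OF x(1)]]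
        by (simp add: ga cmp_natural[OF f W W' g x(1)])
      moreover have "graph_app (act ?P W W' g p) b = ?u W' (act X W W' g x)"
        unfolding ga x(2) by (rule quotient_functor_act[OF X T W W' g x(1)])
      ultimately show ?thesis
        using F_closed[OF P W W' g pc] F_closed[OF X W W' g x(1)] unfolding N_def by blast
    qed
  qed
  let ?S = "sub_functor ?P N"
  note S = sub_functor_FO[OF P N] and So = sub_functor_omap[OF P N]
  have "\<exists>V. generated ?P V"
  proof -
    obtain V\<^sub>1 V\<^sub>2 where "generated Y V\<^sub>1" "generated X V\<^sub>2" using small_functor_generated sm by blast
    then have "generated (?F i) (if i = a then V\<^sub>1 else V\<^sub>2)" if "i \<in> ?I" for i
      using generated_quotient[OF X T] by simp
    from generated_prod[of a b ?F, OF ab F this] show ?thesis by blast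
  qed
  then have Ssm: "small_functor K ?S" using generated_sub[OF P N] generated_small_functor[OF S] by blast
  let ?inc = "mknat ?S ?P (\<lambda>V x. x)"
  note inc = sub_arrow[OF P N]
  have incc: "cmp ?inc W p = p" if "W \<in> VO" "p \<in> N W" for W p
    using that by (simp add: cmp_mknat So)
  let ?m = "Comp (Vect_Vect K) ?pa ?inc" and ?mb = "Comp (Vect_Vect K) ?pb ?inc"
  have m: "?m \<in> mor ?S Y" and mb: "?mb \<in> mor ?S ?L"
    by (rule VV_comp_Hom[OF inc pa], rule VV_comp_Hom[OF inc pb])
  have NP: "p \<in> el ?P W" if "p \<in> N W" for p W using that by (simp add: N_def)
  have mc: "cmp ?m W p = graph_app p a" "cmp ?mb W p = graph_app p b" if W: "W \<in> VO" and p: "p \<in> N W" for W p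
    using cmp_Comp[OF inc pa W] cmp_Comp[OF inc pb W] p by (simp_all add: So W incc cmp_mknat NP)
  have Seq: "p = q" if "W \<in> VO" "p \<in> el ?S W" "q \<in> el ?S W"
    "cmp ?m W p = cmp ?m W q" "cmp ?mb W p = cmp ?mb W q" for W p q
    using Peq[OF that(1)] that by (simp add: So mc NP)
  \<comment> \<open>The pairing of \<open>f\<close> with the unit at \<open>X\<close>; corestricted
    to the pullback it is the factor \<open>?e\<close>.\<close>
  define t where "t = mknat X ?P (\<lambda>W x. graph ?I (\<lambda>i. if i = a then cmp f W x else cmp (quotient_arrow X (torsion X)) W x))"
  have t: "t \<in> mor X ?P"
    unfolding t_def by (rule tuple[OF f quotient_arrow_Hom[OF X T]])
  have tc: "cmp t W x = graph ?I (\<lambda>i. if i = a then cmp f W x else ?u W x)"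
    if "W \<in> VO" "x \<in> el X W" for W x
    unfolding t_def cmp_mknat[OF that] cmp_quotient_arrow[OF X T that] ..
  have tN: "cmp t W x \<in> N W" if W: "W \<in> VO" and x: "x \<in> el X W" for W x
  proof -
    interpret YW: module K "omap Y W" by (rule F_module[OF Y W])
    show ?thesis
      using cmp_closed[OF t W x] x YW.M.minus_self[OF cmp_closed[OF f W x]] torsion_D(1)[OF Y W]
      unfolding N_def tc[OF W x] by (auto simp: Papp)
  qed
  let ?e = "mknat X ?S (cmp t)"
  have e: "?e \<in> mor X ?S" by (rule lift_sub[OF N t tN])
  have ec: "cmp ?e W x = cmp t W x" if "W \<in> VO" "x \<in> el X W" for W x
    using that by (simp add: cmp_mknat)
  have me: "cmp ?m W (cmp ?e W x) = cmp f W x" "cmp ?mb W (cmp ?e W x) = ?u W x"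
    if "W \<in> VO" "x \<in> el X W" for W x
    using that tN[OF that] by (simp_all add: ec mc tc Papp)
  have fme: "f = Comp (Vect_Vect K) ?m ?e"
    by (rule Hom_eqI[OF f VV_comp_Hom[OF e m]]) (simp add: cmp_Comp[OF e m] me)
  let ?TY = "sub_functor Y (torsion Y)"
  note TY = torsion_subfun[OF Y]
  \<comment> \<open>Sends a torsion vector \<open>y\<close> to the pair of \<open>y\<close> and
    zero; this will invert \<open>?m\<close> on torsion.\<close>
  define j where "j = mknat ?TY ?P (\<lambda>W y. graph ?I (\<lambda>i. if i = a then cmp (mknat ?TY Y (\<lambda>V x. x)) W y
    else cmp (mknat ?TY ?L (\<lambda>V x. \<zero>\<^bsub>omap ?L V\<^esub>)) W y))"
  have j: "j \<in> mor ?TY ?P"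
    unfolding j_def by (rule tuple[OF sub_arrow[OF Y TY] null_arrow_Hom[OF sub_functor_FO[OF Y TY] L]])
  have jc: "cmp j W y = graph ?I (\<lambda>i. if i = a then y else \<zero>\<^bsub>omap ?L W\<^esub>)"
    if "W \<in> VO" "y \<in> torsion Y W" for W y
  proof -
    have y: "y \<in> el ?TY W" using that by (simp add: sub_functor_omap[OF Y TY])
    show ?thesis unfolding j_def cmp_mknat[OF that(1) y] ..
  qed
  have jN: "cmp j W y \<in> N W" if W: "W \<in> VO" and y: "y \<in> torsion Y W" for W y
  proof -
    interpret XW: module K "omap X W" by (rule F_module[OF X W])
    interpret YW: module K "omap Y W" by (rule F_module[OF Y W])
    have "y \<ominus>\<^bsub>omap Y W\<^esub> cmp f W \<zero>\<^bsub>omap X W\<^esub> = y"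
      using YW.M.minus_zero_right[OF torsion_carrier[OF y]] lin_zero[OF cmp_lin[OF f W] F_module[OF X W] F_module[OF Y W]] by simp
    then show ?thesis
      using cmp_closed[OF j W, of y] y unfolding N_def jc[OF W y]
      by (auto simp: Papp sub_functor_omap[OF Y TY W] Lops(3)[OF W] intro!: bexI[of _ "\<zero>\<^bsub>omap X W\<^esub>"])
  qed
  let ?j = "mknat ?TY ?S (cmp j)"
  have j': "?j \<in> mor ?TY ?S"
    by (rule lift_sub[OF N j]) (use jN in \<open>simp add: sub_functor_omap[OF Y TY]\<close>)
  \<comment> \<open>Idempotence enters here: \<open>y\<close> is torsion already in the functor
    \<open>?TY\<close>, so its image under the arrow \<open>?j\<close> is torsion in
    \<open>?S\<close>. Being torsion in \<open>Y\<close> would not suffice, since \<open>?j\<close>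
    is defined only on \<open>?TY\<close>.\<close>
  have jT: "cmp j W y \<in> torsion ?S W" if W: "W \<in> VO" and y: "y \<in> torsion Y W" for W y
    using torsion_map[OF j' torsion_torsion[OF Y W y]] y by (simp add: cmp_mknat[OF W] sub_functor_omap[OF Y TY W])
  have mj: "cmp ?m W (cmp j W y) = y" "cmp ?mb W (cmp j W y) = \<zero>\<^bsub>omap ?L W\<^esub>"
    if W: "W \<in> VO" and y: "y \<in> torsion Y W" for W y
    using mc[OF W jN[OF W y]] by (simp_all add: jc[OF W y] Papp)
  \<comment> \<open>The second coordinate of a torsion vector lies in a free functor and so
    vanishes. Hence a torsion vector of \<open>?S\<close> is determined by its first
    coordinate.\<close>
  have Tb: "cmp ?mb W p = \<zero>\<^bsub>omap ?L W\<^esub>" if "W \<in> VO" "p \<in> torsion ?S W" for W p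
    using torsion_map[OF mb that(2)] Lfree that(1) by (simp add: free_iff_torsion)
  have "torsion_iso ?m"
    unfolding torsion_iso_iff[OF m]
  proof
    fix W :: "('k, 'u) vs" assume W: "W \<in> VO"
    show "bij_betw (cmp ?m W) (torsion ?S W) (torsion Y W)"
    proof (rule bij_betw_imageI)
      show "inj_on (cmp ?m W) (torsion ?S W)"
      proof (rule inj_onI)
        fix p q assume p: "p \<in> torsion ?S W" and q: "q \<in> torsion ?S W" and eq: "cmp ?m W p = cmp ?m W q"
        show "p = q"
          by (rule Seq[OF W torsion_carrier[OF p] torsion_carrier[OF q] eq]) (simp only: Tb[OF W p] Tb[OF W q])
      qed
      show "cmp ?m W ` torsion ?S W = torsion Y W"
      proof
        show "cmp ?m W ` torsion ?S W \<subseteq> torsion Y W" using torsion_map[OF m] by blast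
        show "torsion Y W \<subseteq> cmp ?m W ` torsion ?S W"
        proof
          fix y assume y: "y \<in> torsion Y W"
          show "y \<in> cmp ?m W ` torsion ?S W"
            by (rule image_eqI, rule mj(1)[OF W y, symmetric], rule jT[OF W y])
        qed
      qed
    qed
  qed
  moreover have "torsion_equiv ?e"
  proof (rule torsion_equivI[OF e])
    fix W :: "('k, 'u) vs" assume W: "W \<in> VO"
    show "x \<in> torsion X W" if x: "x \<in> el X W" and ex: "cmp ?e W x \<in> torsion ?S W" for x
      using Tb[OF W ex] me(2)[OF W x] Lops(4)[OF W x] by simp
    fix p assume p: "p \<in> el ?S W"
    then have pN: "p \<in> N W" by (simp add: So W)
    obtain x where x: "x \<in> el X W" "graph_app p b = ?u W x"
      "graph_app p a \<ominus>\<^bsub>omap Y W\<^esub> cmp f W x \<in> torsion Y W" using pN by (auto simp: N_def)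
    let ?y = "graph_app p a \<ominus>\<^bsub>omap Y W\<^esub> cmp f W x"
    interpret SW: module K "omap ?S W" by (rule F_module[OF S W])
    interpret LW: module K "omap ?L W" by (rule F_module[OF L W])
    note ex = cmp_closed[OF e W x(1)]
    \<comment> \<open>\<open>p\<close> and the image of \<open>x\<close> have the same second
      coordinate, and their first coordinates differ by the torsion vector \<open>?y\<close>. So
      their difference is the pair of \<open>?y\<close> and zero, which is torsion by
      \<open>jT\<close>.\<close>
    have eq: "p \<ominus>\<^bsub>omap ?S W\<^esub> cmp ?e W x = cmp j W ?y"
    proof (rule Seq[OF W SW.M.minus_closed[OF p ex] torsion_carrier[OF jT[OF W x(3)]]])
      show "cmp ?m W (p \<ominus>\<^bsub>omap ?S W\<^esub> cmp ?e W x) = cmp ?m W (cmp j W ?y)"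
        using lin_minus[OF cmp_lin[OF m W] F_module[OF S W] F_module[OF Y W] p ex] me(1)[OF W x(1)] mc(1)[OF W pN] mj(1)[OF W x(3)] by simp
      show "cmp ?mb W (p \<ominus>\<^bsub>omap ?S W\<^esub> cmp ?e W x) = cmp ?mb W (cmp j W ?y)"
        using lin_minus[OF cmp_lin[OF mb W] F_module[OF S W] F_module[OF L W] p ex] me(2)[OF W x(1)] mc(2)[OF W pN] mj(2)[OF W x(3)]
          LW.M.minus_self[OF pbc[OF W NP[OF pN]]] by (simp add: x(2))
    qed
    show "\<exists>x\<in>el X W. p \<ominus>\<^bsub>omap ?S W\<^esub> cmp ?e W x \<in> torsion ?S W"
      by (rule bexI[OF _ x(1)]) (simp only: eq jT[OF W x(3)])
  qed
  moreover have "?m \<in> Arr (Ind_Vect_op K)" "?e \<in> Arr (Ind_Vect_op K)"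
    using cat.Hom_Arr(1)[OF cat_Ind, of ?m ?S Y] cat.Hom_Arr(1)[OF cat_Ind, of ?e X ?S] m e sm Ssm
    by (simp_all add: Ind_Hom_iff)
  moreover have "Cod (Ind_Vect_op K) ?e = Dom (Ind_Vect_op K) ?m"
    using Hom_Dom_Cod[OF e] Hom_Dom_Cod[OF m] by simp
  moreover have "f = Comp (Ind_Vect_op K) ?m ?e" using fme by simp
  ultimately show ?thesis by blast
qed

text \<open>Both \<open>f\<close> and its inverse preserve torsion.\<close>

lemma iso_equiv_iso:
  assumes fI: "f \<in> Hom (Ind_Vect_op K) X Y" and gI: "g \<in> Hom (Ind_Vect_op K) Y X"
    and gf: "Comp (Ind_Vect_op K) g f = Ident (Ind_Vect_op K) X"
    and fg: "Comp (Ind_Vect_op K) f g = Ident (Ind_Vect_op K) Y"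
  shows "f \<in> equivs \<and> f \<in> isos"
proof -
  have f: "f \<in> mor X Y" and g: "g \<in> mor Y X" using fI gI by (simp_all add: Ind_Hom_iff)
  note X = Hom_dom[OF f] and Y = Hom_cod[OF f]
  have gfx: "cmp g W (cmp f W x) = x" if "W \<in> VO" "x \<in> el X W" for W x
    using cmp_Comp[OF f g that] gf by (simp add: cmp_Ident[OF X that])
  have fgy: "cmp f W (cmp g W y) = y" if "W \<in> VO" "y \<in> el Y W" for W y
    using cmp_Comp[OF g f that] fg by (simp add: cmp_Ident[OF Y that])
  have "torsion_equiv f"
  proof (rule torsion_equivI[OF f])
    fix W :: "('k, 'u) vs" assume W: "W \<in> VO"
    interpret YW: module K "omap Y W" by (rule F_module[OF Y W])
    show "x \<in> torsion X W" if "x \<in> el X W" "cmp f W x \<in> torsion Y W" for x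
      using torsion_map[OF g that(2)] gfx[OF W that(1)] by simp
    show "\<exists>x\<in>el X W. y \<ominus>\<^bsub>omap Y W\<^esub> cmp f W x \<in> torsion Y W" if y: "y \<in> el Y W" for y
      using cmp_closed[OF g W y] fgy[OF W y] YW.M.minus_self[OF y] torsion_D(1)[OF Y W]
      by (intro bexI[of _ "cmp g W y"]) simp_all
  qed
  moreover have "torsion_iso f"
    unfolding torsion_iso_iff[OF f]
  proof
    fix W :: "('k, 'u) vs" assume W: "W \<in> VO"
    show "bij_betw (cmp f W) (torsion X W) (torsion Y W)"
      by (rule bij_betw_byWitness[where f' = "cmp g W"])
        (use gfx[OF W] fgy[OF W] torsion_carrier torsion_map[OF f] torsion_map[OF g] in blast)+
  qed
  ultimately show ?thesis using cat.Hom_Arr(1)[OF cat_Ind fI] by simp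
qed

lemma torsion_theory_equivs_isos: "torsion_theory (Ind_Vect_op K) equivs isos"
  unfolding torsion_theory_def
  using three_for_two_equivs three_for_two_isos orthogonal_equiv_iso equiv_iso_factorization iso_equiv_iso
  by (intro conjI cat.orthogonal_factorization_systemI[OF cat_Ind]) (assumption | blast)+

text \<open>The torsion of a zero functor is zero, so an arrow from \<open>X\<close> to it is
  bijective on torsion parts exactly when \<open>X\<close> has no nonzero torsion.\<close>

lemma torsion_free_part_isos:
  "torsion_free_part (Ind_Vect_op K) isos = free_objects K (\<Q> K EE)"
proof (intro equalityI subsetI)
  fix X :: "('k, 'u) vfunctor"
  assume "X \<in> torsion_free_part (Ind_Vect_op K) isos"
  then obtain Z t where XI: "X \<in> Obj (Ind_Vect_op K)" and Z: "zero_functor Z"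
    and t: "t \<in> mor X Z" and ti: "torsion_iso t"
    unfolding torsion_free_part_def zero_object_Ind_iff Ind_Hom_iff by blast
  note X = Hom_dom[OF t]
  have "torsion X W = {\<zero>\<^bsub>omap X W\<^esub>}" if W: "W \<in> VO" for W
  proof -
    have "inj_on (cmp t W) (torsion X W)" using ti W unfolding torsion_iso_iff[OF t] bij_betw_def by blast
    moreover have "cmp t W x = \<zero>\<^bsub>omap Z W\<^esub>" if "x \<in> torsion X W" for x
      using cmp_closed[OF t W torsion_carrier[OF that]] Z W by (simp add: zero_functor_def)
    ultimately have "x = \<zero>\<^bsub>omap X W\<^esub>" if "x \<in> torsion X W" for x
      using that torsion_D(1)[OF X W] by (metis inj_onD)
    then show ?thesis using torsion_D(1)[OF X W] by blast
  qed
  then show "X \<in> free_objects K (\<Q> K EE)" using XI by (simp add: free_iff_torsion)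
next
  fix X :: "('k, 'u) vfunctor"
  assume free: "X \<in> free_objects K (\<Q> K EE)"
  then have X: "X \<in> FO" and sm: "small_functor K X"
    and tX: "\<And>W. W \<in> VO \<Longrightarrow> torsion X W = {\<zero>\<^bsub>omap X W\<^esub>}" by (simp_all add: free_iff_torsion)
  note N = carrier_subfun[OF X]
  \<comment> \<open>The zero object must itself be small; the quotient of \<open>X\<close> by itself
    is, by \<open>generated_quotient\<close>.\<close>
  let ?Z = "quotient_functor K X (\<lambda>V. el X V)"
  have Z: "zero_functor ?Z" by (rule zero_functor_quotient[OF X])
  note ZF = quotient_functor_FO[OF X N]
  have Zsm: "small_functor K ?Z"
  proof -
    obtain V where "generated X V" using small_functor_generated[OF sm] by blast
    then show ?thesis by (rule generated_small_functor[OF ZF generated_quotient[OF X N]])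
  qed
  note t = quotient_arrow_Hom[OF X N]
  let ?t = "quotient_arrow X (\<lambda>V. el X V)"
  have "torsion_iso ?t"
    unfolding torsion_iso_iff[OF t]
  proof
    fix W :: "('k, 'u) vs" assume W: "W \<in> VO"
    have "torsion ?Z W \<subseteq> el ?Z W" by (rule subsetI) (rule torsion_carrier)
    moreover have "el ?Z W = {\<zero>\<^bsub>omap ?Z W\<^esub>}" by (rule bspec[OF conjunct2[OF Z[unfolded zero_functor_def]] W])
    ultimately have "torsion ?Z W = {\<zero>\<^bsub>omap ?Z W\<^esub>}" using torsion_D(1)[OF ZF W] by blast
    moreover have "cmp ?t W \<zero>\<^bsub>omap X W\<^esub> = \<zero>\<^bsub>omap ?Z W\<^esub>"
      by (rule lin_zero[OF cmp_lin[OF t W] F_module[OF X W] F_module[OF ZF W]])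
    ultimately show "bij_betw (cmp ?t W) (torsion X W) (torsion ?Z W)" by (simp add: tX[OF W] bij_betw_def)
  qed
  moreover have tI: "?t \<in> Hom (Ind_Vect_op K) X ?Z" using t sm Zsm by (simp add: Ind_Hom_iff)
  ultimately have "?t \<in> isos" using cat.Hom_Arr(1)[OF cat_Ind tI] by blast
  moreover have "X \<in> Obj (Ind_Vect_op K)" using X sm by simp
  moreover have "zero_object (Ind_Vect_op K) ?Z" using Z Zsm by (simp add: zero_object_Ind_iff)
  ultimately show "X \<in> torsion_free_part (Ind_Vect_op K) isos"
    unfolding torsion_free_part_def using tI by blast
qed

end

end

theorem theorem4p43:
  fixes K :: "'k ring"
    and \<EE> :: "(('k, 'u::grothendieck_universe) vs \<times> 'u set set) set"
  assumes "field K"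
    and "\<forall>(V, \<F>)\<in>\<EE>. V \<in> Obj (Vect K) \<and> subspace_filter K V \<F>"
  shows "epi_reflective (Ind_Vect_op K) (free_objects K (\<Q> K \<EE>)) \<and>
    (\<exists>\<E> \<M>. torsion_theory (Ind_Vect_op K) \<E> \<M> \<and>
       torsion_free_part (Ind_Vect_op K) \<M> = free_objects K (\<Q> K \<EE>))"
proof -
  interpret vect K by (rule vect.intro[OF assms(1)])
  show ?thesis
    using free_epi_reflective[OF assms(2)] torsion_theory_equivs_isos[OF assms(2)] torsion_free_part_isos[OF assms(2)]
    by blast
qed

end
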